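(* Let $X=(X(t))_{t\in\mathbb{R}^d}$ be the volatility modulated mixed moving average field $$X(t)=\int_{\mathcal{X}\times\mathbb{R}^d}g(x,t-s)\,\sigma(s)\,W(dx,ds),\qquad t\in\mathbb{R}^d,$$ with $g,\sigma,W$ as in the context and $\sigma^2$ a mixed moving average of the form described there, under all assumptions listed there. Then $X$ is a (strictly) stationary random field whose marginal distribution is infinitely divisible and belongs to the class of type G distributions. Moreover, for all $\theta\in\mathbb{R}$ and $t\in\mathbb{R}^d$, $$\mathbb{E}(\exp(i\theta X(t)))=\exp(-\Psi(\theta^2/2)),\qquad \Psi(\zeta)=-\int_0^\infty\left(e^{-\zeta x}-1\right)U(dx)=-\Lambda_V(\zeta),$$ where the function $\Psi$ satisfies $\Psi(0)=0$ and has a completely monotone derivative on $(0,\infty)$.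
   Context: Let $d\in\mathbb{N}$, let $\mathcal{X}$ and $\mathcal{X}^{\sigma}$ be Borel subsets of Euclidean spaces, $p$ a probability measure on $\mathcal{X}$, $p^{\sigma}$ a probability measure on $\mathcal{X}^{\sigma}$, and $g:\mathcal{X}\times\mathbb{R}^d\to\mathbb{R}$ a measurable deterministic function. Gaussian basis and the field $X$. $W$ is a Gaussian independently scattered random measure on $\mathcal{X}\times\mathbb{R}^d$ with $\mathbb{E}(e^{i\theta W(A)})=\exp(-\frac12\theta^2c(A))$, $c(dx,ds)=p(dx)\,ds$. The volatility field $\sigma:\mathbb{R}^d\times\Omega\to\mathbb{R}$ is strictly stationary and independent of $W$. The integral defining $X$ is Walsh's stochastic integral, the first coordinate being time; standing assumption: $\sigma$ is predictable in its first coordinate $s_1$ with respect to a right-continuous complete filtration $(\mathcal{F}_r)_{r\in\mathbb{R}}$ such that $W$ on $\mathcal{X}\times(-\infty,r]\times\mathbb{R}^{d-1}$ is $\mathcal{F}_r$-measurable and $W$ on $\mathcal{X}\times(r,\infty)\times\mathbb{R}^{d-1}$ is independent of $\mathcal{F}_r$, and $\int_{\mathcal{X}\times\mathbb{R}^d}g^2(x,t-s)\mathbb{E}(\sigma^2(s))p(dx)ds<\infty$. Since $\sigma$ is independent of $W$, this is the Wiener integral with respect to $W$ with $\sigma$ frozen. L\'evy basis. $\nu^{\sigma}$ is a measure on $(0,\infty)$ with $\int_0^\infty\min(1,w)\,\nu^{\sigma}(dw)<\infty$ and $\int_1^\infty w^2\,\nu^{\sigma}(dw)<\infty$, and $a^{\sigma}=\int_{|w|\le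 1}w\,\nu^{\sigma}(dw)$ (zero drift). $L^{\sigma}$ is the L\'evy basis on $\mathcal{X}^{\sigma}\times\mathbb{R}^d$ with, for every measurable $A$ with $(p^{\sigma}\otimes Leb)(A)<\infty$, $\mathbb{E}(e^{i\theta L^{\sigma}(A)})=\exp\big((p^{\sigma}\otimes Leb)(A)\int_0^\infty(e^{i\theta w}-1)\nu^{\sigma}(dw)\big)$. Integrals of deterministic functions with respect to $L^{\sigma}$ are in the sense of Rajput and Rosinski. Integrability conditions. A nonnegative measurable $\varphi$ on $\mathcal{X}^{\sigma}\times\mathbb{R}^d$ satisfies the integrability conditions if $$\int_{\mathcal{X}^{\sigma}\times\mathbb{R}^d}\Big|\varphi(y,z)a^{\sigma}+\int_0^\infty\big(w\varphi(y,z)\mathbb{I}_{[-1,1]}(w\varphi(y,z))-\varphi(y,z)\,w\,\mathbb{I}_{[-1,1]}(w)\big)\nu^{\sigma}(dw)\Big|\,p^{\sigma}(dy)\,dz<\infty$$ and $\int_{\mathcal{X}^{\sigma}\times\mathbb{R}^d}\int_0^\infty\min(1,|\varphi(y,z)w|^2)\,\nu^{\sigma}(dw)\,p^{\sigma}(dy)\,dz<\infty$. Assumptions on volatility. $\sigma^2(s)=\int_{\mathcal{X}^{\sigma}\times\mathbb{R}^d}h(y,s-u)L^{\sigma}(dy,du)$, where $h$ is positive, measurable and satisfies the integrability conditions. For all $y\in\mathcal{X}^{\sigma}$ and $t,u\in\mathbb{R}^d$, $k(y,t-u):=\int_{\mathcal{X}\times\mathbb{R}^d}g^2(x,t-s)h(y,s-u)p(dx)ds<\infty$,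 and $k$ also satisfies the integrability conditions. $U(B)=\int_{\mathbb{R}^d}\int_{\mathcal{X}^{\sigma}}\nu^{\sigma}(\{w>0:\,k(y,z)w\in B\})\,p^{\sigma}(dy)\,dz$ for Borel $B\subset(0,\infty)$, and $\Lambda_V(\theta)=\int_0^\infty(e^{-\theta x}-1)U(dx)$ is the log-Laplace exponent ($\mathbb{E}e^{-\theta V(t)}=e^{\Lambda_V(\theta)}$) of $V(t)=\int_{\mathcal{X}\times\mathbb{R}^d}g^2(x,t-s)\sigma^2(s)p(dx)ds$. A distribution is of type G if it is the law of $\sqrt{v}\,\varepsilon$ with $\varepsilon$ standard normal and $v\ge0$ an infinitely divisible random variable independent of $\varepsilon$. A function $f$ on $(0,\infty)$ is completely monotone if it has derivatives of all orders and $(-1)^nf^{(n)}\ge0$ for all $n\ge0$. *)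

theory Defs
  imports "HOL-Probability.Probability"
begin

section \<open>Distributions on the real line\<close>

definition infinitely_divisible :: "real measure \<Rightarrow> bool" where
  "infinitely_divisible \<mu> \<longleftrightarrow>
     prob_space \<mu> \<and> sets \<mu> = sets borel \<and>
     (\<forall>n\<ge>1. \<exists>\<rho>. prob_space \<rho> \<and> sets \<rho> = sets borel \<and>
        \<mu> = (convolution \<rho> ^^ n) (return borel 0))"

text \<open>A pair of real random variables can always be realised on a probability
  space over \<^typ>\<open>real \<times> real\<close>, so fixing that type of sample points is no restriction.\<close>

definition type_G :: "real measure \<Rightarrow> bool" where
  "type_G \<mu> \<longleftrightarrow>
     (\<exists>(P :: (real \<times> real) measure) v \<epsilon>.
        prob_space P \<and> prob_space.indep_var P borel v borel \<epsilon> \<and>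
        (\<forall>\<omega>\<in>space P. 0 \<le> v \<omega>) \<and> infinitely_divisible (distr P borel v) \<and>
        distr P borel \<epsilon> = std_normal_distribution \<and>
        \<mu> = distr P borel (\<lambda>\<omega>. sqrt (v \<omega>) * \<epsilon> \<omega>))"

definition completely_monotone :: "(real \<Rightarrow> real) \<Rightarrow> bool" where
  "completely_monotone f \<longleftrightarrow>
     (\<forall>n. \<forall>x>0. (deriv ^^ n) f differentiable (at x) \<and> 0 \<le> (-1) ^ n * (deriv ^^ n) f x)"


section \<open>Random fields\<close>

text \<open>Strict stationarity is invariance of the finite-dimensional distributions.\<close>

definition strictly_stationary ::
  "'w measure \<Rightarrow> ('t::ab_group_add \<Rightarrow> 'w \<Rightarrow> real) \<Rightarrow> bool" where
  "strictly_stationary M X \<longleftrightarrow>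
     (\<forall>t. X t \<in> borel_measurable M) \<and>
     (\<forall>J r. finite J \<longrightarrow>
        distr M (\<Pi>\<^sub>M t\<in>J. borel) (\<lambda>\<omega>. \<lambda>t\<in>J. X (t + r) \<omega>) =
        distr M (\<Pi>\<^sub>M t\<in>J. borel) (\<lambda>\<omega>. \<lambda>t\<in>J. X t \<omega>))"

definition generated_events :: "'w measure \<Rightarrow> ('i \<Rightarrow> 'w \<Rightarrow> real) \<Rightarrow> 'i set \<Rightarrow> 'w set set" where
  "generated_events M Y I =
     sigma_sets (space M) {Y i -` B \<inter> space M | i B. i \<in> I \<and> B \<in> sets borel}"

definition converges_in_probability ::
  "'w measure \<Rightarrow> (nat \<Rightarrow> 'w \<Rightarrow> real) \<Rightarrow> ('w \<Rightarrow> real) \<Rightarrow> bool" where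
  "converges_in_probability M Y Z \<longleftrightarrow>
     (\<forall>n. Y n \<in> borel_measurable M) \<and> Z \<in> borel_measurable M \<and>
     (\<forall>e>0. (\<lambda>n. measure M {\<omega>\<in>space M. e < \<bar>Y n \<omega> - Z \<omega>\<bar>}) \<longlonglongrightarrow> 0)"


section \<open>Random measures\<close>

text \<open>\<open>c\<close> is the reference measure; the random measure is indexed by the sets of finite
  \<open>c\<close>-measure.\<close>

definition independently_scattered ::
  "'w measure \<Rightarrow> 'z measure \<Rightarrow> ('z set \<Rightarrow> 'w \<Rightarrow> real) \<Rightarrow> bool" where
  "independently_scattered M c L \<longleftrightarrow>
     (\<forall>A\<in>fmeasurable c. L A \<in> borel_measurable M) \<and>
     (\<forall>A :: nat \<Rightarrow> 'z set. range A \<subseteq> fmeasurable c \<and> disjoint_family A \<longrightarrow>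
        prob_space.indep_vars M (\<lambda>_. borel) (\<lambda>n. L (A n)) UNIV \<and>
        ((\<Union>n. A n) \<in> fmeasurable c \<longrightarrow>
           (AE \<omega> in M. (\<lambda>n. L (A n) \<omega>) sums L (\<Union>n. A n) \<omega>)))"

definition gaussian_basis ::
  "'w measure \<Rightarrow> 'z measure \<Rightarrow> ('z set \<Rightarrow> 'w \<Rightarrow> real) \<Rightarrow> bool" where
  "gaussian_basis M c W \<longleftrightarrow>
     independently_scattered M c W \<and>
     (\<forall>A\<in>fmeasurable c. \<forall>\<theta>::real.
        (CLINT \<omega>|M. iexp (\<theta> * W A \<omega>)) = exp (- complex_of_real (\<theta>\<^sup>2 * measure c A / 2)))"

definition levy_basis ::
  "'w measure \<Rightarrow> 'z measure \<Rightarrow> ('z set \<Rightarrow> 'w \<Rightarrow> real) \<Rightarrow> bool" where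
  "levy_basis M c L \<longleftrightarrow>
     independently_scattered M c L \<and>
     (\<forall>A\<in>fmeasurable c. infinitely_divisible (distr M borel (L A)))"

text \<open>The Rajput--Rosinski integral of a deterministic function. The integral is determined
  up to almost sure equality only, hence a relation: \<open>Y\<close> is a version of the
  integral of \<open>f\<close>.\<close>

definition rm_simple_integral ::
  "'z measure \<Rightarrow> ('z set \<Rightarrow> 'w \<Rightarrow> real) \<Rightarrow> ('z \<Rightarrow> real) \<Rightarrow> 'z set \<Rightarrow> 'w \<Rightarrow> real" where
  "rm_simple_integral c L f A \<omega> =
     (\<Sum>v\<in>f ` space c - {0}. v * L (A \<inter> f -` {v} \<inter> space c) \<omega>)"

definition has_rr_integral ::
  "'w measure \<Rightarrow> 'z measure \<Rightarrow> ('z set \<Rightarrow> 'w \<Rightarrow> real) \<Rightarrow> ('z \<Rightarrow> real) \<Rightarrow> ('w \<Rightarrow> real) \<Rightarrow> bool" where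
  "has_rr_integral M c L f Y \<longleftrightarrow>
     f \<in> borel_measurable c \<and>
     (\<exists>\<phi>. (\<forall>n. Bochner_Integration.simple_bochner_integrable c (\<phi> n)) \<and>
          (AE z in c. (\<lambda>n. \<phi> n z) \<longlonglongrightarrow> f z) \<and>
          (\<forall>A\<in>sets c. \<exists>Z. converges_in_probability M (\<lambda>n. rm_simple_integral c L (\<phi> n) A) Z) \<and>
          converges_in_probability M (\<lambda>n. rm_simple_integral c L (\<phi> n) (space c)) Y)"


section \<open>Walsh's stochastic integral\<close>

definition usual_conditions :: "'w measure \<Rightarrow> (real \<Rightarrow> 'w measure) \<Rightarrow> bool" where
  "usual_conditions M F \<longleftrightarrow>
     filtration (space M) F \<and>
     (\<forall>r. sets (F r) \<subseteq> sets M) \<and>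
     (\<forall>r. sets (F r) = (\<Inter>q\<in>{r<..}. sets (F q))) \<and>
     (\<forall>r. \<forall>N\<in>null_sets M. \<forall>A\<subseteq>N. A \<in> sets (F r))"

text \<open>\<open>E\<close> is a space-time domain, \<open>\<tau>\<close> extracts the time coordinate of a point and \<open>\<pi>\<close>
  resets it to \<open>0\<close>, so that \<open>time_strip E \<tau> \<pi> a b B\<close> is the product of
  the time interval \<open>{a<..b}\<close> with a set of space coordinates.\<close>

definition time_strip ::
  "'z measure \<Rightarrow> ('z \<Rightarrow> real) \<Rightarrow> ('z \<Rightarrow> 'z) \<Rightarrow> real \<Rightarrow> real \<Rightarrow> 'z set \<Rightarrow> 'z set" where
  "time_strip E \<tau> \<pi> a b B = {z\<in>space E. a < \<tau> z \<and> \<tau> z \<le> b \<and> \<pi> z \<in> B}"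

definition predictable_sigma ::
  "'w measure \<Rightarrow> (real \<Rightarrow> 'w measure) \<Rightarrow> 'z measure \<Rightarrow> ('z \<Rightarrow> real) \<Rightarrow> ('z \<Rightarrow> 'z) \<Rightarrow> ('z \<times> 'w) measure"
  where
  "predictable_sigma M F E \<tau> \<pi> =
     sigma (space E \<times> space M)
       {time_strip E \<tau> \<pi> a b B \<times> A | a b B A. B \<in> sets E \<and> A \<in> sets (F a)}"

text \<open>An elementary integrand \<open>(Z, a, b, B)\<close> stands for \<open>Z\<close> times the indicator of the strip
  \<open>{a<..b} \<times> B\<close>; a simple integrand is a finite sum of elementary ones.\<close>

type_synonym ('z, 'w) elementary = "('w \<Rightarrow> real) \<times> real \<times> real \<times> 'z set"

definition elementary_integrand ::
  "(real \<Rightarrow> 'w measure) \<Rightarrow> 'z measure \<Rightarrow> ('z \<Rightarrow> real) \<Rightarrow> ('z \<Rightarrow> 'z) \<Rightarrow> ('z, 'w) elementary \<Rightarrow> bool"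
  where
  "elementary_integrand F c \<tau> \<pi> = (\<lambda>(Z, a, b, B).
     Z \<in> borel_measurable (F a) \<and> (\<exists>C. \<forall>\<omega>\<in>space (F a). \<bar>Z \<omega>\<bar> \<le> C) \<and>
     B \<in> sets c \<and> time_strip c \<tau> \<pi> a b B \<in> fmeasurable c)"

definition simple_integrand ::
  "'z measure \<Rightarrow> ('z \<Rightarrow> real) \<Rightarrow> ('z \<Rightarrow> 'z) \<Rightarrow> ('z, 'w) elementary list \<Rightarrow> 'z \<Rightarrow> 'w \<Rightarrow> real" where
  "simple_integrand c \<tau> \<pi> es z \<omega> =
     (\<Sum>(Z, a, b, B)\<leftarrow>es. Z \<omega> * indicator (time_strip c \<tau> \<pi> a b B) z)"

definition walsh_simple_integral ::
  "'z measure \<Rightarrow> ('z \<Rightarrow> real) \<Rightarrow> ('z \<Rightarrow> 'z) \<Rightarrow> ('z set \<Rightarrow> 'w \<Rightarrow> real) \<Rightarrow>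
   ('z, 'w) elementary list \<Rightarrow> 'w \<Rightarrow> real" where
  "walsh_simple_integral c \<tau> \<pi> W es \<omega> =
     (\<Sum>(Z, a, b, B)\<leftarrow>es. Z \<omega> * W (time_strip c \<tau> \<pi> a b B) \<omega>)"

text \<open>\<open>Y\<close> is a version of the Walsh integral of the predictable, square integrable \<open>f\<close>:
  the limit in mean square of the integrals of simple integrands converging to \<open>f\<close> in mean
  square with respect to the product of \<open>c\<close> and the probability measure.\<close>

definition has_walsh_integral ::
  "'w measure \<Rightarrow> (real \<Rightarrow> 'w measure) \<Rightarrow> 'z measure \<Rightarrow> ('z \<Rightarrow> real) \<Rightarrow> ('z \<Rightarrow> 'z) \<Rightarrow>
   ('z set \<Rightarrow> 'w \<Rightarrow> real) \<Rightarrow> ('z \<Rightarrow> 'w \<Rightarrow> real) \<Rightarrow> ('w \<Rightarrow> real) \<Rightarrow> bool" where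
  "has_walsh_integral M F c \<tau> \<pi> W f Y \<longleftrightarrow>
     (\<lambda>(z, \<omega>). f z \<omega>) \<in> borel_measurable (predictable_sigma M F c \<tau> \<pi>) \<and>
     (\<integral>\<^sup>+\<omega>. \<integral>\<^sup>+z. ennreal ((f z \<omega>)\<^sup>2) \<partial>c \<partial>M) < \<infinity> \<and>
     Y \<in> borel_measurable M \<and>
     (\<exists>es. (\<forall>n. \<forall>e\<in>set (es n). elementary_integrand F c \<tau> \<pi> e) \<and>
        (\<lambda>n. \<integral>\<^sup>+\<omega>. \<integral>\<^sup>+z. ennreal ((simple_integrand c \<tau> \<pi> (es n) z \<omega> - f z \<omega>)\<^sup>2) \<partial>c \<partial>M)
          \<longlonglongrightarrow> 0 \<and>
        (\<lambda>n. \<integral>\<^sup>+\<omega>. ennreal ((walsh_simple_integral c \<tau> \<pi> W (es n) \<omega> - Y \<omega>)\<^sup>2) \<partial>M)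
          \<longlonglongrightarrow> 0)"

abbreviation reset_coord :: "'d \<Rightarrow> real ^ 'd \<Rightarrow> real ^ 'd" where
  "reset_coord i s \<equiv> s - axis i (s $ i)"


section \<open>Volatility\<close>

definition small_jump_drift :: "real measure \<Rightarrow> real" where
  "small_jump_drift \<nu> = (LINT w:{w. \<bar>w\<bar> \<le> 1}|\<nu>. w)"

definition integrability_conditions :: "real measure \<Rightarrow> 'z measure \<Rightarrow> ('z \<Rightarrow> real) \<Rightarrow> bool" where
  "integrability_conditions \<nu> q \<phi> \<longleftrightarrow>
     \<phi> \<in> borel_measurable q \<and> (\<forall>z\<in>space q. 0 \<le> \<phi> z) \<and>
     (\<integral>\<^sup>+z. ennreal \<bar>\<phi> z * small_jump_drift \<nu> +
          (LINT w|\<nu>. w * \<phi> z * indicator {-1..1} (w * \<phi> z) - \<phi> z * w * indicator {-1..1} w)\<bar> \<partial>q)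
       < \<infinity> \<and>
     (\<integral>\<^sup>+z. \<integral>\<^sup>+w. ennreal (min 1 (\<bar>\<phi> z * w\<bar>\<^sup>2)) \<partial>\<nu> \<partial>q) < \<infinity>"

definition jump_measure_V ::
  "real measure \<Rightarrow> 'y measure \<Rightarrow> ('y \<times> 't::euclidean_space \<Rightarrow> real) \<Rightarrow> real measure" where
  "jump_measure_V \<nu> q k =
     measure_of {0<..} (sets (restrict_space borel {0<..}))
       (\<lambda>B. \<integral>\<^sup>+z. \<integral>\<^sup>+y. emeasure \<nu> {w\<in>space \<nu>. k (y, z) * w \<in> B} \<partial>q \<partial>lborel)"

definition integrated_variance ::
  "'x measure \<Rightarrow> ('x \<times> 't::euclidean_space \<Rightarrow> real) \<Rightarrow> ('t \<Rightarrow> 'w \<Rightarrow> real) \<Rightarrow> 't \<Rightarrow> 'w \<Rightarrow> real" where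
  "integrated_variance p g \<sigma> t \<omega> =
     (LINT (x, s)|(p \<Otimes>\<^sub>M lborel). (g (x, t - s))\<^sup>2 * (\<sigma> s \<omega>)\<^sup>2)"

end

theory Submission
  imports Defs
begin

text \<open>Given the volatility, \<open>X(t)\<close> is centred Gaussian with variance \<open>V(t)\<close>: the integrand is approximated
  in mean square by simple integrands whose coefficients are truncated values of the volatility at the corners of
  grid cells, and these are both adapted and measurable with respect to the volatility alone. Exchanging the order
  of integration, \<open>V(t)\<close> is the integral of \<open>k(y, t - u)\<close> with respect to the Levy basis, whose
  Laplace transform is explicit. The joint characteristic functions of \<open>X\<close> only depend on integrals
  over all of space and are invariant under translations. Roots of the laws are obtained by stretching
  space, since the exponent of the integral of \<open>k(y, n\<^sup>1\<^sup>/\<^sup>d z)\<close> is that of \<open>k\<close> divided by \<open>n\<close>. A Rajput--Rosinski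
  integral with finite mean has an integrable integrand, which makes all these integrals absolutely convergent.\<close>

text \<open>Two obstacles shape the proof. The definition of the Walsh integral admits coefficients
  that know the past of \<open>W\<close>, and for these conditioning on the volatility does not
  leave a Gaussian sum. The isometry permits any other approximating sequence, but one with suitable
  coefficients has to be built; since no path regularity is assumed, its convergence rests on
  continuity of translations in mean, made uniform in the base point by stationarity. Second, the
  Rajput-Rosinski integral is only a limit in probability, on every set, of integrals of simple
  functions that need not converge in mean. A gliding hump argument shows that the escaping part is
  negligible in probability, and one-sided mean estimates then bound the expectation from below for
  a kernel not yet known to be integrable. The Levy basis is given by characteristic functions only;
  positivity and Laplace transforms come from approximating laws on the half line. When the mean
  square of \<open>X\<close> is zero, one of its two factors may be infinite, so this case is
  treated apart.\<close>

abbreviation (input) Bm :: "'a measure \<Rightarrow> ('a \<Rightarrow> 'b::topological_space) set" where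
 "Bm \<equiv> borel_measurable"

abbreviation (input) en :: "real \<Rightarrow> ennreal" where "en \<equiv> ennreal"

abbreviation (input) nI :: "'a measure \<Rightarrow> ('a \<Rightarrow> ennreal) \<Rightarrow> ennreal" where "nI \<equiv> nn_integral"

abbreviation (input) cor :: "real \<Rightarrow> complex" where "cor \<equiv> complex_of_real"

lemma nn_integral_abs_triangle:
 fixes f g h :: "'a => real"
 assumes [measurable]: "f \<in> Bm M" "g \<in> Bm M" "h \<in> Bm M"
 shows "(nI M (%z. en \<bar>f z - h z\<bar>)) \<le> (nI M (%z. en \<bar>f z - g z\<bar>)) + (nI M (%z. en \<bar>g z - h z\<bar>))"
proof -
 have "(nI M (%z. en \<bar>f z - h z\<bar>)) \<le> (nI M (%z. en \<bar>f z - g z\<bar> + en \<bar>g z - h z\<bar>))"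
  by (intro nn_integral_mono) (simp add: ennreal_plus[symmetric] del: ennreal_plus)
 also have "... = (nI M (%z. en \<bar>f z - g z\<bar>)) + (nI M (%z. en \<bar>g z - h z\<bar>))"
  by (intro nn_integral_add) auto
 finally show ?thesis .
qed

subsection \<open>Approximation by measurable rectangles\<close>

definition rect_sum :: "(real \<times> 'a set \<times> 'b set) list => 'a \<times> 'b => real" where
 "rect_sum l z = (\<Sum>(a, A, B)\<leftarrow>l. a * indicator A (fst z) * indicator B (snd z))"

definition rect_list :: "'a measure => 'b measure => (real \<times> 'a set \<times> 'b set) list => bool" where
 "rect_list M N l \<longleftrightarrow> (\<forall>(a, A, B)\<in>set l. A \<in> fmeasurable M \<and> B \<in> fmeasurable N)"

definition rect_approximable :: "'a measure => 'b measure => ('a \<times> 'b => real) => bool" where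
 "rect_approximable M N f \<longleftrightarrow> f \<in> Bm (M \<Otimes>\<^sub>M N) \<and>
   (\<forall>e>0. \<exists>l. rect_list M N l \<and> (nI (M \<Otimes>\<^sub>M N) (%z. en \<bar>f z - rect_sum l z\<bar>)) < en e)"

lemma rect_sum_simps [simp]:
 "rect_sum [] z = 0"
 "rect_sum ((a, A, B) # l) z = a * indicator A (fst z) * indicator B (snd z) + rect_sum l z"
 "rect_sum (l @ l') z = rect_sum l z + rect_sum l' z"
 by (auto simp: rect_sum_def)

lemma rect_list_simps [simp]:
 "rect_list M N []"
 "rect_list M N ((a, A, B) # l) \<longleftrightarrow> A \<in> fmeasurable M \<and> B \<in> fmeasurable N \<and> rect_list M N l"
 "rect_list M N (l @ l') \<longleftrightarrow> rect_list M N l \<and> rect_list M N l'"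
 by (simp_all add: rect_list_def ball_Un)

lemma rect_sum_measurable:
 "rect_list M N l ==> rect_sum l \<in> Bm (M \<Otimes>\<^sub>M N)"
proof (induction l)
 case Nil
 then show ?case by (simp add: rect_sum_def[abs_def])
next
 case (Cons r l)
 obtain a A B where r: "r = (a, A, B)" by (cases r)
 with Cons have [measurable]: "A \<in> sets M" "B \<in> sets N" "rect_sum l \<in> Bm (M \<Otimes>\<^sub>M N)"
  by auto
 have "(%z. a * indicator A (fst z) * indicator B (snd z) + rect_sum l z) \<in> Bm (M \<Otimes>\<^sub>M N)"
  by measurable
 moreover have "rect_sum (r # l) = (%z. a * indicator A (fst z) * indicator B (snd z) + rect_sum l z)"
  by (simp add: r fun_eq_iff)
 ultimately show ?case by simp
qed

lemma rect_approximableI: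
 assumes f [measurable]: "f \<in> Bm (M \<Otimes>\<^sub>M N)"
  and lim: "\<And>e. e > 0 ==> \<exists>g. rect_approximable M N g \<and> (nI (M \<Otimes>\<^sub>M N) (%z. en \<bar>f z - g z\<bar>)) < en e"
 shows "rect_approximable M N f"
 unfolding rect_approximable_def
proof (intro conjI allI impI f)
 fix e :: real assume "e > 0"
 then obtain g where g: "rect_approximable M N g" "(nI (M \<Otimes>\<^sub>M N) (%z. en \<bar>f z - g z\<bar>)) < en (e/2)"
  using lim[of "e/2"] by auto
 then obtain l where l: "rect_list M N l" "(nI (M \<Otimes>\<^sub>M N) (%z. en \<bar>g z - rect_sum l z\<bar>)) < en (e/2)"
  using \<open>e > 0\<close> unfolding rect_approximable_def by (meson half_gt_zero)
 note [measurable] = rect_sum_measurable[OF l(1)]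
 have [measurable]: "g \<in> Bm (M \<Otimes>\<^sub>M N)" using g by (simp add: rect_approximable_def)
 have "(nI (M \<Otimes>\<^sub>M N) (%z. en \<bar>f z - rect_sum l z\<bar>)) \<le>
   (nI (M \<Otimes>\<^sub>M N) (%z. en \<bar>f z - g z\<bar>)) + (nI (M \<Otimes>\<^sub>M N) (%z. en \<bar>g z - rect_sum l z\<bar>))"
  by (rule nn_integral_abs_triangle) measurable
 also have "... < en (e/2) + en (e/2)"
  using g l by (intro add_strict_mono) auto
 also have "... = en e" using \<open>e > 0\<close> by (simp add: ennreal_plus[symmetric] del: ennreal_plus)
 finally show "\<exists>l. rect_list M N l \<and> (nI (M \<Otimes>\<^sub>M N) (%z. en \<bar>f z - rect_sum l z\<bar>)) < en e"
  using l by blast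
qed

lemma rect_approximable_add:
 assumes "rect_approximable M N f" "rect_approximable M N g"
 shows "rect_approximable M N (%z. f z + g z)"
 unfolding rect_approximable_def
proof (intro conjI allI impI)
 have [measurable]: "f \<in> Bm (M \<Otimes>\<^sub>M N)" "g \<in> Bm (M \<Otimes>\<^sub>M N)"
  using assms by (auto simp: rect_approximable_def)
 show "(%z. f z + g z) \<in> Bm (M \<Otimes>\<^sub>M N)" by measurable
 fix e :: real assume "e > 0"
 then obtain l l' where l: "rect_list M N l" "(nI (M \<Otimes>\<^sub>M N) (%z. en \<bar>f z - rect_sum l z\<bar>)) < en (e/2)"
   and l': "rect_list M N l'" "(nI (M \<Otimes>\<^sub>M N) (%z. en \<bar>g z - rect_sum l' z\<bar>)) < en (e/2)"
  using assms unfolding rect_approximable_def by (meson half_gt_zero)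
 note [measurable] = rect_sum_measurable[OF l(1)] rect_sum_measurable[OF l'(1)]
 have "(nI (M \<Otimes>\<^sub>M N) (%z. en \<bar>f z + g z - rect_sum (l @ l') z\<bar>)) \<le>
   (nI (M \<Otimes>\<^sub>M N) (%z. en \<bar>f z - rect_sum l z\<bar> + en \<bar>g z - rect_sum l' z\<bar>))"
  by (intro nn_integral_mono) (simp add: ennreal_plus[symmetric] del: ennreal_plus)
 also have "... = (nI (M \<Otimes>\<^sub>M N) (%z. en \<bar>f z - rect_sum l z\<bar>)) + (nI (M \<Otimes>\<^sub>M N) (%z. en \<bar>g z - rect_sum l' z\<bar>))"
  by (intro nn_integral_add) measurable
 also have "... < en (e/2) + en (e/2)"
  using l l' by (intro add_strict_mono) auto
 also have "... = en e" using \<open>e > 0\<close> by (simp add: ennreal_plus[symmetric] del: ennreal_plus)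
 finally show "\<exists>l. rect_list M N l \<and> (nI (M \<Otimes>\<^sub>M N) (%z. en \<bar>f z + g z - rect_sum l z\<bar>)) < en e"
  using l l' by (intro exI[of _ "l @ l'"]) auto
qed

lemma rect_sum_scale: "rect_sum (map (%(a, A, B). (c * a, A, B)) l) z = c * rect_sum l z"
 by (induction l) (auto simp: algebra_simps)

lemma rect_list_scale: "rect_list M N l ==> rect_list M N (map (%(a, A, B). (c * a, A, B)) l)"
 by (auto simp: rect_list_def)

lemma rect_approximable_scale:
 assumes "rect_approximable M N f"
 shows "rect_approximable M N (%z. c * f z)"
 unfolding rect_approximable_def
proof (intro conjI allI impI)
 have [measurable]: "f \<in> Bm (M \<Otimes>\<^sub>M N)"
  using assms by (auto simp: rect_approximable_def)
 show "(%z. c * f z) \<in> Bm (M \<Otimes>\<^sub>M N)" by measurable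
 fix e :: real assume "e > 0"
 then obtain l where l: "rect_list M N l" "(nI (M \<Otimes>\<^sub>M N) (%z. en \<bar>f z - rect_sum l z\<bar>)) < en (e/(\<bar>c\<bar>+1))"
  using assms unfolding rect_approximable_def by (meson divide_pos_pos abs_ge_zero add_nonneg_pos zero_less_one)
 note [measurable] = rect_sum_measurable[OF l(1)]
 have "(nI (M \<Otimes>\<^sub>M N) (%z. en \<bar>c * f z - c * rect_sum l z\<bar>)) =
   (nI (M \<Otimes>\<^sub>M N) (%z. en \<bar>c\<bar> * en \<bar>f z - rect_sum l z\<bar>))"
  by (intro nn_integral_cong)
    (simp add: right_diff_distrib[symmetric] abs_mult ennreal_mult[symmetric])
 also have "... = en \<bar>c\<bar> * (nI (M \<Otimes>\<^sub>M N) (%z. en \<bar>f z - rect_sum l z\<bar>))"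
  by (intro nn_integral_cmult) measurable
 also have "... \<le> ennreal \<bar>c\<bar> * en (e/(\<bar>c\<bar>+1))"
  using l by (intro mult_left_mono) auto
 also have "... = en (\<bar>c\<bar> * (e/(\<bar>c\<bar>+1)))" using \<open>e > 0\<close> by (simp add: ennreal_mult[symmetric] del: times_divide_eq_right)
 also have "... < en e"
  using \<open>e > 0\<close> by (intro ennreal_lessI) (auto simp: field_simps)
 finally show "\<exists>l. rect_list M N l \<and> (nI (M \<Otimes>\<^sub>M N) (%z. en \<bar>c * f z - rect_sum l z\<bar>)) < en e"
  using rect_list_scale[OF l(1), of c] by (intro exI[of _ "map (%(a, A, B). (c * a, A, B)) l"])
   (simp only: rect_sum_scale simp_thms)
qed

lemma rect_approximable_rectangle:
 assumes "A \<in> fmeasurable M" "B \<in> fmeasurable N"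
 shows "rect_approximable M N (%z. indicator A (fst z) * indicator B (snd z))"
 unfolding rect_approximable_def
proof (intro conjI allI impI)
 have [measurable]: "A \<in> sets M" "B \<in> sets N" using assms by auto
 show "(%z. indicator A (fst z) * indicator B (snd z) :: real) \<in> Bm (M \<Otimes>\<^sub>M N)" by measurable
 fix e :: real assume "e > 0"
 have "rect_list M N [(1, A, B)]" using assms by simp
 moreover have "(nI (M \<Otimes>\<^sub>M N) (%z. en \<bar>indicator A (fst z) * indicator B (snd z) - rect_sum [(1, A, B)] z\<bar>)) < en e"
  using \<open>e > 0\<close> by simp
 ultimately show "\<exists>l. rect_list M N l \<and>
   (nI (M \<Otimes>\<^sub>M N) (%z. en \<bar>indicator A (fst z) * indicator B (snd z) - rect_sum l z\<bar>)) < en e"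
  by blast
qed

text \<open>Measurable rectangles form an intersection-stable generator, and the sets whose trace on
  a fixed box is approximable are closed under complement and disjoint union. The finite measure of
  the box keeps the trace of a complement approximable and makes the tail of a countable union
  small.\<close>

lemma rect_approximable_indicator_box:
 assumes F: "F \<in> fmeasurable M" and G: "G \<in> fmeasurable N"
  and "sigma_finite_measure N" and Q: "Q \<in> sets (M \<Otimes>\<^sub>M N)"
 shows "rect_approximable M N (indicator (Q \<inter> F \<times> G))"
proof -
 interpret N: sigma_finite_measure N by fact
 have [measurable]: "F \<in> sets M" "G \<in> sets N" using F G by auto
 have fin: "emeasure (M \<Otimes>\<^sub>M N) (F \<times> G) < \<infinity>"
  using F G by (simp add: N.emeasure_pair_measure_Times fmeasurable_def ennreal_mult_less_top)
 have Q': "Q \<in> sigma_sets (space M \<times> space N) {a \<times> b |a b. a \<in> sets M \<and> b \<in> sets N}"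
  using Q by (simp add: sets_pair_measure)
 have sub: "{a \<times> b |a b. a \<in> sets M \<and> b \<in> sets N} \<subseteq> Pow (space M \<times> space N)"
  by (auto dest: sets.sets_into_space)
 from Int_stable_pair_measure_generator[of M N] sub Q' show ?thesis
 proof (induction rule: sigma_sets_induct_disjoint)
  case (basic X)
  then obtain a b where ab: "X = a \<times> b" "a \<in> sets M" "b \<in> sets N" by auto
  have "(indicator (X \<inter> F \<times> G) :: _ => real) = (%z. indicator (a \<inter> F) (fst z) * indicator (b \<inter> G) (snd z))"
   by (auto simp: ab indicator_def fun_eq_iff)
  then show ?case
   using rect_approximable_rectangle[of "a \<inter> F" M "b \<inter> G" N] ab F G
   by (simp add: fmeasurable_Int_fmeasurable Int_commute)
 next
  case empty
  have "(indicator ({} \<inter> F \<times> G) :: _ => real) = (%z. 0 * (indicator F (fst z) * indicator G (snd z)))"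
   by auto
  then show ?case using rect_approximable_scale[OF rect_approximable_rectangle[OF F G], of 0] by simp
 next
  case (compl A)
  have "(indicator ((space M \<times> space N - A) \<inter> F \<times> G) :: _ => real) =
    (%z. indicator F (fst z) * indicator G (snd z) + (-1) * indicator (A \<inter> F \<times> G) z)"
   using sets.sets_into_space[of F M] sets.sets_into_space[of G N]
   by (auto simp: indicator_def fun_eq_iff)
  then show ?case
   using rect_approximable_add[OF rect_approximable_rectangle[OF F G] rect_approximable_scale[OF compl(2), of "-1"]]
   by simp
 next
  case (union A)
  have [measurable]: "\<And>i. A i \<in> sets (M \<Otimes>\<^sub>M N)"
   using union(2) by (auto simp: sets_pair_measure)
  show ?case
  proof (rule rect_approximableI)
   show "indicator (\<Union> (range A) \<inter> F \<times> G) \<in> Bm (M \<Otimes>\<^sub>M N)" by measurable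
   fix e :: real assume "e > 0"
   \<comment> \<open>\<open>R n\<close> is what the first \<open>n\<close> sets miss inside the box.
     It decreases to the empty set, and the finite measure of the box turns this into convergence of
     the measures.\<close>
   define R where "R n = (\<Union>i. A i) \<inter> F \<times> G - (\<Union>i<n. A i)" for n
   have [measurable]: "R n \<in> sets (M \<Otimes>\<^sub>M N)" for n unfolding R_def by measurable
   have "(%n. emeasure (M \<Otimes>\<^sub>M N) (R n)) \<longlonglongrightarrow> emeasure (M \<Otimes>\<^sub>M N) (\<Inter>n. R n)"
   proof (rule Lim_emeasure_decseq)
    show "decseq R" unfolding decseq_def R_def by force
    have "emeasure (M \<Otimes>\<^sub>M N) (R n) \<le> emeasure (M \<Otimes>\<^sub>M N) (F \<times> G)" for n
     by (intro emeasure_mono) (auto simp: R_def)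
    then show "emeasure (M \<Otimes>\<^sub>M N) (R n) \<noteq> \<infinity>" for n
     using fin by (metis infinity_ennreal_def leD top.not_eq_extremum)
   qed auto
   moreover have "(\<Inter>n. R n) = {}" unfolding R_def by auto
   ultimately have "(%n. emeasure (M \<Otimes>\<^sub>M N) (R n)) \<longlonglongrightarrow> 0" by simp
   then have "\<forall>\<^sub>F n in sequentially. emeasure (M \<Otimes>\<^sub>M N) (R n) < en e"
    using \<open>e > 0\<close> by (intro order_tendstoD(2)) auto
   then obtain n where n: "emeasure (M \<Otimes>\<^sub>M N) (R n) < en e" by (auto simp: eventually_sequentially)
   have "rect_approximable M N (%z. \<Sum>i<n. indicator (A i \<inter> F \<times> G) z)"
   proof (induction n)
    case 0
    then show ?case using rect_approximable_scale[OF rect_approximable_rectangle[OF F G], of 0] by simp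
   next
    case (Suc n)
    then show ?case using rect_approximable_add[OF Suc union(3)[of n]] by simp
   qed
   moreover have "\<bar>indicator (\<Union> (range A) \<inter> F \<times> G) z - (\<Sum>i<n. indicator (A i \<inter> F \<times> G) z)\<bar> = (indicator (R n) z :: real)" for z
   proof -
    have "(\<Sum>i<n. indicator (A i \<inter> F \<times> G) z) = (indicator (\<Union>i<n. A i \<inter> F \<times> G) z :: real)"
     using union(1) by (intro indicator_UN_disjoint[symmetric]) (auto simp: disjoint_family_on_def)
    then show ?thesis by (auto simp: R_def indicator_def)
   qed
   ultimately show "\<exists>g. rect_approximable M N g \<and>
     (nI (M \<Otimes>\<^sub>M N) (%z. en \<bar>indicator (\<Union> (range A) \<inter> F \<times> G) z - g z\<bar>)) < en e"
    using n by (intro exI[of _ "%z. \<Sum>i<n. indicator (A i \<inter> F \<times> G) z"]) (auto simp: ennreal_indicator)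
  qed
 qed
qed

text \<open>The boxes \<open>F n \<times> G n\<close> exhaust the product, and the part of
  \<open>Q\<close> outside them has measure tending to zero because \<open>Q\<close> has finite
  measure.\<close>

lemma rect_approximable_indicator:
 assumes "sigma_finite_measure M" "sigma_finite_measure N"
  and Q [measurable]: "Q \<in> sets (M \<Otimes>\<^sub>M N)" and fin: "emeasure (M \<Otimes>\<^sub>M N) Q < \<infinity>"
 shows "rect_approximable M N (indicator Q)"
proof (rule rect_approximableI)
 interpret M: sigma_finite_measure M by fact
 interpret N: sigma_finite_measure N by fact
 show "indicator Q \<in> Bm (M \<Otimes>\<^sub>M N)" by measurable
 fix e :: real assume "e > 0"
 obtain F :: "nat => _" where F: "range F \<subseteq> sets M" "(\<Union>i. F i) = space M" "\<And>i. emeasure M (F i) \<noteq> \<infinity>" "incseq F"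
  by (rule M.sigma_finite_incseq) blast
 obtain G :: "nat => _" where G: "range G \<subseteq> sets N" "(\<Union>i. G i) = space N" "\<And>i. emeasure N (G i) \<noteq> \<infinity>" "incseq G"
  by (rule N.sigma_finite_incseq) blast
 have [measurable]: "F n \<in> sets M" "G n \<in> sets N" for n using F G by auto
 define R where "R n = Q - F n \<times> G n" for n
 have [measurable]: "R n \<in> sets (M \<Otimes>\<^sub>M N)" for n unfolding R_def by measurable
 have "(%n. emeasure (M \<Otimes>\<^sub>M N) (R n)) \<longlonglongrightarrow> emeasure (M \<Otimes>\<^sub>M N) (\<Inter>n. R n)"
 proof (rule Lim_emeasure_decseq)
  show "decseq R" using F(4) G(4) unfolding incseq_def decseq_def R_def by blast
  have "emeasure (M \<Otimes>\<^sub>M N) (R n) \<le> emeasure (M \<Otimes>\<^sub>M N) Q" for n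
   by (intro emeasure_mono) (auto simp: R_def)
  then show "emeasure (M \<Otimes>\<^sub>M N) (R n) \<noteq> \<infinity>" for n
   using fin by (metis infinity_ennreal_def leD top.not_eq_extremum)
 qed auto
 moreover have "(\<Inter>n. R n) = {}"
 proof -
  have "\<exists>n. z \<in> F n \<times> G n" if "z \<in> Q" for z
  proof -
   have "z \<in> space M \<times> space N" using sets.sets_into_space[OF Q] that by (auto simp: space_pair_measure)
   then have "fst z \<in> (\<Union>i. F i)" "snd z \<in> (\<Union>i. G i)" using F(2) G(2) by auto
   then obtain i j where "fst z \<in> F i" "snd z \<in> G j" by auto
   then have "fst z \<in> F (max i j)" "snd z \<in> G (max i j)"
    using F(4) G(4) by (meson incseq_def max.cobounded1 max.cobounded2 subsetD)+
   then show ?thesis by (metis mem_Times_iff)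
  qed
  then show ?thesis by (auto simp: R_def)
 qed
 ultimately have "(%n. emeasure (M \<Otimes>\<^sub>M N) (R n)) \<longlonglongrightarrow> 0" by simp
 then have "\<forall>\<^sub>F n in sequentially. emeasure (M \<Otimes>\<^sub>M N) (R n) < en e"
  using \<open>e > 0\<close> by (intro order_tendstoD(2)) auto
 then obtain n where n: "emeasure (M \<Otimes>\<^sub>M N) (R n) < en e" by (auto simp: eventually_sequentially)
 have "rect_approximable M N (indicator (Q \<inter> F n \<times> G n))"
  using F G assms by (intro rect_approximable_indicator_box) (auto simp: fmeasurable_def top.not_eq_extremum)
 moreover have "\<bar>indicator Q z - indicator (Q \<inter> F n \<times> G n) z\<bar> = (indicator (R n) z :: real)" for z
  by (auto simp: R_def indicator_def)
 ultimately show "\<exists>g. rect_approximable M N g \<and> (nI (M \<Otimes>\<^sub>M N) (%z. en \<bar>indicator Q z - g z\<bar>)) < en e"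
  using n by (intro exI[of _ "indicator (Q \<inter> F n \<times> G n)"]) (auto simp: ennreal_indicator)
qed

text \<open>Rectangle sums are dense in mean. They are the right class here because slicing,
  translating or integrating out one variable acts on each rectangle separately, so statements on
  functions of two variables reduce to statements on sets.\<close>

lemma integrable_imp_rect_approximable:
 assumes "sigma_finite_measure M" "sigma_finite_measure N"
  and "integrable (M \<Otimes>\<^sub>M N) f"
 shows "rect_approximable M N f"
 using assms(3)
proof (induction rule: integrable_induct)
 case (base A c)
 then show ?case
  using rect_approximable_scale[OF rect_approximable_indicator[OF assms(1,2), of A], of c]
  by (simp add: mult.commute)
next
 case (add f g)
 then show ?case by (intro rect_approximable_add)
next
 case (lim f s)
 have IH: "rect_approximable M N (s i)" for i by fact
 have [measurable]: "f \<in> Bm (M \<Otimes>\<^sub>M N)"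
  using lim by (auto dest: borel_measurable_integrable)
 show ?case
 proof (rule rect_approximableI)
  show "f \<in> Bm (M \<Otimes>\<^sub>M N)" by measurable
  fix e :: real assume "e > 0"
  have [measurable]: "\<And>i. s i \<in> Bm (M \<Otimes>\<^sub>M N)"
   using lim by (auto dest: borel_measurable_integrable)
  have "(%i. nI (M \<Otimes>\<^sub>M N) (%x. norm (f x - s i x))) \<longlonglongrightarrow> 0"
  proof (rule nn_integral_dominated_convergence_norm[where w="%x. 2 * norm (f x)"])
   show "(nI (M \<Otimes>\<^sub>M N) (%x. en (2 * norm (f x)))) < \<infinity>"
    using lim(4) by (simp add: ennreal_mult nn_integral_cmult integrable_iff_bounded ennreal_mult_less_top)
  qed (use lim in auto)
  then have "\<forall>\<^sub>F i in sequentially. (nI (M \<Otimes>\<^sub>M N) (%x. norm (f x - s i x))) < en e"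
   using \<open>e > 0\<close> by (intro order_tendstoD(2)) auto
  then obtain i where "(nI (M \<Otimes>\<^sub>M N) (%x. en \<bar>f x - s i x\<bar>)) < en e"
   by (auto simp: eventually_sequentially)
  then show "\<exists>g. rect_approximable M N g \<and> (nI (M \<Otimes>\<^sub>M N) (%z. en \<bar>f z - g z\<bar>)) < en e"
   using IH by blast
 qed
qed

subsection \<open>Continuity of translations in mean\<close>

lemma nn_integral_lborel_translate:
 fixes f :: "'a::euclidean_space => ennreal"
 assumes [measurable]: "f \<in> Bm borel"
 shows "(nI lborel (%s. f (s + r))) = (nI lborel (%s. f s))"
proof -
 have "(nI lborel (%s. f s)) = (\<integral>\<^sup>+s. f s \<partial>distr lborel borel ((+) r))"
  by (simp add: lborel_distr_plus)
 also have "... = (nI lborel (%s. f (s + r)))"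
  by (subst nn_integral_distr) (auto simp: add.commute)
 finally show ?thesis by simp
qed

text \<open>A compact \<open>K\<close> inside \<open>A\<close> and an open \<open>U\<close> around
  \<open>K\<close> (not around \<open>A\<close>) suffice: for shifts shorter than the margin of
  \<open>K\<close> in \<open>U\<close>, a point where the two indicators differ lies, itself or
  after the shift, in \<open>A - K\<close> or in \<open>U - K\<close>.\<close>

lemma set_translation_continuous:
 fixes A :: "'a::euclidean_space set"
 assumes A: "A \<in> fmeasurable lborel" and "e > 0"
 shows "\<exists>d>0. \<forall>r. norm r < d \<longrightarrow>
  (nI lborel (%s. en \<bar>indicator A (s + r) - indicator A s\<bar>)) < en e"
proof -
 have A' [measurable]: "A \<in> sets borel" and finA: "emeasure lborel A < \<infinity>"
  using A by (auto simp: fmeasurable_def)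
 \<comment> \<open>Four sets of measure below \<open>e/8\<close> enter the final bound, two of them
   translates, which adds up to \<open>e/2\<close>.\<close>
 have "\<exists>K. compact K \<and> K \<subseteq> A \<and> emeasure lborel (A - K) < en (e/8)"
 proof -
  have eq: "emeasure lborel A = (SUP K \<in> {K. K \<subseteq> A \<and> compact K}. emeasure lborel K)"
  proof -
   \<comment> \<open>Inner regularity is a statement on finite measures, so it is applied to
     Lebesgue measure concentrated on \<open>A\<close>.\<close>
   define N where "N = density lborel (indicator A)"
   have sN: "sets N = sets borel" "space N = UNIV" by (auto simp: N_def)
   have emN: "emeasure N B = emeasure lborel (A \<inter> B)" if "B \<in> sets borel" for B
    using that by (simp add: N_def emeasure_density indicator_inter_arith[symmetric])
   have "emeasure N (space N) \<noteq> \<infinity>" using finA by (simp add: emN sN)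
   then have "emeasure N A = (SUP K \<in> {K. K \<subseteq> A \<and> compact K}. emeasure N K)"
    by (intro inner_regular) (use sN in auto)
   also have "... = (SUP K \<in> {K. K \<subseteq> A \<and> compact K}. emeasure lborel K)"
    by (intro SUP_cong refl) (auto simp: emN borel_compact Int_absorb1)
   finally show ?thesis by (simp add: emN)
  qed
  show ?thesis
  proof (cases "emeasure lborel A = 0")
   case True
   then show ?thesis using \<open>e > 0\<close> by (intro exI[of _ "{}"]) auto
  next
   case False
   then have "emeasure lborel A - en (e/8) < emeasure lborel A"
    using finA \<open>e > 0\<close> by (intro ennreal_between) (auto simp: zero_less_iff_neq_zero)
   then obtain K where K: "K \<subseteq> A" "compact K" "emeasure lborel A - en (e/8) < emeasure lborel K"
    unfolding eq less_SUP_iff by auto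
   have [measurable]: "K \<in> sets borel" using K by (simp add: borel_compact)
   have "emeasure lborel K < \<infinity>" using emeasure_mono[OF K(1), of lborel] finA by (auto simp: order.strict_trans1)
   then have "emeasure lborel (A - K) = emeasure lborel A - emeasure lborel K"
    using K by (intro emeasure_Diff) auto
   moreover have "emeasure lborel A - emeasure lborel K < en (e/8)"
   proof -
    obtain a where a: "emeasure lborel A = en a" "a \<ge> 0" using finA by (cases "emeasure lborel A") auto
    obtain k where k: "emeasure lborel K = en k" "k \<ge> 0" using \<open>emeasure lborel K < \<infinity>\<close> by (cases "emeasure lborel K") auto
    have "a - e/8 < k"
     using K(3) a(2) k(2) \<open>e > 0\<close> by (cases "a - e/8 \<ge> 0") (simp_all add: a(1) k(1) ennreal_minus ennreal_less_iff)
    then have "en (a - k) < en (e/8)" using \<open>e > 0\<close> by (intro ennreal_lessI) auto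
    then show ?thesis using k(2) by (simp add: a k ennreal_minus)
   qed
   ultimately show ?thesis using K by auto
  qed
 qed
 then obtain K where K: "compact K" "K \<subseteq> A" "emeasure lborel (A - K) < en (e/8)" by auto
 have [measurable]: "K \<in> sets borel" using K by (simp add: borel_compact)
 have "\<exists>U. open U \<and> K \<subseteq> U \<and> emeasure lborel (U - K) < en (e/8)"
  using outer_regular_lborel[of K "e/8"] \<open>e > 0\<close> K by (metis \<open>K \<in> sets borel\<close> divide_pos_pos zero_less_numeral)
 then obtain U where U: "open U" "K \<subseteq> U" "emeasure lborel (U - K) < en (e/8)" by auto
 have [measurable]: "U \<in> sets borel" using U by simp
 obtain d where d: "d > 0" "(\<Union>x\<in>K. ball x d) \<subseteq> U"
  using compact_subset_open_imp_ball_epsilon_subset[OF K(1) U(1,2)] by auto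
 show ?thesis
 proof (intro exI[of _ d] conjI allI impI d)
  fix r :: 'a assume r: "norm r < d"
  have mem: "x \<in> K ==> x + r \<in> U" "x + r \<in> K ==> x \<in> U" for x
  proof -
   assume "x \<in> K"
   then show "x + r \<in> U" using d r by (auto intro!: subsetD[OF d(2)] bexI[of _ x] simp: dist_norm)
  next
   assume "x + r \<in> K"
   then show "x \<in> U" using d r by (auto intro!: subsetD[OF d(2)] bexI[of _ "x + r"] simp: dist_norm)
  qed
  define f where "f s = (indicator (A - K) s + indicator (U - K) s :: ennreal)" for s
  have [measurable]: "f \<in> Bm borel" unfolding f_def by measurable
  have "(nI lborel (%s. en \<bar>indicator A (s + r) - indicator A s\<bar>)) \<le> (nI lborel (%s. f (s + r) + f s))"
  proof (intro nn_integral_mono)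
   fix s
   show "en \<bar>indicator A (s + r) - indicator A s\<bar> \<le> f (s + r) + f s"
    using mem[of s] K(2) U(2) by (auto simp: f_def indicator_def)
  qed
  also have "... = (nI lborel (%s. f s)) + (nI lborel (%s. f s))"
   by (subst nn_integral_add) (auto simp: nn_integral_lborel_translate)
  also have "... \<le> ennreal (e/4) + en (e/4)"
  proof -
   have "(nI lborel (%s. f s)) = emeasure lborel (A - K) + emeasure lborel (U - K)"
    unfolding f_def by (subst nn_integral_add) auto
   also have "... \<le> ennreal (e/8) + en (e/8)" using K U by (intro add_mono) auto
   also have "... = en (e/4)" using \<open>e > 0\<close> by (simp flip: ennreal_plus)
   finally show ?thesis by (intro add_mono)
  qed
  also have "... = en (e/2)" using \<open>e > 0\<close> by (simp flip: ennreal_plus)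
  also have "... < en e" using \<open>e > 0\<close> by (simp add: ennreal_less_iff)
  finally show "(nI lborel (%s. en \<bar>indicator A (s + r) - indicator A s\<bar>)) < en e" .
 qed
qed
lemma nn_integral_pair_translate:
 fixes f :: "'a::euclidean_space \<times> 'b => ennreal"
 assumes "sigma_finite_measure N" and [measurable]: "f \<in> Bm (lborel \<Otimes>\<^sub>M N)"
 shows "(nI (lborel \<Otimes>\<^sub>M N) (%z. f (fst z + r, snd z))) = (nI (lborel \<Otimes>\<^sub>M N) (%z. f z))"
proof -
 interpret N: sigma_finite_measure N by fact
 interpret P: pair_sigma_finite lborel N ..
 have [measurable]: "f \<in> Bm (borel \<Otimes>\<^sub>M N)"
  using assms(2) by (simp cong: measurable_cong_sets)
 have "(nI (lborel \<Otimes>\<^sub>M N) (%z. f (fst z + r, snd z))) = (nI N (%y. nI lborel (%s. f (s + r, y))))"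
  by (subst P.nn_integral_snd[symmetric]) auto
 also have "... = (nI N (%y. nI lborel (%s. f (s, y))))"
  by (intro nn_integral_cong nn_integral_lborel_translate[where f="%s. f (s, y)" for y]) auto
 also have "... = (nI (lborel \<Otimes>\<^sub>M N) (%z. f z))"
  by (subst P.nn_integral_snd) auto
 finally show ?thesis .
qed

lemma rect_sum_translation_continuous:
 fixes l :: "(real \<times> 'a::euclidean_space set \<times> 'b set) list"
 assumes "sigma_finite_measure N" "rect_list lborel N l" "e > 0"
 shows "\<exists>d>0. \<forall>r. norm r < d \<longrightarrow>
   (nI (lborel \<Otimes>\<^sub>M N) (%z. en \<bar>rect_sum l (fst z + r, snd z) - rect_sum l z\<bar>)) < en e"
 using assms(2,3)
proof (induction l arbitrary: e)
 case Nil
 then show ?case by (intro exI[of _ 1]) auto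
next
 case (Cons x l)
 obtain a A B where x: "x = (a, A, B)" by (cases x)
 interpret N: sigma_finite_measure N by fact
 interpret P: pair_sigma_finite lborel N ..
 have A: "A \<in> fmeasurable lborel" "B \<in> fmeasurable N" and l: "rect_list lborel N l"
  using Cons(2) by (auto simp: x)
 have [measurable]: "A \<in> sets borel" "B \<in> sets N" using A by auto
 have rl: "rect_sum l \<in> Bm (lborel \<Otimes>\<^sub>M N)" using rect_sum_measurable[OF l] .
 then have [measurable]: "rect_sum l \<in> Bm (borel \<Otimes>\<^sub>M N)"
  by (simp cong: measurable_cong_sets)
 \<comment> \<open>\<open>b\<close> is the factor by which a translation error of \<open>A\<close>
   is amplified in the term \<open>x\<close>. The added \<open>1\<close> in the denominators below
   covers the case \<open>b = 0\<close>.\<close>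
 define b where "b = \<bar>a\<bar> * measure N B"
 have b: "b \<ge> 0" unfolding b_def by auto
 have "e / (4 * (b + 1)) > 0" using b \<open>e > 0\<close> by auto
 from set_translation_continuous[OF A(1) this] obtain d1 where d1: "d1 > 0"
   "\<And>r. norm r < d1 ==> (nI lborel (%s. en \<bar>indicator A (s + r) - indicator A s\<bar>)) < en (e / (4 * (b + 1)))"
  by auto
 obtain d2 where d2: "d2 > 0" "\<And>r. norm r < d2 ==>
   (nI (lborel \<Otimes>\<^sub>M N) (%z. en \<bar>rect_sum l (fst z + r, snd z) - rect_sum l z\<bar>)) < en (e/2)"
  using Cons(1)[OF l, of "e/2"] \<open>e > 0\<close> by auto
 show ?case
 proof (intro exI[of _ "min d1 d2"] conjI allI impI)
  show "min d1 d2 > 0" using d1 d2 by auto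
  fix r :: 'a assume r: "norm r < min d1 d2"
  have [measurable]: "(%s. indicator A (s + r) :: real) \<in> Bm borel"
   by (rule measurable_compose[of "%s. s + r" borel borel "indicator A"]) auto
  define q where "q s = en \<bar>indicator A (s + r) - indicator A s\<bar>" for s
  have [measurable]: "q \<in> Bm borel" unfolding q_def by measurable
  have "(nI (lborel \<Otimes>\<^sub>M N) (%z. en \<bar>rect_sum (x # l) (fst z + r, snd z) - rect_sum (x # l) z\<bar>)) \<le>
   (nI (lborel \<Otimes>\<^sub>M N) (%z. en (\<bar>a\<bar> * \<bar>indicator A (fst z + r) - indicator A (fst z)\<bar> * indicator B (snd z)) +
    en \<bar>rect_sum l (fst z + r, snd z) - rect_sum l z\<bar>))"
  proof (intro nn_integral_mono)
   fix z :: "'a \<times> 'b"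
   have "\<bar>rect_sum (x # l) (fst z + r, snd z) - rect_sum (x # l) z\<bar> =
    \<bar>a * (indicator A (fst z + r) - indicator A (fst z)) * indicator B (snd z) + (rect_sum l (fst z + r, snd z) - rect_sum l z)\<bar>"
    by (simp add: x algebra_simps)
   also have "... \<le> \<bar>a * (indicator A (fst z + r) - indicator A (fst z)) * indicator B (snd z)\<bar> + \<bar>rect_sum l (fst z + r, snd z) - rect_sum l z\<bar>"
    by (rule abs_triangle_ineq)
   finally show "en \<bar>rect_sum (x # l) (fst z + r, snd z) - rect_sum (x # l) z\<bar> \<le>
     en (\<bar>a\<bar> * \<bar>indicator A (fst z + r) - indicator A (fst z)\<bar> * indicator B (snd z)) +
    en \<bar>rect_sum l (fst z + r, snd z) - rect_sum l z\<bar>"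
    by (simp add: abs_mult flip: ennreal_plus)
  qed
  also have "... = (nI (lborel \<Otimes>\<^sub>M N) (%z. en \<bar>a\<bar> * (q (fst z) * indicator B (snd z)) +
    en \<bar>rect_sum l (fst z + r, snd z) - rect_sum l z\<bar>))"
   unfolding q_def by (intro nn_integral_cong) (simp add: ennreal_mult ennreal_indicator split: split_indicator)
  also have "... = (nI (lborel \<Otimes>\<^sub>M N) (%z. en \<bar>a\<bar> * (q (fst z) * indicator B (snd z)))) +
    (nI (lborel \<Otimes>\<^sub>M N) (%z. en \<bar>rect_sum l (fst z + r, snd z) - rect_sum l z\<bar>))"
   by (intro nn_integral_add) measurable
  also have "... < en (e/2) + en (e/2)"
  proof (intro add_strict_mono)
   have inner: "(nI N (%y. q s * indicator B y)) = q s * emeasure N B" for s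
    by (rule nn_integral_cmult_indicator) fact
   have outer: "(nI lborel (%s. q s * emeasure N B)) = (nI lborel (%s. q s)) * emeasure N B"
    by (rule nn_integral_multc) simp
   have "(nI (lborel \<Otimes>\<^sub>M N) (%z. q (fst z) * indicator B (snd z))) = (nI lborel (%s. q s)) * emeasure N B"
    using N.nn_integral_fst[of "%z. q (fst z) * indicator B (snd z)" lborel, symmetric]
    by (simp add: inner outer)
   moreover have "(nI (lborel \<Otimes>\<^sub>M N) (%z. en \<bar>a\<bar> * (q (fst z) * indicator B (snd z)))) =
     en \<bar>a\<bar> * (nI (lborel \<Otimes>\<^sub>M N) (%z. q (fst z) * indicator B (snd z)))"
    by (rule nn_integral_cmult) measurable
   moreover have "(nI lborel (%s. q s)) \<le> ennreal (e / (4 * (b + 1)))"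
    using d1(2)[of r] r unfolding q_def by (intro less_imp_le) auto
   moreover have "emeasure N B = en (measure N B)"
    using A(2) by (rule emeasure_eq_measure2)
   ultimately have "(nI (lborel \<Otimes>\<^sub>M N) (%z. en \<bar>a\<bar> * (q (fst z) * indicator B (snd z)))) \<le>
     en \<bar>a\<bar> * (en (e / (4 * (b + 1))) * en (measure N B))"
    by (simp only:) (intro mult_left_mono mult_mono, auto)
   also have "... = en (\<bar>a\<bar> * ((e / (4 * (b + 1))) * measure N B))"
    using \<open>e / (4 * (b + 1)) > 0\<close> by (simp only: ennreal_mult measure_nonneg mult_nonneg_nonneg abs_ge_zero less_imp_le)
   also have "\<bar>a\<bar> * ((e / (4 * (b + 1))) * measure N B) = (e/4) * (b / (b + 1))"
    using b by (simp add: b_def)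
   also have "en ((e/4) * (b / (b + 1))) \<le> ennreal ((e/4) * 1)"
    using b \<open>e > 0\<close> by (intro ennreal_leI mult_left_mono) auto
   also have "... < en (e/2)" using \<open>e > 0\<close> by (simp add: ennreal_less_iff)
   finally show "(nI (lborel \<Otimes>\<^sub>M N) (%z. en \<bar>a\<bar> * (q (fst z) * indicator B (snd z)))) < en (e/2)" .
   show "(nI (lborel \<Otimes>\<^sub>M N) (%z. en \<bar>rect_sum l (fst z + r, snd z) - rect_sum l z\<bar>)) < en (e/2)"
    using d2 r by auto
  qed
  also have "... = en e" using \<open>e > 0\<close> by (simp flip: ennreal_plus)
  finally show "(nI (lborel \<Otimes>\<^sub>M N) (%z. en \<bar>rect_sum (x # l) (fst z + r, snd z) - rect_sum (x # l) z\<bar>)) < en e" .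
 qed
qed

text \<open>Translations preserve the integral, so a rectangle sum close to \<open>f\<close> is
  equally close after a shift of both. The second factor is arbitrary so that it can later be the
  probability space; the result then is a continuity in mean of random fields.\<close>

lemma translation_continuous_mean:
 fixes f :: "'a::euclidean_space \<times> 'b => real"
 assumes N: "sigma_finite_measure N" and int: "integrable (lborel \<Otimes>\<^sub>M N) f" and "e > 0"
 shows "\<exists>d>0. \<forall>r. norm r < d \<longrightarrow>
   (nI (lborel \<Otimes>\<^sub>M N) (%z. en \<bar>f (fst z + r, snd z) - f z\<bar>)) < en e"
proof -
 have mf: "f \<in> Bm (lborel \<Otimes>\<^sub>M N)" using int by auto
 then have [measurable]: "f \<in> Bm (borel \<Otimes>\<^sub>M N)"
  by (simp cong: measurable_cong_sets)
 obtain l where l: "rect_list lborel N l" "(nI (lborel \<Otimes>\<^sub>M N) (%z. en \<bar>f z - rect_sum l z\<bar>)) < en (e/4)"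
  using integrable_imp_rect_approximable[OF sigma_finite_lborel N int] \<open>e > 0\<close>
  unfolding rect_approximable_def by (metis zero_less_divide_iff zero_less_numeral)
 have rl [measurable]: "rect_sum l \<in> Bm (lborel \<Otimes>\<^sub>M N)" using rect_sum_measurable[OF l(1)] .
 then have [measurable]: "rect_sum l \<in> Bm (borel \<Otimes>\<^sub>M N)"
  by (simp cong: measurable_cong_sets)
 obtain d where d: "d > 0" "\<And>r. norm r < d ==>
   (nI (lborel \<Otimes>\<^sub>M N) (%z. en \<bar>rect_sum l (fst z + r, snd z) - rect_sum l z\<bar>)) < en (e/4)"
  using rect_sum_translation_continuous[OF N l(1), of "e/4"] \<open>e > 0\<close> by auto
 show ?thesis
 proof (intro exI[of _ d] conjI allI impI d)
  fix r :: 'a assume r: "norm r < d"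
  define g where "g z = en \<bar>f z - rect_sum l z\<bar>" for z
  have [measurable]: "g \<in> Bm (lborel \<Otimes>\<^sub>M N)" unfolding g_def using mf by measurable
  then have [measurable]: "g \<in> Bm (borel \<Otimes>\<^sub>M N)"
   by (simp cong: measurable_cong_sets)
  have "(nI (lborel \<Otimes>\<^sub>M N) (%z. en \<bar>f (fst z + r, snd z) - f z\<bar>)) \<le>
   (nI (lborel \<Otimes>\<^sub>M N) (%z. (g (fst z + r, snd z) + g z) + en \<bar>rect_sum l (fst z + r, snd z) - rect_sum l z\<bar>))"
   unfolding g_def by (intro nn_integral_mono) (simp flip: ennreal_plus)
  also have "... = ((nI (lborel \<Otimes>\<^sub>M N) (%z. g (fst z + r, snd z))) + (nI (lborel \<Otimes>\<^sub>M N) (%z. g z))) +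
    (nI (lborel \<Otimes>\<^sub>M N) (%z. en \<bar>rect_sum l (fst z + r, snd z) - rect_sum l z\<bar>))"
   by (subst nn_integral_add, measurable, subst nn_integral_add, measurable)
  also have "... = ((nI (lborel \<Otimes>\<^sub>M N) (%z. g z)) + (nI (lborel \<Otimes>\<^sub>M N) (%z. g z))) +
    (nI (lborel \<Otimes>\<^sub>M N) (%z. en \<bar>rect_sum l (fst z + r, snd z) - rect_sum l z\<bar>))"
   by (subst nn_integral_pair_translate[OF N]) auto
  also have "... < (en (e/4) + en (e/4)) + en (e/4)"
   using l(2) d(2)[OF r] unfolding g_def by (intro add_strict_mono) auto
  also have "... \<le> ennreal e" using \<open>e > 0\<close> by (simp flip: ennreal_plus add: ennreal_leI)
  finally show "(nI (lborel \<Otimes>\<^sub>M N) (%z. en \<bar>f (fst z + r, snd z) - f z\<bar>)) < en e" .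
 qed
qed
subsection \<open>Characteristic functions on finite products\<close>

text \<open>Divided by its mass \<open>m\<close> the weight is a probability density, and under the
  two weighted laws \<open>X\<close> and \<open>Y\<close> have the same characteristic function; the
  argument \<open>0\<close> shows that both masses agree. The use is to trade one complex
  exponential for an indicator in the presence of the remaining coordinates.\<close>

lemma (in prob_space) weighted_char_eq_imp_eq:
 fixes X Y :: "'a => real" and w v :: "'a => real"
 assumes [measurable]: "X \<in> Bm M" "Y \<in> Bm M"
   "w \<in> Bm M" "v \<in> Bm M" "B \<in> sets borel"
  and w: "\<And>ww. 0 \<le> w ww" "\<And>ww. w ww \<le> C" and v: "\<And>ww. 0 \<le> v ww" "\<And>ww. v ww \<le> C"
  and eq: "\<And>\<theta>. (CLINT ww|M. w ww * iexp (\<theta> * X ww)) = (CLINT ww|M. v ww * iexp (\<theta> * Y ww))"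
 shows "(LINT ww|M. w ww * indicator B (X ww)) = (LINT ww|M. v ww * indicator B (Y ww))"
proof -
 have int_w: "integrable M w" and int_v: "integrable M v"
  using w v by (auto intro!: integrable_const_bound[where B=C])
 define m where "m = (LINT ww|M. w ww)"
 have "cor (LINT ww|M. w ww) = cor (LINT ww|M. v ww)"
  using eq[of 0] by (simp flip: integral_complex_of_real)
 then have m': "m = (LINT ww|M. v ww)" unfolding m_def by simp
 have "m \<ge> 0" unfolding m_def using w by (intro integral_nonneg_AE) auto
 then consider "m = 0" | "m > 0" by linarith
 then show ?thesis
 proof cases
  case 1
  have "AE ww in M. w ww = 0"
   using integral_nonneg_eq_0_iff_AE[OF int_w] w 1 m_def by auto
  moreover have "AE ww in M. v ww = 0"
   using integral_nonneg_eq_0_iff_AE[OF int_v] v 1 m' by auto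
  ultimately have "(LINT ww|M. w ww * indicator B (X ww)) = 0" "(LINT ww|M. v ww * indicator B (Y ww)) = 0"
   by (auto intro!: integral_eq_zero_AE)
  then show ?thesis by simp
 next
  case 2
  have *: "real_distribution (distr (density M (%ww. en (u ww / m))) borel Z) \<and>
    (\<forall>\<theta>. char (distr (density M (%ww. en (u ww / m))) borel Z) \<theta> = (CLINT ww|M. u ww * iexp (\<theta> * Z ww)) / m) \<and>
    measure (distr (density M (%ww. en (u ww / m))) borel Z) B = (LINT ww|M. u ww * indicator B (Z ww)) / m"
   if [measurable]: "u \<in> Bm M" "Z \<in> Bm M" and u: "\<And>ww. 0 \<le> u ww"
    and int: "integrable M u" and m: "m = (LINT ww|M. u ww)" for u Z :: "'a => real"
  proof -
   let ?D = "density M (%ww. en (u ww / m))"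
   have "emeasure ?D (space ?D) = (nI M (%ww. en (u ww / m)))"
    by (simp add: emeasure_density cong: nn_integral_cong)
   also have "... = en (LINT ww|M. u ww / m)"
    using u 2 int by (intro nn_integral_eq_integral) auto
   also have "... = 1" using m 2 by simp
   finally interpret D: prob_space ?D by (rule prob_spaceI)
   have "real_distribution (distr ?D borel Z)"
    by (intro D.real_distribution_distr) simp
   moreover have "char (distr ?D borel Z) \<theta> = (CLINT ww|M. u ww * iexp (\<theta> * Z ww)) / m" for \<theta>
   proof -
    have "char (distr ?D borel Z) \<theta> = (CLINT ww|?D. iexp (\<theta> * Z ww))"
     unfolding char_def by (subst integral_distr) auto
    also have "... = (CLINT ww|M. (u ww / m) *\<^sub>R iexp (\<theta> * Z ww))"
     using u 2 by (intro integral_density) auto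
    also have "... = (CLINT ww|M. (u ww * iexp (\<theta> * Z ww)) / cor m)"
     by (intro Bochner_Integration.integral_cong) (auto simp: scaleR_conv_of_real)
    finally show ?thesis by simp
   qed
   moreover have "measure (distr ?D borel Z) B = (LINT ww|M. u ww * indicator B (Z ww)) / m"
   proof -
    have "measure (distr ?D borel Z) B = (LINT z|distr ?D borel Z. indicator B z)"
     by simp
    also have "... = (LINT ww|?D. indicator B (Z ww))"
     by (subst integral_distr) auto
    also have "... = (LINT ww|M. (u ww / m) *\<^sub>R indicator B (Z ww))"
     using u 2 by (intro integral_density) auto
    also have "... = (LINT ww|M. (u ww * indicator B (Z ww)) / m)"
     by (intro Bochner_Integration.integral_cong) auto
    finally show ?thesis by simp
   qed
   ultimately show ?thesis by blast
  qed
  note W = *[of w X, OF assms(3,1) w(1) int_w m_def] and V = *[of v Y, OF assms(4,2) v(1) int_v m']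
  have "distr (density M (%ww. en (w ww / m))) borel X = distr (density M (%ww. en (v ww / m))) borel Y"
  proof (rule Levy_uniqueness)
   show "char (distr (density M (%ww. en (w ww / m))) borel X) = char (distr (density M (%ww. en (v ww / m))) borel Y)"
    unfolding fun_eq_iff W[THEN conjunct2, THEN conjunct1, rule_format] V[THEN conjunct2, THEN conjunct1, rule_format]
    using eq by simp
  qed (use W V in blast)+
  then have "measure (distr (density M (%ww. en (w ww / m))) borel X) B =
    measure (distr (density M (%ww. en (v ww / m))) borel Y) B"
   by (rule arg_cong)
  then have "(LINT ww|M. w ww * indicator B (X ww)) / m = (LINT ww|M. v ww * indicator B (Y ww)) / m"
   unfolding W[THEN conjunct2, THEN conjunct2] V[THEN conjunct2, THEN conjunct2] .
  then show ?thesis using 2 by simp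
 qed
qed

text \<open>Multivariate uniqueness is obtained from the one-dimensional theorem: coordinate after
  coordinate, an exponential factor is exchanged for the indicator of a Borel set, and when none is
  left the laws agree on boxes.\<close>

lemma (in prob_space) distr_PiM_eqI_char:
 fixes X Y :: "'i => 'a => real"
 assumes J: "finite J"
  and X [measurable]: "\<And>j. X j \<in> Bm M" and Y [measurable]: "\<And>j. Y j \<in> Bm M"
  and char: "\<And>\<theta>. (CLINT ww|M. iexp (\<Sum>j\<in>J. \<theta> j * X j ww)) = (CLINT ww|M. iexp (\<Sum>j\<in>J. \<theta> j * Y j ww))"
 shows "distr M (\<Pi>\<^sub>M j\<in>J. borel) (%ww. \<lambda>j\<in>J. X j ww) = distr M (\<Pi>\<^sub>M j\<in>J. borel) (%ww. \<lambda>j\<in>J. Y j ww)"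
proof -
 define I where "I K B Z ww = (\<Prod>j\<in>K. indicator (B j) (Z j ww) :: real)" for K B and Z :: "'i => 'a => real" and ww
 define S where "S K \<theta> Z ww = (\<Sum>j\<in>J - K. \<theta> j * Z j ww)" for K \<theta> and Z :: "'i => 'a => real" and ww
 have I01: "0 \<le> I K B Z ww" "I K B Z ww \<le> 1" for K B Z ww
  unfolding I_def by (auto intro!: prod_nonneg prod_le_1)
 have I_meas [measurable]: "I K B Z \<in> Bm M"
  if "\<And>j. Z j \<in> Bm M" "\<And>j. B j \<in> sets borel" for K B Z
  unfolding I_def[abs_def] using that by measurable
 have S_meas [measurable]: "S K \<theta> Z \<in> Bm M"
  if "\<And>j. Z j \<in> Bm M" for K \<theta> Z
  unfolding S_def[abs_def] using that by measurable
 have int: "integrable M (%ww. cor (I K B Z ww) * iexp (S K \<theta> Z ww))"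
  if [measurable]: "\<And>j. Z j \<in> Bm M" "\<And>j. B j \<in> sets borel" for K B \<theta> Z
  using I01 by (intro integrable_const_bound[where B=1]) (auto simp: norm_mult)
 have main: "\<forall>B \<theta>. (\<forall>j. B j \<in> sets borel) \<longrightarrow>
   (CLINT ww|M. I K B X ww * iexp (S K \<theta> X ww)) = (CLINT ww|M. I K B Y ww * iexp (S K \<theta> Y ww))"
  if "finite K" "K \<subseteq> J" for K
  using that
 proof (induction K rule: finite_induct)
  case empty
  then show ?case using char by (simp add: I_def S_def)
 next
  case (insert k K)
  have IH: "(CLINT ww|M. I K B X ww * iexp (S K \<theta> X ww)) = (CLINT ww|M. I K B Y ww * iexp (S K \<theta> Y ww))"
   if "\<forall>j. B j \<in> sets borel" for B \<theta>
   using insert.IH insert.prems that by blast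
  show ?case
  proof (intro allI impI)
   fix B :: "'i => real set" and \<theta>
   assume B [measurable]: "\<forall>j. B j \<in> sets borel"
   have [measurable]: "\<And>j. B j \<in> sets borel" using B by auto
   \<comment> \<open>A weight has to be real and nonnegative, so the exponential in the remaining
     coordinates is replaced by \<open>1 + cos\<close> of their linear form with an arbitrary phase
     \<open>\<alpha>\<close>. Varying the phase recovers real and imaginary part.\<close>
   define w where "w Z \<alpha> ww = I K B Z ww * (1 + cos (S (insert k K) \<theta> Z ww + \<alpha>))" for Z \<alpha> ww
   have w_meas [measurable]: "w Z \<alpha> \<in> Bm M" if [measurable]: "\<And>j. Z j \<in> Bm M" for Z \<alpha>
    unfolding w_def[abs_def] by measurable
   have w01: "0 \<le> w Z \<alpha> ww" "w Z \<alpha> ww \<le> 2" for Z \<alpha> ww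
   proof -
    have "-1 \<le> cos (S (insert k K) \<theta> Z ww + \<alpha>)" "cos (S (insert k K) \<theta> Z ww + \<alpha>) \<le> 1" by auto
    then have *: "0 \<le> 1 + cos (S (insert k K) \<theta> Z ww + \<alpha>)" "1 + cos (S (insert k K) \<theta> Z ww + \<alpha>) \<le> 2" by linarith+
    show "0 \<le> w Z \<alpha> ww" unfolding w_def using * I01 by (intro mult_nonneg_nonneg)
    have "w Z \<alpha> ww \<le> 1 * 2" unfolding w_def using * I01 by (intro mult_mono) auto
    then show "w Z \<alpha> ww \<le> 2" by simp
   qed
   have S_split: "S K (\<theta>'(k := c)) Z ww = c * Z k ww + S (insert k K) \<theta>' Z ww" for Z ww c \<theta>'
   proof -
    have *: "J - K = insert k (J - insert k K)" using insert.hyps insert.prems by blast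
    have "S K (\<theta>'(k := c)) Z ww = c * Z k ww + (\<Sum>j\<in>J - insert k K. (\<theta>'(k := c)) j * Z j ww)"
     unfolding S_def by (subst *, subst sum.insert) (use J in simp_all)
    also have "(\<Sum>j\<in>J - insert k K. (\<theta>'(k := c)) j * Z j ww) = S (insert k K) \<theta>' Z ww"
     unfolding S_def by (intro sum.cong) auto
    finally show ?thesis .
   qed
   have eqw: "(LINT ww|M. w X \<alpha> ww * indicator (B k) (X k ww)) = (LINT ww|M. w Y \<alpha> ww * indicator (B k) (Y k ww))" for \<alpha>
   proof (rule weighted_char_eq_imp_eq[where C=2])
    fix c :: real
    \<comment> \<open>The cosine splits into two exponentials, so the induction hypothesis is needed
      for three frequency vectors: \<open>c\<close> at \<open>k\<close>, combined with
      \<open>0\<close>, \<open>\<theta>\<close> or \<open>- \<theta>\<close> on the other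
      coordinates.\<close>
    have expand: "(CLINT ww|M. w Z \<alpha> ww * iexp (c * Z k ww)) =
      (CLINT ww|M. I K B Z ww * iexp (S K ((%_. 0)(k := c)) Z ww)) +
      (exp (\<i> * \<alpha>) / 2) * (CLINT ww|M. I K B Z ww * iexp (S K (\<theta>(k := c)) Z ww)) +
      (exp (- (\<i> * \<alpha>)) / 2) * (CLINT ww|M. I K B Z ww * iexp (S K ((%j. - \<theta> j)(k := c)) Z ww))"
     if Z [measurable]: "\<And>j. Z j \<in> Bm M" for Z
    proof -
     have neg: "S (insert k K) (%j. - \<theta> j) Z ww = - S (insert k K) \<theta> Z ww"
      and zero: "S (insert k K) (%_. 0) Z ww = 0" for ww
      by (simp_all add: S_def sum_negf)
     have iadd: "iexp (x + y) = iexp x * iexp y" for x y :: real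
      by (simp add: distrib_left exp_add)
     have cosx: "cor (cos x) = (iexp x + iexp (-x)) / 2" for x
      by (simp flip: cos_of_real add: cos_exp_eq mult_ac)
     have pt: "cor (a * (1 + cos (s + \<alpha>))) * iexp u = cor a * iexp (u + 0) +
       exp (\<i> * \<alpha>) / 2 * (cor a * iexp (u + s)) +
       exp (- (\<i> * \<alpha>)) / 2 * (cor a * iexp (u + - s))" for a s u :: real
     proof -
      have "iexp (- (s + \<alpha>)) = iexp (- s) * iexp (- \<alpha>)" using iadd[of "-s" "-\<alpha>"] by simp
      then have "cor (cos (s + \<alpha>)) = (iexp s * iexp \<alpha> + iexp (- s) * iexp (- \<alpha>)) / 2"
       unfolding cosx iadd[of s \<alpha>] by simp
      moreover have "exp (- (\<i> * \<alpha>)) = iexp (- \<alpha>)" by simp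
      moreover have "(A * (1 + (S * P + S' * P') / 2)) * U = A * U + P / 2 * (A * (U * S)) + P' / 2 * (A * (U * S'))"
       for A S P S' P' U :: complex by (simp add: field_simps)
      ultimately show ?thesis
       by (simp only: of_real_mult of_real_add[of 1] of_real_1 iadd[of u s] iadd[of u "-s"] add_0_right)
     qed
     have "(CLINT ww|M. w Z \<alpha> ww * iexp (c * Z k ww)) =
      (CLINT ww|M. I K B Z ww * iexp (S K ((%_. 0)(k := c)) Z ww) +
       (exp (\<i> * \<alpha>) / 2) * (I K B Z ww * iexp (S K (\<theta>(k := c)) Z ww)) +
       (exp (- (\<i> * \<alpha>)) / 2) * (I K B Z ww * iexp (S K ((%j. - \<theta> j)(k := c)) Z ww)))"
      unfolding w_def S_split neg zero by (intro Bochner_Integration.integral_cong refl pt)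
     also have "... = (CLINT ww|M. I K B Z ww * iexp (S K ((%_. 0)(k := c)) Z ww)) +
       (CLINT ww|M. (exp (\<i> * \<alpha>) / 2) * (I K B Z ww * iexp (S K (\<theta>(k := c)) Z ww))) +
       (CLINT ww|M. (exp (- (\<i> * \<alpha>)) / 2) * (I K B Z ww * iexp (S K ((%j. - \<theta> j)(k := c)) Z ww)))"
      by (simp only: Bochner_Integration.integral_add Bochner_Integration.integrable_add integrable_mult_right int Z \<open>\<And>j. B j \<in> sets borel\<close>)
     finally show ?thesis by simp
    qed
    show "(CLINT ww|M. w X \<alpha> ww * iexp (c * X k ww)) = (CLINT ww|M. w Y \<alpha> ww * iexp (c * Y k ww))"
     unfolding expand[of X, OF X] expand[of Y, OF Y] by (simp only: IH[OF B])
   qed (use w01 in auto)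
   have w_eq: "(LINT ww|M. w Z \<alpha> ww * indicator (B k) (Z k ww)) =
     (LINT ww|M. I (insert k K) B Z ww) + (LINT ww|M. I (insert k K) B Z ww * cos (S (insert k K) \<theta> Z ww + \<alpha>))"
    if Z [measurable]: "\<And>j. Z j \<in> Bm M" for Z \<alpha>
   proof -
    have "(LINT ww|M. w Z \<alpha> ww * indicator (B k) (Z k ww)) =
      (LINT ww|M. I (insert k K) B Z ww + I (insert k K) B Z ww * cos (S (insert k K) \<theta> Z ww + \<alpha>))"
     using insert.hyps by (intro Bochner_Integration.integral_cong) (simp_all add: w_def I_def algebra_simps)
    also have "... = (LINT ww|M. I (insert k K) B Z ww) + (LINT ww|M. I (insert k K) B Z ww * cos (S (insert k K) \<theta> Z ww + \<alpha>))"
    proof (rule Bochner_Integration.integral_add)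
     show "integrable M (I (insert k K) B Z)"
      using I01 by (intro integrable_const_bound[where B=1]) auto
     show "integrable M (%ww. I (insert k K) B Z ww * cos (S (insert k K) \<theta> Z ww + \<alpha>))"
      using I01 by (intro integrable_const_bound[where B=1]) (auto simp: abs_mult intro!: mult_le_one)
    qed
    finally show ?thesis .
   qed
   \<comment> \<open>The phases \<open>0\<close> and \<open>pi\<close> have opposite cosines, so
     adding the two identities isolates the indicators.\<close>
   have cos_pi: "I (insert k K) B Z ww * cos (S (insert k K) \<theta> Z ww + pi) = - (I (insert k K) B Z ww * cos (S (insert k K) \<theta> Z ww + 0))" for Z ww
    by simp
   have I_eq: "(LINT ww|M. I (insert k K) B X ww) = (LINT ww|M. I (insert k K) B Y ww)"
    using eqw[of 0] eqw[of pi] unfolding w_eq[of X, OF X] w_eq[of Y, OF Y] cos_pi by simp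
   have cos_eq: "(LINT ww|M. I (insert k K) B X ww * cos (S (insert k K) \<theta> X ww + \<alpha>)) =
     (LINT ww|M. I (insert k K) B Y ww * cos (S (insert k K) \<theta> Y ww + \<alpha>))" for \<alpha>
    using eqw[of \<alpha>] I_eq unfolding w_eq[of X, OF X] w_eq[of Y, OF Y] by simp
   \<comment> \<open>The phases \<open>0\<close> and \<open>- pi/2\<close> give cosine and sine,
     hence the full exponential.\<close>
   have iexp_eq: "(CLINT ww|M. I (insert k K) B Z ww * iexp (S (insert k K) \<theta> Z ww)) =
     cor (LINT ww|M. I (insert k K) B Z ww * cos (S (insert k K) \<theta> Z ww + 0)) +
     \<i> * cor (LINT ww|M. I (insert k K) B Z ww * cos (S (insert k K) \<theta> Z ww + (- pi/2)))"
    if Z [measurable]: "\<And>j. Z j \<in> Bm M" for Z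
   proof -
    have cos_int: "integrable M (%ww. cor (I (insert k K) B Z ww * cos (S (insert k K) \<theta> Z ww + \<alpha>)))" for \<alpha>
     using I01 by (intro integrable_const_bound[where B=1]) (auto simp: abs_mult norm_mult intro!: mult_le_one)
    have "(CLINT ww|M. I (insert k K) B Z ww * iexp (S (insert k K) \<theta> Z ww)) =
     (CLINT ww|M. cor (I (insert k K) B Z ww * cos (S (insert k K) \<theta> Z ww + 0)) +
      \<i> * cor (I (insert k K) B Z ww * cos (S (insert k K) \<theta> Z ww + (- pi/2))))"
    proof (intro Bochner_Integration.integral_cong refl)
     have sin: "cos (x + - pi/2) = sin x" for x :: real by (simp add: cos_diff)
     show "cor (I (insert k K) B Z ww) * iexp (S (insert k K) \<theta> Z ww) =
       cor (I (insert k K) B Z ww * cos (S (insert k K) \<theta> Z ww + 0)) +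
       \<i> * cor (I (insert k K) B Z ww * cos (S (insert k K) \<theta> Z ww + (- pi/2)))" for ww
      unfolding sin by (simp add: cis_conv_exp[symmetric] complex_eq_iff)
    qed
    also have "... = (CLINT ww|M. cor (I (insert k K) B Z ww * cos (S (insert k K) \<theta> Z ww + 0))) +
      (CLINT ww|M. \<i> * cor (I (insert k K) B Z ww * cos (S (insert k K) \<theta> Z ww + (- pi/2))))"
     by (intro Bochner_Integration.integral_add integrable_mult_right cos_int)
    also have "... = cor (LINT ww|M. I (insert k K) B Z ww * cos (S (insert k K) \<theta> Z ww + 0)) +
      \<i> * cor (LINT ww|M. I (insert k K) B Z ww * cos (S (insert k K) \<theta> Z ww + (- pi/2)))"
     by (simp only: integral_mult_right_zero integral_complex_of_real)
    finally show ?thesis .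
   qed
   show "(CLINT ww|M. I (insert k K) B X ww * iexp (S (insert k K) \<theta> X ww)) =
     (CLINT ww|M. I (insert k K) B Y ww * iexp (S (insert k K) \<theta> Y ww))"
    unfolding iexp_eq[of X, OF X] iexp_eq[of Y, OF Y] cos_eq ..
  qed
 qed
 show ?thesis
 proof (rule measure_eqI_PiM_finite[OF J])
  show "sets (distr M (Pi\<^sub>M J (%j. borel)) (%ww. \<lambda>j\<in>J. X j ww)) = sets (Pi\<^sub>M J (%j. borel))"
   "sets (distr M (Pi\<^sub>M J (%j. borel)) (%ww. \<lambda>j\<in>J. Y j ww)) = sets (Pi\<^sub>M J (%j. borel))"
   by simp_all
  show "range (%_. space (Pi\<^sub>M J (%j. borel))) \<subseteq> prod_algebra J (%j. borel :: real measure)"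
   using J by (auto simp: space_PiM intro!: prod_algebraI_finite)
  show "(\<Union>i::nat. space (Pi\<^sub>M J (%j. borel))) = space (Pi\<^sub>M J (%j. borel))" by auto
  show "emeasure (distr M (Pi\<^sub>M J (%j. borel)) (%ww. \<lambda>j\<in>J. X j ww)) (space (Pi\<^sub>M J (%j. borel))) \<noteq> \<infinity>"
   by (subst emeasure_distr) auto
 next
  fix A :: "'i => real set" assume A: "\<And>i. i \<in> J ==> A i \<in> sets borel"
  \<comment> \<open>\<open>main\<close> asks for Borel sets at all indices, so \<open>A\<close> is
    completed by the whole line outside \<open>J\<close>.\<close>
  define B where "B j = (if j \<in> J then A j else UNIV)" for j
  have [measurable]: "B j \<in> sets borel" for j using A by (auto simp: B_def)
  have PA: "Pi\<^sub>E J A = Pi\<^sub>E J B" unfolding B_def by (intro PiE_cong) auto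
  have em: "emeasure (distr M (Pi\<^sub>M J (%j. borel)) (%ww. \<lambda>j\<in>J. Z j ww)) (Pi\<^sub>E J A) = en (LINT ww|M. I J B Z ww)"
   if Z [measurable]: "\<And>j. Z j \<in> Bm M" for Z
  proof -
   have sets: "Pi\<^sub>E J B \<in> sets (Pi\<^sub>M J (%j. borel))" by (intro sets_PiM_I_finite J) auto
   have "emeasure (distr M (Pi\<^sub>M J (%j. borel)) (%ww. \<lambda>j\<in>J. Z j ww)) (Pi\<^sub>E J A) =
    emeasure M ((%ww. \<lambda>j\<in>J. Z j ww) -` Pi\<^sub>E J B \<inter> space M)"
    unfolding PA by (intro emeasure_distr sets) measurable
   also have "... = emeasure M {ww\<in>space M. \<forall>j\<in>J. Z j ww \<in> B j}"
    by (intro arg_cong[where f="emeasure M"]) auto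
   also have "... = en (measure M {ww\<in>space M. \<forall>j\<in>J. Z j ww \<in> B j})"
    by (simp add: emeasure_eq_measure)
   also have "measure M {ww\<in>space M. \<forall>j\<in>J. Z j ww \<in> B j} = (LINT ww|M. indicator {ww\<in>space M. \<forall>j\<in>J. Z j ww \<in> B j} ww)"
    by (simp add: Int_absorb2 subset_iff Collect_conj_eq)
   also have "... = (LINT ww|M. I J B Z ww)"
    using J by (intro Bochner_Integration.integral_cong refl)
     (auto simp: I_def indicator_def prod_zero_iff split: if_splits)
   finally show ?thesis .
  qed
  have "cor (LINT ww|M. I J B X ww) = cor (LINT ww|M. I J B Y ww)"
   using main[OF J subset_refl, rule_format, of B "%_. 0"] by (simp add: S_def flip: integral_complex_of_real)
  then show "emeasure (distr M (Pi\<^sub>M J (%j. borel)) (%ww. \<lambda>j\<in>J. X j ww)) (Pi\<^sub>E J A) =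
     emeasure (distr M (Pi\<^sub>M J (%j. borel)) (%ww. \<lambda>j\<in>J. Y j ww)) (Pi\<^sub>E J A)"
   unfolding em[of X, OF X] em[of Y, OF Y] by simp
 qed
qed

section \<open>Additive random set functions\<close>

text \<open>Lists instead of functions: a random set function is additive only up to null sets, so a
  sum belongs to a representation. \<open>step_fun\<close> and \<open>set_sum\<close> read the same
  representation, once as a function and once as a random variable. The sets may overlap.\<close>

definition step_fun :: "(real \<times> 'z set) list => 'z => real" where
 "step_fun l z = (\<Sum>(a, A)\<leftarrow>l. a * indicator A z)"

definition set_sum :: "('z set => 'w => real) => (real \<times> 'z set) list => 'w => real" where
 "set_sum L l ww = (\<Sum>(a, A)\<leftarrow>l. a * L A ww)"

definition fm_list :: "'z measure => (real \<times> 'z set) list => bool" where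
 "fm_list c l \<longleftrightarrow> (\<forall>(a, A)\<in>set l. A \<in> fmeasurable c)"

text \<open>Disjointness is meant by position in the list, the form in which the values on the sets
  are independent. Empty sets may occur repeatedly.\<close>

definition disjoint_list :: "(real \<times> 'z set) list => bool" where
 "disjoint_list l \<longleftrightarrow> sorted_wrt (%x y. snd x \<inter> snd y = {}) l"

definition scale_list :: "real => (real \<times> 'z set) list => (real \<times> 'z set) list" where
 "scale_list r l = map (%(a, A). (r * a, A)) l"

lemma step_fun_simps [simp]:
 "step_fun [] z = 0"
 "step_fun ((a, A) # l) z = a * indicator A z + step_fun l z"
 "step_fun (l @ l') z = step_fun l z + step_fun l' z"
 by (auto simp: step_fun_def)

lemma set_sum_simps [simp]:
 "set_sum L [] ww = 0"
 "set_sum L ((a, A) # l) ww = a * L A ww + set_sum L l ww"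
 "set_sum L (l @ l') ww = set_sum L l ww + set_sum L l' ww"
 by (auto simp: set_sum_def)

lemma fm_list_simps [simp]:
 "fm_list c []"
 "fm_list c ((a, A) # l) \<longleftrightarrow> A \<in> fmeasurable c \<and> fm_list c l"
 "fm_list c (l @ l') \<longleftrightarrow> fm_list c l \<and> fm_list c l'"
 by (simp_all add: fm_list_def ball_Un)

lemma step_fun_scale [simp]: "step_fun (scale_list r l) z = r * step_fun l z"
 by (induction l) (auto simp: scale_list_def algebra_simps)

lemma set_sum_scale [simp]: "set_sum L (scale_list r l) ww = r * set_sum L l ww"
 by (induction l) (auto simp: scale_list_def algebra_simps)

lemma fm_list_scale [simp]: "fm_list c l ==> fm_list c (scale_list r l)"
 by (auto simp: fm_list_def scale_list_def)

lemma integrable_step_fun: "fm_list c l ==> integrable c (step_fun l)"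
proof (induction l)
 case Nil
 have "step_fun [] = (%z. 0)" by (simp add: fun_eq_iff)
 then show ?case by simp
next
 case (Cons x l)
 obtain a A where x: "x = (a, A)" by (cases x)
 have "integrable c (%z. a * indicator A z + step_fun l z)"
  using Cons by (intro Bochner_Integration.integrable_add integrable_mult_right integrable_real_indicator)
   (auto simp: x fmeasurable_def)
 moreover have "step_fun (x # l) = (%z. a * indicator A z + step_fun l z)" by (simp add: x fun_eq_iff)
 ultimately show ?case by simp
qed

lemma step_fun_measurable: "fm_list c l ==> step_fun l \<in> Bm c"
 using integrable_step_fun by (rule borel_measurable_integrable)

lemma step_fun_disjoint_eq_0:
 "\<forall>x\<in>set l. z \<notin> snd x ==> step_fun l z = 0"
proof (induction l)
 case (Cons x l)
 obtain a A where x: "x = (a, A)" by (cases x)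
 show ?case using Cons by (simp add: x)
qed simp

text \<open>Off all the sets the step function is zero, so \<open>\<psi> 0 = 0\<close> removes the
  complement, whose measure may be infinite.\<close>

lemma has_bochner_integral_comp_step_fun:
 fixes \<psi> :: "real => 'b::{banach, second_countable_topology}"
 assumes "disjoint_list l" "fm_list c l" "\<psi> 0 = 0"
 shows "has_bochner_integral c (%z. \<psi> (step_fun l z)) (\<Sum>(b, B)\<leftarrow>l. measure c B *\<^sub>R \<psi> b)"
 using assms(1,2)
proof (induction l)
 case Nil
 then show ?case by (simp add: assms(3) has_bochner_integral_zero)
next
 case (Cons x l)
 obtain b B where x: "x = (b, B)" by (cases x)
 have B: "B \<in> fmeasurable c" and IH: "has_bochner_integral c (%z. \<psi> (step_fun l z)) (\<Sum>(b, B)\<leftarrow>l. measure c B *\<^sub>R \<psi> b)"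
  using Cons by (auto simp: x disjoint_list_def)
 have disj: "step_fun l z = 0" if "z \<in> B" for z
  using Cons(2) that by (intro step_fun_disjoint_eq_0) (fastforce simp: x disjoint_list_def)
 have *: "\<psi> (step_fun (x # l) z) = indicator B z *\<^sub>R \<psi> b + \<psi> (step_fun l z)" for z
  using disj[of z] by (auto simp: x assms(3) split: split_indicator)
 have "has_bochner_integral c (%z. indicator B z *\<^sub>R \<psi> b) (measure c B *\<^sub>R \<psi> b)"
  using B by (intro has_bochner_integral_indicator) (auto simp: fmeasurable_def)
 from has_bochner_integral_add[OF this IH] show ?case
  unfolding * by (simp add: x)
qed

locale random_set_function = prob_space M for M :: "'w measure" +
 fixes c :: "'z measure" and L :: "'z set => 'w => real"
 assumes scattered: "independently_scattered M c L"
  and empty_set: "AE ww in M. L {} ww = 0"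
begin

lemma L_measurable: "A \<in> fmeasurable c ==> L A \<in> Bm M"
 using scattered by (auto simp: independently_scattered_def)

lemma set_sum_measurable: "fm_list c l ==> set_sum L l \<in> Bm M"
proof (induction l)
 case Nil
 have "set_sum L [] = (%ww. 0)" by (simp add: fun_eq_iff)
 then show ?case by simp
next
 case (Cons x l)
 obtain a A where x: "x = (a, A)" by (cases x)
 have [measurable]: "L A \<in> Bm M" "set_sum L l \<in> Bm M"
  using Cons L_measurable by (auto simp: x)
 have "(%ww. a * L A ww + set_sum L l ww) \<in> Bm M" by measurable
 moreover have "set_sum L (x # l) = (%ww. a * L A ww + set_sum L l ww)" by (simp add: x fun_eq_iff)
 ultimately show ?case by simp
qed

text \<open>Finite additivity is countable additivity for a sequence padded with empty sets, on
  which \<open>L\<close> vanishes.\<close>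

lemma L_Un:
 assumes A: "A \<in> fmeasurable c" and B: "B \<in> fmeasurable c" and disj: "A \<inter> B = {}"
 shows "AE ww in M. L (A \<union> B) ww = L A ww + L B ww"
proof -
 have r: "range (binaryset A B) \<subseteq> fmeasurable c" using A B by (simp add: range_binaryset_eq)
 have d: "disjoint_family (binaryset A B)" using disj by (auto simp: disjoint_family_on_def binaryset_def)
 have "(\<Union>n. binaryset A B n) = A \<union> B" by (rule UN_binaryset_eq)
 then have "AE ww in M. (%n. L (binaryset A B n) ww) sums L (A \<union> B) ww"
  using scattered r d A B unfolding independently_scattered_def
  by (metis fmeasurable.Un)
 with empty_set show ?thesis
 proof eventually_elim
  case (elim ww)
  have "(%n. L (binaryset A B n) ww) sums (\<Sum>n\<in>{0,1}. L (binaryset A B n) ww)"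
   using elim(1) by (intro sums_finite) (auto simp: binaryset_def)
  then have "(%n. L (binaryset A B n) ww) sums (L A ww + L B ww)" by (simp add: binaryset_def)
  then show ?case using elim(2) sums_unique2 by blast
 qed
qed

lemma L_split:
 assumes A: "A \<in> fmeasurable c" and B: "B \<in> sets c"
 shows "AE ww in M. L A ww = L (A \<inter> B) ww + L (A - B) ww"
proof -
 have "A \<inter> B \<in> fmeasurable c" "A - B \<in> fmeasurable c"
  using A B by (auto intro: fmeasurable_Int_fmeasurable fmeasurable_Diff)
 then have "AE ww in M. L ((A \<inter> B) \<union> (A - B)) ww = L (A \<inter> B) ww + L (A - B) ww"
  by (intro L_Un) auto
 then show ?thesis by (simp add: Int_Diff_Un)
qed

text \<open>\<open>A\<close> is cut along the list one entry after another. Splitting off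
  \<open>B\<close> does not change the later pieces, since the remaining sets are disjoint from
  \<open>B\<close>.\<close>

lemma L_refine:
 assumes "disjoint_list l" "fm_list c l" "A \<in> fmeasurable c"
 shows "AE ww in M. L A ww = set_sum L (map (%(b, B). (1, B \<inter> A)) l) ww + L (A - \<Union>(snd ` set l)) ww"
 using assms
proof (induction l arbitrary: A)
 case Nil
 then show ?case by simp
next
 case (Cons x l)
 obtain b B where x: "x = (b, B)" by (cases x)
 have B: "B \<in> fmeasurable c" and l: "disjoint_list l" "fm_list c l"
  and disj: "\<And>y. y \<in> set l ==> B \<inter> snd y = {}"
  using Cons(2,3) by (auto simp: x disjoint_list_def)
 have "A - B \<in> fmeasurable c" using Cons(4) B by (intro fmeasurable_Diff) auto
 from Cons(1)[OF l this] L_split[OF Cons(4), of B] B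
 have "AE ww in M. L A ww = L (A \<inter> B) ww + (set_sum L (map (%(b, B'). (1, B' \<inter> (A - B))) l) ww + L ((A - B) - \<Union>(snd ` set l)) ww)"
  by (auto elim: eventually_elim2)
 moreover have "map (%(b, B'). (1 :: real, B' \<inter> (A - B))) l = map (%(b, B'). (1, B' \<inter> A)) l"
  using disj by (intro map_cong refl) fastforce
 moreover have "(A - B) - \<Union>(snd ` set l) = A - \<Union>(snd ` set (x # l))" by (auto simp: x)
 ultimately show ?case by (simp add: x Int_commute add.assoc)
qed

lemma set_sum_split:
 assumes "fm_list c l" "A \<in> sets c"
 shows "AE ww in M. set_sum L l ww = set_sum L (map (%(b, B). (b, B \<inter> A)) l) ww + set_sum L (map (%(b, B). (b, B - A)) l) ww"
 using assms(1)
proof (induction l)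
 case Nil
 then show ?case by simp
next
 case (Cons x l)
 obtain b B where x: "x = (b, B)" by (cases x)
 have B: "B \<in> fmeasurable c" "fm_list c l" using Cons(2) by (auto simp: x)
 from Cons(1)[OF B(2)] L_split[OF B(1) assms(2)] show ?case
  by eventually_elim (simp add: x algebra_simps)
qed

lemma disjoint_list_append:
 "disjoint_list (l @ l') \<longleftrightarrow> disjoint_list l \<and> disjoint_list l' \<and> (\<forall>x\<in>set l. \<forall>y\<in>set l'. snd x \<inter> snd y = {})"
 by (simp add: disjoint_list_def sorted_wrt_append)

lemma disjoint_list_map:
 assumes "disjoint_list l" "\<And>x. x \<in> set l ==> snd (f x) \<subseteq> snd x"
 shows "disjoint_list (map f l)"
 unfolding disjoint_list_def sorted_wrt_map
proof (rule sorted_wrt_mono_rel)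
 show "sorted_wrt (%x y. snd x \<inter> snd y = {}) l" using assms(1) by (simp add: disjoint_list_def)
 show "snd (f x) \<inter> snd (f y) = {}" if "x \<in> set l" "y \<in> set l" "snd x \<inter> snd y = {}" for x y
  using assms(2)[OF that(1)] assms(2)[OF that(2)] that(3) by blast
qed

text \<open>Independence is available for disjoint sets only. A new set \<open>A\<close> cuts every
  old set in two, raises the value by \<open>a\<close> on the inner piece and adds the piece of
  \<open>A\<close> not yet covered; \<open>L\<close> follows these cuts almost surely.\<close>

lemma ex_disjoint_list:
 assumes "fm_list c l"
 shows "\<exists>l'. disjoint_list l' \<and> fm_list c l' \<and> (\<forall>z. step_fun l' z = step_fun l z) \<and>
   (AE ww in M. set_sum L l' ww = set_sum L l ww)"
 using assms
proof (induction l)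
 case Nil
 then show ?case by (intro exI[of _ "[]"]) (simp add: disjoint_list_def)
next
 case (Cons x l)
 obtain a A where x: "x = (a, A)" by (cases x)
 have A: "A \<in> fmeasurable c" and fl: "fm_list c l" using Cons(2) by (auto simp: x)
 obtain k where k: "disjoint_list k" "fm_list c k" "\<And>z. step_fun k z = step_fun l z"
   "AE ww in M. set_sum L k ww = set_sum L l ww"
  using Cons(1)[OF fl] by auto
 define U where "U = \<Union>(snd ` set k)"
 have U: "U \<in> sets c" unfolding U_def using k(2) by (intro sets.finite_UN) (auto simp: fm_list_def)
 define k1 where "k1 = map (%(b, B). (b, B - A)) k"
 define k2 where "k2 = map (%(b, B). (b + a, B \<inter> A)) k"
 have mem: "\<exists>B b. (b, B) \<in> set k \<and> snd y = B - A" if "y \<in> set k1" for y using that by (auto simp: k1_def)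
 have mem2: "\<exists>B b. (b, B) \<in> set k \<and> snd y = B \<inter> A" if "y \<in> set k2" for y using that by (auto simp: k2_def)
 have "disjoint_list k1" "disjoint_list k2"
  unfolding k1_def k2_def using k(1) by (auto intro!: disjoint_list_map)
 moreover have "\<forall>y\<in>set k1. \<forall>y'\<in>set k2. snd y \<inter> snd y' = {}"
  using mem mem2 by fastforce
 moreover have "\<forall>y\<in>set k1. snd y \<inter> (A - U) = {}" "\<forall>y\<in>set k2. snd y \<inter> (A - U) = {}"
  using mem mem2 unfolding U_def by fastforce+
 ultimately have disj: "disjoint_list (k1 @ k2 @ [(a, A - U)])"
  unfolding disjoint_list_append by (simp add: disjoint_list_def ball_Un)
 have fm1: "fm_list c k1" "fm_list c k2"
  using k(2) A unfolding fm_list_def k1_def k2_def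
  by (fastforce intro: fmeasurable_Diff fmeasurable_Int_fmeasurable)+
 have fm: "fm_list c (k1 @ k2 @ [(a, A - U)])"
  using fm1 A U by (auto intro: fmeasurable_Diff)
 have s1: "step_fun k1 z + step_fun k2 z + a * indicator (A - \<Union>(snd ` set k)) z = a * indicator A z + step_fun k z" for z
  unfolding k1_def k2_def using k(1)
 proof (induction k)
  case (Cons y k)
  obtain b B where y: "y = (b, B)" by (cases y)
  have dk: "disjoint_list k" and d: "\<And>y. y \<in> set k ==> B \<inter> snd y = {}" using Cons(2) by (auto simp: disjoint_list_def y)
  show ?case
  proof (cases "z \<in> B")
   case True
   then have "z \<notin> \<Union>(snd ` set k)" using d by auto
   then show ?thesis using Cons(1)[OF dk] True by (auto simp: y indicator_def split: if_splits)
  next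
   case False
   then show ?thesis using Cons(1)[OF dk] by (auto simp: y indicator_def split: if_splits)
  qed
 qed simp
 have j2: "set_sum L k2 ww = set_sum L (map (%(b, B). (b, B \<inter> A)) k) ww + a * set_sum L (map (%(b, B). (1, B \<inter> A)) k) ww" for ww
  unfolding k2_def by (induction k) (auto simp: algebra_simps)
 have "AE ww in M. set_sum L (k1 @ k2 @ [(a, A - U)]) ww = set_sum L (x # l) ww"
  using L_refine[OF k(1,2) A] set_sum_split[OF k(2), of A] k(4) A
  by (auto simp: x j2 k1_def U_def algebra_simps elim!: eventually_rev_mp)
 then show ?case using disj fm s1 k(3) unfolding U_def[symmetric]
  by (intro exI[of _ "k1 @ k2 @ [(a, A - U)]"]) (auto simp: x add.assoc)
qed

lemma indep_disjoint_list:
 assumes "disjoint_list l" "fm_list c l"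
 shows "indep_vars (%_. borel) (%i. L (snd (l ! i))) {..<length l}"
proof -
 \<comment> \<open>The definition of independent scattering speaks of infinite sequences, so the
   list is continued by empty sets.\<close>
 define B where "B i = (if i < length l then snd (l ! i) else {})" for i
 have "disjoint_family B"
  using assms(1) unfolding disjoint_list_def sorted_wrt_iff_nth_less disjoint_family_on_def B_def
  by (auto simp: Int_commute) (metis disjoint_iff linorder_neqE_nat)
 moreover have "range B \<subseteq> fmeasurable c"
  using assms(2) by (auto simp: B_def fm_list_def) (metis nth_mem prod.collapse case_prodD)
 ultimately have "indep_vars (%_. borel) (%n. L (B n)) UNIV"
  using scattered unfolding independently_scattered_def by blast
 then have "indep_vars (%_. borel) (%n. L (B n)) {..<length l}"
  by (rule indep_vars_subset) auto
 then show ?thesis by (subst indep_vars_cong[OF refl _ refl, where Y="%n. L (B n)"]) (auto simp: B_def)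
qed

text \<open>Independence turns the transform of the sum into a product, and the exponents add up to
  an integral of \<open>\<psi>\<close> along the step function. The abstract \<open>\<zeta>\<close>
  and \<open>\<psi>\<close> serve the Gaussian basis, with \<open>\<psi>\<close> quadratic, and the
  subordinator basis, with \<open>\<psi>\<close> its exponent, alike.\<close>

lemma transform_disjoint_list:
 fixes \<zeta> :: complex and \<psi> :: "real => complex"
 assumes "disjoint_list l" "fm_list c l" "\<psi> 0 = 0"
  and hyp: "\<And>b B. (b, B) \<in> set l ==> integrable M (%ww. exp (\<zeta> * (b * L B ww))) \<and>
    (CLINT ww|M. exp (\<zeta> * (b * L B ww))) = exp (measure c B *\<^sub>R \<psi> b)"
 shows "(CLINT ww|M. exp (\<zeta> * set_sum L l ww)) = exp (CLINT z|c. \<psi> (step_fun l z))"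
  and "integrable M (%ww. exp (\<zeta> * set_sum L l ww))"
proof -
 let ?n = "length l"
 let ?Y = "%i ww. exp (\<zeta> * (fst (l ! i) * L (snd (l ! i)) ww))"
 have ind: "indep_vars (%_. borel) ?Y {..<?n}"
  by (rule indep_vars_compose2[OF indep_disjoint_list[OF assms(1,2)], where Y="%i x. exp (\<zeta> * (fst (l ! i) * x))"]) measurable
 have mem: "(fst (l ! i), snd (l ! i)) \<in> set l" if "i < ?n" for i using that by simp
 have eq: "exp (\<zeta> * set_sum L l ww) = (\<Prod>i<?n. ?Y i ww)" for ww
  by (simp add: set_sum_def sum_list_sum_nth case_prod_beta sum_distrib_left atLeast0LessThan flip: exp_sum)
 have int: "\<And>i. i \<in> {..<?n} ==> integrable M (?Y i)" using hyp mem by auto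
 show "integrable M (%ww. exp (\<zeta> * set_sum L l ww))"
  unfolding eq by (intro indep_vars_integrable ind int) auto
 have "(CLINT ww|M. exp (\<zeta> * set_sum L l ww)) = (\<Prod>i<?n. CLINT ww|M. ?Y i ww)"
  unfolding eq by (intro indep_vars_lebesgue_integral ind int) auto
 also have "... = (\<Prod>i<?n. exp (measure c (snd (l ! i)) *\<^sub>R \<psi> (fst (l ! i))))"
  using hyp mem by (intro prod.cong refl) auto
 also have "... = exp (\<Sum>(b, B)\<leftarrow>l. measure c B *\<^sub>R \<psi> b)"
  by (simp add: sum_list_sum_nth case_prod_beta atLeast0LessThan flip: exp_sum)
 also have "(\<Sum>(b, B)\<leftarrow>l. measure c B *\<^sub>R \<psi> b) = (CLINT z|c. \<psi> (step_fun l z))"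
  using has_bochner_integral_comp_step_fun[where \<psi>=\<psi>, OF assms(1-3)] by (simp add: has_bochner_integral_iff)
 finally show "(CLINT ww|M. exp (\<zeta> * set_sum L l ww)) = exp (CLINT z|c. \<psi> (step_fun l z))" .
qed

end

section \<open>Nonnegative infinitely divisible laws without drift\<close>

text \<open>The derivative of \<open>exp\<close> has modulus at most \<open>1\<close> on the closed
  left half plane, which is convex.\<close>

lemma norm_exp_diff_le:
 fixes z w :: complex
 assumes "Re z \<le> 0" "Re w \<le> 0"
 shows "norm (exp z - exp w) \<le> norm (z - w)"
proof -
 have "norm (exp z - exp w) \<le> 1 * norm (z - w)"
 proof (rule field_differentiable_bound[of "{z. Re z \<le> 0}" exp exp])
  show "convex {z. Re z \<le> 0}" by (rule convex_halfspace_Re_le)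
 qed (use assms in \<open>auto intro!: derivative_eq_intros\<close>)
 then show ?thesis by simp
qed

lemma norm_exp_scaled_diff_le:
 fixes \<zeta> :: complex and x y :: real
 assumes "Re \<zeta> \<le> 0" "0 \<le> x" "0 \<le> y"
 shows "norm (exp (\<zeta> * x) - exp (\<zeta> * y)) \<le> norm \<zeta> * \<bar>x - y\<bar>"
proof -
 have "norm (exp (\<zeta> * x) - exp (\<zeta> * y)) \<le> norm (\<zeta> * x - \<zeta> * y)"
  using assms by (intro norm_exp_diff_le) (auto simp: mult_nonpos_nonneg)
 also have "\<zeta> * x - \<zeta> * y = \<zeta> * of_real (x - y)" by (simp add: right_diff_distrib)
 finally show ?thesis by (simp only: norm_mult norm_of_real)
qed

text \<open>With \<open>u = z n / real (m n)\<close>, both \<open>1 + u\<close> and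
  \<open>exp u\<close> lie in the unit disc, so their powers of order \<open>m n\<close> differ by
  at most \<open>m n\<close> times their distance, which is quadratic in \<open>u\<close>. The
  hypothesis on \<open>1 + u\<close> takes the place of complex logarithms.\<close>

lemma power_add_divide_tendsto_exp:
 fixes z :: "nat => complex" and m :: "nat => nat"
 assumes z: "z \<longlonglongrightarrow> l" and m: "filterlim m at_top sequentially"
  and le: "\<And>n. norm (1 + z n / real (m n)) \<le> 1" and Re: "\<And>n. Re (z n) \<le> 0"
 shows "(%n. (1 + z n / real (m n)) ^ m n) \<longlonglongrightarrow> exp l"
proof -
 have m_real: "filterlim (%n. real (m n)) at_top sequentially"
  by (rule filterlim_compose[OF filterlim_real_sequentially m])
 have zn: "(%n. norm (z n)) \<longlonglongrightarrow> norm l" by (intro tendsto_intros z)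
 have "(%n. norm (z n) / real (m n)) \<longlonglongrightarrow> 0"
  by (rule real_tendsto_divide_at_top[OF zn m_real])
 then have ev1: "\<forall>\<^sub>F n in sequentially. norm (z n) / real (m n) < 1"
  by (rule order_tendstoD) simp
 have ev2: "\<forall>\<^sub>F n in sequentially. m n \<ge> 1" using m by (simp add: filterlim_at_top)
 have "(%n. (1 + z n / real (m n)) ^ m n - exp (z n)) \<longlonglongrightarrow> 0"
 proof (rule Lim_null_comparison)
  show "\<forall>\<^sub>F n in sequentially. norm ((1 + z n / real (m n)) ^ m n - exp (z n)) \<le> 3 * (norm (z n))\<^sup>2 / real (m n)"
   using ev1 ev2
  proof eventually_elim
   case (elim n)
   have m0: "real (m n) > 0" using elim by simp
   define u where "u = z n / real (m n)"
   have u: "norm u < 1" using elim m0 by (simp add: u_def norm_divide)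
   have Reu: "Re u \<le> 0" unfolding u_def using Re[of n] m0 by (simp add: divide_nonpos_nonneg)
   have "exp (z n) = exp u ^ m n"
    using m0 by (simp add: u_def flip: exp_of_nat_mult)
   moreover have A: "norm ((1 + u) ^ m n - exp u ^ m n) \<le> m n * norm (1 + u - exp u)"
    using le[of n] Reu by (intro norm_power_diff) (auto simp: u_def)
   \<comment> \<open>The Taylor remainder carries the factor \<open>exp \<bar>Re u\<bar>\<close>,
     which is at most \<open>exp 1\<close> and so at most \<open>3\<close>.\<close>
   have B: "norm (1 + u - exp u) \<le> 3 * (norm u)\<^sup>2"
   proof -
    have "norm (exp u - (\<Sum>k\<le>1. u ^ k / fact k)) \<le> exp \<bar>Re u\<bar> * norm u ^ Suc 1 / fact 1"
     by (rule Taylor_exp)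
    also have "... \<le> 3 * (norm u)\<^sup>2"
    proof -
     have "\<bar>Re u\<bar> \<le> 1" using u abs_Re_le_cmod[of u] by linarith
     then have "exp \<bar>Re u\<bar> \<le> exp 1" by simp
     also have "... \<le> 3" by (rule exp_le)
     finally show ?thesis by (simp add: power2_eq_square mult_right_mono)
    qed
    finally show ?thesis by (simp add: norm_minus_commute algebra_simps)
   qed
   have "norm ((1 + u) ^ m n - exp u ^ m n) \<le> m n * (3 * (norm u)\<^sup>2)"
    using m0 by (intro order_trans[OF A] mult_left_mono B) simp
   ultimately have "norm ((1 + u) ^ m n - exp (z n)) \<le> m n * (3 * (norm u)\<^sup>2)"
    by (simp only:)
   also have "... = 3 * (norm (z n))\<^sup>2 / real (m n)"
    using m0 by (simp add: u_def norm_divide power2_eq_square)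
   finally show ?case by (simp add: u_def)
  qed
  have "(%n. 3 * (norm (z n))\<^sup>2) \<longlonglongrightarrow> 3 * (norm l)\<^sup>2" by (intro tendsto_intros zn)
  then show "(%n. 3 * (norm (z n))\<^sup>2 / real (m n)) \<longlonglongrightarrow> 0"
   by (rule real_tendsto_divide_at_top[OF _ m_real])
 qed
 moreover have "(%n. exp (z n)) \<longlonglongrightarrow> exp l" by (intro tendsto_intros z)
 ultimately have "(%n. ((1 + z n / real (m n)) ^ m n - exp (z n)) + exp (z n)) \<longlonglongrightarrow> 0 + exp l"
  by (rule tendsto_add)
 then show ?thesis by simp
qed

text \<open>A subprobability law is completed by an atom at \<open>0\<close>.\<close>

lemma ex_atom_completion:
 fixes D :: "real measure"
 assumes fin: "finite_measure D" and sets [measurable_cong]: "sets D = sets borel" and le: "measure D UNIV \<le> 1"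
  and nonneg: "AE x in D. 0 \<le> x"
 shows "\<exists>\<rho>. real_distribution \<rho> \<and> (AE x in \<rho>. 0 \<le> x) \<and>
  (\<forall>f :: real => complex. f \<in> Bm borel \<longrightarrow> (\<forall>x\<ge>0. norm (f x) \<le> 1) \<longrightarrow>
    (CLINT x|\<rho>. f x) = f 0 * (1 - measure D UNIV) + (CLINT x|D. f x))"
proof -
 interpret D: finite_measure D by fact
 have spD [simp]: "space D = UNIV" using sets_eq_imp_space_eq[OF sets] by simp
 define p where "p = measure D UNIV"
 have p: "0 \<le> p" "p \<le> 1" using le by (auto simp: p_def)
 show ?thesis
 proof (cases "p = 0")
  \<comment> \<open>Without mass there is no normalised law to mix with, and the completion is the
    atom alone.\<close>
  case True
  then have "emeasure D (space D) = 0" by (simp add: p_def D.emeasure_eq_measure)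
  then have null: "AE x in D. False"
   by (intro AE_I[where N="space D"]) auto
  have "(CLINT x|D. f x) = 0" for f :: "real => complex"
   using null by (intro integral_eq_zero_AE) (auto elim: eventually_mono)
  moreover have "real_distribution (return borel (0::real))"
   by (intro real_distribution.intro real_distribution_axioms.intro prob_space_return) auto
  ultimately show ?thesis
   using True by (intro exI[of _ "return borel 0"]) (auto simp: integral_return AE_return p_def)
 next
  case False
  then have p0: "p > 0" using p by auto
  define D' where "D' = density D (%_. en (1 / p))"
  have sD' [simp, measurable_cong]: "sets D' = sets borel" by (simp add: D'_def sets)
  have "emeasure D' (space D') = en (1/p) * en p"
   by (simp add: D'_def emeasure_density nn_integral_cmult p_def D.emeasure_eq_measure)
  also have "... = 1" using p0 by (simp flip: ennreal_mult)
  finally interpret D': prob_space D' by (rule prob_spaceI)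
  interpret P: pair_prob_space "measure_pmf (bernoulli_pmf p)" D' ..
  \<comment> \<open>The completed law is that of a product of a Bernoulli variable with success
    probability \<open>p\<close> and an independent variable with the normalised law
    \<open>D'\<close>.\<close>
  let ?g = "%(b, x). if b then x else (0::real)"
  have g [measurable]: "?g \<in> Bm (measure_pmf (bernoulli_pmf p) \<Otimes>\<^sub>M D')"
   by measurable
  define \<rho> where "\<rho> = distr (measure_pmf (bernoulli_pmf p) \<Otimes>\<^sub>M D') borel ?g"
  have "real_distribution \<rho>" unfolding \<rho>_def by (intro P.real_distribution_distr g)
  moreover have D'_nn: "AE x in D'. 0 \<le> x"
   unfolding D'_def using nonneg by (subst AE_density) auto
  moreover have "AE x in \<rho>. 0 \<le> x"
  proof -
   have "AE z in (measure_pmf (bernoulli_pmf p) \<Otimes>\<^sub>M D'). 0 \<le> ?g z"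
    using D'_nn by (intro P.AE_pair_measure) (auto intro!: AE_I2 elim: eventually_mono)
   then show ?thesis unfolding \<rho>_def by (subst AE_distr_iff) (auto split: prod.split)
  qed
  moreover have "(CLINT x|\<rho>. f x) = f 0 * (1 - measure D UNIV) + (CLINT x|D. f x)"
   if [measurable]: "f \<in> Bm borel" and f: "\<And>x. x \<ge> 0 ==> norm (f x) \<le> 1" for f :: "real => complex"
  proof -
   have "(CLINT x|\<rho>. f x) = (CLINT z|(measure_pmf (bernoulli_pmf p) \<Otimes>\<^sub>M D'). f (?g z))"
    unfolding \<rho>_def by (subst integral_distr) auto
   also have "... = (LINT b|(measure_pmf (bernoulli_pmf p)). (LINT x|D'. f (?g (b, x))))"
   proof (rule P.integral_fst'[symmetric])
    have "AE z in (measure_pmf (bernoulli_pmf p) \<Otimes>\<^sub>M D'). norm (f (?g z)) \<le> 1"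
     using D'_nn f by (intro P.AE_pair_measure) (auto intro!: AE_I2 elim!: eventually_mono)
    then show "integrable (measure_pmf (bernoulli_pmf p) \<Otimes>\<^sub>M D') (%z. f (?g z))"
     by (intro P.P.integrable_const_bound[where B=1]) measurable
   qed
   also have "... = p *\<^sub>R (CLINT x|D'. f x) + (1 - p) *\<^sub>R f 0"
    using p by (subst integral_measure_pmf[of UNIV]) (auto simp: UNIV_bool D'.prob_space)
   also have "(CLINT x|D'. f x) = (CLINT x|D. (1/p) *\<^sub>R f x)"
    unfolding D'_def using p0 by (intro integral_density) auto
   also have "... = (1/p) *\<^sub>R (CLINT x|D. f x)" by (rule integral_scaleR_right)
   also have "p *\<^sub>R ... = (CLINT x|D. f x)" using p0 by simp
   finally show ?thesis by (simp add: p_def scaleR_conv_of_real mult.commute)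
  qed
  ultimately show ?thesis by blast
 qed
qed

text \<open>The sum of the coordinates on a product space has the required law. Nonnegativity bounds
  the exponentials, so the transforms multiply on the whole closed left half plane and not only on
  the imaginary axis.\<close>

lemma ex_iid_sum:
 fixes \<rho> :: "real measure"
 assumes "real_distribution \<rho>" and nonneg: "AE x in \<rho>. 0 \<le> x"
 shows "\<exists>\<beta>. real_distribution \<beta> \<and> (AE x in \<beta>. 0 \<le> x) \<and>
  (\<forall>\<zeta>::complex. Re \<zeta> \<le> 0 \<longrightarrow> (CLINT x|\<beta>. exp (\<zeta> * x)) = (CLINT x|\<rho>. exp (\<zeta> * x)) ^ m)"
proof -
 interpret \<rho>: real_distribution \<rho> by fact
 interpret P: product_prob_space "%_::nat. \<rho>" "{..<m}" ..
 have PS: "prob_space (\<Pi>\<^sub>M i\<in>{..<m}. \<rho>)" by (intro prob_space_PiM) unfold_locales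
 define \<beta> where "\<beta> = distr (\<Pi>\<^sub>M i\<in>{..<m}. \<rho>) borel (%x. \<Sum>i<m. x i)"
 have [measurable]: "(%x. \<Sum>i<m. x i) \<in> Bm (\<Pi>\<^sub>M i\<in>{..<m}. \<rho>)"
  by (intro borel_measurable_sum) (auto intro!: measurable_compose[OF measurable_component_singleton])
 have "real_distribution \<beta>" unfolding \<beta>_def by (intro prob_space.real_distribution_distr[OF PS]) measurable
 moreover have "AE x in \<beta>. 0 \<le> x"
 proof -
  have "AE x in (\<Pi>\<^sub>M i\<in>{..<m}. \<rho>). \<forall>i\<in>{..<m}. 0 \<le> x i"
   by (intro AE_finite_allI finite_lessThan P.AE_component nonneg)
  then have "AE x in (\<Pi>\<^sub>M i\<in>{..<m}. \<rho>). 0 \<le> (\<Sum>i<m. x i)"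
   by eventually_elim (auto intro: sum_nonneg)
  then show ?thesis unfolding \<beta>_def by (subst AE_distr_iff) auto
 qed
 moreover have "(CLINT x|\<beta>. exp (\<zeta> * x)) = (CLINT x|\<rho>. exp (\<zeta> * x)) ^ m" if \<zeta>: "Re \<zeta> \<le> 0" for \<zeta> :: complex
 proof -
  have int: "integrable \<rho> (%x. exp (\<zeta> * cor x))"
   using nonneg \<zeta> by (intro \<rho>.integrable_const_bound[where B=1]) (auto elim!: eventually_mono simp: mult_nonpos_nonneg)
  have "(CLINT x|\<beta>. exp (\<zeta> * x)) = (CLINT x|(\<Pi>\<^sub>M i\<in>{..<m}. \<rho>). exp (\<zeta> * (\<Sum>i<m. x i)))"
   unfolding \<beta>_def by (subst integral_distr) auto
  also have "... = (CLINT x|(\<Pi>\<^sub>M i\<in>{..<m}. \<rho>). (\<Prod>i<m. exp (\<zeta> * cor (x i))))"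
   by (simp add: sum_distrib_left exp_sum)
  also have "... = (\<Prod>i<m. CLINT x|\<rho>. exp (\<zeta> * x))"
   by (rule P.product_integral_prod) (use int in auto)
  finally show ?thesis by simp
 qed
 ultimately show ?thesis by blast
qed

text \<open>The Levy measure of a driftless nonnegative law. The finite mean combines integrability
  of small and of large jumps; through it the exponent converges absolutely without
  compensation.\<close>

locale jump_measure =
 fixes \<nu> :: "real measure"
 assumes sets_\<nu>: "sets \<nu> = sets (restrict_space borel {0<..})"
  and finite_mean: "(\<integral>\<^sup>+w. en w \<partial>\<nu>) < \<infinity>"
begin

lemma space_\<nu>: "space \<nu> = {0<..}"
 using sets_eq_imp_space_eq[OF sets_\<nu>] by (simp add: space_restrict_space)

lemma measurable_\<nu>: "f \<in> measurable borel N ==> f \<in> measurable \<nu> N"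
 using measurable_restrict_space1[of f borel N "{0<..}"] measurable_cong_sets[OF sets_\<nu> refl, of N] by blast

lemma id_measurable_\<nu> [measurable]: "(%w. w) \<in> measurable \<nu> borel"
 by (rule measurable_\<nu>) simp

lemma integrable_id: "integrable \<nu> (%w. w)"
proof (rule integrableI_bounded)
 have "(\<integral>\<^sup>+w. en (norm w) \<partial>\<nu>) = (\<integral>\<^sup>+w. en w \<partial>\<nu>)"
  by (intro nn_integral_cong) (auto simp: space_\<nu>)
 then show "(\<integral>\<^sup>+w. en (norm w) \<partial>\<nu>) < \<infinity>" using finite_mean by simp
qed measurable

definition mean :: real where "mean = (LINT w|\<nu>. w)"

lemma mean_nonneg: "0 \<le> mean"
 unfolding mean_def by (intro integral_nonneg_AE AE_I2) (simp add: space_\<nu>)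

lemma nn_integral_id: "(\<integral>\<^sup>+w. en w \<partial>\<nu>) = en mean"
 unfolding mean_def by (intro nn_integral_eq_integral integrable_id AE_I2) (simp add: space_\<nu>)

lemma sigma_finite: "sigma_finite_measure \<nu>"
proof (rule sigma_finite_measure.intro)
 let ?A = "%n::nat. {w\<in>space \<nu>. 1 \<le> real (Suc n) * w}"
 have "emeasure \<nu> (?A n) \<noteq> \<infinity>" for n
 proof -
  have "emeasure \<nu> (?A n) \<le> ennreal (real (Suc n)) * (\<integral>\<^sup>+w. en w * indicator (space \<nu>) w \<partial>\<nu>)"
  proof -
   have "?A n = {w\<in>space \<nu>. 1 \<le> ennreal (real (Suc n)) * en w}"
    by (auto simp: space_\<nu> ennreal_mult[symmetric] simp del: of_nat_Suc)
   then show ?thesis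
    using nn_integral_Markov_inequality[of "%w. en w" "space \<nu>" \<nu> "en (real (Suc n))"] by simp
  qed
  also have "... < \<infinity>" using finite_mean by (simp add: ennreal_mult_less_top cong: nn_integral_cong)
  finally show ?thesis by simp
 qed
 moreover have "(\<Union>n. ?A n) = space \<nu>"
 proof -
  have "\<exists>n. 1 \<le> real (Suc n) * w" if "w > 0" for w
  proof -
   obtain n where "1 / w < real n" using reals_Archimedean2 by blast
   then have "1 \<le> real (Suc n) * w" using that by (simp add: field_simps)
   then show ?thesis ..
  qed
  then show ?thesis by (auto simp: space_\<nu> simp del: of_nat_Suc)
 qed
 ultimately show "\<exists>A. countable A \<and> A \<subseteq> sets \<nu> \<and> \<Union>A = space \<nu> \<and> (\<forall>a\<in>A. emeasure \<nu> a \<noteq> \<infinity>)"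
  by (intro exI[of _ "range ?A"]) (auto simp del: of_nat_Suc)
qed

text \<open>A complex argument covers the characteristic exponent (\<open>\<zeta>\<close> imaginary)
  and the Laplace exponent (\<open>\<zeta>\<close> negative) at once, over the closed left half
  plane.\<close>

definition exponent :: "complex => complex" where
 "exponent \<zeta> = (CLINT w|\<nu>. exp (\<zeta> * w) - 1)"

lemma integrable_exponent:
 assumes "Re \<zeta> \<le> 0"
 shows "integrable \<nu> (%w. exp (\<zeta> * cor w) - 1)"
proof (rule Bochner_Integration.integrable_bound)
 show "integrable \<nu> (%w. norm \<zeta> * w)" using integrable_id by simp
 show "AE w in \<nu>. norm (exp (\<zeta> * cor w) - 1) \<le> norm (norm \<zeta> * w)"
 proof (rule AE_I2)
  fix w assume "w \<in> space \<nu>"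
  then show "norm (exp (\<zeta> * cor w) - 1) \<le> norm (norm \<zeta> * w)"
   using norm_exp_scaled_diff_le[OF assms, of w 0] by (simp add: space_\<nu> norm_mult)
 qed
qed measurable

text \<open>Jumps larger than \<open>1 / real (Suc n)\<close> have finite total mass. A variable
  that makes one such jump with a probability proportional to \<open>t / real m\<close> and rests at
  \<open>0\<close> otherwise, summed over \<open>m\<close> independent copies, is a discrete form of
  a compound Poisson law, and it visibly lives on the half line.\<close>

lemma approximating_law:
 fixes t :: real
 assumes t: "0 \<le> t"
 shows "\<exists>\<beta> m. real_distribution \<beta> \<and> (AE x in \<beta>. 0 \<le> x) \<and> n \<le> m \<and>
   (\<forall>\<zeta>::complex. Re \<zeta> \<le> 0 \<longrightarrow>
    norm (1 + t * (CLINT w|\<nu>. indicator {1 / real (Suc n)<..} w *\<^sub>R (exp (\<zeta> * w) - 1)) / real m) \<le> 1 \<and>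
    (CLINT x|\<beta>. exp (\<zeta> * x)) =
    (1 + t * (CLINT w|\<nu>. indicator {1 / real (Suc n)<..} w *\<^sub>R (exp (\<zeta> * w) - 1)) / real m) ^ m)"
proof -
 let ?A = "{1 / real (Suc n)<..} :: real set"
 have Apos: "w > 0" if "w \<in> ?A" for w
  using that by (meson divide_pos_pos greaterThan_iff less_trans of_nat_0_less_iff zero_less_Suc zero_less_one)
 have A\<nu>: "?A \<in> sets \<nu>" using Apos unfolding sets_\<nu> by (auto simp: sets_restrict_space_iff simp del: of_nat_Suc)
 have [measurable]: "indicator ?A \<in> Bm \<nu>" for A by (rule measurable_\<nu>) auto
 have intA: "integrable \<nu> (indicator ?A :: real => real)"
 proof (rule Bochner_Integration.integrable_bound)
  show "integrable \<nu> (%w. real (Suc n) * w)" using integrable_id by simp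
  show "AE w in \<nu>. norm (indicator ?A w :: real) \<le> norm (real (Suc n) * w)"
   by (intro AE_I2) (auto simp: space_\<nu> field_simps split: split_indicator)
 qed measurable
 have AS: "?A \<inter> space \<nu> = ?A" using Apos by (auto simp: space_\<nu>)
 obtain m0 where m0: "t * measure \<nu> ?A \<le> real m0" using real_arch_simple[of "t * measure \<nu> ?A"] by auto
 \<comment> \<open>Large enough for the jump probability not to exceed \<open>1\<close>, positive,
   and at least \<open>n\<close> so that it tends to infinity with \<open>n\<close>.\<close>
 define m where "m = max (Suc n) m0"
 have m: "n \<le> m" "0 < real m" "t * measure \<nu> ?A \<le> real m" using m0 unfolding m_def by linarith+
 define r where "r = t / real m"
 have r: "0 \<le> r" using t m by (simp add: r_def)
 \<comment> \<open>The law of a single jump, of total mass at most \<open>1\<close>; the missing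
   mass is then put at \<open>0\<close>.\<close>
 define D where "D = distr (density \<nu> (%w. en (r * indicator ?A w))) borel (%w. w)"
 have sD: "sets D = sets borel" by (simp add: D_def)
 have emD: "emeasure D UNIV = en (r * measure \<nu> ?A)"
 proof -
  have "emeasure D UNIV = (\<integral>\<^sup>+w. en (r * indicator ?A w) \<partial>\<nu>)"
   unfolding D_def by (subst emeasure_distr) (auto simp: emeasure_density cong: nn_integral_cong)
  also have "... = en (LINT w|\<nu>. r * indicator ?A w)"
   using r intA by (intro nn_integral_eq_integral) auto
  also have "(LINT w|\<nu>. r * indicator ?A w) = r * measure \<nu> ?A"
   by (simp add: AS del: of_nat_Suc)
  finally show ?thesis .
 qed
 have spD: "space D = UNIV" by (simp add: D_def)
 have finD: "finite_measure D" by (rule finite_measureI) (simp add: spD emD)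
 have mD: "measure D UNIV = r * measure \<nu> ?A" using emD r by (simp add: measure_def)
 have "measure D UNIV \<le> 1" using m by (simp add: mD r_def field_simps)
 moreover have "AE x in D. 0 \<le> x"
  unfolding D_def by (subst AE_distr_iff) (auto simp: AE_density space_\<nu> intro!: AE_I2)
 ultimately obtain \<rho> where \<rho>: "real_distribution \<rho>" "AE x in \<rho>. 0 \<le> x"
  "\<And>f :: real => complex. f \<in> Bm borel ==> (\<And>x. x\<ge>0 ==> norm (f x) \<le> 1) ==>
    (CLINT x|\<rho>. f x) = f 0 * (1 - measure D UNIV) + (CLINT x|D. f x)"
  using ex_atom_completion[OF finD sD] by blast
 interpret \<rho>: real_distribution \<rho> by (rule \<rho>(1))
 have tr: "(CLINT x|\<rho>. exp (\<zeta> * x)) = 1 + t * (CLINT w|\<nu>. indicator ?A w *\<^sub>R (exp (\<zeta> * w) - 1)) / real m"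
  if \<zeta>: "Re \<zeta> \<le> 0" for \<zeta> :: complex
 proof -
  have "(CLINT x|\<rho>. exp (\<zeta> * x)) = 1 - measure D UNIV + (CLINT x|D. exp (\<zeta> * x))"
   using \<zeta> by (subst \<rho>(3)) (auto simp: mult_nonpos_nonneg)
  also have "(CLINT x|D. exp (\<zeta> * x)) = (CLINT w|\<nu>. (r * indicator ?A w) *\<^sub>R exp (\<zeta> * w))"
   unfolding D_def using r by (subst integral_distr) (auto intro!: integral_density)
  also have "... = (CLINT w|\<nu>. r *\<^sub>R (indicator ?A w *\<^sub>R (exp (\<zeta> * w) - 1)) + cor (r * indicator ?A w))"
   by (intro Bochner_Integration.integral_cong refl) (auto simp: scaleR_conv_of_real algebra_simps split: split_indicator)
  also have "... = r *\<^sub>R (CLINT w|\<nu>. indicator ?A w *\<^sub>R (exp (\<zeta> * w) - 1)) + (CLINT w|\<nu>. cor (r * indicator ?A w))"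
  proof -
   have i1: "integrable \<nu> (%w. indicator ?A w *\<^sub>R (exp (\<zeta> * cor w) - 1))"
    by (rule integrable_mult_indicator[OF A\<nu> integrable_exponent[OF \<zeta>]])
   have i2: "integrable \<nu> (%w. cor (r * indicator ?A w))"
    by (intro integrable_of_real integrable_mult_right intA)
   show ?thesis
    using Bochner_Integration.integral_add[OF integrable_scaleR_right[OF i1, of r] i2]
    by (simp only: integral_scaleR_right)
  qed
  also have "(CLINT w|\<nu>. cor (r * indicator ?A w)) = cor (r * measure \<nu> ?A)"
   by (subst integral_complex_of_real) (simp add: AS del: of_nat_Suc)
  finally show ?thesis unfolding mD by (simp add: r_def scaleR_conv_of_real)
 qed
 have le1: "norm (CLINT x|\<rho>. exp (\<zeta> * x)) \<le> 1" if \<zeta>: "Re \<zeta> \<le> 0" for \<zeta> :: complex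
 proof -
  have int: "integrable \<rho> (%x. exp (\<zeta> * cor x))"
   using \<rho>(2) \<zeta> by (intro \<rho>.integrable_const_bound[where B=1]) (auto elim!: eventually_mono simp: mult_nonpos_nonneg)
  have "norm (CLINT x|\<rho>. exp (\<zeta> * x)) \<le> (LINT x|\<rho>. norm (exp (\<zeta> * cor x)))"
   by (rule integral_norm_bound)
  also have "... \<le> (LINT x|\<rho>. 1)"
  proof (rule integral_mono_AE[OF integrable_norm[OF int]])
   show "AE x in \<rho>. norm (exp (\<zeta> * cor x)) \<le> 1"
    using \<rho>(2) \<zeta> by (auto elim!: eventually_mono simp: mult_nonpos_nonneg)
  qed simp
  finally show ?thesis using \<rho>.prob_space by simp
 qed
 obtain \<beta> where "real_distribution \<beta>" "AE x in \<beta>. 0 \<le> x"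
  "\<And>\<zeta>::complex. Re \<zeta> \<le> 0 ==> (CLINT x|\<beta>. exp (\<zeta> * x)) = (CLINT x|\<rho>. exp (\<zeta> * x)) ^ m"
  using ex_iid_sum[OF \<rho>(1,2), of m] by blast
 then show ?thesis
  using m(1) by (intro exI[of _ \<beta>] exI[of _ m] conjI allI impI; (simp only: tr[symmetric] le1)?)
qed

text \<open>The formula for the characteristic function does not show directly where the law lives.
  The approximating laws on the half line converge weakly to \<open>\<mu>\<close> by Levy
  continuity, and bounded continuous test functions carry nonnegativity and the transform on the
  left half plane over to \<open>\<mu>\<close>.\<close>

lemma subordinator_law:
 fixes t :: real and \<zeta> :: complex
 assumes \<mu>: "real_distribution \<mu>" and t: "0 \<le> t"
  and char: "\<And>\<theta>. char \<mu> \<theta> = exp (t * exponent (\<i> * \<theta>))"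
 shows "AE x in \<mu>. 0 \<le> x"
  and "Re \<zeta> \<le> 0 ==> (CLINT x|\<mu>. exp (\<zeta> * x)) = exp (t * exponent \<zeta>)"
proof -
 interpret \<mu>: real_distribution \<mu> by fact
 define \<psi> where "\<psi> n \<zeta> = (CLINT w|\<nu>. indicator {1 / real (Suc n)<..} w *\<^sub>R (exp (\<zeta> * cor w) - 1))" for n \<zeta>
 have "\<forall>n. \<exists>\<beta> m. real_distribution \<beta> \<and> (AE x in \<beta>. 0 \<le> x) \<and> n \<le> m \<and>
   (\<forall>\<zeta>::complex. Re \<zeta> \<le> 0 \<longrightarrow> norm (1 + t * \<psi> n \<zeta> / real m) \<le> 1 \<and>
    (CLINT x|\<beta>. exp (\<zeta> * x)) = (1 + t * \<psi> n \<zeta> / real m) ^ m)"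
  unfolding \<psi>_def by (intro allI approximating_law t)
 then obtain \<beta> m where \<beta>: "\<And>n. real_distribution (\<beta> n)" "\<And>n. AE x in \<beta> n. 0 \<le> x" and m: "\<And>n. n \<le> m n"
  and le: "\<And>n (\<zeta>::complex). Re \<zeta> \<le> 0 ==> norm (1 + t * \<psi> n \<zeta> / real (m n)) \<le> 1"
  and tr: "\<And>n (\<zeta>::complex). Re \<zeta> \<le> 0 ==> (CLINT x|\<beta> n. exp (\<zeta> * x)) = (1 + t * \<psi> n \<zeta> / real (m n)) ^ m n"
  by metis
 have mtop: "filterlim m at_top sequentially"
  using m by (intro filterlim_at_top_mono[OF filterlim_ident]) auto
 have conv: "(%n. CLINT x|\<beta> n. exp (\<zeta> * x)) \<longlonglongrightarrow> exp (t * exponent \<zeta>)" if \<zeta>: "Re \<zeta> \<le> 0" for \<zeta> :: complex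
 proof -
  have meas: "(%w. indicator {1 / real (Suc n)<..} w *\<^sub>R (exp (\<zeta> * cor w) - 1)) \<in> Bm \<nu>" for n
   by (rule measurable_\<nu>) measurable
  have "(%n. \<psi> n \<zeta>) \<longlonglongrightarrow> exponent \<zeta>"
   unfolding \<psi>_def exponent_def
  proof (rule integral_dominated_convergence[where w="%w. norm \<zeta> * w"])
   show "integrable \<nu> (%w. norm \<zeta> * w)" using integrable_id by simp
   show "(%w. exp (\<zeta> * cor w) - 1) \<in> Bm \<nu>" by measurable
   show "AE w in \<nu>. (%n. indicator {1 / real (Suc n)<..} w *\<^sub>R (exp (\<zeta> * cor w) - 1)) \<longlonglongrightarrow> exp (\<zeta> * cor w) - 1"
   proof (rule AE_I2)
    fix w assume "w \<in> space \<nu>"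
    then have "w > 0" by (simp add: space_\<nu>)
    then have "\<forall>\<^sub>F n in sequentially. 1 / real (Suc n) < w"
     by (intro order_tendstoD(2)[OF LIMSEQ_Suc[OF lim_1_over_n]])
    then have "\<forall>\<^sub>F n in sequentially. indicator {1 / real (Suc n)<..} w *\<^sub>R (exp (\<zeta> * cor w) - 1) = exp (\<zeta> * cor w) - 1"
     by eventually_elim simp
    then show "(%n. indicator {1 / real (Suc n)<..} w *\<^sub>R (exp (\<zeta> * cor w) - 1)) \<longlonglongrightarrow> exp (\<zeta> * cor w) - 1"
     by (rule tendsto_eventually)
   qed
   show "AE w in \<nu>. norm (indicator {1 / real (Suc n)<..} w *\<^sub>R (exp (\<zeta> * cor w) - 1)) \<le> norm \<zeta> * w" for n
   proof (rule AE_I2)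
    fix w assume "w \<in> space \<nu>"
    then show "norm (indicator {1 / real (Suc n)<..} w *\<^sub>R (exp (\<zeta> * cor w) - 1)) \<le> norm \<zeta> * w"
     using norm_exp_scaled_diff_le[OF \<zeta>, of w 0] by (auto simp: space_\<nu> split: split_indicator)
   qed
  qed (rule meas)
  then have lim: "(%n. t * \<psi> n \<zeta>) \<longlonglongrightarrow> t * exponent \<zeta>" by (intro tendsto_intros)
  have "Re (\<psi> n \<zeta>) \<le> 0" for n
  proof -
   have int: "integrable \<nu> (%w. indicator {1 / real (Suc n)<..} w *\<^sub>R (exp (\<zeta> * cor w) - 1))"
   proof (rule Bochner_Integration.integrable_bound[OF integrable_exponent[OF \<zeta>] meas])
    show "AE x in \<nu>. norm (indicator {1 / real (Suc n)<..} x *\<^sub>R (exp (\<zeta> * cor x) - 1)) \<le> norm (exp (\<zeta> * cor x) - 1)"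
     by (intro AE_I2) (auto split: split_indicator)
   qed
   have "Re (\<psi> n \<zeta>) = (LINT w|\<nu>. Re (indicator {1 / real (Suc n)<..} w *\<^sub>R (exp (\<zeta> * cor w) - 1)))"
    unfolding \<psi>_def by (rule integral_Re[OF int, symmetric])
   moreover have "0 \<le> (LINT w|\<nu>. - Re (indicator {1 / real (Suc n)<..} w *\<^sub>R (exp (\<zeta> * cor w) - 1)))"
   proof (intro integral_nonneg_AE AE_I2)
    fix w assume w: "w \<in> space \<nu>"
    have "Re (exp (\<zeta> * cor w)) \<le> norm (exp (\<zeta> * cor w))" by (rule complex_Re_le_cmod)
    also have "... \<le> 1" using w \<zeta> by (simp add: space_\<nu> mult_nonpos_nonneg)
    finally show "0 \<le> - Re (indicator {1 / real (Suc n)<..} w *\<^sub>R (exp (\<zeta> * cor w) - 1))"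
     by (auto split: split_indicator)
   qed
   ultimately show ?thesis by (simp only: Bochner_Integration.integral_minus neg_0_le_iff_le)
  qed
  then have "Re (t * \<psi> n \<zeta>) \<le> 0" for n using t by (simp add: mult_nonneg_nonpos)
  from power_add_divide_tendsto_exp[OF lim mtop le[OF \<zeta>] this] show ?thesis by (simp add: tr[OF \<zeta>])
 qed
 have weak: "weak_conv_m \<beta> \<mu>"
 proof (rule levy_continuity[OF \<beta>(1) \<mu>])
  show "(%n. char (\<beta> n) \<theta>) \<longlonglongrightarrow> char \<mu> \<theta>" for \<theta>
   using conv[of "\<i> * \<theta>"] unfolding char by (simp add: char_def mult.assoc)
 qed
 interpret \<beta>: real_distribution "\<beta> n" for n by (rule \<beta>)
 note W = weak_conv_imp_integral_bdd_continuous_conv[OF \<beta>(1) \<mu> weak]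
 show nn: "AE x in \<mu>. 0 \<le> x"
 proof -
  \<comment> \<open>A bounded continuous function that is positive exactly on the negative half
    line.\<close>
  let ?f = "%x::real. min 1 (max 0 (- x))"
  have "(%n. LINT x|\<beta> n. ?f x) \<longlonglongrightarrow> (LINT x|\<mu>. ?f x)"
   by (rule W[where B=1]) (auto intro!: continuous_intros)
  moreover have "(LINT x|\<beta> n. ?f x) = 0" for n
   using \<beta>(2)[of n] by (intro integral_eq_zero_AE) (auto elim: eventually_mono)
  ultimately have "(LINT x|\<mu>. ?f x) = 0" by (simp add: LIMSEQ_const_iff)
  moreover have "integrable \<mu> ?f" by (intro \<mu>.integrable_const_bound[where B=1]) auto
  ultimately have "AE x in \<mu>. ?f x = 0" by (subst (asm) integral_nonneg_eq_0_iff_AE) auto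
  then show ?thesis by eventually_elim (auto simp: min_def max_def split: if_splits)
 qed
 show "(CLINT x|\<mu>. exp (\<zeta> * x)) = exp (t * exponent \<zeta>)" if \<zeta>: "Re \<zeta> \<le> 0"
 proof -
  \<comment> \<open>\<open>max 0 x\<close> keeps the test function bounded on the negative half
    line, which none of the laws charges.\<close>
  let ?f = "%x::real. exp (\<zeta> * cor (max 0 x))"
  have "(%n. CLINT x|\<beta> n. ?f x) \<longlonglongrightarrow> (CLINT x|\<mu>. ?f x)"
   using \<zeta> by (intro W[where B=1]) (auto intro!: continuous_intros simp: mult_nonpos_nonneg)
  moreover have "(CLINT x|\<beta> n. ?f x) = (CLINT x|\<beta> n. exp (\<zeta> * x))" for n
   using \<beta>(2)[of n] by (intro integral_cong_AE) (auto elim: eventually_mono)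
  moreover have "(CLINT x|\<mu>. ?f x) = (CLINT x|\<mu>. exp (\<zeta> * x))"
   using nn by (intro integral_cong_AE) (auto elim: eventually_mono)
  ultimately have "(%n. CLINT x|\<beta> n. exp (\<zeta> * x)) \<longlonglongrightarrow> (CLINT x|\<mu>. exp (\<zeta> * x))" by simp
  from LIMSEQ_unique[OF this conv[OF \<zeta>]] show ?thesis .
 qed
qed

end

text \<open>For nonnegative \<open>v\<close>, \<open>1 - exp (- v)\<close> lies between
  \<open>v - v^2\<close> and \<open>v\<close>, and the quadratic error disappears after scaling. The
  purpose is to read a mean off a Laplace transform near \<open>0\<close>.\<close>

lemma scaled_one_minus_exp_tendsto:
 fixes u :: "nat => real"
 assumes u: "\<And>n. 0 \<le> u n" and lim: "(%n. real (Suc n) * u n) \<longlonglongrightarrow> x"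
 shows "(%n. real (Suc n) * (1 - exp (- u n))) \<longlonglongrightarrow> x"
proof (rule real_tendsto_sandwich)
 have le: "1 - exp (- v) \<le> v" and ge: "v - v\<^sup>2 \<le> 1 - exp (- v)" if v: "0 \<le> v" for v :: real
 proof -
  show "1 - exp (- v) \<le> v" using exp_ge_add_one_self[of "- v"] by simp
  have "exp (- v) = 1 / exp v" by (simp add: exp_minus field_simps)
  also have "... \<le> 1 / (1 + v)" using v exp_ge_add_one_self[of v] by (intro divide_left_mono) auto
  also have "... \<le> 1 - v + v\<^sup>2"
  proof -
   have "1 \<le> (1 - v + v\<^sup>2) * (1 + v)" using v by (simp add: algebra_simps power2_eq_square)
   then show ?thesis using v by (simp add: divide_le_eq)
  qed
  finally show "v - v\<^sup>2 \<le> 1 - exp (- v)" by simp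
 qed
 show "\<forall>\<^sub>F n in sequentially. real (Suc n) * (1 - exp (- u n)) \<le> real (Suc n) * u n"
  by (intro always_eventually allI mult_left_mono le u) simp
 show "\<forall>\<^sub>F n in sequentially. real (Suc n) * u n - (real (Suc n) * u n)\<^sup>2 / real (Suc n) \<le> real (Suc n) * (1 - exp (- u n))"
 proof (intro always_eventually allI)
  fix n
  have "real (Suc n) * u n - (real (Suc n) * u n)\<^sup>2 / real (Suc n) = real (Suc n) * (u n - (u n)\<^sup>2)"
   by (simp add: power2_eq_square field_simps)
  also have "... \<le> real (Suc n) * (1 - exp (- u n))" by (intro mult_left_mono ge u) simp
  finally show "real (Suc n) * u n - (real (Suc n) * u n)\<^sup>2 / real (Suc n) \<le> real (Suc n) * (1 - exp (- u n))" .
 qed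
 have "filterlim (%n. real (Suc n)) at_top sequentially"
  by (rule filterlim_compose[OF filterlim_real_sequentially filterlim_Suc])
 then have "(%n. real (Suc n) * u n - (real (Suc n) * u n)\<^sup>2 / real (Suc n)) \<longlonglongrightarrow> x - 0"
  by (intro tendsto_diff lim real_tendsto_divide_at_top[OF tendsto_power[OF lim]])
 then show "(%n. real (Suc n) * u n - (real (Suc n) * u n)\<^sup>2 / real (Suc n)) \<longlonglongrightarrow> x" by simp
qed (rule lim)

section \<open>Subordinator bases\<close>

locale subordinator_basis = random_set_function M c L + jump_measure \<nu>
 for M :: "'w measure" and c :: "'z measure" and L and \<nu> +
 assumes char_L: "\<And>A \<theta>. A \<in> fmeasurable c ==>
  (CLINT ww|M. iexp (\<theta> * L A ww)) = exp (cor (measure c A) * (CLINT w|\<nu>. iexp (\<theta> * w) - 1))"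
  and c_sigma_finite: "sigma_finite_measure c"
begin

lemma
 fixes \<zeta> :: complex
 assumes A: "A \<in> fmeasurable c"
 shows L_nonneg: "AE ww in M. 0 \<le> L A ww"
  and L_transform: "Re \<zeta> \<le> 0 ==> (CLINT ww|M. exp (\<zeta> * L A ww)) = exp (measure c A * exponent \<zeta>)"
proof -
 have [measurable]: "L A \<in> Bm M" using A by (rule L_measurable)
 have rd: "real_distribution (distr M borel (L A))" by (rule real_distribution_distr) measurable
 have ch: "char (distr M borel (L A)) \<theta> = exp (measure c A * exponent (\<i> * \<theta>))" for \<theta>
 proof -
  have "char (distr M borel (L A)) \<theta> = (CLINT ww|M. iexp (\<theta> * L A ww))"
   unfolding char_def by (subst integral_distr) auto
  then show ?thesis using char_L[OF A, of \<theta>] by (simp add: exponent_def mult.assoc)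
 qed
 note law = subordinator_law[OF rd measure_nonneg ch]
 show "AE ww in M. 0 \<le> L A ww" using law(1) by (subst (asm) AE_distr_iff) auto
 show "(CLINT ww|M. exp (\<zeta> * L A ww)) = exp (measure c A * exponent \<zeta>)" if "Re \<zeta> \<le> 0"
  using law(2)[OF that] by (subst (asm) integral_distr) auto
qed

text \<open>The functions \<open>g n\<close> are bounded on the half line and approach the identity
  from below, and the expectation of \<open>g n (L A)\<close> is explicit by the transform at a
  small negative argument. Fatou gives integrability, dominated convergence then gives the
  value.\<close>

lemma
 assumes A: "A \<in> fmeasurable c"
 shows L_integrable: "integrable M (L A)"
  and L_expectation: "(LINT ww|M. L A ww) = measure c A * mean"
proof -
 have [measurable]: "L A \<in> Bm M" using A by (rule L_measurable)
 define g where "g n x = real (Suc n) * (1 - exp (- (x / real (Suc n))))" for n and x :: real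
 have g_meas [measurable]: "g n \<in> Bm borel" for n unfolding g_def by measurable
 have g_lim: "(%n. g n x) \<longlonglongrightarrow> x" if "0 \<le> x" for x
  unfolding g_def by (rule scaled_one_minus_exp_tendsto) (use that in auto)
 have g_nonneg: "0 \<le> g n x" and g_le: "g n x \<le> x" if "0 \<le> x" for n x
 proof -
  show "0 \<le> g n x" using that unfolding g_def by (intro mult_nonneg_nonneg) auto
  have "real (Suc n) * (1 - exp (- (x / real (Suc n)))) \<le> real (Suc n) * (x / real (Suc n))"
   using exp_ge_add_one_self[of "- (x / real (Suc n))"] by (intro mult_left_mono) auto
  then show "g n x \<le> x" by (simp add: g_def)
 qed
 define a where "a n = (LINT w|\<nu>. 1 - exp (- (w / real (Suc n))))" for n
 have a: "real (Suc n) * a n = (LINT w|\<nu>. g n w)" for n unfolding a_def g_def by simp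
 have a_nonneg: "0 \<le> a n" for n unfolding a_def by (intro integral_nonneg_AE AE_I2) (simp add: space_\<nu>)
 have "(%n. LINT w|\<nu>. g n w) \<longlonglongrightarrow> (LINT w|\<nu>. w)"
  by (rule integral_dominated_convergence[where w="%w. w"])
    (use g_lim g_nonneg g_le in \<open>auto simp: integrable_id space_\<nu> intro!: AE_I2 measurable_\<nu>\<close>)
 then have "(%n. measure c A * (real (Suc n) * a n)) \<longlonglongrightarrow> measure c A * mean"
  unfolding a mean_def by (intro tendsto_intros)
 then have "(%n. real (Suc n) * (measure c A * a n)) \<longlonglongrightarrow> measure c A * mean"
  by (simp only: mult.left_commute)
 then have lim: "(%n. real (Suc n) * (1 - exp (- (measure c A * a n)))) \<longlonglongrightarrow> measure c A * mean"
  by (rule scaled_one_minus_exp_tendsto[rotated]) (use a_nonneg in simp)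
 have g_int: "integrable M (%ww. g n (L A ww))" for n
 proof (rule integrable_const_bound[where B="real (Suc n)"])
  show "AE ww in M. norm (g n (L A ww)) \<le> real (Suc n)"
   using L_nonneg[OF A]
  proof eventually_elim
   case (elim ww)
   have "g n (L A ww) \<le> real (Suc n) * 1" unfolding g_def by (intro mult_left_mono) auto
   then show ?case using g_nonneg[OF elim, of n] by simp
  qed
 qed measurable
 have E: "(LINT ww|M. g n (L A ww)) = real (Suc n) * (1 - exp (- (measure c A * a n)))" for n
 proof -
  let ?\<zeta> = "cor (- (1 / real (Suc n)))"
  have ex: "exp (?\<zeta> * cor x) = cor (exp (- (x / real (Suc n))))" for x
   by (simp add: exp_of_real[symmetric])
  have e: "exponent ?\<zeta> = cor (- a n)"
  proof -
   have "exponent ?\<zeta> = (CLINT w|\<nu>. cor (exp (- (w / real (Suc n))) - 1))"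
    unfolding exponent_def ex by simp
   also have "... = cor (LINT w|\<nu>. - (1 - exp (- (w / real (Suc n)))))"
    by (subst integral_complex_of_real) simp
   also have "(LINT w|\<nu>. - (1 - exp (- (w / real (Suc n))))) = - a n"
    unfolding a_def by (rule Bochner_Integration.integral_minus)
   finally show ?thesis .
  qed
  have "cor (LINT ww|M. exp (- (L A ww / real (Suc n)))) = (CLINT ww|M. exp (?\<zeta> * L A ww))"
   unfolding ex by (rule integral_complex_of_real[symmetric])
  also have "... = exp (measure c A * exponent ?\<zeta>)"
   by (rule L_transform[OF A]) simp
  also have "... = cor (exp (- (measure c A * a n)))"
   unfolding e by (simp add: exp_of_real[symmetric])
  finally have Eexp: "(LINT ww|M. exp (- (L A ww / real (Suc n)))) = exp (- (measure c A * a n))"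
   by (simp only: of_real_eq_iff)
  have int: "integrable M (%ww. exp (- (L A ww / real (Suc n))))"
   using L_nonneg[OF A] by (intro integrable_const_bound[where B=1]) (auto elim!: eventually_mono)
  have "(LINT ww|M. g n (L A ww)) = real (Suc n) * (LINT ww|M. 1 - exp (- (L A ww / real (Suc n))))"
   unfolding g_def by simp
  also have "(LINT ww|M. 1 - exp (- (L A ww / real (Suc n)))) = 1 - exp (- (measure c A * a n))"
   using Bochner_Integration.integral_diff[OF integrable_const[of 1] int] prob_space unfolding Eexp by simp
  finally show ?thesis .
 qed
 have "(nI M (%ww. en (L A ww))) = (nI M (%ww. liminf (%n. en (g n (L A ww)))))"
  using L_nonneg[OF A]
 proof (intro nn_integral_cong_AE, eventually_elim)
  case (elim ww)
  have "(%n. en (g n (L A ww))) \<longlonglongrightarrow> ennreal (L A ww)"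
   using g_lim[OF elim(2)] by (rule tendsto_ennrealI)
  then show ?case using lim_imp_Liminf[OF sequentially_bot] by metis
 qed
 also have "... \<le> liminf (%n. nI M (%ww. en (g n (L A ww))))"
  by (rule nn_integral_liminf) measurable
 also have "(%n. nI M (%ww. en (g n (L A ww)))) = (%n. en (real (Suc n) * (1 - exp (- (measure c A * a n)))))"
 proof
  fix n
  have "AE ww in M. 0 \<le> g n (L A ww)" using L_nonneg[OF A] by eventually_elim (rule g_nonneg)
  then show "(nI M (%ww. en (g n (L A ww)))) = en (real (Suc n) * (1 - exp (- (measure c A * a n))))"
   unfolding E[symmetric] by (intro nn_integral_eq_integral g_int)
 qed
 also have "liminf ... = en (measure c A * mean)"
  using lim by (intro lim_imp_Liminf tendsto_ennrealI sequentially_bot)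
 finally have le: "(nI M (%ww. en (L A ww))) \<le> ennreal (measure c A * mean)" .
 show int: "integrable M (L A)"
 proof (rule integrableI_bounded)
  have "(nI M (%ww. en (norm (L A ww)))) = (nI M (%ww. en (L A ww)))"
   using L_nonneg[OF A] by (intro nn_integral_cong_AE) (auto elim: eventually_mono)
  then show "(nI M (%ww. en (norm (L A ww)))) < \<infinity>"
   using le by (simp add: le_less_trans)
 qed measurable
 have "(%n. LINT ww|M. g n (L A ww)) \<longlonglongrightarrow> (LINT ww|M. L A ww)"
 proof (rule integral_dominated_convergence[OF _ _ int])
  show "AE ww in M. (%n. g n (L A ww)) \<longlonglongrightarrow> L A ww"
   using L_nonneg[OF A] by eventually_elim (rule g_lim)
  show "AE ww in M. norm (g n (L A ww)) \<le> L A ww" for n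
   using L_nonneg[OF A] by eventually_elim (use g_nonneg g_le in auto)
 qed measurable
 then show "(LINT ww|M. L A ww) = measure c A * mean"
  using lim unfolding E by (rule LIMSEQ_unique)
qed

text \<open>On a disjoint list the values of \<open>L\<close> are nonnegative, so dropping the
  negative coefficients can only enlarge the sum, and what remains has mean proportional to the
  integral of the positive part. As \<open>ennreal\<close> cuts at zero, the bound is one-sided: it
  compares positive part with positive part.\<close>

lemma nn_integral_set_sum_le:
 assumes l: "fm_list c l"
 shows "(nI M (%ww. en (set_sum L l ww))) \<le> ennreal mean * (nI c (%z. en (step_fun l z)))"
proof -
 obtain k where k: "disjoint_list k" "fm_list c k" "\<And>z. step_fun k z = step_fun l z"
  "AE ww in M. set_sum L k ww = set_sum L l ww"
  using ex_disjoint_list[OF l] by auto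
 define k' where "k' = map (%(b, B). (max 0 b, B)) k"
 have k': "fm_list c k'" using k(2) by (auto simp: fm_list_def k'_def)
 have nonneg: "AE ww in M. \<forall>x\<in>set k. 0 \<le> L (snd x) ww"
 proof (rule AE_finite_allI)
  show "finite (set k)" by simp
  fix x assume "x \<in> set k"
  then have "snd x \<in> fmeasurable c" using k(2) by (auto simp: fm_list_def)
  then show "AE ww in M. 0 \<le> L (snd x) ww" by (rule L_nonneg)
 qed
 have le: "set_sum L k ww \<le> set_sum L k' ww \<and> 0 \<le> set_sum L k' ww" if "\<forall>x\<in>set k. 0 \<le> L (snd x) ww" for ww
  using that unfolding k'_def
  by (induction k) (auto simp: intro!: add_mono mult_right_mono add_nonneg_nonneg)
 have E: "integrable M (set_sum L k') \<and> (LINT ww|M. set_sum L k' ww) = mean * (\<Sum>(b, B)\<leftarrow>k. measure c B *\<^sub>R max 0 b)"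
  using k(2) unfolding k'_def
 proof (induction k)
  case Nil
  have "set_sum L [] = (%_. 0)" by (simp add: fun_eq_iff)
  then show ?case by simp
 next
  case (Cons x k)
  obtain b B where x: "x = (b, B)" by (cases x)
  have B: "B \<in> fmeasurable c" "fm_list c k" using Cons(2) by (auto simp: x)
  let ?k = "map (%(b, B). (max 0 b, B)) k"
  have eq: "set_sum L (map (%(b, B). (max 0 b, B)) (x # k)) = (%ww. max 0 b * L B ww + set_sum L ?k ww)"
   by (simp add: x fun_eq_iff)
  show ?case unfolding eq using Cons(1)[OF B(2)] L_integrable[OF B(1)] L_expectation[OF B(1)]
   by (simp add: x algebra_simps)
 qed
 have "(nI M (%ww. en (set_sum L l ww))) \<le> (nI M (%ww. en (set_sum L k' ww)))"
 proof (rule nn_integral_mono_AE)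
  show "AE ww in M. en (set_sum L l ww) \<le> ennreal (set_sum L k' ww)"
   using k(4) nonneg
  proof eventually_elim
   case (elim ww)
   then show ?case using le[of ww] by (intro ennreal_leI) linarith
  qed
 qed
 also have "... = en (LINT ww|M. set_sum L k' ww)"
  using E nonneg le by (intro nn_integral_eq_integral) (auto elim!: eventually_mono)
 also have "... = en mean * en (\<Sum>(b, B)\<leftarrow>k. measure c B *\<^sub>R max 0 b)"
  using E mean_nonneg by (simp add: ennreal_mult' )
 also have "en (\<Sum>(b, B)\<leftarrow>k. measure c B *\<^sub>R max 0 b) = (nI c (%z. en (max 0 (step_fun k z))))"
 proof -
  have "has_bochner_integral c (%z. max 0 (step_fun k z)) (\<Sum>(b, B)\<leftarrow>k. measure c B *\<^sub>R max 0 b)"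
   by (rule has_bochner_integral_comp_step_fun[where \<psi>="max 0", OF k(1,2)]) simp
  then show ?thesis
   by (subst nn_integral_eq_integral) (auto simp: has_bochner_integral_iff)
 qed
 also have "... = (nI c (%z. en (step_fun l z)))"
  by (intro nn_integral_cong) (simp add: k(3) max_def ennreal_neg)
 finally show ?thesis .
qed

lemma nn_integral_abs_split:
 fixes f :: "'x => real"
 assumes [measurable]: "f \<in> Bm N"
 shows "(nI N (%x. en \<bar>f x\<bar>)) = (nI N (%x. en (f x))) + (nI N (%x. en (- f x)))"
proof -
 have "(nI N (%x. en \<bar>f x\<bar>)) = (nI N (%x. en (f x) + en (- f x)))"
  by (intro nn_integral_cong) (auto simp: abs_if ennreal_neg)
 also have "... = (nI N (%x. en (f x))) + (nI N (%x. en (- f x)))"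
  by (intro nn_integral_add) measurable
 finally show ?thesis .
qed

lemma nn_integral_abs_set_sum_le:
 assumes l: "fm_list c l"
 shows "(nI M (%ww. en \<bar>set_sum L l ww\<bar>)) \<le> ennreal mean * (nI c (%z. en \<bar>step_fun l z\<bar>))"
proof -
 have "(nI M (%ww. en (- set_sum L l ww))) \<le> ennreal mean * (nI c (%z. en (- step_fun l z)))"
  using nn_integral_set_sum_le[OF fm_list_scale[OF l, of "-1"]] by simp
 then show ?thesis
  unfolding nn_integral_abs_split[OF set_sum_measurable[OF l]] nn_integral_abs_split[OF step_fun_measurable[OF l]]
  using nn_integral_set_sum_le[OF l] by (simp add: distrib_left add_mono)
qed

lemma set_sum_diff_le:
 assumes "fm_list c l" "fm_list c k"
 shows "(nI M (%ww. en \<bar>set_sum L l ww - set_sum L k ww\<bar>)) \<le> ennreal mean * (nI c (%z. en \<bar>step_fun l z - step_fun k z\<bar>))"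
 using nn_integral_abs_set_sum_le[of "l @ scale_list (-1) k"] assms by simp

text \<open>The one-sided bound for the negated list shows that the negative part of the sum has
  mean zero.\<close>

lemma set_sum_nonneg:
 assumes l: "fm_list c l" and nonneg: "\<And>z. 0 \<le> step_fun l z"
 shows "AE ww in M. 0 \<le> set_sum L l ww"
proof -
 have [measurable]: "set_sum L l \<in> Bm M" using l by (rule set_sum_measurable)
 have "(nI M (%ww. en (- set_sum L l ww))) \<le> ennreal mean * (nI c (%z. en (- step_fun l z)))"
  using nn_integral_set_sum_le[OF fm_list_scale[OF l, of "-1"]] by simp
 also have "... = 0" using nonneg by (simp add: ennreal_neg)
 finally have "(nI M (%ww. en (- set_sum L l ww))) = 0" by simp
 then have "AE ww in M. en (- set_sum L l ww) = 0"
  by (subst (asm) nn_integral_0_iff_AE) auto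
 then show ?thesis by eventually_elim (simp add: ennreal_eq_0_iff)
qed

lemma ex_positive_part_list:
 assumes l: "fm_list c l"
 shows "\<exists>k. fm_list c k \<and> (\<forall>z. step_fun k z = max 0 (step_fun l z))"
proof -
 obtain k where k: "disjoint_list k" "fm_list c k" "\<And>z. step_fun k z = step_fun l z"
  using ex_disjoint_list[OF l] by auto
 have "step_fun (map (%(b, B). (max 0 b, B)) k) z = max 0 (step_fun k z)" for z
  using k(1)
 proof (induction k)
  case (Cons x k)
  obtain b B where x: "x = (b, B)" by (cases x)
  have IH: "step_fun (map (%(b, B). (max 0 b, B)) k) z = max 0 (step_fun k z)"
   using Cons by (simp add: disjoint_list_def)
  have "step_fun k z = 0" if "z \<in> B"
   using Cons(2) that by (intro step_fun_disjoint_eq_0) (fastforce simp: x disjoint_list_def)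
  then show ?case using IH by (auto simp: x split: split_indicator)
 qed simp
 moreover have "fm_list c (map (%(b, B). (max 0 b, B)) k)"
  using k(2) by (auto simp: fm_list_def)
 ultimately show ?thesis using k(3) by (intro exI[of _ "map (%(b, B). (max 0 b, B)) k"]) simp
qed

end

section \<open>Integrals as limits in mean and their transforms\<close>

lemma tendsto_0_le_ennreal:
 fixes f g :: "nat => ennreal"
 assumes "\<forall>\<^sub>F n in sequentially. f n \<le> g n" "g \<longlonglongrightarrow> 0"
 shows "f \<longlonglongrightarrow> 0"
 by (rule tendsto_sandwich[OF always_eventually assms(1) tendsto_const assms(2)]) simp

lemma ex_list_approx:
 fixes f :: "'z => real"
 assumes "integrable c f" "e > 0"
 shows "\<exists>l. fm_list c l \<and> (nI c (%z. en \<bar>f z - step_fun l z\<bar>)) < en e"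
 using assms
proof (induction arbitrary: e rule: integrable_induct)
 case (base A b)
 have "fm_list c [(b, A)]" using base by (simp add: fmeasurable_def)
 moreover have "(nI c (%z. en \<bar>indicator A z *\<^sub>R b - step_fun [(b, A)] z\<bar>)) < en e"
  using base by (simp add: mult.commute)
 ultimately show ?case by blast
next
 case (add f g)
 obtain l where l: "fm_list c l" "(nI c (%z. en \<bar>f z - step_fun l z\<bar>)) < en (e/2)"
  using add(3)[of "e/2"] add.prems by auto
 obtain k where k: "fm_list c k" "(nI c (%z. en \<bar>g z - step_fun k z\<bar>)) < en (e/2)"
  using add(4)[of "e/2"] add.prems by auto
 have [measurable]: "f \<in> Bm c" "g \<in> Bm c" using add by auto
 note [measurable] = step_fun_measurable[OF l(1)] step_fun_measurable[OF k(1)]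
 have "(nI c (%z. en \<bar>f z + g z - step_fun (l @ k) z\<bar>)) \<le>
   (nI c (%z. en \<bar>f z - step_fun l z\<bar> + en \<bar>g z - step_fun k z\<bar>))"
  by (intro nn_integral_mono) (simp flip: ennreal_plus)
 also have "... = (nI c (%z. en \<bar>f z - step_fun l z\<bar>)) + (nI c (%z. en \<bar>g z - step_fun k z\<bar>))"
  by (intro nn_integral_add) measurable
 also have "... < en (e/2) + en (e/2)" using l k by (intro add_strict_mono) auto
 also have "... = en e" using add.prems by (simp flip: ennreal_plus)
 finally show ?case using l k by (intro exI[of _ "l @ k"]) simp
next
 case (lim f s)
 have [measurable]: "f \<in> Bm c" "\<And>i. s i \<in> Bm c" using lim by auto
 have "(%i. nI c (%x. norm (f x - s i x))) \<longlonglongrightarrow> 0"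
 proof (rule nn_integral_dominated_convergence_norm[where w="%x. 2 * norm (f x)"])
  show "(nI c (%x. en (2 * norm (f x)))) < \<infinity>"
   using lim(4) by (simp add: ennreal_mult nn_integral_cmult integrable_iff_bounded ennreal_mult_less_top)
 qed (use lim in auto)
 then have "\<forall>\<^sub>F i in sequentially. (nI c (%x. norm (f x - s i x))) < en (e/2)"
  using lim.prems by (intro order_tendstoD(2)) auto
 then obtain i where i: "(nI c (%x. en \<bar>f x - s i x\<bar>)) < en (e/2)"
  by (auto simp: eventually_sequentially)
 obtain l where l: "fm_list c l" "(nI c (%z. en \<bar>s i z - step_fun l z\<bar>)) < en (e/2)"
  using lim(5)[of "e/2" i] lim.prems by auto
 note [measurable] = step_fun_measurable[OF l(1)]
 have "(nI c (%z. en \<bar>f z - step_fun l z\<bar>)) \<le>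
   (nI c (%z. en \<bar>f z - s i z\<bar>)) + (nI c (%z. en \<bar>s i z - step_fun l z\<bar>))"
  by (rule nn_integral_abs_triangle) measurable
 also have "... < en (e/2) + en (e/2)" using l i by (intro add_strict_mono) auto
 also have "... = en e" using lim.prems by (simp flip: ennreal_plus)
 finally show ?case using l by blast
qed

context jump_measure
begin

text \<open>By the finite mean the constant is uniform over the half line, so convergence of kernels
  in mean is enough for convergence of the exponents.\<close>

lemma exponent_Lipschitz:
 fixes \<zeta> :: complex and a b :: real
 assumes \<zeta>: "Re \<zeta> \<le> 0" and a: "0 \<le> a" and b: "0 \<le> b"
 shows "norm (exponent (\<zeta> * a) - exponent (\<zeta> * b)) \<le> norm \<zeta> * mean * \<bar>a - b\<bar>"
proof -
 have Re: "Re (\<zeta> * cor a) \<le> 0" "Re (\<zeta> * cor b) \<le> 0"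
  using assms by (auto simp: mult_nonpos_nonneg)
 note i = integrable_exponent[OF Re(1)] integrable_exponent[OF Re(2)]
 have "exponent (\<zeta> * a) - exponent (\<zeta> * b) =
   (CLINT w|\<nu>. (exp (\<zeta> * cor a * cor w) - 1) - (exp (\<zeta> * cor b * cor w) - 1))"
  unfolding exponent_def by (rule Bochner_Integration.integral_diff[OF i, symmetric])
 also have "norm ... \<le> (LINT w|\<nu>. norm \<zeta> * \<bar>a - b\<bar> * w)"
 proof (rule order_trans[OF integral_norm_bound], rule integral_mono)
  show "integrable \<nu> (%w. norm \<zeta> * \<bar>a - b\<bar> * w)" using integrable_id by simp
  show "integrable \<nu> (%w. norm ((exp (\<zeta> * cor a * cor w) - 1) - (exp (\<zeta> * cor b * cor w) - 1)))"
   by (intro integrable_norm Bochner_Integration.integrable_diff i)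
  fix w assume "w \<in> space \<nu>"
  then have w: "0 \<le> w" by (simp add: space_\<nu>)
  have "norm (exp (\<zeta> * cor (a * w)) - exp (\<zeta> * cor (b * w))) \<le> norm \<zeta> * \<bar>a * w - b * w\<bar>"
   using \<zeta> a b w by (intro norm_exp_scaled_diff_le) auto
  also have "\<bar>a * w - b * w\<bar> = \<bar>a - b\<bar> * w" using w by (simp add: abs_mult flip: left_diff_distrib)
  finally show "norm ((exp (\<zeta> * cor a * cor w) - 1) - (exp (\<zeta> * cor b * cor w) - 1)) \<le> norm \<zeta> * \<bar>a - b\<bar> * w"
   by (simp add: mult.assoc)
 qed
 finally show ?thesis by (simp add: mean_def mult_ac)
qed

lemma exponent_0 [simp]: "exponent 0 = 0"
 by (simp add: exponent_def)

lemma measurable_exponent_scaled [measurable]: "(%b::real. exponent (\<zeta> * b)) \<in> Bm borel"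
proof -
 interpret sigma_finite_measure \<nu> by (rule sigma_finite)
 show ?thesis unfolding exponent_def by (rule borel_measurable_lebesgue_integral) measurable
qed

lemma integrable_exponent_comp:
 fixes \<kappa> :: "'z => real" and \<zeta> :: complex
 assumes \<kappa>: "integrable c \<kappa>" and nonneg: "\<And>z. z \<in> space c ==> 0 \<le> \<kappa> z" and \<zeta>: "Re \<zeta> \<le> 0"
 shows "integrable c (%z. exponent (\<zeta> * \<kappa> z))"
proof (rule Bochner_Integration.integrable_bound)
 have [measurable]: "\<kappa> \<in> Bm c" using \<kappa> by auto
 show "integrable c (%z. norm \<zeta> * mean * \<kappa> z)" using \<kappa> by simp
 show "(%z. exponent (\<zeta> * \<kappa> z)) \<in> Bm c" by measurable
 show "AE z in c. norm (exponent (\<zeta> * \<kappa> z)) \<le> norm (norm \<zeta> * mean * \<kappa> z)"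
 proof (rule AE_I2)
  fix z assume "z \<in> space c"
  then show "norm (exponent (\<zeta> * \<kappa> z)) \<le> norm (norm \<zeta> * mean * \<kappa> z)"
   using exponent_Lipschitz[OF \<zeta> nonneg[of z] order_refl] mean_nonneg nonneg[of z] by (simp add: abs_mult)
 qed
qed

end

context subordinator_basis
begin

lemma transform_nonneg_list:
 fixes \<zeta> :: complex
 assumes l: "fm_list c l" and nonneg: "\<And>z. 0 \<le> step_fun l z" and \<zeta>: "Re \<zeta> \<le> 0"
 shows "(CLINT ww|M. exp (\<zeta> * set_sum L l ww)) = exp (CLINT z|c. exponent (\<zeta> * step_fun l z))"
proof -
 obtain k where k: "disjoint_list k" "fm_list c k" "\<And>z. step_fun k z = step_fun l z"
  "AE ww in M. set_sum L k ww = set_sum L l ww"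
  using ex_disjoint_list[OF l] by auto
 \<comment> \<open>A disjoint list of a nonnegative step function can still carry a negative value
   on an empty set. Such a value lies outside the range of the transform formula, but there
   \<open>L {}\<close> vanishes almost surely.\<close>
 have k_cases: "0 \<le> b \<or> B = {}" if "(b, B) \<in> set k" for b B
 proof (rule ccontr)
  assume "\<not> (0 \<le> b \<or> B = {})"
  then obtain z where z: "z \<in> B" and b: "b < 0" by auto
  have "step_fun k z = b" using k(1) that z
  proof (induction k)
   case (Cons x k)
   obtain b' B' where x: "x = (b', B')" by (cases x)
   show ?case
   proof (cases "x = (b, B)")
    case True
    have "step_fun k z = 0"
     using Cons(2) True z by (intro step_fun_disjoint_eq_0) (fastforce simp: disjoint_list_def)
    then show ?thesis using True z by simp
   next
    case False
    then have mem: "(b, B) \<in> set k" using Cons(3) by auto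
    then have "B' \<inter> B = {}" using Cons(2) by (fastforce simp: disjoint_list_def x)
    then have "z \<notin> B'" using z by blast
    moreover have "step_fun k z = b" using Cons mem z by (auto simp: disjoint_list_def)
    ultimately show ?thesis by (simp add: x)
   qed
  qed simp
  then show False using nonneg[of z] k(3)[of z] b by simp
 qed
 have "(CLINT ww|M. exp (\<zeta> * set_sum L k ww)) = exp (CLINT z|c. exponent (\<zeta> * step_fun k z))"
 proof (rule transform_disjoint_list(1)[where \<psi>="%b. exponent (\<zeta> * b)", OF k(1,2)])
  fix b B assume bB: "(b, B) \<in> set k"
  then have B: "B \<in> fmeasurable c" using k(2) by (auto simp: fm_list_def)
  have [measurable]: "L B \<in> Bm M" using B by (rule L_measurable)
  from k_cases[OF bB] show "integrable M (%ww. exp (\<zeta> * (b * L B ww))) \<and>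
    (CLINT ww|M. exp (\<zeta> * (b * L B ww))) = exp (measure c B *\<^sub>R exponent (\<zeta> * b))"
  proof
   assume b: "0 \<le> b"
   then have \<zeta>b: "Re (\<zeta> * cor b) \<le> 0" using \<zeta> by (simp add: mult_nonpos_nonneg)
   have "integrable M (%ww. exp (\<zeta> * cor b * cor (L B ww)))"
    using L_nonneg[OF B] \<zeta>b by (intro integrable_const_bound[where B=1]) (auto elim!: eventually_mono simp: mult_nonpos_nonneg)
   with L_transform[OF B \<zeta>b] show ?thesis
    by (simp add: mult.assoc scaleR_conv_of_real)
  next
   assume B0: "B = {}"
   have AE1: "AE ww in M. exp (\<zeta> * (b * L B ww)) = 1"
    using empty_set unfolding B0 by eventually_elim simp
   have "integrable M (%ww. exp (\<zeta> * (b * L B ww)))"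
    using AE1 by (subst integrable_cong_AE[where g="%_. 1"]) auto
   moreover have "(CLINT ww|M. exp (\<zeta> * (b * L B ww))) = (CLINT ww|M. 1)"
    using AE1 by (intro integral_cong_AE) auto
   ultimately show ?thesis using prob_space by (simp add: B0)
  qed
 qed simp
 moreover have "(CLINT ww|M. exp (\<zeta> * set_sum L k ww)) = (CLINT ww|M. exp (\<zeta> * set_sum L l ww))"
  using k(4) set_sum_measurable[OF k(2)] set_sum_measurable[OF l]
  by (intro integral_cong_AE) (auto elim!: eventually_mono)
 ultimately show ?thesis by (simp add: k(3))
qed

text \<open>An integral in the sense of convergence in mean. Both limits run along the same lists,
  so every estimate on lists passes to the pair of kernel and value.\<close>

definition L_integral :: "('z => real) => ('w => real) => bool" where
 "L_integral \<kappa> Y \<longleftrightarrow> Y \<in> Bm M \<and> integrable c \<kappa> \<and>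
   (\<exists>l. (\<forall>n. fm_list c (l n)) \<and> (%n. nI c (%z. en \<bar>\<kappa> z - step_fun (l n) z\<bar>)) \<longlonglongrightarrow> 0 \<and>
    (%n. nI M (%ww. en \<bar>Y ww - set_sum L (l n) ww\<bar>)) \<longlonglongrightarrow> 0)"

text \<open>The transform is known for nonnegative step functions only. Passing to positive parts
  brings the lists closer to a nonnegative kernel, and the change of the random sums is bounded by
  the change of the functions.\<close>

lemma L_integral_nonneg_lists:
 assumes Y: "L_integral \<kappa> Y" and nonneg: "\<And>z. z \<in> space c ==> 0 \<le> \<kappa> z"
 shows "\<exists>l. (\<forall>n. fm_list c (l n)) \<and> (\<forall>n z. 0 \<le> step_fun (l n) z) \<and>
  (%n. nI c (%z. en \<bar>\<kappa> z - step_fun (l n) z\<bar>)) \<longlonglongrightarrow> 0 \<and>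
  (%n. nI M (%ww. en \<bar>Y ww - set_sum L (l n) ww\<bar>)) \<longlonglongrightarrow> 0"
proof -
 have [measurable]: "Y \<in> Bm M" "\<kappa> \<in> Bm c"
  using Y by (auto simp: L_integral_def)
 obtain l where l: "\<And>n. fm_list c (l n)"
  and lim1: "(%n. nI c (%z. en \<bar>\<kappa> z - step_fun (l n) z\<bar>)) \<longlonglongrightarrow> 0"
  and lim2: "(%n. nI M (%ww. en \<bar>Y ww - set_sum L (l n) ww\<bar>)) \<longlonglongrightarrow> 0"
  using Y by (auto simp: L_integral_def)
 have "\<forall>n. \<exists>k. fm_list c k \<and> (\<forall>z. step_fun k z = max 0 (step_fun (l n) z))"
  using ex_positive_part_list[OF l] by blast
 then obtain k where k: "\<And>n. fm_list c (k n)" "\<And>n z. step_fun (k n) z = max 0 (step_fun (l n) z)"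
  by metis
 note [measurable] = set_sum_measurable[OF l] set_sum_measurable[OF k(1)]
 show ?thesis
 proof (intro exI[of _ k] conjI allI)
  show "fm_list c (k n)" for n by (rule k)
  show "0 \<le> step_fun (k n) z" for n z by (simp add: k)
  show "(%n. nI c (%z. en \<bar>\<kappa> z - step_fun (k n) z\<bar>)) \<longlonglongrightarrow> 0"
  proof (rule tendsto_sandwich[OF _ _ tendsto_const lim1])
   show "\<forall>\<^sub>F n in sequentially. (nI c (%z. en \<bar>\<kappa> z - step_fun (k n) z\<bar>)) \<le> (nI c (%z. en \<bar>\<kappa> z - step_fun (l n) z\<bar>))"
    using nonneg by (intro always_eventually allI nn_integral_mono ennreal_leI) (fastforce simp: k max_def)
  qed simp
  show "(%n. nI M (%ww. en \<bar>Y ww - set_sum L (k n) ww\<bar>)) \<longlonglongrightarrow> 0"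
  proof (rule tendsto_sandwich[OF _ _ tendsto_const])
   show "\<forall>\<^sub>F n in sequentially. (nI M (%ww. en \<bar>Y ww - set_sum L (k n) ww\<bar>)) \<le>
    (nI M (%ww. en \<bar>Y ww - set_sum L (l n) ww\<bar>)) + en mean * (nI c (%z. en \<bar>\<kappa> z - step_fun (l n) z\<bar>))"
   proof (intro always_eventually allI)
    fix n
    have "(nI M (%ww. en \<bar>Y ww - set_sum L (k n) ww\<bar>)) \<le>
     (nI M (%ww. en \<bar>Y ww - set_sum L (l n) ww\<bar>)) + (nI M (%ww. en \<bar>set_sum L (l n) ww - set_sum L (k n) ww\<bar>))"
     by (rule nn_integral_abs_triangle) measurable
    also have "(nI M (%ww. en \<bar>set_sum L (l n) ww - set_sum L (k n) ww\<bar>)) \<le>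
      en mean * (nI c (%z. en \<bar>step_fun (l n) z - step_fun (k n) z\<bar>))"
     by (rule set_sum_diff_le[OF l k(1)])
    also have "(nI c (%z. en \<bar>step_fun (l n) z - step_fun (k n) z\<bar>)) \<le> (nI c (%z. en \<bar>\<kappa> z - step_fun (l n) z\<bar>))"
     using nonneg by (intro nn_integral_mono ennreal_leI) (fastforce simp: k max_def)
    finally show "(nI M (%ww. en \<bar>Y ww - set_sum L (k n) ww\<bar>)) \<le>
     (nI M (%ww. en \<bar>Y ww - set_sum L (l n) ww\<bar>)) + en mean * (nI c (%z. en \<bar>\<kappa> z - step_fun (l n) z\<bar>))"
     by (simp add: add_left_mono mult_left_mono)
   qed
   have "(%n. (nI M (%ww. en \<bar>Y ww - set_sum L (l n) ww\<bar>)) + en mean * (nI c (%z. en \<bar>\<kappa> z - step_fun (l n) z\<bar>))) \<longlonglongrightarrow> 0 + en mean * 0"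
    by (intro tendsto_add lim2 ennreal_tendsto_cmult lim1) simp
   then show "(%n. (nI M (%ww. en \<bar>Y ww - set_sum L (l n) ww\<bar>)) + en mean * (nI c (%z. en \<bar>\<kappa> z - step_fun (l n) z\<bar>))) \<longlonglongrightarrow> 0"
    by simp
  qed simp
 qed
qed

lemma L_integral_nonneg:
 assumes Y: "L_integral \<kappa> Y" and nonneg: "\<And>z. z \<in> space c ==> 0 \<le> \<kappa> z"
 shows "AE ww in M. 0 \<le> Y ww"
proof -
 have [measurable]: "Y \<in> Bm M" using Y by (auto simp: L_integral_def)
 obtain l where l': "(\<forall>n. fm_list c (l n)) \<and> (\<forall>n z. 0 \<le> step_fun (l n) z) \<and>
  (%n. nI c (%z. en \<bar>\<kappa> z - step_fun (l n) z\<bar>)) \<longlonglongrightarrow> 0 \<and> (%n. nI M (%ww. en \<bar>Y ww - set_sum L (l n) ww\<bar>)) \<longlonglongrightarrow> 0"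
  using L_integral_nonneg_lists[OF Y nonneg] ..
 then have l: "\<And>n. fm_list c (l n)" "\<And>n z. 0 \<le> step_fun (l n) z"
  and lim1: "(%n. nI c (%z. en \<bar>\<kappa> z - step_fun (l n) z\<bar>)) \<longlonglongrightarrow> 0"
  and lim: "(%n. nI M (%ww. en \<bar>Y ww - set_sum L (l n) ww\<bar>)) \<longlonglongrightarrow> 0"
  by simp_all
 have "(nI M (%ww. en (- Y ww))) \<le> (nI M (%ww. en \<bar>Y ww - set_sum L (l n) ww\<bar>))" for n
  by (intro nn_integral_mono_AE eventually_mono[OF set_sum_nonneg[OF l(1,2), of n]] ennreal_leI) linarith
 then have "(nI M (%ww. en (- Y ww))) \<le> 0"
  by (intro LIMSEQ_le_const[OF lim]) auto
 then have "AE ww in M. en (- Y ww) = 0"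
  by (subst nn_integral_0_iff_AE[symmetric]) auto
 then show ?thesis by eventually_elim (simp add: ennreal_eq_0_iff)
qed

text \<open>Both sides are continuous in mean: the exponent by its Lipschitz bound, the expectation
  because \<open>exp (\<zeta> * y)\<close> is Lipschitz in nonnegative \<open>y\<close> with
  constant \<open>norm \<zeta>\<close>.\<close>

lemma L_integral_transform:
 fixes \<zeta> :: complex
 assumes Y: "L_integral \<kappa> Y" and nonneg: "\<And>z. z \<in> space c ==> 0 \<le> \<kappa> z" and \<zeta>: "Re \<zeta> \<le> 0"
 shows "(CLINT ww|M. exp (\<zeta> * Y ww)) = exp (CLINT z|c. exponent (\<zeta> * \<kappa> z))"
proof -
 have [measurable]: "Y \<in> Bm M" and \<kappa>_int: "integrable c \<kappa>"
  using Y by (auto simp: L_integral_def)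
 have Y_nonneg: "AE ww in M. 0 \<le> Y ww" using L_integral_nonneg[OF Y] nonneg by blast
 obtain l where l': "(\<forall>n. fm_list c (l n)) \<and> (\<forall>n z. 0 \<le> step_fun (l n) z) \<and>
  (%n. nI c (%z. en \<bar>\<kappa> z - step_fun (l n) z\<bar>)) \<longlonglongrightarrow> 0 \<and> (%n. nI M (%ww. en \<bar>Y ww - set_sum L (l n) ww\<bar>)) \<longlonglongrightarrow> 0"
  using L_integral_nonneg_lists[OF Y nonneg] ..
 then have l: "\<And>n. fm_list c (l n)" "\<And>n z. 0 \<le> step_fun (l n) z"
  and lim1: "(%n. nI c (%z. en \<bar>\<kappa> z - step_fun (l n) z\<bar>)) \<longlonglongrightarrow> 0"
  and lim2: "(%n. nI M (%ww. en \<bar>Y ww - set_sum L (l n) ww\<bar>)) \<longlonglongrightarrow> 0"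
  by simp_all
 note [measurable] = set_sum_measurable[OF l(1)]
 have "(%n. CLINT z|c. exponent (\<zeta> * step_fun (l n) z)) \<longlonglongrightarrow> (CLINT z|c. exponent (\<zeta> * \<kappa> z))"
 proof (rule tendsto_L1_int)
  show "integrable c (%z. exponent (\<zeta> * step_fun (l n) z))" for n
   using l by (intro integrable_exponent_comp \<zeta> integrable_step_fun)
  show "integrable c (%z. exponent (\<zeta> * \<kappa> z))" by (intro integrable_exponent_comp \<zeta> \<kappa>_int nonneg)
  have "\<forall>\<^sub>F n in sequentially. (nI c (%z. en (norm (exponent (\<zeta> * step_fun (l n) z) - exponent (\<zeta> * \<kappa> z))))) \<le>
    en (norm \<zeta> * mean) * (nI c (%z. en \<bar>\<kappa> z - step_fun (l n) z\<bar>))"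
  proof (intro always_eventually allI)
   fix n
   have [measurable]: "\<kappa> \<in> Bm c" "step_fun (l n) \<in> Bm c"
    using \<kappa>_int step_fun_measurable[OF l(1)] by auto
   have "(nI c (%z. en (norm (exponent (\<zeta> * step_fun (l n) z) - exponent (\<zeta> * \<kappa> z))))) \<le>
     (nI c (%z. en (norm \<zeta> * mean) * en \<bar>\<kappa> z - step_fun (l n) z\<bar>))"
   proof (rule nn_integral_mono)
    fix z assume "z \<in> space c"
    then show "en (norm (exponent (\<zeta> * step_fun (l n) z) - exponent (\<zeta> * \<kappa> z))) \<le>
      en (norm \<zeta> * mean) * en \<bar>\<kappa> z - step_fun (l n) z\<bar>"
     using exponent_Lipschitz[OF \<zeta> l(2)[of n z] nonneg[of z]] mean_nonneg
     by (simp add: abs_minus_commute ennreal_leI flip: ennreal_mult)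
   qed
   also have "... = en (norm \<zeta> * mean) * (nI c (%z. en \<bar>\<kappa> z - step_fun (l n) z\<bar>))"
    by (intro nn_integral_cmult) measurable
   finally show "(nI c (%z. en (norm (exponent (\<zeta> * step_fun (l n) z) - exponent (\<zeta> * \<kappa> z))))) \<le>
    en (norm \<zeta> * mean) * (nI c (%z. en \<bar>\<kappa> z - step_fun (l n) z\<bar>))" .
  qed
  moreover have "(%n. en (norm \<zeta> * mean) * (nI c (%z. en \<bar>\<kappa> z - step_fun (l n) z\<bar>))) \<longlonglongrightarrow> 0"
   using ennreal_tendsto_cmult[OF _ lim1, of "en (norm \<zeta> * mean)"] by simp
  ultimately show "(%n. nI c (%z. en (norm (exponent (\<zeta> * step_fun (l n) z) - exponent (\<zeta> * \<kappa> z))))) \<longlonglongrightarrow> 0"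
   by (rule tendsto_0_le_ennreal)
 qed
 then have conv1: "(%n. exp (CLINT z|c. exponent (\<zeta> * step_fun (l n) z))) \<longlonglongrightarrow> exp (CLINT z|c. exponent (\<zeta> * \<kappa> z))"
  by (intro tendsto_intros)
 have "(%n. CLINT ww|M. exp (\<zeta> * set_sum L (l n) ww)) \<longlonglongrightarrow> (CLINT ww|M. exp (\<zeta> * Y ww))"
 proof (rule tendsto_L1_int)
  show "integrable M (%ww. exp (\<zeta> * cor (set_sum L (l n) ww)))" for n
   using set_sum_nonneg[OF l(1,2), of n] \<zeta> by (intro integrable_const_bound[where B=1]) (auto elim!: eventually_mono simp: mult_nonpos_nonneg)
  show "integrable M (%ww. exp (\<zeta> * cor (Y ww)))"
   using Y_nonneg \<zeta> by (intro integrable_const_bound[where B=1]) (auto elim!: eventually_mono simp: mult_nonpos_nonneg)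
  have "\<forall>\<^sub>F n in sequentially. (nI M (%ww. en (norm (exp (\<zeta> * cor (set_sum L (l n) ww)) - exp (\<zeta> * cor (Y ww)))))) \<le>
    en (norm \<zeta>) * (nI M (%ww. en \<bar>Y ww - set_sum L (l n) ww\<bar>))"
  proof (intro always_eventually allI)
   fix n
   have "(nI M (%ww. en (norm (exp (\<zeta> * cor (set_sum L (l n) ww)) - exp (\<zeta> * cor (Y ww)))))) \<le>
     (nI M (%ww. en (norm \<zeta>) * en \<bar>Y ww - set_sum L (l n) ww\<bar>))"
   proof (rule nn_integral_mono_AE)
    show "AE ww in M. en (norm (exp (\<zeta> * cor (set_sum L (l n) ww)) - exp (\<zeta> * cor (Y ww)))) \<le>
      en (norm \<zeta>) * en \<bar>Y ww - set_sum L (l n) ww\<bar>"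
     using set_sum_nonneg[OF l(1,2), of n] Y_nonneg
    proof eventually_elim
     case (elim ww)
     then show ?case using norm_exp_scaled_diff_le[OF \<zeta>, of "set_sum L (l n) ww" "Y ww"]
      by (simp add: abs_minus_commute ennreal_leI flip: ennreal_mult)
    qed
   qed
   also have "... = en (norm \<zeta>) * (nI M (%ww. en \<bar>Y ww - set_sum L (l n) ww\<bar>))"
    by (intro nn_integral_cmult) measurable
   finally show "(nI M (%ww. en (norm (exp (\<zeta> * cor (set_sum L (l n) ww)) - exp (\<zeta> * cor (Y ww)))))) \<le>
    en (norm \<zeta>) * (nI M (%ww. en \<bar>Y ww - set_sum L (l n) ww\<bar>))" .
  qed
  moreover have "(%n. en (norm \<zeta>) * (nI M (%ww. en \<bar>Y ww - set_sum L (l n) ww\<bar>))) \<longlonglongrightarrow> 0"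
   using ennreal_tendsto_cmult[OF _ lim2, of "en (norm \<zeta>)"] by simp
  ultimately show "(%n. nI M (%ww. en (norm (exp (\<zeta> * cor (set_sum L (l n) ww)) - exp (\<zeta> * cor (Y ww)))))) \<longlonglongrightarrow> 0"
   by (rule tendsto_0_le_ennreal)
 qed
 then have "(%n. exp (CLINT z|c. exponent (\<zeta> * step_fun (l n) z))) \<longlonglongrightarrow> (CLINT ww|M. exp (\<zeta> * Y ww))"
  using l \<zeta> by (simp add: transform_nonneg_list)
 from LIMSEQ_unique[OF this conv1] show ?thesis .
qed

end

section \<open>The gliding hump and the Rajput-Rosinski integral\<close>

text \<open>An argument in the manner of Vitali, Hahn and Saks. Along a subsequence the mass of
  \<open>D (r i)\<close> sits, up to small errors, on rings that are disjoint for different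
  \<open>i\<close>, so a single set \<open>A'\<close> can imitate a different \<open>A (r i)\<close>
  on each ring.\<close>

lemma gliding_hump:
 fixes D :: "nat => 'z => real" and A :: "nat => 'z set"
 assumes "sigma_finite_measure c" and D: "\<And>j. integrable c (D j)"
  and lim: "AE z in c. (%j. D j z) \<longlonglongrightarrow> 0"
  and A [measurable]: "\<And>j. A j \<in> sets c" and "e > 0"
 shows "\<exists>r A'. strict_mono r \<and> A' \<in> sets c \<and>
   (\<forall>i::nat. (nI c (%z. en (\<bar>D (r i) z\<bar> * \<bar>indicator A' z - indicator (A (r i)) z\<bar>))) \<le> ennreal e)"
proof -
 interpret sigma_finite_measure c by fact
 have [measurable]: "D j \<in> Bm c" for j using D by auto
 obtain F :: "nat => _" where F: "range F \<subseteq> sets c" "(\<Union>i. F i) = space c" "\<And>i. emeasure c (F i) \<noteq> \<infinity>" "incseq F"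
  by (rule sigma_finite_incseq) blast
 have [measurable]: "F k \<in> sets c" for k using F by auto
 \<comment> \<open>The sets \<open>E k\<close> exhaust almost all of the space. On each of them all
   \<open>D j\<close> share a bound and the measure is finite, so dominated convergence
   applies.\<close>
 define E where "E k = {z\<in>space c. z \<in> F k \<and> (\<forall>j. \<bar>D j z\<bar> \<le> real k)}" for k :: nat
 have [measurable]: "E k \<in> sets c" for k unfolding E_def by measurable
 have E_mono: "E k \<subseteq> E k'" if "k \<le> k'" for k k'
 proof -
  have "F k \<subseteq> F k'" using F(4) that by (simp add: incseq_def)
  moreover have "real k \<le> real k'" using that by simp
  ultimately show ?thesis unfolding E_def using order_trans by blast
 qed
 have cover: "AE z in c. \<exists>k. z \<in> E k"
 proof (rule AE_mp[OF lim AE_I2], rule impI)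
  fix z assume z: "z \<in> space c" and "(%j. D j z) \<longlonglongrightarrow> 0"
  then have "Bseq (%j. D j z)" by (intro convergent_imp_Bseq) (auto simp: convergent_def)
  then obtain K where K: "\<And>j. norm (D j z) \<le> K" by (auto simp: Bseq_def)
  obtain k1 where k1: "K \<le> real k1" using real_arch_simple[of K] by auto
  obtain k2 where k2: "z \<in> F k2" using z F(2) by auto
  have "z \<in> F (max k1 k2)" using k2 F(4) by (meson incseq_def max.cobounded2 subsetD)
  moreover have "\<bar>D j z\<bar> \<le> real (max k1 k2)" for j using K[of j] k1 by simp
  ultimately show "\<exists>k. z \<in> E k" using z unfolding E_def by blast
 qed
 have small1: "\<exists>j>j0. (nI c (%z. en \<bar>D j z * indicator (E k) z\<bar>)) < en (e/2)" for j0 k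
 proof -
  have "(%j. nI c (%z. norm (0 - D j z * indicator (E k) z))) \<longlonglongrightarrow> 0"
  proof (rule nn_integral_dominated_convergence_norm[where w="%z. real k * indicator (F k) z"])
   show "(nI c (%z. en (real k * indicator (F k) z))) < \<infinity>"
    using F(3)[of k] by (simp add: ennreal_mult nn_integral_cmult ennreal_indicator ennreal_mult_less_top top.not_eq_extremum)
   show "AE z in c. norm (D j z * indicator (E k) z) \<le> real k * indicator (F k) z" for j
    by (intro AE_I2) (auto simp: E_def split: split_indicator)
   show "AE z in c. (%j. D j z * indicator (E k) z) \<longlonglongrightarrow> 0"
    using lim by eventually_elim (auto split: split_indicator)
  qed measurable
  then have "\<forall>\<^sub>F j in sequentially. (nI c (%z. norm (0 - D j z * indicator (E k) z))) < en (e/2)"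
   using \<open>e > 0\<close> by (intro order_tendstoD(2)) auto
  then obtain N where N: "\<And>j. j \<ge> N ==> (nI c (%z. norm (0 - D j z * indicator (E k) z))) < en (e/2)"
   by (auto simp: eventually_sequentially)
  show ?thesis using N[of "max N (Suc j0)"] by (intro exI[of _ "max N (Suc j0)"]) auto
 qed
 have small2: "\<exists>k\<ge>k0. (nI c (%z. en \<bar>D j z * indicator (space c - E k) z\<bar>)) < en (e/2)" for j k0
 proof -
  have "(%k. nI c (%z. norm (0 - D j z * indicator (space c - E k) z))) \<longlonglongrightarrow> 0"
  proof (rule nn_integral_dominated_convergence_norm[where w="%z. norm (D j z)"])
   show "(nI c (%z. en (norm (D j z)))) < \<infinity>" using D[of j] by (simp add: integrable_iff_bounded)
   show "AE z in c. norm (D j z * indicator (space c - E k) z) \<le> norm (D j z)" for k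
    by (intro AE_I2) (auto split: split_indicator)
   show "AE z in c. (%k. D j z * indicator (space c - E k) z) \<longlonglongrightarrow> 0"
    using cover
   proof eventually_elim
    case (elim z)
    then obtain k where k: "z \<in> E k" by auto
    have "\<forall>\<^sub>F k' in sequentially. D j z * indicator (space c - E k') z = 0"
     using eventually_ge_at_top[of k] by eventually_elim (use k E_mono in \<open>auto split: split_indicator\<close>)
    then show ?case by (rule tendsto_eventually)
   qed
  qed measurable
  then have "\<forall>\<^sub>F k in sequentially. (nI c (%z. norm (0 - D j z * indicator (space c - E k) z))) < en (e/2)"
   using \<open>e > 0\<close> by (intro order_tendstoD(2)) auto
  then obtain N where N: "\<And>k. k \<ge> N ==> (nI c (%z. norm (0 - D j z * indicator (space c - E k) z))) < en (e/2)"
   by (auto simp: eventually_sequentially)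
  show ?thesis using N[of "max N k0"] by (intro exI[of _ "max N k0"]) auto
 qed
 \<comment> \<open>A state is an index of \<open>D\<close> together with a level of
   \<open>E\<close>. The next index makes the hump negligible on the old level, and the next level
   is so large that the hump is negligible outside.\<close>
 define Q where "Q x y \<longleftrightarrow> fst x < fst y \<and> snd x \<le> snd y \<and>
   (nI c (%z. en \<bar>D (fst y) z * indicator (E (snd x)) z\<bar>)) < en (e/2) \<and>
   (nI c (%z. en \<bar>D (fst y) z * indicator (space c - E (snd y)) z\<bar>)) < en (e/2)" for x y :: "nat \<times> nat"
 have Q: "\<exists>y. Q x y" for x
 proof -
  obtain j where j: "j > fst x" "(nI c (%z. en \<bar>D j z * indicator (E (snd x)) z\<bar>)) < en (e/2)"
   using small1 by blast
  obtain k where k: "k \<ge> snd x" "(nI c (%z. en \<bar>D j z * indicator (space c - E k) z\<bar>)) < en (e/2)"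
   using small2 by blast
  have "Q x (j, k)" unfolding Q_def fst_conv snd_conv using j k by blast
  then show ?thesis ..
 qed
 have "\<exists>s. \<forall>i. True \<and> Q (s i) (s (Suc i))"
  by (rule dependent_nat_choice[where P="%_ _. True" and Q="%_. Q"]) (use Q in simp_all)
 then have "\<exists>s. \<forall>i. Q (s i) (s (Suc i))" by simp
 then obtain s where s1: "\<And>i. fst (s i) < fst (s (Suc i))" and s2: "\<And>i. snd (s i) \<le> snd (s (Suc i))"
  and s3: "\<And>i. (nI c (%z. en \<bar>D (fst (s (Suc i))) z * indicator (E (snd (s i))) z\<bar>)) < en (e/2)"
  and s4: "\<And>i. (nI c (%z. en \<bar>D (fst (s (Suc i))) z * indicator (space c - E (snd (s (Suc i)))) z\<bar>)) < en (e/2)"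
  unfolding Q_def by blast
 define r where "r i = fst (s (Suc i))" for i
 define H where "H i = E (snd (s i))" for i
 have H_mono: "H i \<subseteq> H j" if "i \<le> j" for i j
  using that unfolding H_def by (intro E_mono lift_Suc_mono_le[of "%i. snd (s i)", OF s2])
 have [measurable]: "H i \<in> sets c" for i unfolding H_def by measurable
 \<comment> \<open>\<open>A'\<close> follows \<open>A (r i)\<close> on the \<open>i\<close>-th ring;
   the rings are disjoint because the levels increase.\<close>
 define A' where "A' = (\<Union>i. A (r i) \<inter> (H (Suc i) - H i))"
 show ?thesis
 proof (intro exI[of _ r] exI[of _ A'] conjI allI)
  show "strict_mono r" unfolding strict_mono_Suc_iff r_def using s1 by blast
  show "A' \<in> sets c" unfolding A'_def by measurable
  fix i
  have same: "indicator A' z = (indicator (A (r i)) z :: real)" if "z \<in> H (Suc i)" "z \<notin> H i" for z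
  proof -
   have "j = i" if "z \<in> H (Suc j) - H j" for j
   proof (rule ccontr)
    assume "j \<noteq> i"
    then have "Suc j \<le> i \<or> Suc i \<le> j" by linarith
    then show False using that \<open>z \<in> H (Suc i)\<close> \<open>z \<notin> H i\<close> H_mono by blast
   qed
   then have "z \<in> A' \<longleftrightarrow> z \<in> A (r i)" unfolding A'_def using that by blast
   then show ?thesis by (simp add: indicator_def)
  qed
  have "(nI c (%z. en (\<bar>D (r i) z\<bar> * \<bar>indicator A' z - indicator (A (r i)) z\<bar>))) \<le>
   (nI c (%z. en \<bar>D (r i) z * indicator (H i) z\<bar> + en \<bar>D (r i) z * indicator (space c - H (Suc i)) z\<bar>))"
  proof (rule nn_integral_mono)
   fix z assume z: "z \<in> space c"
   show "en (\<bar>D (r i) z\<bar> * \<bar>indicator A' z - indicator (A (r i)) z\<bar>) \<le>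
    en \<bar>D (r i) z * indicator (H i) z\<bar> + en \<bar>D (r i) z * indicator (space c - H (Suc i)) z\<bar>"
   proof (cases "z \<in> H (Suc i) \<and> z \<notin> H i")
    case True
    then show ?thesis using same by simp
   next
    case False
    have "\<bar>indicator A' z - indicator (A (r i)) z\<bar> \<le> (1::real)" by (auto split: split_indicator)
    then have "\<bar>D (r i) z\<bar> * \<bar>indicator A' z - indicator (A (r i)) z\<bar> \<le> \<bar>D (r i) z\<bar> * 1"
     by (intro mult_left_mono) auto
    also have "... \<le> \<bar>D (r i) z * indicator (H i) z\<bar> + \<bar>D (r i) z * indicator (space c - H (Suc i)) z\<bar>"
     using False z by (auto split: split_indicator)
    finally show ?thesis by (simp add: ennreal_leI flip: ennreal_plus)
   qed
  qed
  also have "... = (nI c (%z. en \<bar>D (r i) z * indicator (H i) z\<bar>)) + (nI c (%z. en \<bar>D (r i) z * indicator (space c - H (Suc i)) z\<bar>))"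
   by (intro nn_integral_add) measurable
  also have "... \<le> ennreal (e/2) + en (e/2)"
   using s3[of i] s4[of i] unfolding r_def H_def by (intro add_mono less_imp_le)
  also have "... = en e" using \<open>e > 0\<close> by (simp flip: ennreal_plus)
  finally show "(nI c (%z. en (\<bar>D (r i) z\<bar> * \<bar>indicator A' z - indicator (A (r i)) z\<bar>))) \<le> ennreal e" .
 qed
qed

context subordinator_basis
begin

text \<open>The rate \<open>(1/2) ^ n\<close> makes the expected increments summable, so the sums
  converge almost surely, and Fatou bounds the mean distance to the limit.\<close>

lemma ex_L_integral:
 assumes \<kappa>: "integrable c \<kappa>"
 shows "\<exists>Y. L_integral \<kappa> Y"
proof -
 have [measurable]: "\<kappa> \<in> Bm c" using \<kappa> by auto
 have "\<forall>n. \<exists>l. fm_list c l \<and> (nI c (%z. en \<bar>\<kappa> z - step_fun l z\<bar>)) < en ((1/2) ^ n)"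
  using ex_list_approx[OF \<kappa>] by simp
 then obtain l where l: "\<And>n. fm_list c (l n)" "\<And>n. (nI c (%z. en \<bar>\<kappa> z - step_fun (l n) z\<bar>)) < en ((1/2) ^ n)"
  by metis
 note [measurable] = set_sum_measurable[OF l(1)] step_fun_measurable[OF l(1)]
 have diff: "(nI M (%ww. en \<bar>set_sum L (l n) ww - set_sum L (l m) ww\<bar>)) \<le> ennreal (mean * (2 * (1/2) ^ min n m))" for n m
 proof -
  have "(nI M (%ww. en \<bar>set_sum L (l n) ww - set_sum L (l m) ww\<bar>)) \<le> ennreal mean * (nI c (%z. en \<bar>step_fun (l n) z - step_fun (l m) z\<bar>))"
   by (rule set_sum_diff_le[OF l(1) l(1)])
  also have "... \<le> ennreal mean * en (2 * (1/2) ^ min n m)"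
  proof (rule mult_left_mono)
   have "(nI c (%z. en \<bar>step_fun (l n) z - step_fun (l m) z\<bar>)) \<le>
    (nI c (%z. en \<bar>step_fun (l n) z - \<kappa> z\<bar>)) + (nI c (%z. en \<bar>\<kappa> z - step_fun (l m) z\<bar>))"
    by (rule nn_integral_abs_triangle) measurable
   also have "... \<le> ennreal ((1/2) ^ n) + en ((1/2) ^ m)"
    using l(2)[of n] l(2)[of m] by (intro add_mono less_imp_le) (simp_all add: abs_minus_commute)
   also have "... = en ((1/2) ^ n + (1/2) ^ m)" by (simp flip: ennreal_plus)
   also have "... \<le> ennreal (2 * (1/2) ^ min n m)"
   proof (rule ennreal_leI)
    have "(1/2 :: real) ^ n \<le> (1/2) ^ min n m" "(1/2 :: real) ^ m \<le> (1/2) ^ min n m"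
     by (auto intro!: power_decreasing)
    then show "(1/2 :: real) ^ n + (1/2) ^ m \<le> 2 * (1/2) ^ min n m" by linarith
   qed
   finally show "(nI c (%z. en \<bar>step_fun (l n) z - step_fun (l m) z\<bar>)) \<le> ennreal (2 * (1/2) ^ min n m)" .
  qed simp
  also have "... = en (mean * (2 * (1/2) ^ min n m))" using mean_nonneg by (simp add: ennreal_mult)
  finally show ?thesis .
 qed
 have "(nI M (%ww. (\<Sum>n. en \<bar>set_sum L (l (Suc n)) ww - set_sum L (l n) ww\<bar>))) =
   (\<Sum>n. nI M (%ww. en \<bar>set_sum L (l (Suc n)) ww - set_sum L (l n) ww\<bar>))"
  by (rule nn_integral_suminf) measurable
 also have "... \<le> (\<Sum>n. en (mean * (2 * (1/2) ^ n)))"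
 proof (rule suminf_le)
  show "(nI M (%ww. en \<bar>set_sum L (l (Suc n)) ww - set_sum L (l n) ww\<bar>)) \<le> ennreal (mean * (2 * (1/2) ^ n))" for n
   using diff[of "Suc n" n] by (simp add: min_def)
 qed auto
 also have "... < \<infinity>"
 proof -
  have "summable (%n. mean * (2 * (1/2::real) ^ n))" by (intro summable_mult summable_geometric) simp
  then show ?thesis using mean_nonneg by (subst suminf_ennreal2) auto
 qed
 finally have "AE ww in M. (\<Sum>n. en \<bar>set_sum L (l (Suc n)) ww - set_sum L (l n) ww\<bar>) \<noteq> \<infinity>"
  by (intro nn_integral_PInf_AE) auto
 then have conv: "AE ww in M. convergent (%n. set_sum L (l n) ww)"
 proof eventually_elim
  case (elim ww)
  have "summable (%n. \<bar>set_sum L (l (Suc n)) ww - set_sum L (l n) ww\<bar>)"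
   using elim by (intro summable_suminf_not_top) auto
  then have "summable (%n. set_sum L (l (Suc n)) ww - set_sum L (l n) ww)" by (rule summable_rabs_cancel)
  then have "convergent (%n. \<Sum>i<n. set_sum L (l (Suc i)) ww - set_sum L (l i) ww)" by (simp add: summable_iff_convergent)
  moreover have "(\<Sum>i<n. set_sum L (l (Suc i)) ww - set_sum L (l i) ww) = set_sum L (l n) ww - set_sum L (l 0) ww" for n
   by (rule sum_lessThan_telescope)
  ultimately have "convergent (%n. set_sum L (l n) ww - set_sum L (l 0) ww)" by (simp only:)
  then show ?case by (simp add: convergent_diff_const_right_iff)
 qed
 define Y where "Y ww = lim (%n. set_sum L (l n) ww)" for ww
 have [measurable]: "Y \<in> Bm M" unfolding Y_def by measurable
 have le: "(nI M (%ww. en \<bar>Y ww - set_sum L (l n) ww\<bar>)) \<le> ennreal (mean * (2 * (1/2) ^ n))" for n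
 proof -
  have "(nI M (%ww. en \<bar>Y ww - set_sum L (l n) ww\<bar>)) = (nI M (%ww. liminf (%m. en \<bar>set_sum L (l m) ww - set_sum L (l n) ww\<bar>)))"
  proof (rule nn_integral_cong_AE)
   show "AE ww in M. en \<bar>Y ww - set_sum L (l n) ww\<bar> = liminf (%m. en \<bar>set_sum L (l m) ww - set_sum L (l n) ww\<bar>)"
    using conv
   proof eventually_elim
    case (elim ww)
    then have "(%m. set_sum L (l m) ww) \<longlonglongrightarrow> Y ww" unfolding Y_def by (simp add: convergent_LIMSEQ_iff)
    then have "(%m. en \<bar>set_sum L (l m) ww - set_sum L (l n) ww\<bar>) \<longlonglongrightarrow> ennreal \<bar>Y ww - set_sum L (l n) ww\<bar>"
     by (intro tendsto_intros)
    from lim_imp_Liminf[OF sequentially_bot this] show ?case by simp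
   qed
  qed
  also have "... \<le> liminf (%m. nI M (%ww. en \<bar>set_sum L (l m) ww - set_sum L (l n) ww\<bar>))"
   by (rule nn_integral_liminf) measurable
  also have "... \<le> liminf (%m. en (mean * (2 * (1/2) ^ n)))"
  proof (rule Liminf_mono)
   show "\<forall>\<^sub>F m in sequentially. (nI M (%ww. en \<bar>set_sum L (l m) ww - set_sum L (l n) ww\<bar>)) \<le> ennreal (mean * (2 * (1/2) ^ n))"
    using eventually_ge_at_top[of n]
   proof eventually_elim
    case (elim m)
    then show ?case using diff[of m n] by (simp add: min_def split: if_splits)
   qed
  qed
  finally show ?thesis by (simp add: Liminf_const)
 qed
 have lim0: "(%n. en (r * (1/2) ^ n)) \<longlonglongrightarrow> 0" for r :: real
 proof -
  have "(%n. r * (1/2) ^ n) \<longlonglongrightarrow> r * 0" by (intro tendsto_intros LIMSEQ_realpow_zero) auto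
  then have "(%n. en (r * (1/2) ^ n)) \<longlonglongrightarrow> ennreal (r * 0)" by (rule tendsto_ennrealI)
  then show ?thesis by simp
 qed
 have "(%n. nI c (%z. en \<bar>\<kappa> z - step_fun (l n) z\<bar>)) \<longlonglongrightarrow> 0"
  using l(2) by (intro tendsto_0_le_ennreal[OF always_eventually lim0[of 1]]) (simp add: less_imp_le)
 moreover have "(%n. nI M (%ww. en \<bar>Y ww - set_sum L (l n) ww\<bar>)) \<longlonglongrightarrow> 0"
  using le by (intro tendsto_0_le_ennreal[OF always_eventually lim0[of "mean * 2"]]) (simp add: mult.assoc)
 ultimately have "L_integral \<kappa> Y" unfolding L_integral_def using l(1) \<kappa> by auto
 then show ?thesis by (intro exI[of _ Y])
qed

end

context subordinator_basis
begin

text \<open>The distance to zero that describes convergence in probability; the minimum with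
  \<open>1\<close> makes it finite for every random variable.\<close>

definition rho :: "('w => real) => real" where
 "rho X = (LINT ww|M. min 1 \<bar>X ww\<bar>)"

lemma integrable_min_1: "X \<in> Bm M ==> integrable M (%ww. min 1 \<bar>X ww :: real\<bar>)"
 by (intro integrable_const_bound[where B=1]) auto

lemma rho_nonneg: "0 \<le> rho X"
 unfolding rho_def by (intro integral_nonneg_AE) auto

lemma rho_triangle:
 assumes [measurable]: "X \<in> Bm M" "Y \<in> Bm M" "Z \<in> Bm M"
  and le: "AE ww in M. \<bar>X ww\<bar> \<le> \<bar>Y ww\<bar> + \<bar>Z ww\<bar>"
 shows "rho X \<le> rho Y + rho Z"
proof -
 have "rho X \<le> (LINT ww|M. min 1 \<bar>Y ww\<bar> + min 1 \<bar>Z ww\<bar>)"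
  unfolding rho_def
 proof (rule integral_mono_AE)
  show "AE ww in M. min 1 \<bar>X ww\<bar> \<le> min 1 \<bar>Y ww\<bar> + min 1 \<bar>Z ww\<bar>"
   using le by eventually_elim (auto simp: min_def)
 qed (intro integrable_min_1 Bochner_Integration.integrable_add; measurable)+
 also have "... = rho Y + rho Z"
  unfolding rho_def by (intro Bochner_Integration.integral_add integrable_min_1) measurable
 finally show ?thesis .
qed

lemma rho_le:
 assumes [measurable]: "X \<in> Bm M" and le: "(nI M (%ww. en \<bar>X ww\<bar>)) \<le> ennreal b" and b: "0 \<le> b"
 shows "rho X \<le> b"
proof -
 have "en (rho X) = (nI M (%ww. en (min 1 \<bar>X ww\<bar>)))"
  unfolding rho_def by (intro nn_integral_eq_integral[symmetric] integrable_min_1) auto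
 also have "... \<le> (nI M (%ww. en \<bar>X ww\<bar>))" by (intro nn_integral_mono ennreal_leI) auto
 also note le
 finally show ?thesis using b by (simp add: ennreal_le_iff)
qed

lemma rho_set_sum_diff_le:
 assumes "fm_list c l" "fm_list c k" and le: "(nI c (%z. en \<bar>step_fun l z - step_fun k z\<bar>)) \<le> ennreal b" and b: "0 \<le> b"
 shows "rho (%ww. set_sum L l ww - set_sum L k ww) \<le> mean * b"
proof (rule rho_le)
 note [measurable] = set_sum_measurable[OF assms(1)] set_sum_measurable[OF assms(2)]
 show "(%ww. set_sum L l ww - set_sum L k ww) \<in> Bm M" by measurable
 have "(nI M (%ww. en \<bar>set_sum L l ww - set_sum L k ww\<bar>)) \<le> ennreal mean * (nI c (%z. en \<bar>step_fun l z - step_fun k z\<bar>))"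
  by (rule set_sum_diff_le[OF assms(1,2)])
 also have "... \<le> ennreal mean * en b" by (intro mult_left_mono le) simp
 also have "... = en (mean * b)" using mean_nonneg b by (simp add: ennreal_mult)
 finally show "(nI M (%ww. en \<bar>set_sum L l ww - set_sum L k ww\<bar>)) \<le> ennreal (mean * b)" .
 show "0 \<le> mean * b" using mean_nonneg b by simp
qed

lemma rho_tendsto_0:
 assumes "converges_in_probability M Y Z"
 shows "(%n. rho (%ww. Y n ww - Z ww)) \<longlonglongrightarrow> 0"
proof (rule LIMSEQ_I)
 fix r :: real assume "0 < r"
 have [measurable]: "\<And>n. Y n \<in> Bm M" "Z \<in> Bm M"
  using assms by (auto simp: converges_in_probability_def)
 have "(%n. measure M {ww\<in>space M. r/2 < \<bar>Y n ww - Z ww\<bar>}) \<longlonglongrightarrow> 0"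
  using assms half_gt_zero[OF \<open>0 < r\<close>] unfolding converges_in_probability_def by blast
 then have "\<forall>\<^sub>F n in sequentially. measure M {ww\<in>space M. r/2 < \<bar>Y n ww - Z ww\<bar>} < r/2"
  using \<open>0 < r\<close> by (intro order_tendstoD(2)) auto
 then obtain N where N: "\<And>n. n \<ge> N ==> measure M {ww\<in>space M. r/2 < \<bar>Y n ww - Z ww\<bar>} < r/2"
  by (auto simp: eventually_sequentially)
 have "rho (%ww. Y n ww - Z ww) < r" if n: "n \<ge> N" for n
 proof -
  let ?B = "{ww\<in>space M. r/2 < \<bar>Y n ww - Z ww\<bar>}"
  have "rho (%ww. Y n ww - Z ww) \<le> (LINT ww|M. r/2 + indicator ?B ww)"
   unfolding rho_def
  proof (rule integral_mono_AE)
   show "integrable M (%ww. r/2 + indicator ?B ww :: real)"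
    by (intro integrable_const_bound[where B="r/2 + 1"]) (use \<open>0 < r\<close> in \<open>auto split: split_indicator\<close>)
   show "AE ww in M. min 1 \<bar>Y n ww - Z ww\<bar> \<le> r/2 + indicator ?B ww"
    using \<open>0 < r\<close> by (intro AE_I2) (auto simp: min_def split: split_indicator)
  qed (intro integrable_min_1, measurable)
  also have "... = r/2 + measure M ?B"
  proof -
   have iB: "integrable M (indicator ?B :: _ => real)" by (intro integrable_const_bound[where B=1]) auto
   show ?thesis
    using Bochner_Integration.integral_add[OF integrable_const[of "r/2"] iB] by (simp add: prob_space)
  qed
  also have "... < r" using N[OF n] by simp
  finally show ?thesis .
 qed
 then show "\<exists>no. \<forall>n\<ge>no. norm (rho (%ww. Y n ww - Z ww) - 0) < r"
  using rho_nonneg by (intro exI[of _ N]) auto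
qed

lemma rm_simple_integral_list:
 assumes \<phi>: "Bochner_Integration.simple_bochner_integrable c \<phi>" and A: "A \<in> sets c"
 shows "\<exists>l. fm_list c l \<and> (\<forall>z\<in>space c. step_fun l z = \<phi> z * indicator A z) \<and>
  set_sum L l = rm_simple_integral c L \<phi> A"
proof -
 have sf: "simple_function c \<phi>" and fin: "emeasure c {y\<in>space c. \<phi> y \<noteq> 0} \<noteq> \<infinity>"
  using \<phi> by (auto elim: simple_bochner_integrable.cases)
 have fin_im: "finite (\<phi> ` space c - {0})" using sf by (simp add: simple_function_def)
 then obtain vs where vs: "set vs = \<phi> ` space c - {0}" "distinct vs"
  using finite_distinct_list by blast
 define l where "l = map (%v. (v, A \<inter> \<phi> -` {v} \<inter> space c)) vs"
 have "A \<inter> \<phi> -` {v} \<inter> space c \<in> fmeasurable c" if "v \<in> set vs" for v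
 proof (rule fmeasurableI)
  have "\<phi> -` {v} \<inter> space c \<in> sets c" using sf by (rule simple_functionD(2))
  then show meas: "A \<inter> \<phi> -` {v} \<inter> space c \<in> sets c" using A by (simp add: Int_assoc)
  have "emeasure c (A \<inter> \<phi> -` {v} \<inter> space c) \<le> emeasure c {y\<in>space c. \<phi> y \<noteq> 0}"
   using that sf by (intro emeasure_mono) (auto simp: vs intro: borel_measurable_simple_function)
  then show "emeasure c (A \<inter> \<phi> -` {v} \<inter> space c) < \<infinity>"
   using fin by (simp add: top.not_eq_extremum le_less_trans)
 qed
 then have "fm_list c l" by (auto simp: fm_list_def l_def)
 moreover have "step_fun l z = \<phi> z * indicator A z" if z: "z \<in> space c" for z
 proof -
  have "step_fun l z = (\<Sum>v\<in>set vs. v * indicator (A \<inter> \<phi> -` {v} \<inter> space c) z)"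
   using vs(2) by (simp add: step_fun_def l_def sum_list_distinct_conv_sum_set o_def)
  also have "... = (\<Sum>v\<in>set vs. if v = \<phi> z then \<phi> z * indicator A z else 0)"
   using z by (intro sum.cong) (auto split: split_indicator)
  also have "... = (if \<phi> z \<in> set vs then \<phi> z * indicator A z else 0)"
   by (rule sum.delta) (simp only: vs fin_im)
  also have "... = \<phi> z * indicator A z" using z by (auto simp: vs)
  finally show ?thesis .
 qed
 moreover have "set_sum L l = rm_simple_integral c L \<phi> A"
  using vs by (simp add: fun_eq_iff set_sum_def l_def rm_simple_integral_def sum_list_distinct_conv_sum_set o_def)
 ultimately show ?thesis by blast
qed

text \<open>The simple functions of the definition converge almost everywhere but perhaps not in
  mean. On sets of finite measure where they are uniformly bounded they do, and the question is the
  contribution from outside. If it did not vanish in probability, humps could be glued into one set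
  on which the integrals do not converge, against the requirement of convergence on every measurable
  set. This yields lists that converge in mean on growing sets and almost surely as random
  sums.\<close>

lemma rr_integral_lists:
 assumes rr: "has_rr_integral M c L f Y"
 shows "\<exists>k H. (\<forall>i::nat. fm_list c (k i)) \<and> (\<forall>i. H i \<in> sets c) \<and> (AE z in c. \<forall>\<^sub>F i in sequentially. z \<in> H i) \<and>
   (%i. nI c (%z. en \<bar>step_fun (k i) z - f z * indicator (H i) z\<bar>)) \<longlonglongrightarrow> 0 \<and>
   (AE ww in M. (%i. set_sum L (k i) ww) \<longlonglongrightarrow> Y ww)"
proof -
 interpret C: sigma_finite_measure c by (rule c_sigma_finite)
 obtain \<phi> where sb: "\<And>n. Bochner_Integration.simple_bochner_integrable c (\<phi> n)"
  and lim: "AE z in c. (%n. \<phi> n z) \<longlonglongrightarrow> f z"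
  and convA: "\<And>A. A \<in> sets c ==> \<exists>Z. converges_in_probability M (%n. rm_simple_integral c L (\<phi> n) A) Z"
  and convY: "converges_in_probability M (%n. rm_simple_integral c L (\<phi> n) (space c)) Y"
  and f [measurable]: "f \<in> Bm c"
  using rr unfolding has_rr_integral_def by blast
 have [measurable]: "Y \<in> Bm M" using convY by (simp add: converges_in_probability_def)
 have \<phi>_int: "integrable c (\<phi> n)" for n
  using has_bochner_integral_simple_bochner_integrable[OF sb[of n]] by (simp add: has_bochner_integral_iff)
 then have [measurable]: "\<phi> n \<in> Bm c" for n by auto
 define l where "l n A = (SOME l. fm_list c l \<and> (\<forall>z\<in>space c. step_fun l z = \<phi> n z * indicator A z) \<and>
  set_sum L l = rm_simple_integral c L (\<phi> n) A)" for n A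
 have l: "fm_list c (l n A)" "\<And>z. z \<in> space c ==> step_fun (l n A) z = \<phi> n z * indicator A z"
   "set_sum L (l n A) = rm_simple_integral c L (\<phi> n) A" if "A \<in> sets c" for n A
  using someI_ex[OF rm_simple_integral_list[OF sb[of n] that]] unfolding l_def by blast+
 define J where "J n A = set_sum L (l n A)" for n A
 have J_meas [measurable]: "J n A \<in> Bm M" if "A \<in> sets c" for n A
  unfolding J_def by (rule set_sum_measurable[OF l(1)[OF that]])
 have J_conv: "\<exists>Z. Z \<in> Bm M \<and> (%n. rho (%ww. J n A ww - Z ww)) \<longlonglongrightarrow> 0" if A: "A \<in> sets c" for A
 proof -
  obtain Z where Z: "converges_in_probability M (%n. J n A) Z"
   using convA[OF A] unfolding J_def l(3)[OF A] by blast
  then show ?thesis using rho_tendsto_0[OF Z] by (auto simp: converges_in_probability_def)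
 qed
 have J_Y: "(%n. rho (%ww. J n (space c) ww - Y ww)) \<longlonglongrightarrow> 0"
  using rho_tendsto_0[OF convY] unfolding J_def l(3)[OF sets.top] .
 obtain F :: "nat => _" where F: "range F \<subseteq> sets c" "(\<Union>i. F i) = space c" "\<And>i. emeasure c (F i) \<noteq> \<infinity>" "incseq F"
  by (rule C.sigma_finite_incseq) blast
 have [measurable]: "F k \<in> sets c" for k using F by auto
 define E where "E k = {z\<in>space c. z \<in> F k \<and> (\<forall>j. \<bar>\<phi> j z\<bar> \<le> real k)}" for k :: nat
 have E_meas [measurable]: "E k \<in> sets c" for k unfolding E_def by measurable
 have Ec_meas [measurable]: "space c - E k \<in> sets c" for k by measurable
 have E_mono: "E k \<subseteq> E k'" if "k \<le> k'" for k k'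
 proof -
  have "F k \<subseteq> F k'" using F(4) that by (simp add: incseq_def)
  moreover have "real k \<le> real k'" using that by simp
  ultimately show ?thesis unfolding E_def using order_trans by blast
 qed
 have cover: "AE z in c. \<exists>k. z \<in> E k"
 proof (rule AE_mp[OF lim AE_I2], rule impI)
  fix z assume z: "z \<in> space c" and "(%j. \<phi> j z) \<longlonglongrightarrow> f z"
  then have "Bseq (%j. \<phi> j z)" by (intro convergent_imp_Bseq) (auto simp: convergent_def)
  then obtain K where K: "\<And>j. norm (\<phi> j z) \<le> K" by (auto simp: Bseq_def)
  obtain k1 where k1: "K \<le> real k1" using real_arch_simple[of K] by auto
  obtain k2 where k2: "z \<in> F k2" using z F(2) by auto
  have "z \<in> F (max k1 k2)" using k2 F(4) by (meson incseq_def max.cobounded2 subsetD)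
  moreover have "\<bar>\<phi> j z\<bar> \<le> real (max k1 k2)" for j using K[of j] k1 by simp
  ultimately show "\<exists>k. z \<in> E k" using z unfolding E_def by blast
 qed
 have tail: "\<exists>K\<ge>K'. (nI c (%z. en \<bar>\<phi> j z * indicator (space c - E K) z\<bar>)) < en b" if "b > 0" for j K' b
 proof -
  have "(%k. nI c (%z. norm (0 - \<phi> j z * indicator (space c - E k) z))) \<longlonglongrightarrow> 0"
  proof (rule nn_integral_dominated_convergence_norm[where w="%z. norm (\<phi> j z)"])
   show "(nI c (%z. en (norm (\<phi> j z)))) < \<infinity>" using \<phi>_int[of j] by (simp add: integrable_iff_bounded)
   show "AE z in c. norm (\<phi> j z * indicator (space c - E k) z) \<le> norm (\<phi> j z)" for k
    by (intro AE_I2) (auto split: split_indicator)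
   show "AE z in c. (%k. \<phi> j z * indicator (space c - E k) z) \<longlonglongrightarrow> 0"
    using cover
   proof eventually_elim
    case (elim z)
    then obtain k where k: "z \<in> E k" by auto
    have "\<forall>\<^sub>F k' in sequentially. \<phi> j z * indicator (space c - E k') z = 0"
     using eventually_ge_at_top[of k] by eventually_elim (use k E_mono in \<open>auto split: split_indicator\<close>)
    then show ?case by (rule tendsto_eventually)
   qed
  qed measurable
  then have "\<forall>\<^sub>F k in sequentially. (nI c (%z. norm (0 - \<phi> j z * indicator (space c - E k) z))) < en b"
   using that by (intro order_tendstoD(2)) auto
  then obtain N where N: "\<And>k. k \<ge> N ==> (nI c (%z. norm (0 - \<phi> j z * indicator (space c - E k) z))) < en b"
   by (auto simp: eventually_sequentially)
  show ?thesis using N[of "max N K'"] by (intro exI[of _ "max N K'"]) auto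
 qed
 have step1: "\<exists>K\<ge>K'. \<exists>n0. \<forall>n\<ge>n0. rho (J n (space c - E K)) < e" if "e > 0" for e K'
 proof (rule ccontr)
  assume "\<not> (\<exists>K\<ge>K'. \<exists>n0. \<forall>n\<ge>n0. rho (J n (space c - E K)) < e)"
  then have neg: "\<And>K n0. K \<ge> K' ==> \<exists>n\<ge>n0. e \<le> rho (J n (space c - E K))" by (meson not_less)
  \<comment> \<open>An error of \<open>b\<close> in the mean of the functions costs at most
    \<open>mean * b\<close> in \<open>rho\<close>, and this is at most \<open>e / 4\<close>.\<close>
  define b where "b = e / (4 * (mean + 1))"
  have b: "b > 0" using \<open>e > 0\<close> mean_nonneg by (simp add: b_def)
  have mb: "mean * b \<le> e / 4"
  proof -
   have "mean * b \<le> (mean + 1) * b" using b by (intro mult_right_mono) auto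
   also have "... = e / 4" using mean_nonneg by (simp add: b_def field_simps)
   finally show ?thesis .
  qed
  \<comment> \<open>If the claim fails, one can choose for every \<open>j\<close> a level making the
    tail of \<open>\<phi> j\<close> negligible in mean, and then an index \<open>n j\<close> whose
    tail is not negligible in probability.\<close>
  have "\<forall>j. \<exists>K n. K \<ge> K' \<and> (nI c (%z. en \<bar>\<phi> j z * indicator (space c - E K) z\<bar>)) < en b \<and>
    n \<ge> j \<and> e \<le> rho (J n (space c - E K))"
   using tail[OF b] neg by meson
  then obtain K n where K: "\<And>j. (nI c (%z. en \<bar>\<phi> j z * indicator (space c - E (K j)) z\<bar>)) < en b"
   and n: "\<And>j. n j \<ge> j" and ge: "\<And>j. e \<le> rho (J (n j) (space c - E (K j)))"
   by metis
  define A where "A j = space c - E (K j)" for j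
  have A_meas [measurable]: "A j \<in> sets c" for j unfolding A_def by measurable
  have ntop: "filterlim n at_top sequentially"
   using n by (intro filterlim_at_top_mono[OF filterlim_ident]) auto
  \<comment> \<open>The gliding hump requires convergence to zero almost everywhere, which holds for
    this difference. What \<open>\<phi> j\<close> contributes on \<open>A j\<close> is small by the
    choice of the level.\<close>
  define D where "D j z = \<phi> (n j) z - \<phi> j z" for j z
  have D_int: "integrable c (D j)" for j unfolding D_def by (intro Bochner_Integration.integrable_diff \<phi>_int)
  have D_lim: "AE z in c. (%j. D j z) \<longlonglongrightarrow> 0"
   using lim
  proof eventually_elim
   case (elim z)
   have "(%j. \<phi> (n j) z - \<phi> j z) \<longlonglongrightarrow> f z - f z"
    by (intro tendsto_diff elim filterlim_compose[OF elim ntop])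
   then show ?case by (simp add: D_def)
  qed
  obtain r A' where r: "strict_mono r" and A': "A' \<in> sets c"
   and hump': "\<forall>i::nat. (nI c (%z. en (\<bar>D (r i) z\<bar> * \<bar>indicator A' z - indicator (A (r i)) z\<bar>))) \<le> ennreal b"
   using gliding_hump[where D=D and A=A, OF c_sigma_finite D_int D_lim A_meas b]
   by (elim exE conjE) (rule that; assumption)
  note hump = hump'[rule_format]
  obtain Z where Z [measurable]: "Z \<in> Bm M" and J_Z: "(%n. rho (%ww. J n A' ww - Z ww)) \<longlonglongrightarrow> 0"
   using J_conv[OF A'] by blast
  note [measurable] = J_meas[OF A'] J_meas[OF A_meas]
  \<comment> \<open>Of the size \<open>e\<close>, one quarter is lost to \<open>\<phi> j\<close> on
    \<open>A j\<close> and one to exchanging \<open>A j\<close> for \<open>A'\<close>. The other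
    half must show in the distances of the integrals over \<open>A'\<close> to their limit
    \<open>Z\<close>.\<close>
  have low: "e / 2 \<le> rho (%ww. J (n (r i)) A' ww - Z ww) + rho (%ww. J (r i) A' ww - Z ww)" for i
  proof -
   let ?j = "r i"
   let ?l1 = "l (n ?j) (A ?j) @ scale_list (-1) (l ?j (A ?j))"
   let ?l2 = "l (n ?j) A' @ scale_list (-1) (l ?j A')"
   have fm: "fm_list c ?l1" "fm_list c ?l2" using l(1)[OF A_meas] l(1)[OF A'] by auto
   have S: "step_fun ?l1 z - step_fun ?l2 z = D ?j z * (indicator (A ?j) z - indicator A' z)" if "z \<in> space c" for z
    using that by (simp add: l(2)[OF A_meas] l(2)[OF A'] D_def algebra_simps)
   have "(nI c (%z. en \<bar>step_fun ?l1 z - step_fun ?l2 z\<bar>)) \<le> ennreal b"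
   proof -
    have "(nI c (%z. en \<bar>step_fun ?l1 z - step_fun ?l2 z\<bar>)) = (nI c (%z. en (\<bar>D (r i) z\<bar> * \<bar>indicator A' z - indicator (A (r i)) z\<bar>)))"
     by (rule nn_integral_cong) (simp only: S abs_mult abs_minus_commute)
    then show ?thesis using hump[of i] by simp
   qed
   then have d1: "rho (%ww. set_sum L ?l1 ww - set_sum L ?l2 ww) \<le> e / 4"
    using rho_set_sum_diff_le[OF fm, of b] b mb by simp
   have d2: "rho (J ?j (A ?j)) \<le> e / 4"
   proof -
    have "(nI c (%z. en \<bar>step_fun (l ?j (A ?j)) z - step_fun [] z\<bar>)) = (nI c (%z. en \<bar>\<phi> ?j z * indicator (space c - E (K ?j)) z\<bar>))"
     by (rule nn_integral_cong) (simp add: l(2)[OF A_meas] A_def[symmetric])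
    also have "... \<le> ennreal b" using K[of ?j] by simp
    finally have "rho (%ww. set_sum L (l ?j (A ?j)) ww - set_sum L [] ww) \<le> mean * b"
     using b by (intro rho_set_sum_diff_le l(1)[OF A_meas]) auto
    then show ?thesis using mb by (simp add: J_def)
   qed
   have "e \<le> rho (J (n ?j) (A ?j))" using ge[of ?j] by (simp add: A_def)
   also have "... \<le> rho (%ww. J (n ?j) (A ?j) ww - J ?j (A ?j) ww) + rho (J ?j (A ?j))"
    by (rule rho_triangle) auto
   also have "rho (%ww. J (n ?j) (A ?j) ww - J ?j (A ?j) ww) \<le>
     rho (%ww. set_sum L ?l1 ww - set_sum L ?l2 ww) + rho (%ww. J (n ?j) A' ww - J ?j A' ww)"
    by (rule rho_triangle) (auto simp: J_def[symmetric])
   also have "rho (%ww. J (n ?j) A' ww - J ?j A' ww) \<le> rho (%ww. J (n ?j) A' ww - Z ww) + rho (%ww. J ?j A' ww - Z ww)"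
    by (rule rho_triangle) auto
   finally show ?thesis using d1 d2 by linarith
  qed
  have rtop: "filterlim r at_top sequentially" by (rule filterlim_subseq[OF r])
  have "(%i. rho (%ww. J (n (r i)) A' ww - Z ww) + rho (%ww. J (r i) A' ww - Z ww)) \<longlonglongrightarrow> 0 + 0"
   by (intro tendsto_add filterlim_compose[OF J_Z] filterlim_compose[OF ntop] rtop)
  then have "e / 2 \<le> 0 + 0" by (rule LIMSEQ_le_const) (use low in auto)
  then show False using \<open>e > 0\<close> by simp
 qed
 have E_lim: "(%n. nI c (%z. en \<bar>f z * indicator (E K) z - \<phi> n z * indicator (E K) z\<bar>)) \<longlonglongrightarrow> 0" for K
 proof -
  have "(%n. nI c (%z. norm (f z * indicator (E K) z - \<phi> n z * indicator (E K) z))) \<longlonglongrightarrow> 0"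
  proof (rule nn_integral_dominated_convergence_norm[where w="%z. real K * indicator (F K) z"])
   show "(nI c (%z. en (real K * indicator (F K) z))) < \<infinity>"
    using F(3)[of K] by (simp add: ennreal_mult nn_integral_cmult ennreal_indicator ennreal_mult_less_top top.not_eq_extremum)
   show "AE z in c. norm (\<phi> j z * indicator (E K) z) \<le> real K * indicator (F K) z" for j
    by (intro AE_I2) (auto simp: E_def split: split_indicator)
   show "AE z in c. (%j. \<phi> j z * indicator (E K) z) \<longlonglongrightarrow> f z * indicator (E K) z"
    using lim by eventually_elim (intro tendsto_intros)
  qed measurable
  then show ?thesis by simp
 qed
 \<comment> \<open>For each \<open>i\<close> a level with negligible tail is chosen first, then an
   index late enough for that level.\<close>
 define Q where "Q i K n \<longleftrightarrow> K \<ge> i \<and> rho (%ww. J n (E K) ww - Y ww) < 2 / real (Suc i) \<and>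
   (nI c (%z. en \<bar>f z * indicator (E K) z - \<phi> n z * indicator (E K) z\<bar>)) < en (1 / real (Suc i))" for i K n
 have pick: "\<exists>K n. Q i K n" for i
 proof -
  have pos: "0 < 1 / real (Suc i)" by simp
  obtain K n0 where K: "K \<ge> i" "\<And>n. n \<ge> n0 ==> rho (J n (space c - E K)) < 1 / real (Suc i)"
   using step1[OF pos, of i] by blast
  have "\<forall>\<^sub>F n in sequentially. rho (%ww. J n (space c) ww - Y ww) < 1 / real (Suc i)"
   by (rule order_tendstoD(2)[OF J_Y pos])
  moreover have "\<forall>\<^sub>F n in sequentially. (nI c (%z. en \<bar>f z * indicator (E K) z - \<phi> n z * indicator (E K) z\<bar>)) < en (1 / real (Suc i))"
   by (rule order_tendstoD(2)[OF E_lim]) (simp del: of_nat_Suc)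
  ultimately have "\<forall>\<^sub>F n in sequentially. rho (%ww. J n (space c) ww - Y ww) < 1 / real (Suc i) \<and>
    (nI c (%z. en \<bar>f z * indicator (E K) z - \<phi> n z * indicator (E K) z\<bar>)) < en (1 / real (Suc i)) \<and> n \<ge> n0"
   using eventually_ge_at_top[of n0] by eventually_elim blast
  then obtain n where n: "rho (%ww. J n (space c) ww - Y ww) < 1 / real (Suc i)"
    "(nI c (%z. en \<bar>f z * indicator (E K) z - \<phi> n z * indicator (E K) z\<bar>)) < en (1 / real (Suc i))" "n \<ge> n0"
   using eventually_happens'[OF sequentially_bot] by blast
  note [measurable] = J_meas[OF E_meas] J_meas[OF Ec_meas] J_meas[OF sets.top]
  let ?l1 = "l n (E K)" and ?l2 = "l n (space c) @ scale_list (-1) (l n (space c - E K))"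
  have fm: "fm_list c ?l1" "fm_list c ?l2" using l(1)[OF E_meas] l(1)[OF Ec_meas] l(1)[OF sets.top] by auto
  have "step_fun ?l1 z - step_fun ?l2 z = 0" if "z \<in> space c" for z
   using that by (simp add: l(2)[OF E_meas] l(2)[OF Ec_meas] l(2)[OF sets.top] split: split_indicator)
  then have "(nI c (%z. en \<bar>step_fun ?l1 z - step_fun ?l2 z\<bar>)) = (nI c (%z. 0))"
   by (intro nn_integral_cong) (simp del: step_fun_simps)
  then have z: "rho (%ww. set_sum L ?l1 ww - set_sum L ?l2 ww) \<le> 0"
   using rho_set_sum_diff_le[OF fm, of 0] by simp
  have "rho (%ww. J n (E K) ww - Y ww) \<le> rho (%ww. set_sum L ?l1 ww - set_sum L ?l2 ww) +
    rho (%ww. J n (space c) ww - Y ww - J n (space c - E K) ww)"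
   by (rule rho_triangle) (auto simp: J_def[symmetric])
  also have "rho (%ww. J n (space c) ww - Y ww - J n (space c - E K) ww) \<le>
    rho (%ww. J n (space c) ww - Y ww) + rho (J n (space c - E K))"
   by (rule rho_triangle) auto
  finally have "rho (%ww. J n (E K) ww - Y ww) < 1 / real (Suc i) + 1 / real (Suc i)"
   using z n(1) K(2)[OF n(3)] by linarith
  then have "rho (%ww. J n (E K) ww - Y ww) < 2 / real (Suc i)" by (simp del: of_nat_Suc)
  then have "Q i K n" unfolding Q_def using K(1) n(2) by blast
  then show ?thesis by blast
 qed
 then obtain K n where Q: "\<And>i. Q i (K i) (n i)" by metis
 then have K: "\<And>i. K i \<ge> i" and nrho: "\<And>i. rho (%ww. J (n i) (E (K i)) ww - Y ww) < 2 / real (Suc i)"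
  and nE: "\<And>i. (nI c (%z. en \<bar>f z * indicator (E (K i)) z - \<phi> (n i) z * indicator (E (K i)) z\<bar>)) < en (1 / real (Suc i))"
  unfolding Q_def by blast+
 note [measurable] = J_meas[OF E_meas]
 have two: "(%i. 2 / real (Suc i)) \<longlonglongrightarrow> 0"
  using tendsto_mult_right_zero[OF LIMSEQ_Suc[OF lim_1_over_n], of 2] by simp
 have rho_lim: "(%i. LINT ww|M. norm (min 1 \<bar>J (n i) (E (K i)) ww - Y ww\<bar>)) \<longlonglongrightarrow> 0"
 proof (rule tendsto_sandwich[OF _ _ tendsto_const two])
  have eq: "(LINT ww|M. norm (min 1 \<bar>J (n i) (E (K i)) ww - Y ww\<bar>)) = rho (%ww. J (n i) (E (K i)) ww - Y ww)" for i
   unfolding rho_def by (intro Bochner_Integration.integral_cong) auto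
  show "\<forall>\<^sub>F i in sequentially. 0 \<le> (LINT ww|M. norm (min 1 \<bar>J (n i) (E (K i)) ww - Y ww\<bar>))"
   unfolding eq by (simp add: rho_nonneg)
  show "\<forall>\<^sub>F i in sequentially. (LINT ww|M. norm (min 1 \<bar>J (n i) (E (K i)) ww - Y ww\<bar>)) \<le> 2 / real (Suc i)"
   unfolding eq by (intro always_eventually allI less_imp_le nrho)
 qed
 \<comment> \<open>Convergence in \<open>rho\<close> gives almost sure convergence along a
   subsequence only; the levels are thinned out with it.\<close>
 have "\<exists>r::nat=>nat. strict_mono r \<and> (AE ww in M. (%i. min 1 \<bar>J (n (r i)) (E (K (r i))) ww - Y ww\<bar>) \<longlonglongrightarrow> 0)"
  by (rule tendsto_L1_AE_subseq[OF _ rho_lim]) (intro integrable_min_1, measurable)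
 then obtain r where r: "strict_mono r" and r_lim: "AE ww in M. (%i. min 1 \<bar>J (n (r i)) (E (K (r i))) ww - Y ww\<bar>) \<longlonglongrightarrow> 0"
  by blast
 have rtop: "filterlim r at_top sequentially" by (rule filterlim_subseq[OF r])
 show ?thesis
 proof (intro exI[of _ "%i. l (n (r i)) (E (K (r i)))"] exI[of _ "%i. E (K (r i))"] conjI allI)
  show "fm_list c (l (n (r i)) (E (K (r i))))" for i by (rule l(1)[OF E_meas])
  show "E (K (r i)) \<in> sets c" for i by (rule E_meas)
  show "AE z in c. \<forall>\<^sub>F i in sequentially. z \<in> E (K (r i))"
   using cover
  proof eventually_elim
   case (elim z)
   then obtain k where k: "z \<in> E k" by auto
   have "k \<le> K (r i)" if "k \<le> i" for i
    using that K[of "r i"] seq_suble[OF r, of i] by linarith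
   then have "z \<in> E (K (r i))" if "k \<le> i" for i using k E_mono that by blast
   then show ?case by (rule eventually_mono[OF eventually_ge_at_top[of k]])
  qed
  show "(%i. nI c (%z. en \<bar>step_fun (l (n (r i)) (E (K (r i)))) z - f z * indicator (E (K (r i))) z\<bar>)) \<longlonglongrightarrow> 0"
  proof (rule tendsto_0_le_ennreal)
   have "(%i. en (1 / real (Suc i))) \<longlonglongrightarrow> ennreal 0"
    by (intro tendsto_ennrealI LIMSEQ_Suc[OF lim_1_over_n])
   then show "(%i. en (1 / real (Suc (r i)))) \<longlonglongrightarrow> 0"
    using filterlim_compose[OF _ rtop] by fastforce
   show "\<forall>\<^sub>F i in sequentially. (nI c (%z. en \<bar>step_fun (l (n (r i)) (E (K (r i)))) z - f z * indicator (E (K (r i))) z\<bar>)) \<le> ennreal (1 / real (Suc (r i)))"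
   proof (intro always_eventually allI)
    fix i
    have "(nI c (%z. en \<bar>step_fun (l (n (r i)) (E (K (r i)))) z - f z * indicator (E (K (r i))) z\<bar>)) =
     (nI c (%z. en \<bar>f z * indicator (E (K (r i))) z - \<phi> (n (r i)) z * indicator (E (K (r i))) z\<bar>))"
     by (rule nn_integral_cong) (simp only: l(2)[OF E_meas] abs_minus_commute)
    then show "(nI c (%z. en \<bar>step_fun (l (n (r i)) (E (K (r i)))) z - f z * indicator (E (K (r i))) z\<bar>)) \<le> ennreal (1 / real (Suc (r i)))"
     using nE[of "r i"] by simp
   qed
  qed
  show "AE ww in M. (%i. set_sum L (l (n (r i)) (E (K (r i)))) ww) \<longlonglongrightarrow> Y ww"
   using r_lim
  proof eventually_elim
   case (elim ww)
   have "\<forall>\<^sub>F i in sequentially. min 1 \<bar>J (n (r i)) (E (K (r i))) ww - Y ww\<bar> < 1"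
    by (rule order_tendstoD(2)[OF elim]) simp
   then have "\<forall>\<^sub>F i in sequentially. min 1 \<bar>J (n (r i)) (E (K (r i))) ww - Y ww\<bar> = \<bar>J (n (r i)) (E (K (r i))) ww - Y ww\<bar>"
    by eventually_elim (auto simp: min_def split: if_splits)
   then have "(%i. \<bar>J (n (r i)) (E (K (r i))) ww - Y ww\<bar>) \<longlonglongrightarrow> 0"
    using elim by (simp cong: tendsto_cong)
   then show ?case unfolding J_def by (simp add: tendsto_rabs_zero_iff LIM_zero_iff)
  qed
 qed
qed

text \<open>For a nonnegative kernel that is not known to be integrable, the right side is still
  finite when \<open>s = 1\<close>. The bound for lists is applied against \<open>k i\<close> and
  passed to the limit by Fatou. Off \<open>H i\<close> the list \<open>k i\<close> is close to zero,
  so \<open>step_fun m\<close> itself is the error there, and it vanishes in the limit.\<close>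

lemma rr_integral_one_sided:
 fixes s :: real
 assumes rr: "has_rr_integral M c L f Y" and m: "fm_list c m" and s: "\<bar>s\<bar> = 1"
 shows "(nI M (%ww. en (s * (set_sum L m ww - Y ww)))) \<le> ennreal mean * (nI c (%z. en (s * (step_fun m z - f z))))"
proof -
 have f [measurable]: "f \<in> Bm c" using rr by (simp add: has_rr_integral_def)
 obtain k H where k: "\<And>i::nat. fm_list c (k i)" and H [measurable]: "\<And>i. H i \<in> sets c"
  and cover: "AE z in c. \<forall>\<^sub>F i in sequentially. z \<in> H i"
  and lim: "(%i. nI c (%z. en \<bar>step_fun (k i) z - f z * indicator (H i) z\<bar>)) \<longlonglongrightarrow> 0"
  and J: "AE ww in M. (%i. set_sum L (k i) ww) \<longlonglongrightarrow> Y ww"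
  using rr_integral_lists[OF rr] by blast
 note [measurable] = set_sum_measurable[OF k] set_sum_measurable[OF m] step_fun_measurable[OF k] step_fun_measurable[OF m]
 have out: "(%i. nI c (%z. en \<bar>step_fun m z * indicator (space c - H i) z\<bar>)) \<longlonglongrightarrow> 0"
 proof -
  have "(%i. nI c (%z. norm (0 - step_fun m z * indicator (space c - H i) z))) \<longlonglongrightarrow> 0"
  proof (rule nn_integral_dominated_convergence_norm[where w="%z. norm (step_fun m z)"])
   show "(nI c (%z. en (norm (step_fun m z)))) < \<infinity>"
    using integrable_step_fun[OF m] by (simp add: integrable_iff_bounded)
   show "AE z in c. norm (step_fun m z * indicator (space c - H i) z) \<le> norm (step_fun m z)" for i
    by (intro AE_I2) (auto split: split_indicator)
   show "AE z in c. (%i. step_fun m z * indicator (space c - H i) z) \<longlonglongrightarrow> 0"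
    using cover
   proof eventually_elim
    case (elim z)
    then have "\<forall>\<^sub>F i in sequentially. step_fun m z * indicator (space c - H i) z = 0" by eventually_elim auto
    then show ?case by (rule tendsto_eventually)
   qed
  qed measurable
  then show ?thesis by simp
 qed
 let ?R = "nI c (%z. en (s * (step_fun m z - f z)))"
 let ?g = "%i. en mean * (?R + ((nI c (%z. en \<bar>step_fun m z * indicator (space c - H i) z\<bar>)) +
   (nI c (%z. en \<bar>step_fun (k i) z - f z * indicator (H i) z\<bar>))))"
 have "(nI M (%ww. en (s * (set_sum L m ww - Y ww)))) = (nI M (%ww. liminf (%i. en (s * (set_sum L m ww - set_sum L (k i) ww)))))"
 proof (rule nn_integral_cong_AE)
  show "AE ww in M. en (s * (set_sum L m ww - Y ww)) = liminf (%i. en (s * (set_sum L m ww - set_sum L (k i) ww)))"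
   using J
  proof eventually_elim
   case (elim ww)
   then have "(%i. en (s * (set_sum L m ww - set_sum L (k i) ww))) \<longlonglongrightarrow> ennreal (s * (set_sum L m ww - Y ww))"
    by (intro tendsto_intros)
   from lim_imp_Liminf[OF sequentially_bot this] show ?case by simp
  qed
 qed
 also have "... \<le> liminf (%i. nI M (%ww. en (s * (set_sum L m ww - set_sum L (k i) ww))))"
  by (rule nn_integral_liminf) measurable
 also have "... \<le> liminf ?g"
 proof (intro Liminf_mono always_eventually allI)
  fix i
  have "fm_list c (scale_list s (m @ scale_list (-1) (k i)))" using m k by simp
  from nn_integral_set_sum_le[OF this]
  have "(nI M (%ww. en (s * (set_sum L m ww - set_sum L (k i) ww)))) \<le>
    en mean * (nI c (%z. en (s * (step_fun m z - step_fun (k i) z))))"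
   by simp
  also have "... \<le> ?g i"
  proof (rule mult_left_mono)
   have "(nI c (%z. en (s * (step_fun m z - step_fun (k i) z)))) \<le>
    (nI c (%z. en (s * (step_fun m z - f z)) + (en \<bar>step_fun m z * indicator (space c - H i) z\<bar> +
      en \<bar>step_fun (k i) z - f z * indicator (H i) z\<bar>)))"
   proof (rule nn_integral_mono)
    fix z assume z: "z \<in> space c"
    define a where "a = step_fun m z" define b where "b = step_fun (k i) z" define d where "d = f z"
    have s': "s = 1 \<or> s = -1" using s by linarith
    \<comment> \<open>On \<open>H i\<close> the triangle inequality goes through \<open>d\<close>;
      off \<open>H i\<close> the two absolute values are those of \<open>a\<close> and
      \<open>b\<close>. The maximum with \<open>0\<close> stands for the truncation made by
      \<open>ennreal\<close>.\<close>
    have "s * (a - b) \<le> max 0 (s * (a - d)) + (\<bar>a * indicator (space c - H i) z\<bar> + \<bar>b - d * indicator (H i) z\<bar>)"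
     using s' z by (cases "z \<in> H i") (auto simp: max_def)
    then have "en (s * (a - b)) \<le> ennreal (max 0 (s * (a - d)) + (\<bar>a * indicator (space c - H i) z\<bar> + \<bar>b - d * indicator (H i) z\<bar>))"
     by (rule ennreal_leI)
    also have "... = en (s * (a - d)) + (en \<bar>a * indicator (space c - H i) z\<bar> + en \<bar>b - d * indicator (H i) z\<bar>)"
     by (simp add: max_def ennreal_neg)
    finally show "en (s * (step_fun m z - step_fun (k i) z)) \<le> ennreal (s * (step_fun m z - f z)) + (en \<bar>step_fun m z * indicator (space c - H i) z\<bar> +
      en \<bar>step_fun (k i) z - f z * indicator (H i) z\<bar>)"
     unfolding a_def b_def d_def .
   qed
   also have "... = ?R + (nI c (%z. en \<bar>step_fun m z * indicator (space c - H i) z\<bar> +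
      en \<bar>step_fun (k i) z - f z * indicator (H i) z\<bar>))"
    by (rule nn_integral_add) measurable
   also have "(nI c (%z. en \<bar>step_fun m z * indicator (space c - H i) z\<bar> +
      en \<bar>step_fun (k i) z - f z * indicator (H i) z\<bar>)) = (nI c (%z. en \<bar>step_fun m z * indicator (space c - H i) z\<bar>)) +
      (nI c (%z. en \<bar>step_fun (k i) z - f z * indicator (H i) z\<bar>))"
    by (rule nn_integral_add) measurable
   finally show "(nI c (%z. en (s * (step_fun m z - step_fun (k i) z)))) \<le> ?R + ((nI c (%z. en \<bar>step_fun m z * indicator (space c - H i) z\<bar>)) +
      (nI c (%z. en \<bar>step_fun (k i) z - f z * indicator (H i) z\<bar>)))" .
  qed simp
  finally show "(nI M (%ww. en (s * (set_sum L m ww - set_sum L (k i) ww)))) \<le> ?g i" .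
 qed
 also have "liminf ?g = en mean * (?R + (0 + 0))"
  by (intro lim_imp_Liminf sequentially_bot ennreal_tendsto_cmult tendsto_add tendsto_const out lim) simp
 finally show ?thesis by simp
qed

lemma rr_integral_diff_le:
 assumes rr: "has_rr_integral M c L f Y" and m: "fm_list c m"
 shows "(nI M (%ww. en \<bar>Y ww - set_sum L m ww\<bar>)) \<le> ennreal mean * (nI c (%z. en \<bar>f z - step_fun m z\<bar>))"
proof -
 have [measurable]: "f \<in> Bm c" "Y \<in> Bm M"
  using rr by (auto simp: has_rr_integral_def converges_in_probability_def)
 note [measurable] = set_sum_measurable[OF m] step_fun_measurable[OF m]
 have 1: "(nI M (%ww. en \<bar>Y ww - set_sum L m ww\<bar>)) =
  (nI M (%ww. en (Y ww - set_sum L m ww))) + (nI M (%ww. en (- (Y ww - set_sum L m ww))))"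
  by (rule nn_integral_abs_split) measurable
 have 2: "(nI c (%z. en \<bar>f z - step_fun m z\<bar>)) =
  (nI c (%z. en (f z - step_fun m z))) + (nI c (%z. en (- (f z - step_fun m z))))"
  by (rule nn_integral_abs_split) measurable
 show ?thesis unfolding 1 2 distrib_left
  using rr_integral_one_sided[OF rr m, of "-1"] rr_integral_one_sided[OF rr m, of 1]
  by (intro add_mono) simp_all
qed

lemma
 assumes "fm_list c m"
 shows integrable_set_sum: "integrable M (set_sum L m)"
  and set_sum_expectation: "(LINT ww|M. set_sum L m ww) = mean * (LINT z|c. step_fun m z)"
proof -
 have "integrable M (set_sum L m) \<and> (LINT ww|M. set_sum L m ww) = mean * (LINT z|c. step_fun m z)"
  using assms
 proof (induction m)
  case Nil
  have "set_sum L [] = (%_. 0)" by (simp add: fun_eq_iff)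
  then show ?case by simp
 next
  case (Cons x m)
  obtain b B where x: "x = (b, B)" by (cases x)
  have B: "B \<in> fmeasurable c" "fm_list c m" using Cons(2) by (auto simp: x)
  have eq: "set_sum L (x # m) = (%ww. b * L B ww + set_sum L m ww)" by (simp add: x fun_eq_iff)
  have iB: "integrable c (%z. b * indicator B z :: real)" using B by (auto simp: fmeasurable_def)
  have "(LINT z|c. step_fun (x # m) z) = (LINT z|c. b * indicator B z + step_fun m z)" by (simp add: x)
  also have "... = (LINT z|c. b * indicator B z) + (LINT z|c. step_fun m z)"
   by (rule Bochner_Integration.integral_add[OF iB integrable_step_fun[OF B(2)]])
  also have "(LINT z|c. b * indicator B z) = b * measure c B"
   using B by (simp add: fmeasurable_def Int_absorb2 sets.sets_into_space)
  finally have S: "(LINT z|c. step_fun (x # m) z) = b * measure c B + (LINT z|c. step_fun m z)" .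
  show ?case unfolding eq S using Cons(1)[OF B(2)] L_integrable[OF B(1)] L_expectation[OF B(1)]
   by (simp add: algebra_simps)
 qed
 then show "integrable M (set_sum L m)" "(LINT ww|M. set_sum L m ww) = mean * (LINT z|c. step_fun m z)" by auto
qed

text \<open>The loss when \<open>Y\<close> replaces the sum is the positive part of the sum minus
  \<open>Y\<close>. By the one-sided bound it is controlled by the positive part of
  \<open>step_fun m - f\<close>, which is at most the error against \<open>g\<close> because
  \<open>g\<close> lies below \<open>f\<close>.\<close>

lemma rr_integral_expectation_ge:
 assumes rr: "has_rr_integral M c L f Y" and g: "integrable c g" and gf: "\<And>z. z \<in> space c ==> 0 \<le> g z \<and> g z \<le> f z"
 shows "en mean * (nI c (%z. en (g z))) \<le> (nI M (%ww. en (Y ww)))"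
proof (rule ennreal_le_epsilon)
 have [measurable]: "Y \<in> Bm M" "g \<in> Bm c"
  using rr g by (auto simp: has_rr_integral_def converges_in_probability_def)
 fix e :: real assume "0 < e"
 \<comment> \<open>Two errors \<open>mean * d\<close> occur, one from approximating \<open>g\<close>
   and one from the one-sided bound.\<close>
 define d where "d = e / (2 * (mean + 1))"
 have d: "0 < d" using \<open>0 < e\<close> mean_nonneg by (simp add: d_def)
 have md: "mean * d + mean * d \<le> e"
 proof -
  have "mean * d \<le> (mean + 1) * d" using d by (intro mult_right_mono) auto
  also have "... = e / 2" using mean_nonneg by (simp add: d_def field_simps)
  finally show ?thesis by linarith
 qed
 obtain l where l: "fm_list c l" "(nI c (%z. en \<bar>g z - step_fun l z\<bar>)) < en d"
  using ex_list_approx[OF g d] by blast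
 obtain m where m: "fm_list c m" "\<And>z. step_fun m z = max 0 (step_fun l z)"
  using ex_positive_part_list[OF l(1)] by blast
 note [measurable] = set_sum_measurable[OF m(1)] step_fun_measurable[OF m(1)]
 have gm: "(nI c (%z. en \<bar>g z - step_fun m z\<bar>)) \<le> ennreal d"
 proof -
  have "(nI c (%z. en \<bar>g z - step_fun m z\<bar>)) \<le> (nI c (%z. en \<bar>g z - step_fun l z\<bar>))"
   using gf by (intro nn_integral_mono ennreal_leI) (fastforce simp: m(2) max_def)
  then show ?thesis using l(2) by simp
 qed
 have "(nI c (%z. en (g z))) \<le> (nI c (%z. en (step_fun m z) + en \<bar>g z - step_fun m z\<bar>))"
 proof (rule nn_integral_mono)
  fix z
  have "en (g z) \<le> ennreal (step_fun m z + \<bar>g z - step_fun m z\<bar>)" by (rule ennreal_leI) simp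
  also have "... = en (step_fun m z) + en \<bar>g z - step_fun m z\<bar>"
   by (rule ennreal_plus) (simp_all add: m(2))
  finally show "en (g z) \<le> ennreal (step_fun m z) + en \<bar>g z - step_fun m z\<bar>" .
 qed
 also have "... = (nI c (%z. en (step_fun m z))) + (nI c (%z. en \<bar>g z - step_fun m z\<bar>))"
  by (rule nn_integral_add) measurable
 also have "... \<le> (nI c (%z. en (step_fun m z))) + en d" by (intro add_left_mono gm)
 finally have "en mean * (nI c (%z. en (g z))) \<le> ennreal mean * ((nI c (%z. en (step_fun m z))) + en d)"
  by (rule mult_left_mono) simp
 also have "... = en mean * (nI c (%z. en (step_fun m z))) + en (mean * d)"
  using mean_nonneg d by (simp add: distrib_left ennreal_mult)
 also have "en mean * (nI c (%z. en (step_fun m z))) \<le> (nI M (%ww. en (Y ww))) + en (mean * d)"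
 proof -
  have "(nI c (%z. en (step_fun m z))) = en (LINT z|c. step_fun m z)"
   by (rule nn_integral_eq_integral[OF integrable_step_fun[OF m(1)]]) (simp add: m(2))
  then have "en mean * (nI c (%z. en (step_fun m z))) = en (LINT ww|M. set_sum L m ww)"
   using mean_nonneg by (simp add: set_sum_expectation[OF m(1)] ennreal_mult')
  also have "... = (nI M (%ww. en (set_sum L m ww)))"
   by (rule nn_integral_eq_integral[symmetric, OF integrable_set_sum[OF m(1)] set_sum_nonneg[OF m(1)]]) (simp add: m(2))
  also have "... \<le> (nI M (%ww. en (Y ww) + en (1 * (set_sum L m ww - Y ww))))"
  proof (rule nn_integral_mono)
   fix ww
   show "en (set_sum L m ww) \<le> ennreal (Y ww) + en (1 * (set_sum L m ww - Y ww))"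
    by (cases "0 \<le> Y ww"; cases "Y ww \<le> set_sum L m ww") (simp_all add: ennreal_neg ennreal_leI flip: ennreal_plus)
  qed
  also have "... = (nI M (%ww. en (Y ww))) + (nI M (%ww. en (1 * (set_sum L m ww - Y ww))))"
   by (rule nn_integral_add) measurable
  also have "... \<le> (nI M (%ww. en (Y ww))) + en (mean * d)"
  proof (rule add_left_mono)
   have "(nI M (%ww. en (1 * (set_sum L m ww - Y ww)))) \<le> ennreal mean * (nI c (%z. en (1 * (step_fun m z - f z))))"
    by (rule rr_integral_one_sided[OF rr m(1)]) simp
   also have "... \<le> ennreal mean * (nI c (%z. en \<bar>g z - step_fun m z\<bar>))"
   proof (intro mult_left_mono nn_integral_mono ennreal_leI)
    fix z assume "z \<in> space c"
    then have "g z \<le> f z" using gf by blast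
    then show "1 * (step_fun m z - f z) \<le> \<bar>g z - step_fun m z\<bar>" unfolding mult_1 by linarith
   qed simp
   also have "... \<le> ennreal mean * en d" by (intro mult_left_mono gm) simp
   also have "... = en (mean * d)" using mean_nonneg d by (simp add: ennreal_mult)
   finally show "(nI M (%ww. en (1 * (set_sum L m ww - Y ww)))) \<le> ennreal (mean * d)" .
  qed
  finally show ?thesis .
 qed
 finally have "en mean * (nI c (%z. en (g z))) \<le> (nI M (%ww. en (Y ww))) + en (mean * d) + en (mean * d)"
  by (simp add: add_right_mono)
 also have "... = (nI M (%ww. en (Y ww))) + en (mean * d + mean * d)"
  using mean_nonneg d by (subst ennreal_plus) (simp_all add: add.assoc)
 also have "... \<le> (nI M (%ww. en (Y ww))) + en e" by (intro add_left_mono ennreal_leI md)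
 finally show "en mean * (nI c (%z. en (g z))) \<le> (nI M (%ww. en (Y ww))) + en e" .
qed

text \<open>Truncations of \<open>f\<close> are integrable minorants that increase to
  \<open>f\<close>. When the expectation on the right is finite and the mean of the jumps is not
  zero, this forces \<open>f\<close> to be integrable.\<close>

lemma rr_integral_expectation:
 assumes rr: "has_rr_integral M c L f Y" and f: "\<And>z. z \<in> space c ==> 0 \<le> f z"
 shows "en mean * (nI c (%z. en (f z))) \<le> (nI M (%ww. en (Y ww)))"
proof -
 interpret C: sigma_finite_measure c by (rule c_sigma_finite)
 have [measurable]: "f \<in> Bm c" using rr by (simp add: has_rr_integral_def)
 obtain F :: "nat => _" where F: "range F \<subseteq> sets c" "(\<Union>i. F i) = space c" "\<And>i. emeasure c (F i) \<noteq> \<infinity>" "incseq F"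
  by (rule C.sigma_finite_incseq) blast
 have [measurable]: "F k \<in> sets c" for k using F by auto
 define g where "g k z = min (f z) (real k) * indicator (F k) z" for k z
 have [measurable]: "g k \<in> Bm c" for k unfolding g_def by measurable
 have le: "en mean * (nI c (%z. en (g k z))) \<le> (nI M (%ww. en (Y ww)))" for k
 proof (rule rr_integral_expectation_ge[OF rr])
  show "integrable c (g k)"
  proof (rule Bochner_Integration.integrable_bound)
   show "integrable c (%z. real k * indicator (F k) z)" using F(3)[of k] by (auto simp: top.not_eq_extremum)
   show "AE z in c. norm (g k z) \<le> norm (real k * indicator (F k) z)"
    using f by (intro AE_I2) (auto simp: g_def split: split_indicator)
  qed measurable
  show "0 \<le> g k z \<and> g k z \<le> f z" if "z \<in> space c" for z
   using f[OF that] by (auto simp: g_def split: split_indicator)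
 qed
 have "(nI c (%z. en (f z))) = (nI c (%z. liminf (%k. en (g k z))))"
 proof (rule nn_integral_cong)
  fix z assume "z \<in> space c"
  then obtain i where i: "z \<in> F i" using F(2) by auto
  obtain j where j: "f z \<le> real j" using real_arch_simple by blast
  have "\<forall>\<^sub>F k in sequentially. en (g k z) = en (f z)"
   using eventually_ge_at_top[of "max i j"]
  proof eventually_elim
   case (elim k)
   then have "z \<in> F k" using i F(4) by (auto simp: incseq_def)
   then show ?case using elim j by (simp add: g_def min_def)
  qed
  then have "(%k. en (g k z)) \<longlonglongrightarrow> ennreal (f z)" by (rule tendsto_eventually)
  from lim_imp_Liminf[OF sequentially_bot this] show "en (f z) = liminf (%k. en (g k z))" by simp
 qed
 also have "... \<le> liminf (%k. nI c (%z. en (g k z)))"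
  by (rule nn_integral_liminf) measurable
 finally have fatou: "(nI c (%z. en (f z))) \<le> liminf (%k. nI c (%z. en (g k z)))" .
 show ?thesis
 proof (cases "mean = 0")
  case False
  then have mean: "0 < mean" using mean_nonneg by simp
  have "(nI c (%z. en (g k z))) \<le> ennreal (1 / mean) * (nI M (%ww. en (Y ww)))" for k
  proof -
   have "en (1 / mean) * (en mean * (nI c (%z. en (g k z)))) \<le> ennreal (1 / mean) * (nI M (%ww. en (Y ww)))"
    by (intro mult_left_mono le) simp
   moreover have "en (1 / mean) * en mean = 1" using mean by (simp flip: ennreal_mult)
   ultimately show ?thesis by (simp flip: mult.assoc)
  qed
  then have "liminf (%k. nI c (%z. en (g k z))) \<le> liminf (%k::nat. en (1 / mean) * (nI M (%ww. en (Y ww))))"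
   by (intro Liminf_mono always_eventually allI)
  also have "... = en (1 / mean) * (nI M (%ww. en (Y ww)))" by (simp add: Liminf_const)
  finally have "en mean * (nI c (%z. en (f z))) \<le> ennreal mean * (en (1 / mean) * (nI M (%ww. en (Y ww))))"
   using fatou by (intro mult_left_mono) auto
  moreover have "en mean * en (1 / mean) = 1" using mean by (simp flip: ennreal_mult)
  ultimately show ?thesis by (simp flip: mult.assoc)
 qed simp
qed

end

section \<open>Integrating a family of integrals\<close>

lemma ennreal_abs_integral_diff_le:
 fixes u v :: "'s => real"
 assumes "integrable m u" "integrable m v"
 shows "en \<bar>(LINT s|m. u s) - (LINT s|m. v s)\<bar> \<le> (nI m (%s. en \<bar>u s - v s\<bar>))"
proof -
 have i: "integrable m (%s. u s - v s)" using assms by simp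
 have "en \<bar>(LINT s|m. u s) - (LINT s|m. v s)\<bar> = en (norm (LINT s|m. u s - v s))"
  using assms by simp
 also have "... \<le> (nI m (%s. en (norm (u s - v s))))" by (rule integral_norm_bound_ennreal[OF i])
 finally show ?thesis by simp
qed

definition section_list :: "(real \<times> 's set \<times> 'z set) list => 's => (real \<times> 'z set) list" where
 "section_list l s = map (%(a, A, B). (a * indicator A s, B)) l"

definition integrated_list :: "'s measure => (real \<times> 's set \<times> 'z set) list => (real \<times> 'z set) list" where
 "integrated_list m l = map (%(a, A, B). (a * measure m A, B)) l"

lemma step_fun_section_list: "step_fun (section_list l s) z = rect_sum l (s, z)"
 by (induction l) (auto simp: section_list_def)

lemma fm_section_list: "rect_list m c l ==> fm_list c (section_list l s)"
 by (induction l) (auto simp: section_list_def)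

lemma fm_integrated_list: "rect_list m c l ==> fm_list c (integrated_list m l)"
 by (induction l) (auto simp: integrated_list_def)

lemma set_sum_section_list:
 assumes "rect_list m c l"
 shows "integrable m (%s. set_sum L (section_list l s) ww) \<and>
  (LINT s|m. set_sum L (section_list l s) ww) = set_sum L (integrated_list m l) ww"
 using assms
proof (induction l)
 case Nil
 then show ?case by (simp add: section_list_def integrated_list_def)
next
 case (Cons x l)
 obtain a A B where x: "x = (a, A, B)" by (cases x)
 have A: "A \<in> fmeasurable m" and l: "rect_list m c l" using Cons(2) by (auto simp: x)
 have iA: "integrable m (%s. a * indicator A s * L B ww)" using A by (auto simp: fmeasurable_def)
 have eq: "set_sum L (section_list (x # l) s) ww = a * indicator A s * L B ww + set_sum L (section_list l s) ww" for s
  by (simp add: x section_list_def)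
 have "(LINT s|m. a * indicator A s * L B ww) = a * measure m A * L B ww"
  using A by (simp add: fmeasurable_def Int_absorb2 sets.sets_into_space)
 then show ?case unfolding eq using Cons(1)[OF l] iA
  by (simp add: x integrated_list_def)
qed

text \<open>With indicators in place of the random measure a set sum is a step function, so the
  preceding computation applies to functions as well.\<close>

lemma step_fun_integrated_list:
 assumes "rect_list m c l"
 shows "integrable m (%s. rect_sum l (s, z)) \<and> (LINT s|m. rect_sum l (s, z)) = step_fun (integrated_list m l) z"
 using set_sum_section_list[OF assms, where L="%B z. indicator B z" and ww=z]
 by (simp add: set_sum_def step_fun_def[symmetric] step_fun_section_list)

context subordinator_basis
begin

lemma measurable_set_sum_section_list:
 assumes "rect_list m c l"
 shows "(%(s, ww). set_sum L (section_list l s) ww) \<in> Bm (m \<Otimes>\<^sub>M M)"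
 using assms
proof (induction l)
 case Nil
 then show ?case by (simp add: section_list_def)
next
 case (Cons x l)
 obtain a A B where x: "x = (a, A, B)" by (cases x)
 have [measurable]: "A \<in> sets m" "L B \<in> Bm M"
  and l: "rect_list m c l" using Cons(2) L_measurable by (auto simp: x)
 note [measurable] = Cons(1)[OF l]
 have eq: "(%(s, ww). set_sum L (section_list (x # l) s) ww) = (%z. a * indicator A (fst z) * L B (snd z) + (%(s, ww). set_sum L (section_list l s) ww) z)"
  by (auto simp: x section_list_def fun_eq_iff)
 show ?case unfolding eq by measurable
qed

text \<open>The estimate is reduced to the unscaled one by dividing the list by \<open>a\<close>,
  which is why zero is separated.\<close>

lemma rr_integral_scaled_diff_le:
 assumes rr: "has_rr_integral M c L f Y" and k: "fm_list c k" and a: "0 \<le> a"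
 shows "(nI M (%ww. en \<bar>a * Y ww - set_sum L k ww\<bar>)) \<le> ennreal mean * (nI c (%z. en \<bar>a * f z - step_fun k z\<bar>))"
proof (cases "a = 0")
 case True
 then show ?thesis using nn_integral_abs_set_sum_le[OF k] by simp
next
 case False
 then have a0: "0 < a" using a by simp
 have [measurable]: "f \<in> Bm c" "Y \<in> Bm M"
  using rr by (auto simp: has_rr_integral_def converges_in_probability_def)
 note [measurable] = set_sum_measurable[OF k] step_fun_measurable[OF k]
 have fk: "fm_list c (scale_list (1/a) k)" using k by (rule fm_list_scale)
 have eq: "\<bar>a * u - v\<bar> = a * \<bar>u - 1/a * v\<bar>" for u v
 proof -
  have "a * u - v = a * (u - 1/a * v)" using a0 by (simp add: field_simps)
  then show ?thesis using a0 by (simp only: abs_mult abs_of_pos)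
 qed
 have "(nI M (%ww. en \<bar>a * Y ww - set_sum L k ww\<bar>)) = en a * (nI M (%ww. en \<bar>Y ww - set_sum L (scale_list (1/a) k) ww\<bar>))"
  using a0 by (simp only: eq set_sum_scale ennreal_mult less_imp_le abs_ge_zero) (rule nn_integral_cmult, measurable)
 also have "... \<le> ennreal a * (en mean * (nI c (%z. en \<bar>f z - step_fun (scale_list (1/a) k) z\<bar>)))"
  by (intro mult_left_mono rr_integral_diff_le[OF rr fk]) simp
 also have "... = en mean * (en a * (nI c (%z. en \<bar>f z - step_fun (scale_list (1/a) k) z\<bar>)))"
  by (simp only: mult.left_commute)
 also have "en a * (nI c (%z. en \<bar>f z - step_fun (scale_list (1/a) k) z\<bar>)) = (nI c (%z. en \<bar>a * f z - step_fun k z\<bar>))"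
  using a0 by (simp only: eq step_fun_scale ennreal_mult less_imp_le abs_ge_zero) (rule nn_integral_cmult[symmetric], measurable)
 finally show ?thesis .
qed

text \<open>A stochastic Fubini theorem. For rectangle sums, integrating out \<open>s\<close> is an
  exact finite identity for functions and random sums alike. The mean error of each section is
  bounded by its error as a function, and Tonelli adds these errors over \<open>s\<close>.\<close>

lemma integrated_L_integral:
 fixes m :: "'s measure" and H :: "'s => real" and h :: "'s => 'z => real" and V2 :: "'s => 'w => real"
 assumes m: "sigma_finite_measure m"
  and V2 [measurable]: "(%(s, ww). V2 s ww) \<in> Bm (m \<Otimes>\<^sub>M M)"
  and H [measurable]: "H \<in> Bm m" and H_nonneg: "\<And>s. 0 \<le> H s"
  and Hh: "integrable (m \<Otimes>\<^sub>M c) (%(s, z). H s * h s z)"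
  and rr: "\<And>s. s \<in> space m ==> has_rr_integral M c L (h s) (V2 s)"
 shows "L_integral (%z. LINT s|m. H s * h s z) (%ww. LINT s|m. H s * V2 s ww)"
proof -
 interpret m: sigma_finite_measure m by fact
 interpret C: sigma_finite_measure c by (rule c_sigma_finite)
 interpret mc: pair_sigma_finite m c ..
 interpret mM: pair_sigma_finite m M ..
 define G where "G = (%(s, z). H s * h s z)"
 have G_int: "integrable (m \<Otimes>\<^sub>M c) G" using Hh by (simp add: G_def)
 then have [measurable]: "G \<in> Bm (m \<Otimes>\<^sub>M c)" by auto
 define X where "X = (%(s, ww). H s * V2 s ww)"
 have [measurable]: "X \<in> Bm (m \<Otimes>\<^sub>M M)" unfolding X_def by measurable
 have approx_le: "(nI M (%ww. nI m (%s. en \<bar>X (s, ww) - set_sum L (section_list l s) ww\<bar>))) \<le>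
   en mean * (nI (m \<Otimes>\<^sub>M c) (%z. en \<bar>G z - rect_sum l z\<bar>))" if l: "rect_list m c l" for l
 proof -
  note [measurable] = measurable_set_sum_section_list[OF l] rect_sum_measurable[OF l]
  have meas: "(%(s, ww). en \<bar>X (s, ww) - set_sum L (section_list l s) ww\<bar>) \<in> Bm (m \<Otimes>\<^sub>M M)"
   by measurable
  have "(nI M (%ww. nI m (%s. en \<bar>X (s, ww) - set_sum L (section_list l s) ww\<bar>))) =
   (nI m (%s. nI M (%ww. en \<bar>X (s, ww) - set_sum L (section_list l s) ww\<bar>)))"
   using mM.Fubini'[OF meas] by simp
  also have "... \<le> (nI m (%s. en mean * (nI c (%z. en \<bar>G (s, z) - rect_sum l (s, z)\<bar>))))"
  proof (rule nn_integral_mono)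
   fix s assume "s \<in> space m"
   from rr_integral_scaled_diff_le[OF rr[OF this] fm_section_list[OF l] H_nonneg]
   show "(nI M (%ww. en \<bar>X (s, ww) - set_sum L (section_list l s) ww\<bar>)) \<le> ennreal mean * (nI c (%z. en \<bar>G (s, z) - rect_sum l (s, z)\<bar>))"
    by (simp add: X_def G_def step_fun_section_list)
  qed
  also have "... = en mean * (nI m (%s. nI c (%z. en \<bar>G (s, z) - rect_sum l (s, z)\<bar>)))"
   by (rule nn_integral_cmult) measurable
  also have "(nI m (%s. nI c (%z. en \<bar>G (s, z) - rect_sum l (s, z)\<bar>))) = (nI (m \<Otimes>\<^sub>M c) (%z. en \<bar>G z - rect_sum l z\<bar>))"
   by (rule C.nn_integral_fst) measurable
  finally show ?thesis .
 qed
 have X_AE: "AE ww in M. integrable m (%s. X (s, ww))"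
 proof -
  have "(nI M (%ww. nI m (%s. en \<bar>X (s, ww)\<bar>))) \<le> ennreal mean * (nI (m \<Otimes>\<^sub>M c) (%z. en \<bar>G z\<bar>))"
   using approx_le[of "[]"] by (simp add: section_list_def)
  also have "... < \<infinity>" using G_int by (simp add: integrable_iff_bounded ennreal_mult_less_top)
  finally have "AE ww in M. (nI m (%s. en \<bar>X (s, ww)\<bar>)) \<noteq> \<infinity>"
   by (intro nn_integral_PInf_AE) auto
  then show ?thesis
   by (rule AE_mp) (intro AE_I2 impI integrableI_bounded, auto simp: top.not_eq_extremum)
 qed
 have G_AE: "AE z in c. integrable m (%s. G (s, z))"
  using mc.AE_integrable_snd[of "%s z. G (s, z)"] G_int by simp
 have \<kappa>_int: "integrable c (%z. LINT s|m. G (s, z))"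
  using mc.integrable_snd[of "%s z. G (s, z)"] G_int by simp
 have "\<forall>n. \<exists>l. rect_list m c l \<and> (nI (m \<Otimes>\<^sub>M c) (%z. en \<bar>G z - rect_sum l z\<bar>)) < en (1 / real (Suc n))"
  using integrable_imp_rect_approximable[OF m c_sigma_finite G_int]
  unfolding rect_approximable_def by (simp del: of_nat_Suc)
 then obtain l where l: "\<And>n. rect_list m c (l n)" "\<And>n. (nI (m \<Otimes>\<^sub>M c) (%z. en \<bar>G z - rect_sum (l n) z\<bar>)) < en (1 / real (Suc n))"
  by metis
 have lim0: "(%n. en (1 / real (Suc n))) \<longlonglongrightarrow> 0"
  using tendsto_ennrealI[OF LIMSEQ_Suc[OF lim_1_over_n]] by simp
 have lim1: "(%n. nI c (%z. en \<bar>(LINT s|m. G (s, z)) - step_fun (integrated_list m (l n)) z\<bar>)) \<longlonglongrightarrow> 0"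
 proof (rule tendsto_0_le_ennreal[OF always_eventually lim0], rule allI)
  fix n
  note [measurable] = rect_sum_measurable[OF l(1)]
  have meas: "(%(s, z). en \<bar>G (s, z) - rect_sum (l n) (s, z)\<bar>) \<in> Bm (m \<Otimes>\<^sub>M c)" by measurable
  have "(nI c (%z. en \<bar>(LINT s|m. G (s, z)) - step_fun (integrated_list m (l n)) z\<bar>)) \<le>
   (nI c (%z. nI m (%s. en \<bar>G (s, z) - rect_sum (l n) (s, z)\<bar>)))"
  proof (rule nn_integral_mono_AE)
   show "AE z in c. en \<bar>(LINT s|m. G (s, z)) - step_fun (integrated_list m (l n)) z\<bar> \<le> (nI m (%s. en \<bar>G (s, z) - rect_sum (l n) (s, z)\<bar>))"
    using G_AE
   proof eventually_elim
    case (elim z)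
    then show ?case
     using ennreal_abs_integral_diff_le[OF elim conjunct1[OF step_fun_integrated_list[OF l(1), of n z]]]
     by (simp only: step_fun_integrated_list[OF l(1)])
   qed
  qed
  also have "... = (nI m (%s. nI c (%z. en \<bar>G (s, z) - rect_sum (l n) (s, z)\<bar>)))"
   using mc.Fubini'[OF meas] by simp
  also have "... = (nI (m \<Otimes>\<^sub>M c) (%z. en \<bar>G z - rect_sum (l n) z\<bar>))"
   by (rule C.nn_integral_fst) measurable
  also have "... \<le> ennreal (1 / real (Suc n))" using l(2) by (rule less_imp_le)
  finally show "(nI c (%z. en \<bar>(LINT s|m. G (s, z)) - step_fun (integrated_list m (l n)) z\<bar>)) \<le> ennreal (1 / real (Suc n))" .
 qed
 have "(%n. en mean * en (1 / real (Suc n))) \<longlonglongrightarrow> ennreal mean * 0"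
  by (intro ennreal_tendsto_cmult lim0) simp
 then have lim0': "(%n. en mean * en (1 / real (Suc n))) \<longlonglongrightarrow> 0" by simp
 have lim2: "(%n. nI M (%ww. en \<bar>(LINT s|m. X (s, ww)) - set_sum L (integrated_list m (l n)) ww\<bar>)) \<longlonglongrightarrow> 0"
 proof (rule tendsto_0_le_ennreal[OF always_eventually lim0'], rule allI)
  fix n
  have "(nI M (%ww. en \<bar>(LINT s|m. X (s, ww)) - set_sum L (integrated_list m (l n)) ww\<bar>)) \<le>
   (nI M (%ww. nI m (%s. en \<bar>X (s, ww) - set_sum L (section_list (l n) s) ww\<bar>)))"
  proof (rule nn_integral_mono_AE)
   show "AE ww in M. en \<bar>(LINT s|m. X (s, ww)) - set_sum L (integrated_list m (l n)) ww\<bar> \<le> (nI m (%s. en \<bar>X (s, ww) - set_sum L (section_list (l n) s) ww\<bar>))"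
    using X_AE
   proof eventually_elim
    case (elim ww)
    then show ?case
     using ennreal_abs_integral_diff_le[OF elim conjunct1[OF set_sum_section_list[OF l(1), of L n ww]]]
     by (simp only: set_sum_section_list[OF l(1)])
   qed
  qed
  also have "... \<le> ennreal mean * (nI (m \<Otimes>\<^sub>M c) (%z. en \<bar>G z - rect_sum (l n) z\<bar>))" by (rule approx_le[OF l(1)])
  also have "... \<le> ennreal mean * en (1 / real (Suc n))" by (rule mult_left_mono[OF less_imp_le[OF l(2)]]) simp
  finally show "(nI M (%ww. en \<bar>(LINT s|m. X (s, ww)) - set_sum L (integrated_list m (l n)) ww\<bar>)) \<le> ennreal mean * en (1 / real (Suc n))" .
 qed
 have "(%ww. LINT s|m. X (s, ww)) \<in> Bm M"
  by (rule m.borel_measurable_lebesgue_integral) measurable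
 then have "L_integral (%z. LINT s|m. G (s, z)) (%ww. LINT s|m. X (s, ww))"
  unfolding L_integral_def using \<kappa>_int lim1 lim2 fm_integrated_list[OF l(1)]
  by (intro conjI exI[of _ "%n. integrated_list m (l n)"] allI)
 then show ?thesis by (simp add: G_def X_def)
qed

end

section \<open>Gaussian random measures and the Walsh integral\<close>

lemma (in prob_space) indep_set_mono:
 "indep_set A B ==> A' \<subseteq> A ==> B' \<subseteq> B ==> indep_set A' B'"
 unfolding indep_set_def by (erule indep_sets_mono_sets) (auto split: bool.split)

lemma (in prob_space) indep_var_subalgebras:
 assumes sp: "space N1 = space M" "space N2 = space M"
  and indep: "indep_set (sets N1) (sets N2)"
  and U: "U \<in> measurable N1 S" and V: "V \<in> measurable N2 T"
 shows "indep_var S U T V"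
proof -
 have sub: "sets N1 \<subseteq> events" "sets N2 \<subseteq> events" using indep by (auto simp: indep_set_def indep_sets_def split: bool.splits)
 have rv: "random_variable S U" "random_variable T V"
 proof -
  show "random_variable S U"
  proof (rule measurableI)
   show "U x \<in> space S" if "x \<in> space M" for x using measurable_space[OF U, of x] that sp(1) by simp
   show "U -` A \<inter> space M \<in> events" if "A \<in> sets S" for A
    using subsetD[OF sub(1) measurable_sets[OF U that]] unfolding sp(1) .
  qed
  show "random_variable T V"
  proof (rule measurableI)
   show "V x \<in> space T" if "x \<in> space M" for x using measurable_space[OF V, of x] that sp(2) by simp
   show "V -` A \<inter> space M \<in> events" if "A \<in> sets T" for A
    using subsetD[OF sub(2) measurable_sets[OF V that]] unfolding sp(2) .
  qed
 qed
 have "{U -` A \<inter> space M |A. A \<in> sets S} \<subseteq> sets N1" using measurable_sets[OF U] sp(1) by auto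
 from sets.sigma_sets_subset[OF this] have "sigma_sets (space M) {U -` A \<inter> space M |A. A \<in> sets S} \<subseteq> sets N1"
  by (simp only: sp)
 moreover have "{V -` A \<inter> space M |A. A \<in> sets T} \<subseteq> sets N2" using measurable_sets[OF V] sp(2) by auto
 from sets.sigma_sets_subset[OF this] have "sigma_sets (space M) {V -` A \<inter> space M |A. A \<in> sets T} \<subseteq> sets N2"
  by (simp only: sp)
 ultimately show ?thesis
  unfolding indep_var_eq using rv indep_set_mono[OF indep] by blast
qed

lemma nn_integral_square_add_le:
 fixes u v :: "'a => real"
 assumes [measurable]: "u \<in> Bm N" "v \<in> Bm N"
 shows "(nI N (%x. en ((u x + v x)\<^sup>2))) \<le> 2 * (nI N (%x. en ((u x)\<^sup>2))) + 2 * (nI N (%x. en ((v x)\<^sup>2)))"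
proof -
 have "(nI N (%x. en ((u x + v x)\<^sup>2))) \<le> (nI N (%x. 2 * en ((u x)\<^sup>2) + 2 * en ((v x)\<^sup>2)))"
 proof (rule nn_integral_mono)
  fix x
  have "(u x + v x)\<^sup>2 \<le> 2 * (u x)\<^sup>2 + 2 * (v x)\<^sup>2"
   using zero_le_power2[of "u x - v x"] by (simp add: power2_eq_square algebra_simps)
  then have "en ((u x + v x)\<^sup>2) \<le> ennreal (2 * (u x)\<^sup>2 + 2 * (v x)\<^sup>2)" by (rule ennreal_leI)
  also have "... = 2 * en ((u x)\<^sup>2) + 2 * en ((v x)\<^sup>2)" by (simp add: ennreal_mult)
  finally show "en ((u x + v x)\<^sup>2) \<le> 2 * en ((u x)\<^sup>2) + 2 * en ((v x)\<^sup>2)" .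
 qed
 also have "... = 2 * (nI N (%x. en ((u x)\<^sup>2))) + 2 * (nI N (%x. en ((v x)\<^sup>2)))"
  by (simp add: nn_integral_add nn_integral_cmult)
 finally show ?thesis .
qed

locale gaussian_set_function = random_set_function M c W for M :: "'w measure" and c :: "'z measure" and W +
 assumes char_W: "\<And>A (\<theta>::real). A \<in> fmeasurable c ==>
  (CLINT ww|M. iexp (\<theta> * W A ww)) = exp (- cor (\<theta>\<^sup>2 * measure c A / 2))"
begin

lemma char_set_sum:
 assumes l: "fm_list c l"
 shows "(CLINT ww|M. exp (\<i> * set_sum W l ww)) = exp (- cor ((LINT z|c. (step_fun l z)\<^sup>2) / 2))"
proof -
 obtain k where k: "disjoint_list k" "fm_list c k" "\<And>z. step_fun k z = step_fun l z"
  "AE ww in M. set_sum W k ww = set_sum W l ww"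
  using ex_disjoint_list[OF l] by auto
 have "(CLINT ww|M. exp (\<i> * set_sum W k ww)) = exp (CLINT z|c. cor (- ((step_fun k z)\<^sup>2 / 2)))"
 proof (rule transform_disjoint_list(1)[where \<psi>="%b. cor (- (b\<^sup>2 / 2))", OF k(1,2)])
  fix b B assume "(b, B) \<in> set k"
  then have B: "B \<in> fmeasurable c" using k(2) by (auto simp: fm_list_def)
  have [measurable]: "W B \<in> Bm M" using B by (rule L_measurable)
  have "integrable M (%ww. exp (\<i> * cor (b * W B ww)))"
   by (intro integrable_const_bound[where B=1]) auto
  with char_W[OF B, of b] show "integrable M (%ww. exp (\<i> * (b * W B ww))) \<and>
    (CLINT ww|M. exp (\<i> * (b * W B ww))) = exp (measure c B *\<^sub>R cor (- (b\<^sup>2 / 2)))"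
   by (simp add: scaleR_conv_of_real mult_ac)
 qed simp
 also have "(CLINT z|c. cor (- ((step_fun k z)\<^sup>2 / 2))) = - cor ((LINT z|c. (step_fun l z)\<^sup>2) / 2)"
  by (simp only: integral_complex_of_real k(3) of_real_minus[symmetric] Bochner_Integration.integral_minus integral_divide_zero)
 also have "(CLINT ww|M. exp (\<i> * set_sum W k ww)) = (CLINT ww|M. exp (\<i> * set_sum W l ww))"
  using k(4) set_sum_measurable[OF k(2)] set_sum_measurable[OF l]
  by (intro integral_cong_AE) (auto elim!: eventually_mono)
 finally show ?thesis .
qed

lemma integrable_step_fun_square:
 assumes l: "fm_list c l"
 shows "integrable c (%z. (step_fun l z)\<^sup>2)"
proof -
 obtain k where k: "disjoint_list k" "fm_list c k" "\<And>z. step_fun k z = step_fun l z"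
  using ex_disjoint_list[OF l] by auto
 show ?thesis
  using has_bochner_integral_comp_step_fun[where \<psi>="%b. b\<^sup>2", OF k(1,2)] by (simp add: has_bochner_integral_iff k(3))
qed

text \<open>The characteristic function identifies the law as a standard normal one scaled by
  \<open>sqrt v\<close>, and the moments are transported from there.\<close>

lemma
 assumes l: "fm_list c l"
 shows integrable_set_sum_square: "integrable M (%ww. (set_sum W l ww)\<^sup>2)"
  and integrable_set_sum': "integrable M (set_sum W l)"
  and expectation_set_sum_square: "(LINT ww|M. (set_sum W l ww)\<^sup>2) = (LINT z|c. (step_fun l z)\<^sup>2)"
  and expectation_set_sum: "(LINT ww|M. set_sum W l ww) = 0"
proof -
 define v where "v = (LINT z|c. (step_fun l z)\<^sup>2)"
 have v: "0 \<le> v" unfolding v_def by (intro integral_nonneg_AE) auto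
 have [measurable]: "set_sum W l \<in> Bm M" using l by (rule set_sum_measurable)
 have ch: "(CLINT ww|M. exp (\<i> * (\<theta> * set_sum W l ww))) = exp (- cor (\<theta>\<^sup>2 * v / 2))" for \<theta> :: real
  using char_set_sum[OF fm_list_scale[OF l, of \<theta>]] by (simp add: v_def power_mult_distrib)
 have law: "distr M borel (set_sum W l) = distr std_normal_distribution borel (%x. sqrt v * x)"
 proof (rule Levy_uniqueness)
  interpret N: real_distribution std_normal_distribution by (rule real_dist_normal_dist)
  show "real_distribution (distr M borel (set_sum W l))" by (rule real_distribution_distr) measurable
  show "real_distribution (distr std_normal_distribution borel (%x. sqrt v * x))"
   by (rule N.real_distribution_distr) measurable
  show "char (distr M borel (set_sum W l)) = char (distr std_normal_distribution borel (%x. sqrt v * x))"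
  proof
   fix \<theta>
   have "char (distr M borel (set_sum W l)) \<theta> = exp (- cor (\<theta>\<^sup>2 * v / 2))"
    unfolding char_def using ch[of \<theta>] by (subst integral_distr) auto
   moreover have "char (distr std_normal_distribution borel (%x. sqrt v * x)) \<theta> = char std_normal_distribution (\<theta> * sqrt v)"
    unfolding char_def by (subst integral_distr) (auto simp: mult.assoc)
   ultimately show "char (distr M borel (set_sum W l)) \<theta> = char (distr std_normal_distribution borel (%x. sqrt v * x)) \<theta>"
    using v by (simp add: char_std_normal_distribution power_mult_distrib exp_of_real[symmetric] flip: of_real_power)
  qed
 qed
 have i2: "integrable std_normal_distribution (%x. x\<^sup>2)" and i1: "integrable std_normal_distribution (%x. x)"
  using integrable_std_normal_distribution_moment[of 2] integrable_std_normal_distribution_moment[of 1] by simp_all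
 have e2: "(LINT x|std_normal_distribution. x\<^sup>2) = 1"
  using std_normal_distribution_even_moments[of 1] by simp
 have e1: "(LINT x|std_normal_distribution. x) = 0"
  using integral_std_normal_distribution_moment_odd[of 1] by simp
 have "integrable (distr M borel (set_sum W l)) (%x. x\<^sup>2)"
  unfolding law by (subst integrable_distr_eq) (auto simp: power_mult_distrib i2)
 then show "integrable M (%ww. (set_sum W l ww)\<^sup>2)" by (subst (asm) integrable_distr_eq) auto
 have "integrable (distr M borel (set_sum W l)) (%x. x)"
  unfolding law by (subst integrable_distr_eq) (auto simp: i1)
 then show "integrable M (set_sum W l)" by (subst (asm) integrable_distr_eq) auto
 have "(LINT ww|M. (set_sum W l ww)\<^sup>2) = (LINT x|distr M borel (set_sum W l). x\<^sup>2)"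
  by (subst integral_distr) auto
 also have "... = v" unfolding law using v by (subst integral_distr) (auto simp: power_mult_distrib e2)
 finally show "(LINT ww|M. (set_sum W l ww)\<^sup>2) = (LINT z|c. (step_fun l z)\<^sup>2)" by (simp add: v_def)
 have "(LINT ww|M. set_sum W l ww) = (LINT x|distr M borel (set_sum W l). x)"
  by (subst integral_distr) auto
 also have "... = 0" unfolding law by (subst integral_distr) (auto simp: e1)
 finally show "(LINT ww|M. set_sum W l ww) = 0" .
qed

lemma
 assumes A: "A \<in> fmeasurable c"
 shows integrable_W: "integrable M (W A)" and expectation_W: "(LINT ww|M. W A ww) = 0"
  and integrable_W_square: "integrable M (%ww. (W A ww)\<^sup>2)"
  and expectation_W_square: "(LINT ww|M. (W A ww)\<^sup>2) = measure c A"
proof -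
 have l: "fm_list c [(1, A)]" using A by simp
 have eq: "set_sum W [(1, A)] = W A" by (simp add: fun_eq_iff)
 show "integrable M (W A)" using integrable_set_sum'[OF l] unfolding eq .
 show "(LINT ww|M. W A ww) = 0" using expectation_set_sum[OF l] unfolding eq .
 show "integrable M (%ww. (W A ww)\<^sup>2)" using integrable_set_sum_square[OF l] unfolding eq .
 have "(LINT z|c. (step_fun [(1, A)] z)\<^sup>2) = (LINT z|c. indicator A z)"
  by (intro Bochner_Integration.integral_cong) (auto split: split_indicator)
 then show "(LINT ww|M. (W A ww)\<^sup>2) = measure c A"
  using expectation_set_sum_square[OF l] A unfolding eq by (simp add: fmeasurable_def Int_absorb2 sets.sets_into_space)
qed

text \<open>Polarisation: where the sets overlap, the step function of the two together takes the
  value \<open>2\<close>, and its square exceeds the sum of the two indicators by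
  \<open>2\<close>.\<close>

lemma
 assumes A: "A \<in> fmeasurable c" and B: "B \<in> fmeasurable c"
 shows integrable_W_mult: "integrable M (%ww. W A ww * W B ww)"
  and expectation_W_mult: "(LINT ww|M. W A ww * W B ww) = measure c (A \<inter> B)"
proof -
 have l: "fm_list c [(1, A), (1, B)]" using A B by simp
 have [measurable]: "W A \<in> Bm M" "W B \<in> Bm M" using A B L_measurable by auto
 have eq: "W A ww * W B ww = ((set_sum W [(1, A), (1, B)] ww)\<^sup>2 - (W A ww)\<^sup>2 - (W B ww)\<^sup>2) / 2" for ww
  by (simp add: power2_eq_square algebra_simps)
 note i = integrable_set_sum_square[OF l] integrable_W_square[OF A] integrable_W_square[OF B]
 show "integrable M (%ww. W A ww * W B ww)" unfolding eq using i by (intro integrable_divide Bochner_Integration.integrable_diff)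
 have AB: "A \<inter> B \<in> fmeasurable c" using A B by (auto intro: fmeasurable_Int_fmeasurable)
 have int: "integrable c (indicator D :: _ => real)" "(LINT z|c. indicator D z) = measure c D" if "D \<in> fmeasurable c" for D
  using that by (auto simp: fmeasurable_def Int_absorb2 sets.sets_into_space)
 have "(LINT z|c. (step_fun [(1, A), (1, B)] z)\<^sup>2) = (LINT z|c. indicator A z + indicator B z + 2 * indicator (A \<inter> B) z)"
  by (intro Bochner_Integration.integral_cong) (auto split: split_indicator)
 also have "... = measure c A + measure c B + 2 * measure c (A \<inter> B)"
  using int[OF A] int[OF B] int[OF AB] by simp
 finally have "(LINT ww|M. (set_sum W [(1, A), (1, B)] ww)\<^sup>2) = measure c A + measure c B + 2 * measure c (A \<inter> B)"
  using expectation_set_sum_square[OF l] by simp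
 then show "(LINT ww|M. W A ww * W B ww) = measure c (A \<inter> B)"
  unfolding eq using i expectation_W_square[OF A] expectation_W_square[OF B] by simp
qed

end

text \<open>The real number in a triple is the time at which the coefficient is known. It does not
  enter the value, but adaptedness refers to it.\<close>

definition random_step :: "(('w => real) \<times> real \<times> 'z set) list => 'z => 'w => real" where
 "random_step es z ww = (\<Sum>(Z, a, S)\<leftarrow>es. Z ww * indicator S z)"

definition random_sum :: "('z set => 'w => real) => (('w => real) \<times> real \<times> 'z set) list => 'w => real" where
 "random_sum W es ww = (\<Sum>(Z, a, S)\<leftarrow>es. Z ww * W S ww)"

definition scale_random :: "real => (('w => real) \<times> real \<times> 'z set) list => (('w => real) \<times> real \<times> 'z set) list" where
 "scale_random r es = map (%(Z, a, S). (%ww. r * Z ww, a, S)) es"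

lemma random_step_simps [simp]:
 "random_step [] z ww = 0"
 "random_step ((Z, a, S) # es) z ww = Z ww * indicator S z + random_step es z ww"
 "random_step (es @ es') z ww = random_step es z ww + random_step es' z ww"
 by (auto simp: random_step_def)

lemma random_sum_simps [simp]:
 "random_sum W [] ww = 0"
 "random_sum W ((Z, a, S) # es) ww = Z ww * W S ww + random_sum W es ww"
 "random_sum W (es @ es') ww = random_sum W es ww + random_sum W es' ww"
 by (auto simp: random_sum_def)

lemma random_step_scale [simp]: "random_step (scale_random r es) z ww = r * random_step es z ww"
 by (induction es) (auto simp: scale_random_def algebra_simps)

lemma random_sum_scale [simp]: "random_sum W (scale_random r es) ww = r * random_sum W es ww"
 by (induction es) (auto simp: scale_random_def algebra_simps)

locale walsh_basis = gaussian_set_function M c W for M :: "'w measure" and c :: "'z measure" and W +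
 fixes F :: "real => 'w measure" and \<tau> :: "'z => real"
 assumes c_sigma_finite: "sigma_finite_measure c"
  and \<tau>_meas [measurable]: "\<tau> \<in> Bm c"
  and space_F: "\<And>r. space (F r) = space M"
  and F_sub: "\<And>r. sets (F r) \<subseteq> sets M"
  and F_mono: "\<And>r r'. r \<le> r' ==> sets (F r) \<subseteq> sets (F r')"
  and W_adapted: "\<And>r A. A \<in> fmeasurable c ==> (\<And>z. z \<in> A ==> \<tau> z \<le> r) ==> W A \<in> Bm (F r)"
  and W_future: "\<And>r. indep_set (sets (F r)) (generated_events M W {A \<in> fmeasurable c. \<forall>z\<in>A. r < \<tau> z})"
begin

lemma F_measurable_mono: "Z \<in> Bm (F r) ==> r \<le> r' ==> Z \<in> Bm (F r')"
 using F_mono[of r r'] by (auto simp: measurable_def space_F)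

lemma F_measurable_M: "Z \<in> Bm (F r) ==> Z \<in> Bm M"
 using F_sub[of r] by (auto simp: measurable_def space_F)

definition adapted_list :: "(('w => real) \<times> real \<times> 'z set) list => bool" where
 "adapted_list es \<longleftrightarrow> (\<forall>(Z, a, S)\<in>set es. Z \<in> Bm (F a) \<and> (\<exists>C. \<forall>ww\<in>space M. \<bar>Z ww\<bar> \<le> C) \<and>
   S \<in> fmeasurable c \<and> (\<forall>z\<in>S. a < \<tau> z))"

lemma adapted_list_simps [simp]:
 "adapted_list []"
 "adapted_list ((Z, a, S) # es) \<longleftrightarrow> Z \<in> Bm (F a) \<and> (\<exists>C. \<forall>ww\<in>space M. \<bar>Z ww\<bar> \<le> C) \<and>
   S \<in> fmeasurable c \<and> (\<forall>z\<in>S. a < \<tau> z) \<and> adapted_list es"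
 "adapted_list (es @ es') \<longleftrightarrow> adapted_list es \<and> adapted_list es'"
 by (simp_all add: adapted_list_def ball_Un)

lemma adapted_list_scale: "adapted_list es ==> adapted_list (scale_random r es)"
proof (induction es)
 case (Cons x es)
 obtain Z a S where x: "x = (Z, a, S)" by (cases x)
 from Cons(2) obtain C where C: "\<And>ww. ww \<in> space M ==> \<bar>Z ww\<bar> \<le> C" by (auto simp: x)
 have "\<bar>r * Z ww\<bar> \<le> \<bar>r\<bar> * C" if "ww \<in> space M" for ww using C[OF that] by (simp add: abs_mult mult_left_mono)
 then show ?case using Cons by (auto simp: x scale_random_def)
qed (simp add: scale_random_def)

lemma random_step_measurable:
 assumes "adapted_list es"
 shows "(%(z, ww). random_step es z ww) \<in> Bm (c \<Otimes>\<^sub>M M)"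
 using assms
proof (induction es)
 case (Cons x es)
 obtain Z a S where x: "x = (Z, a, S)" by (cases x)
 have [measurable]: "Z \<in> Bm M" "S \<in> sets c" using Cons(2) F_measurable_M by (auto simp: x)
 have es: "adapted_list es" using Cons(2) by (auto simp: x)
 note [measurable] = Cons(1)[OF es]
 have eq: "(%(z, ww). random_step (x # es) z ww) = (%y. Z (snd y) * indicator S (fst y) + (%(z, ww). random_step es z ww) y)"
  by (auto simp: x fun_eq_iff)
 show ?case unfolding eq by measurable
next
 case Nil
 have "(%(z, ww). random_step [] z ww) = (%_. 0)" by (auto simp: fun_eq_iff)
 then show ?case by simp
qed

lemma random_sum_measurable:
 assumes "adapted_list es"
 shows "random_sum W es \<in> Bm M"
 using assms
proof (induction es)
 case Nil
 have "random_sum W [] = (%_. 0)" by (simp add: fun_eq_iff)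
 then show ?case by simp
next
 case (Cons x es)
 obtain Z a S where x: "x = (Z, a, S)" by (cases x)
 have [measurable]: "Z \<in> Bm M" "W S \<in> Bm M" using Cons(2) F_measurable_M L_measurable by (auto simp: x)
 have es: "adapted_list es" using Cons(2) by (auto simp: x)
 note [measurable] = Cons(1)[OF es]
 have eq: "random_sum W (x # es) = (%ww. Z ww * W S ww + random_sum W es ww)" by (simp add: x fun_eq_iff)
 show ?case unfolding eq by measurable
qed

text \<open>Products of two noise values after time \<open>r\<close> are still measurable with
  respect to the noise after \<open>r\<close>, so the independence from \<open>F r\<close> applies
  to them as well as to single values.\<close>

lemma independent_of_past:
 assumes U: "U \<in> Bm (F r)" "integrable M U"
  and A: "A \<in> fmeasurable c" "\<And>z. z \<in> A ==> r < \<tau> z" and B: "B \<in> fmeasurable c" "\<And>z. z \<in> B ==> r < \<tau> z"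
 shows "integrable M (%ww. U ww * W A ww)" "(LINT ww|M. U ww * W A ww) = 0"
  and "integrable M (%ww. U ww * (W A ww * W B ww))" "(LINT ww|M. U ww * (W A ww * W B ww)) = (LINT ww|M. U ww) * measure c (A \<inter> B)"
proof -
 define I where "I = {A \<in> fmeasurable c. \<forall>z\<in>A. r < \<tau> z}"
 define G where "G = {W i -` D \<inter> space M |i D. i \<in> I \<and> D \<in> sets borel}"
 define N where "N = sigma (space M) G"
 have G: "G \<subseteq> Pow (space M)" by (auto simp: G_def)
 have sets_N: "sets N = generated_events M W I" and space_N: "space N = space M"
  using G by (auto simp: N_def generated_events_def G_def)
 have W_N: "W D \<in> Bm N" if "D \<in> I" for D
 proof (rule measurableI)
  fix E :: "real set" assume "E \<in> sets borel"
  then have "W D -` E \<inter> space M \<in> G" using that by (auto simp: G_def)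
  then show "W D -` E \<inter> space N \<in> sets N" using G by (auto simp: N_def)
 qed simp
 have AI: "A \<in> I" "B \<in> I" using A B by (auto simp: I_def)
 have [measurable]: "W A \<in> Bm N" "W B \<in> Bm N" using W_N AI by auto
 have indep: "indep_set (sets (F r)) (sets N)" unfolding sets_N I_def by (rule W_future)
 have iv: "indep_var borel U borel V" if "V \<in> Bm N" for V :: "'w => real"
  by (rule indep_var_subalgebras[OF space_F space_N indep U(1) that])
 have ivA: "indep_var borel U borel (W A)" by (rule iv) measurable
 show "integrable M (%ww. U ww * W A ww)" by (rule indep_var_integrable[OF ivA U(2) integrable_W[OF A(1)]])
 show "(LINT ww|M. U ww * W A ww) = 0"
  using indep_var_lebesgue_integral[OF ivA U(2) integrable_W[OF A(1)]] expectation_W[OF A(1)] by simp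
 have ivB: "indep_var borel U borel (%ww. W A ww * W B ww)" by (rule iv) measurable
 show "integrable M (%ww. U ww * (W A ww * W B ww))" by (rule indep_var_integrable[OF ivB U(2) integrable_W_mult[OF A(1) B(1)]])
 show "(LINT ww|M. U ww * (W A ww * W B ww)) = (LINT ww|M. U ww) * measure c (A \<inter> B)"
  using indep_var_lebesgue_integral[OF ivB U(2) integrable_W_mult[OF A(1) B(1)]] expectation_W_mult[OF A(1) B(1)] by simp
qed

text \<open>The later time \<open>a'\<close> is the one to condition on. The part of
  \<open>S\<close> up to \<open>a'\<close> is then known and is multiplied by the centred
  independent \<open>W S'\<close>; the part after \<open>a'\<close> is, together with
  \<open>S'\<close>, independent of both coefficients. This handles overlapping sets too.\<close>

lemma cross_term_ordered:
 assumes Z: "Z \<in> Bm (F a)" "\<And>ww. ww \<in> space M ==> \<bar>Z ww\<bar> \<le> C" and S: "S \<in> fmeasurable c" "\<And>z. z \<in> S ==> a < \<tau> z"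
  and Z': "Z' \<in> Bm (F a')" "\<And>ww. ww \<in> space M ==> \<bar>Z' ww\<bar> \<le> C'" and S': "S' \<in> fmeasurable c" "\<And>z. z \<in> S' ==> a' < \<tau> z"
  and le: "a \<le> a'"
 shows "integrable M (%ww. (Z ww * W S ww) * (Z' ww * W S' ww)) \<and>
  (LINT ww|M. (Z ww * W S ww) * (Z' ww * W S' ww)) = (LINT ww|M. Z ww * Z' ww) * measure c (S \<inter> S')"
proof -
 have ZF [measurable]: "Z \<in> Bm (F a')" "Z' \<in> Bm (F a')"
  by (rule F_measurable_mono[OF Z(1) le], rule Z'(1))
 have [measurable]: "Z \<in> Bm M" "Z' \<in> Bm M" by (rule F_measurable_M[OF Z(1)], rule F_measurable_M[OF Z'(1)])
 define T where "T = {z\<in>space c. \<tau> z \<le> a'}"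
 have T [measurable]: "T \<in> sets c" unfolding T_def by measurable
 have S1: "S \<inter> T \<in> fmeasurable c" and S2: "S - T \<in> fmeasurable c"
  using S T by (auto intro: fmeasurable_Int_fmeasurable fmeasurable_Diff)
 have Sspace: "S \<subseteq> space c" using S by (auto simp: fmeasurable_def dest: sets.sets_into_space)
 have W1 [measurable]: "W (S \<inter> T) \<in> Bm (F a')" by (rule W_adapted[OF S1]) (auto simp: T_def)
 have [measurable]: "W S \<in> Bm M" "W S' \<in> Bm M" "W (S \<inter> T) \<in> Bm M" "W (S - T) \<in> Bm M"
  using S S' S1 S2 L_measurable by auto
 have bound: "\<bar>Z ww * Z' ww\<bar> \<le> \<bar>C\<bar> * \<bar>C'\<bar>" if "ww \<in> space M" for ww
  unfolding abs_mult using Z(2)[OF that] Z'(2)[OF that] by (intro mult_mono) auto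
 have ZZ: "integrable M (%ww. Z ww * Z' ww)"
  using bound by (intro integrable_const_bound[where B="\<bar>C\<bar> * \<bar>C'\<bar>"]) auto
 have U1: "integrable M (%ww. Z ww * Z' ww * W (S \<inter> T) ww)"
 proof (rule Bochner_Integration.integrable_bound)
  show "integrable M (%ww. \<bar>C\<bar> * \<bar>C'\<bar> * W (S \<inter> T) ww)" using integrable_W[OF S1] by simp
  show "AE ww in M. norm (Z ww * Z' ww * W (S \<inter> T) ww) \<le> norm (\<bar>C\<bar> * \<bar>C'\<bar> * W (S \<inter> T) ww)"
   using bound by (intro AE_I2) (auto simp: abs_mult intro!: mult_right_mono)
 qed measurable
 have U1F: "(%ww. Z ww * Z' ww * W (S \<inter> T) ww) \<in> Bm (F a')" by measurable
 have U2F: "(%ww. Z ww * Z' ww) \<in> Bm (F a')" by measurable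
 note p1 = independent_of_past(1,2)[OF U1F U1 S' S']
 have S2': "\<And>z. z \<in> S - T ==> a' < \<tau> z" using Sspace by (auto simp: T_def)
 note p2 = independent_of_past(3,4)[OF U2F ZZ S2 S2' S']
 have eq: "AE ww in M. (Z ww * Z' ww * W (S \<inter> T) ww) * W S' ww + Z ww * Z' ww * (W (S - T) ww * W S' ww) =
   (Z ww * W S ww) * (Z' ww * W S' ww)"
  using L_split[OF S(1) T] by eventually_elim (simp add: algebra_simps)
 have int: "integrable M (%ww. (Z ww * Z' ww * W (S \<inter> T) ww) * W S' ww + Z ww * Z' ww * (W (S - T) ww * W S' ww))"
  by (intro Bochner_Integration.integrable_add p1(1) p2(1))
 have I: "integrable M (%ww. (Z ww * W S ww) * (Z' ww * W S' ww))"
  by (rule integrable_cong_AE_imp[OF int]) (measurable, rule eq)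
 have "(LINT ww|M. (Z ww * W S ww) * (Z' ww * W S' ww)) =
  (LINT ww|M. (Z ww * Z' ww * W (S \<inter> T) ww) * W S' ww + Z ww * Z' ww * (W (S - T) ww * W S' ww))"
  by (rule sym, rule integral_cong_AE) (measurable, rule eq)
 also have "... = 0 + (LINT ww|M. Z ww * Z' ww) * measure c ((S - T) \<inter> S')"
  using p1 p2 by (subst Bochner_Integration.integral_add) auto
 also have "(S - T) \<inter> S' = S \<inter> S'" using S' by (fastforce simp: T_def)
 finally show ?thesis using I by simp
qed

lemma cross_term:
 assumes Z: "Z \<in> Bm (F a)" "\<And>ww. ww \<in> space M ==> \<bar>Z ww\<bar> \<le> C" and S: "S \<in> fmeasurable c" "\<And>z. z \<in> S ==> a < \<tau> z"
  and Z': "Z' \<in> Bm (F a')" "\<And>ww. ww \<in> space M ==> \<bar>Z' ww\<bar> \<le> C'" and S': "S' \<in> fmeasurable c" "\<And>z. z \<in> S' ==> a' < \<tau> z"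
 shows "integrable M (%ww. (Z ww * W S ww) * (Z' ww * W S' ww)) \<and>
  (LINT ww|M. (Z ww * W S ww) * (Z' ww * W S' ww)) = (LINT ww|M. Z ww * Z' ww) * measure c (S \<inter> S')"
proof (cases "a \<le> a'")
 case True
 show ?thesis using cross_term_ordered[OF Z S Z' S' True] by blast
next
 case False
 then have "a' \<le> a" by simp
 with cross_term_ordered[OF Z' S' Z S] show ?thesis by (simp add: mult.commute Int_commute)
qed

text \<open>Both sides of the isometry are expanded into the bilinear form of the pairs of elementary terms.\<close>

lemma walsh_inner_product:
 assumes "adapted_list es" "adapted_list es'"
 shows "integrable M (%ww. random_sum W es ww * random_sum W es' ww) \<and>
  (\<forall>ww. integrable c (%z. random_step es z ww * random_step es' z ww)) \<and>
  integrable M (%ww. LINT z|c. random_step es z ww * random_step es' z ww) \<and>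
  (LINT ww|M. random_sum W es ww * random_sum W es' ww) = (LINT ww|M. LINT z|c. random_step es z ww * random_step es' z ww)"
 using assms(1)
proof (induction es)
 case Nil
 then show ?case by simp
next
 case (Cons x es)
 obtain Z a S where x: "x = (Z, a, S)" by (cases x)
 obtain C where Z: "Z \<in> Bm (F a)" "\<And>ww. ww \<in> space M ==> \<bar>Z ww\<bar> \<le> C" and S: "S \<in> fmeasurable c" "\<And>z. z \<in> S ==> a < \<tau> z"
  and es: "adapted_list es"
  using Cons(2) by (auto simp: x)
 have one: "integrable M (%ww. Z ww * W S ww * random_sum W es' ww) \<and>
  (\<forall>ww. integrable c (%z. Z ww * indicator S z * random_step es' z ww)) \<and>
  integrable M (%ww. LINT z|c. Z ww * indicator S z * random_step es' z ww) \<and>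
  (LINT ww|M. Z ww * W S ww * random_sum W es' ww) = (LINT ww|M. LINT z|c. Z ww * indicator S z * random_step es' z ww)"
  using assms(2)
 proof (induction es')
  case Nil
  then show ?case by simp
 next
  case (Cons y es')
  obtain Z' a' S' where y: "y = (Z', a', S')" by (cases y)
  obtain C' where Z': "Z' \<in> Bm (F a')" "\<And>ww. ww \<in> space M ==> \<bar>Z' ww\<bar> \<le> C'" and S': "S' \<in> fmeasurable c" "\<And>z. z \<in> S' ==> a' < \<tau> z"
   and es': "adapted_list es'"
   using Cons(2) by (auto simp: y)
  note ct = cross_term[OF Z S Z' S'] and IH = Cons(1)[OF es']
  have [measurable]: "Z \<in> Bm M" "Z' \<in> Bm M" by (rule F_measurable_M[OF Z(1)], rule F_measurable_M[OF Z'(1)])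
  have SS: "S \<inter> S' \<in> fmeasurable c" using S S' by (auto intro: fmeasurable_Int_fmeasurable)
  have iS: "integrable c (%z. Z ww * Z' ww * indicator (S \<inter> S') z)"
   and eS: "(LINT z|c. Z ww * Z' ww * indicator (S \<inter> S') z) = Z ww * Z' ww * measure c (S \<inter> S')" for ww
   using SS by (auto simp: fmeasurable_def Int_absorb2 sets.sets_into_space)
  have bound: "\<bar>Z ww * Z' ww\<bar> \<le> \<bar>C\<bar> * \<bar>C'\<bar>" if "ww \<in> space M" for ww
   unfolding abs_mult using Z(2)[OF that] Z'(2)[OF that] by (intro mult_mono) auto
  have ZZ: "integrable M (%ww. Z ww * Z' ww)"
   using bound by (intro integrable_const_bound[where B="\<bar>C\<bar> * \<bar>C'\<bar>"]) auto
  have eq1: "Z ww * W S ww * random_sum W (y # es') ww = (Z ww * W S ww) * (Z' ww * W S' ww) + Z ww * W S ww * random_sum W es' ww" for ww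
   by (simp add: y algebra_simps)
  have eq2: "Z ww * indicator S z * random_step (y # es') z ww = Z ww * Z' ww * indicator (S \<inter> S') z + Z ww * indicator S z * random_step es' z ww" for z ww
   by (auto simp: y algebra_simps split: split_indicator)
  have eq3: "(LINT z|c. Z ww * indicator S z * random_step (y # es') z ww) = Z ww * Z' ww * measure c (S \<inter> S') + (LINT z|c. Z ww * indicator S z * random_step es' z ww)" for ww
   unfolding eq2 using IH iS[of ww] by (subst Bochner_Integration.integral_add) (auto simp only: eS)
  show ?case
  proof (intro conjI allI)
   show "integrable M (%ww. Z ww * W S ww * random_sum W (y # es') ww)"
    unfolding eq1 using ct IH by (intro Bochner_Integration.integrable_add) auto
   show "integrable c (%z. Z ww * indicator S z * random_step (y # es') z ww)" for ww
    unfolding eq2 using IH iS by (intro Bochner_Integration.integrable_add) auto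
   show "integrable M (%ww. LINT z|c. Z ww * indicator S z * random_step (y # es') z ww)"
    unfolding eq3 using IH ZZ by (intro Bochner_Integration.integrable_add integrable_mult_left) auto
   show "(LINT ww|M. Z ww * W S ww * random_sum W (y # es') ww) = (LINT ww|M. LINT z|c. Z ww * indicator S z * random_step (y # es') z ww)"
    unfolding eq1 eq3 using ct IH ZZ by simp
  qed
 qed
 note IH = Cons(1)[OF es]
 have eq1: "random_sum W (x # es) ww * random_sum W es' ww = Z ww * W S ww * random_sum W es' ww + random_sum W es ww * random_sum W es' ww" for ww
  by (simp add: x algebra_simps)
 have eq2: "random_step (x # es) z ww * random_step es' z ww = Z ww * indicator S z * random_step es' z ww + random_step es z ww * random_step es' z ww" for z ww
  by (simp add: x algebra_simps)
 have eq3: "(LINT z|c. random_step (x # es) z ww * random_step es' z ww) = (LINT z|c. Z ww * indicator S z * random_step es' z ww) + (LINT z|c. random_step es z ww * random_step es' z ww)" for ww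
  unfolding eq2 using IH one by (intro Bochner_Integration.integral_add) auto
 show ?case
 proof (intro conjI allI)
  show "integrable M (%ww. random_sum W (x # es) ww * random_sum W es' ww)"
   unfolding eq1 using one IH by (intro Bochner_Integration.integrable_add) auto
  show "integrable c (%z. random_step (x # es) z ww * random_step es' z ww)" for ww
   unfolding eq2 using one IH by (intro Bochner_Integration.integrable_add) auto
  show "integrable M (%ww. LINT z|c. random_step (x # es) z ww * random_step es' z ww)"
   unfolding eq3 using one IH by (intro Bochner_Integration.integrable_add) auto
  show "(LINT ww|M. random_sum W (x # es) ww * random_sum W es' ww) = (LINT ww|M. LINT z|c. random_step (x # es) z ww * random_step es' z ww)"
   unfolding eq1 eq3 using one IH by simp
 qed
qed

lemma walsh_isometry:
 assumes es: "adapted_list es"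
 shows "(nI M (%ww. en ((random_sum W es ww)\<^sup>2))) = (nI M (%ww. nI c (%z. en ((random_step es z ww)\<^sup>2))))"
proof -
 note ip = walsh_inner_product[OF es es]
 have "(nI M (%ww. en ((random_sum W es ww)\<^sup>2))) = en (LINT ww|M. random_sum W es ww * random_sum W es ww)"
  using ip unfolding power2_eq_square by (intro nn_integral_eq_integral) auto
 also have "... = en (LINT ww|M. LINT z|c. random_step es z ww * random_step es z ww)" using ip by simp
 also have "... = (nI M (%ww. en (LINT z|c. random_step es z ww * random_step es z ww)))"
  using ip by (intro nn_integral_eq_integral[symmetric] AE_I2 integral_nonneg_AE) auto
 also have "... = (nI M (%ww. nI c (%z. en ((random_step es z ww)\<^sup>2))))"
  using ip unfolding power2_eq_square by (intro nn_integral_cong nn_integral_eq_integral[symmetric]) auto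
 finally show ?thesis .
qed

end

section \<open>Mean square limits of Walsh sums\<close>

text \<open>Expanding a square gives \<open>2 * \<bar>x * y\<bar> \<le> x^2 / e + e * y^2\<close>.
  The free weight \<open>e\<close> stands in for the Cauchy-Schwarz inequality and stays meaningful
  for infinite integrals.\<close>

lemma nn_integral_abs_le_square:
 fixes x :: "'a => real" and y :: "'a => real"
 assumes [measurable]: "x \<in> Bm N" "y \<in> Bm N" and e: "0 < e"
 shows "(nI N (%t. en \<bar>x t * y t\<bar>)) \<le> ennreal (1 / e) * (nI N (%t. en ((x t)\<^sup>2))) + en e * (nI N (%t. en ((y t)\<^sup>2)))"
proof -
 have "(nI N (%t. en \<bar>x t * y t\<bar>)) \<le> (nI N (%t. en (1 / e) * en ((x t)\<^sup>2) + en e * en ((y t)\<^sup>2)))"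
 proof (rule nn_integral_mono)
  fix t
  define r where "r = sqrt e"
  have r: "0 < r" "r * r = e" using e by (simp_all add: r_def)
  have "0 \<le> (\<bar>x t\<bar> / r - r * \<bar>y t\<bar>)\<^sup>2" by simp
  also have "... = (x t)\<^sup>2 / e + e * (y t)\<^sup>2 - 2 * \<bar>x t * y t\<bar>"
  proof -
   have "(\<bar>x t\<bar> / r - r * \<bar>y t\<bar>)\<^sup>2 = \<bar>x t\<bar>\<^sup>2 / (r * r) + (r * r) * \<bar>y t\<bar>\<^sup>2 - 2 * (\<bar>x t\<bar> * \<bar>y t\<bar>)"
    using r(1) by (simp add: power2_eq_square field_simps)
   then show ?thesis by (simp add: r(2) abs_mult)
  qed
  finally have "2 * \<bar>x t * y t\<bar> \<le> (x t)\<^sup>2 / e + e * (y t)\<^sup>2" by simp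
  then have "\<bar>x t * y t\<bar> \<le> 1 / e * (x t)\<^sup>2 + e * (y t)\<^sup>2" by simp
  then have "en \<bar>x t * y t\<bar> \<le> ennreal (1 / e * (x t)\<^sup>2 + e * (y t)\<^sup>2)" by (rule ennreal_leI)
  also have "... = en (1 / e) * en ((x t)\<^sup>2) + en e * en ((y t)\<^sup>2)"
   using e by (simp add: ennreal_mult[symmetric] ennreal_plus[symmetric] del: ennreal_plus)
  finally show "en \<bar>x t * y t\<bar> \<le> ennreal (1 / e) * en ((x t)\<^sup>2) + en e * en ((y t)\<^sup>2)" .
 qed
 also have "... = en (1 / e) * (nI N (%t. en ((x t)\<^sup>2))) + en e * (nI N (%t. en ((y t)\<^sup>2)))"
  by (subst nn_integral_add) (simp_all add: nn_integral_cmult)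
 finally show ?thesis .
qed

text \<open>One factor vanishes in mean square and the other stays bounded: the weight
  \<open>e\<close> is fixed first to make the bounded term small, and the other term then tends to
  zero.\<close>

lemma mult_tendsto_0_mean:
 fixes x y :: "nat => 'a => real"
 assumes [measurable]: "\<And>n. x n \<in> Bm N" "\<And>n. y n \<in> Bm N"
  and x: "(%n. nI N (%t. en ((x n t)\<^sup>2))) \<longlonglongrightarrow> 0"
  and y: "\<forall>\<^sub>F n in sequentially. (nI N (%t. en ((y n t)\<^sup>2))) \<le> ennreal C" and C: "0 \<le> C"
 shows "(%n. nI N (%t. en \<bar>x n t * y n t\<bar>)) \<longlonglongrightarrow> 0"
proof (rule order_tendstoI)
 fix a :: ennreal assume "0 < a"
 then obtain q where q: "0 < q" "q < a" using dense by blast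
 then obtain b where b': "q = en b" "0 \<le> b" by (cases q) auto
 then have b: "0 < b" "en b < a" using q by (auto simp: less_le)
 \<comment> \<open>This weight leaves \<open>b / 4\<close> for the bounded factor; the vanishing
   factor eventually takes less than \<open>b / 2\<close>.\<close>
 define e where "e = b / (4 * (C + 1))"
 have e: "0 < e" using b C by (simp add: e_def)
 have eC: "e * C \<le> b / 4"
 proof -
  have "e * C \<le> e * (C + 1)" using e by simp
  also have "... = b / 4" using C by (simp add: e_def field_simps)
  finally show ?thesis .
 qed
 have "(%n. en (1 / e) * (nI N (%t. en ((x n t)\<^sup>2)))) \<longlonglongrightarrow> ennreal (1 / e) * 0"
  by (intro ennreal_tendsto_cmult x) simp
 then have "\<forall>\<^sub>F n in sequentially. en (1 / e) * (nI N (%t. en ((x n t)\<^sup>2))) < en (b / 2)"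
  using b(1) by (intro order_tendstoD(2)) auto
 then show "\<forall>\<^sub>F n in sequentially. (nI N (%t. en \<bar>x n t * y n t\<bar>)) < a"
  using y
 proof eventually_elim
  case (elim n)
  have "(nI N (%t. en \<bar>x n t * y n t\<bar>)) \<le> ennreal (1 / e) * (nI N (%t. en ((x n t)\<^sup>2))) + en e * (nI N (%t. en ((y n t)\<^sup>2)))"
   by (rule nn_integral_abs_le_square[OF _ _ e]) measurable
  also have "... \<le> ennreal (b / 2) + en e * en C"
   using elim by (intro add_mono mult_left_mono) auto
  also have "en e * en C = en (e * C)" using e C by (simp add: ennreal_mult)
  also have "en (b / 2) + en (e * C) = en (b / 2 + e * C)"
   using b e C by (simp add: ennreal_plus)
  also have "... \<le> ennreal b" using eC b by (intro ennreal_leI) simp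
  also have "... < a" by (rule b(2))
  finally show ?case .
 qed
qed simp

lemma square_tendsto_mean:
 fixes u :: "nat => 'a => real" and v :: "'a => real"
 assumes [measurable]: "\<And>n. u n \<in> Bm N" "v \<in> Bm N"
  and lim: "(%n. nI N (%t. en ((u n t - v t)\<^sup>2))) \<longlonglongrightarrow> 0"
  and v: "(nI N (%t. en ((v t)\<^sup>2))) < \<infinity>"
 shows "(%n. nI N (%t. en \<bar>(u n t)\<^sup>2 - (v t)\<^sup>2\<bar>)) \<longlonglongrightarrow> 0"
proof -
 obtain V where V: "(nI N (%t. en ((v t)\<^sup>2))) = en V" "0 \<le> V"
  using v by (cases "nI N (%t. en ((v t)\<^sup>2))") auto
 have "\<forall>\<^sub>F n in sequentially. (nI N (%t. en ((u n t - v t)\<^sup>2))) < en 1"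
  by (rule order_tendstoD(2)[OF lim]) simp
 \<comment> \<open>\<open>u + v\<close> is written as \<open>(u - v) + 2 * v\<close>. Its mean
   square is at most twice that of \<open>u - v\<close>, eventually below \<open>1\<close>, plus
   twice that of \<open>2 * v\<close>, hence \<open>2 + 8 * V\<close>.\<close>
 then have "\<forall>\<^sub>F n in sequentially. (nI N (%t. en ((u n t + v t)\<^sup>2))) \<le> ennreal (2 + 8 * V)"
 proof eventually_elim
  case (elim n)
  have "u n t + v t = (u n t - v t) + 2 * v t" for t by simp
  then have "(nI N (%t. en ((u n t + v t)\<^sup>2))) = (nI N (%t. en (((u n t - v t) + 2 * v t)\<^sup>2)))" by (simp only:)
  also have "... \<le> 2 * (nI N (%t. en ((u n t - v t)\<^sup>2))) + 2 * (nI N (%t. en ((2 * v t)\<^sup>2)))"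
   by (rule nn_integral_square_add_le) measurable
  also have "(nI N (%t. en ((2 * v t)\<^sup>2))) = en (4 * V)"
   using V by (simp add: power_mult_distrib ennreal_mult nn_integral_cmult)
  also have "2 * (nI N (%t. en ((u n t - v t)\<^sup>2))) + 2 * en (4 * V) \<le> 2 * en 1 + 2 * en (4 * V)"
   using elim by (intro add_right_mono mult_left_mono) auto
  also have "... = en (2 + 8 * V)"
  proof -
   have "2 * en 1 + 2 * en (4 * V) = en 2 * en 1 + en 2 * en (4 * V)" by simp
   also have "... = en (2 * 1) + en (2 * (4 * V))" using V(2) by (simp only: ennreal_mult[symmetric])
   also have "... = en (2 + 8 * V)" using V(2) by (subst ennreal_plus[symmetric]) simp_all
   finally show ?thesis .
  qed
  finally show ?case .
 qed
 then have "(%n. nI N (%t. en \<bar>(u n t - v t) * (u n t + v t)\<bar>)) \<longlonglongrightarrow> 0"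
  using V(2) by (intro mult_tendsto_0_mean[OF _ _ lim, where C="2 + 8 * V"]) auto
 moreover have "(u n t - v t) * (u n t + v t) = (u n t)\<^sup>2 - (v t)\<^sup>2" for n t
  by (simp add: power2_eq_square algebra_simps)
 ultimately show ?thesis by simp
qed

context walsh_basis
begin

text \<open>Predictability is weakened to joint measurability and the strips to arbitrary sets after
  the time of the coefficient. This larger class contains the sums over grid cells cut with other
  sets that occur later.\<close>

definition walsh_limit :: "('z => 'w => real) => ('w => real) => bool" where
 "walsh_limit f Y \<longleftrightarrow> (%(z, ww). f z ww) \<in> Bm (c \<Otimes>\<^sub>M M) \<and> Y \<in> Bm M \<and>
   (\<exists>es. (\<forall>n. adapted_list (es n)) \<and>
    (%n. nI M (%ww. nI c (%z. en ((random_step (es n) z ww - f z ww)\<^sup>2)))) \<longlonglongrightarrow> 0 \<and>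
    (%n. nI M (%ww. en ((random_sum W (es n) ww - Y ww)\<^sup>2))) \<longlonglongrightarrow> 0)"

lemma iterated_square_eq:
 assumes [measurable]: "(%(z, ww). g z ww) \<in> Bm (c \<Otimes>\<^sub>M M)"
 shows "(nI M (%ww. nI c (%z. en ((g z ww)\<^sup>2)))) = (nI (c \<Otimes>\<^sub>M M) (%y. en ((g (fst y) (snd y))\<^sup>2)))"
proof -
 interpret c: sigma_finite_measure c by (rule c_sigma_finite)
 interpret cM: pair_sigma_finite c M ..
 show ?thesis using cM.nn_integral_snd[of "%y. en ((g (fst y) (snd y))\<^sup>2)"] by simp
qed

lemma joint_measurable_diff:
 assumes "(%(z, ww). f z ww) \<in> Bm (c \<Otimes>\<^sub>M M)" "(%(z, ww). g z ww) \<in> Bm (c \<Otimes>\<^sub>M M)"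
 shows "(%(z, ww). f z ww - g z ww :: real) \<in> Bm (c \<Otimes>\<^sub>M M)"
proof -
 note [measurable] = assms
 show ?thesis by measurable
qed

lemma iterated_square_add_le:
 fixes f g :: "'z => 'w => real"
 assumes [measurable]: "(%(z, ww). f z ww) \<in> Bm (c \<Otimes>\<^sub>M M)" "(%(z, ww). g z ww) \<in> Bm (c \<Otimes>\<^sub>M M)"
 shows "(nI M (%ww. nI c (%z. en ((f z ww + g z ww)\<^sup>2)))) \<le>
  2 * (nI M (%ww. nI c (%z. en ((f z ww)\<^sup>2)))) + 2 * (nI M (%ww. nI c (%z. en ((g z ww)\<^sup>2))))"
proof -
 have m: "(%(z, ww). f z ww + g z ww) \<in> Bm (c \<Otimes>\<^sub>M M)" by measurable
 show ?thesis
  unfolding iterated_square_eq[OF m] iterated_square_eq[OF assms(1)] iterated_square_eq[OF assms(2)]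
  by (rule nn_integral_square_add_le) measurable
qed

lemma tendsto_0_double_sum:
 fixes a b :: "nat => ennreal"
 assumes "a \<longlonglongrightarrow> 0" "b \<longlonglongrightarrow> 0"
 shows "(%n. 2 * a n + 2 * b n) \<longlonglongrightarrow> 0"
proof -
 have "(%n. 2 * a n + 2 * b n) \<longlonglongrightarrow> 2 * 0 + 2 * 0"
  by (intro tendsto_add ennreal_tendsto_cmult assms) simp_all
 then show ?thesis by simp
qed

text \<open>By the isometry, two sequences approximating the same integrand have sums that approach
  each other, so the sequence of the definition can be exchanged for a more convenient one.\<close>

lemma walsh_limit_any_sequence:
 assumes Y: "walsh_limit f Y" and es: "\<And>n. adapted_list (es n)"
  and lim: "(%n. nI M (%ww. nI c (%z. en ((random_step (es n) z ww - f z ww)\<^sup>2)))) \<longlonglongrightarrow> 0"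
 shows "(%n. nI M (%ww. en ((random_sum W (es n) ww - Y ww)\<^sup>2))) \<longlonglongrightarrow> 0"
proof -
 have f: "(%(z, ww). f z ww) \<in> Bm (c \<Otimes>\<^sub>M M)" and [measurable]: "Y \<in> Bm M"
  using Y by (auto simp: walsh_limit_def)
 obtain ks where ks: "\<And>n. adapted_list (ks n)"
  and k1: "(%n. nI M (%ww. nI c (%z. en ((random_step (ks n) z ww - f z ww)\<^sup>2)))) \<longlonglongrightarrow> 0"
  and k2: "(%n. nI M (%ww. en ((random_sum W (ks n) ww - Y ww)\<^sup>2))) \<longlonglongrightarrow> 0"
  using Y by (auto simp: walsh_limit_def)
 note [measurable] = random_sum_measurable[OF es] random_sum_measurable[OF ks]
 have diff: "(%n. nI M (%ww. en ((random_sum W (es n) ww - random_sum W (ks n) ww)\<^sup>2))) \<longlonglongrightarrow> 0"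
 proof (rule tendsto_0_le_ennreal[OF always_eventually tendsto_0_double_sum[OF lim k1]], rule allI)
  fix n
  have ad: "adapted_list (es n @ scale_random (-1) (ks n))" using es ks adapted_list_scale by simp
  have "(nI M (%ww. en ((random_sum W (es n) ww - random_sum W (ks n) ww)\<^sup>2))) =
   (nI M (%ww. nI c (%z. en ((random_step (es n) z ww - random_step (ks n) z ww)\<^sup>2))))"
   using walsh_isometry[OF ad] by simp
  also have "... = (nI M (%ww. nI c (%z. en (((random_step (es n) z ww - f z ww) + (-1) * (random_step (ks n) z ww - f z ww))\<^sup>2))))"
   by simp
  also have "... \<le> 2 * (nI M (%ww. nI c (%z. en ((random_step (es n) z ww - f z ww)\<^sup>2)))) +
    2 * (nI M (%ww. nI c (%z. en (((-1) * (random_step (ks n) z ww - f z ww))\<^sup>2))))"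
  proof (rule iterated_square_add_le)
   show "(%(z, ww). random_step (es n) z ww - f z ww) \<in> Bm (c \<Otimes>\<^sub>M M)"
    by (rule joint_measurable_diff[OF random_step_measurable[OF es] f])
   have [measurable]: "(%(z, ww). random_step (ks n) z ww - f z ww) \<in> Bm (c \<Otimes>\<^sub>M M)"
    by (rule joint_measurable_diff[OF random_step_measurable[OF ks] f])
   show "(%(z, ww). (-1) * (random_step (ks n) z ww - f z ww)) \<in> Bm (c \<Otimes>\<^sub>M M)" by measurable
  qed
  finally show "(nI M (%ww. en ((random_sum W (es n) ww - random_sum W (ks n) ww)\<^sup>2))) \<le>
   2 * (nI M (%ww. nI c (%z. en ((random_step (es n) z ww - f z ww)\<^sup>2)))) +
   2 * (nI M (%ww. nI c (%z. en ((random_step (ks n) z ww - f z ww)\<^sup>2))))" by (simp only: power_mult_distrib) simp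
 qed
 show ?thesis
 proof (rule tendsto_0_le_ennreal[OF always_eventually tendsto_0_double_sum[OF diff k2]], rule allI)
  fix n
  have "(nI M (%ww. en ((random_sum W (es n) ww - Y ww)\<^sup>2))) =
   (nI M (%ww. en (((random_sum W (es n) ww - random_sum W (ks n) ww) + (random_sum W (ks n) ww - Y ww))\<^sup>2)))" by simp
  also have "... \<le> 2 * (nI M (%ww. en ((random_sum W (es n) ww - random_sum W (ks n) ww)\<^sup>2))) + 2 * (nI M (%ww. en ((random_sum W (ks n) ww - Y ww)\<^sup>2)))"
   by (rule nn_integral_square_add_le) measurable
  finally show "(nI M (%ww. en ((random_sum W (es n) ww - Y ww)\<^sup>2))) \<le>
   2 * (nI M (%ww. en ((random_sum W (es n) ww - random_sum W (ks n) ww)\<^sup>2))) + 2 * (nI M (%ww. en ((random_sum W (ks n) ww - Y ww)\<^sup>2)))" .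
 qed
qed

lemma walsh_limit_zero: "walsh_limit (%z ww. 0) (%ww. 0)"
 unfolding walsh_limit_def by (auto intro!: exI[of _ "%n. []"])

lemma walsh_limit_add_scale:
 assumes Y: "walsh_limit f Y" and X: "walsh_limit g X"
 shows "walsh_limit (%z ww. f z ww + a * g z ww) (%ww. Y ww + a * X ww)"
proof -
 have f: "(%(z, ww). f z ww) \<in> Bm (c \<Otimes>\<^sub>M M)" and [measurable]: "Y \<in> Bm M"
  using Y by (auto simp: walsh_limit_def)
 have g: "(%(z, ww). g z ww) \<in> Bm (c \<Otimes>\<^sub>M M)" and [measurable]: "X \<in> Bm M"
  using X by (auto simp: walsh_limit_def)
 obtain es where es: "\<And>n. adapted_list (es n)"
  and e1: "(%n. nI M (%ww. nI c (%z. en ((random_step (es n) z ww - f z ww)\<^sup>2)))) \<longlonglongrightarrow> 0"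
  and e2: "(%n. nI M (%ww. en ((random_sum W (es n) ww - Y ww)\<^sup>2))) \<longlonglongrightarrow> 0"
  using Y by (auto simp: walsh_limit_def)
 obtain ks where ks: "\<And>n. adapted_list (ks n)"
  and k1: "(%n. nI M (%ww. nI c (%z. en ((random_step (ks n) z ww - g z ww)\<^sup>2)))) \<longlonglongrightarrow> 0"
  and k2: "(%n. nI M (%ww. en ((random_sum W (ks n) ww - X ww)\<^sup>2))) \<longlonglongrightarrow> 0"
  using X by (auto simp: walsh_limit_def)
 note [measurable] = random_sum_measurable[OF es] random_sum_measurable[OF ks] f g random_step_measurable[OF es] random_step_measurable[OF ks]
 let ?l = "%n. es n @ scale_random a (ks n)"
 have sc: "(%n. en (a\<^sup>2) * b n) \<longlonglongrightarrow> 0" if "b \<longlonglongrightarrow> 0" for b :: "nat => ennreal"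
  using ennreal_tendsto_cmult[OF _ that, of "en (a\<^sup>2)"] by simp
 show ?thesis
  unfolding walsh_limit_def
 proof (intro conjI exI[of _ ?l] allI)
  show "(%(z, ww). f z ww + a * g z ww) \<in> Bm (c \<Otimes>\<^sub>M M)" by measurable
  show "(%ww. Y ww + a * X ww) \<in> Bm M" by measurable
  show "adapted_list (?l n)" for n using es ks adapted_list_scale by simp
  show "(%n. nI M (%ww. nI c (%z. en ((random_step (?l n) z ww - (f z ww + a * g z ww))\<^sup>2)))) \<longlonglongrightarrow> 0"
  proof (rule tendsto_0_le_ennreal[OF always_eventually tendsto_0_double_sum[OF e1 sc[OF k1]]], rule allI)
   fix n
   have m1: "(%(z, ww). random_step (es n) z ww - f z ww) \<in> Bm (c \<Otimes>\<^sub>M M)" by measurable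
   have m2: "(%(z, ww). random_step (ks n) z ww - g z ww) \<in> Bm (c \<Otimes>\<^sub>M M)" by measurable
   have m3: "(%(z, ww). a * (random_step (ks n) z ww - g z ww)) \<in> Bm (c \<Otimes>\<^sub>M M)" by measurable
   have "random_step (?l n) z ww - (f z ww + a * g z ww) = (random_step (es n) z ww - f z ww) + a * (random_step (ks n) z ww - g z ww)" for z ww
    by (simp add: algebra_simps)
   then have "(nI M (%ww. nI c (%z. en ((random_step (?l n) z ww - (f z ww + a * g z ww))\<^sup>2)))) \<le>
    2 * (nI M (%ww. nI c (%z. en ((random_step (es n) z ww - f z ww)\<^sup>2)))) +
    2 * (nI M (%ww. nI c (%z. en ((a * (random_step (ks n) z ww - g z ww))\<^sup>2))))"
    using iterated_square_add_le[OF m1 m3] by (simp only:)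
   also have "(nI M (%ww. nI c (%z. en ((a * (random_step (ks n) z ww - g z ww))\<^sup>2)))) =
    en (a\<^sup>2) * (nI M (%ww. nI c (%z. en ((random_step (ks n) z ww - g z ww)\<^sup>2))))"
    unfolding iterated_square_eq[OF m3] iterated_square_eq[OF m2]
    by (simp only: power_mult_distrib ennreal_mult zero_le_power2) (rule nn_integral_cmult, measurable)
   finally show "(nI M (%ww. nI c (%z. en ((random_step (?l n) z ww - (f z ww + a * g z ww))\<^sup>2)))) \<le>
    2 * (nI M (%ww. nI c (%z. en ((random_step (es n) z ww - f z ww)\<^sup>2)))) +
    2 * (en (a\<^sup>2) * (nI M (%ww. nI c (%z. en ((random_step (ks n) z ww - g z ww)\<^sup>2)))))" .
  qed
  show "(%n. nI M (%ww. en ((random_sum W (?l n) ww - (Y ww + a * X ww))\<^sup>2))) \<longlonglongrightarrow> 0"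
  proof (rule tendsto_0_le_ennreal[OF always_eventually tendsto_0_double_sum[OF e2 sc[OF k2]]], rule allI)
   fix n
   have "random_sum W (?l n) ww - (Y ww + a * X ww) = (random_sum W (es n) ww - Y ww) + a * (random_sum W (ks n) ww - X ww)" for ww
    by (simp add: algebra_simps)
   then have "(nI M (%ww. en ((random_sum W (?l n) ww - (Y ww + a * X ww))\<^sup>2))) =
    (nI M (%ww. en (((random_sum W (es n) ww - Y ww) + a * (random_sum W (ks n) ww - X ww))\<^sup>2)))"
    by (simp only:)
   also have "... \<le> 2 * (nI M (%ww. en ((random_sum W (es n) ww - Y ww)\<^sup>2))) + 2 * (nI M (%ww. en ((a * (random_sum W (ks n) ww - X ww))\<^sup>2)))"
    by (rule nn_integral_square_add_le) measurable
   also have "(nI M (%ww. en ((a * (random_sum W (ks n) ww - X ww))\<^sup>2))) = en (a\<^sup>2) * (nI M (%ww. en ((random_sum W (ks n) ww - X ww)\<^sup>2)))"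
    by (simp only: power_mult_distrib ennreal_mult zero_le_power2) (rule nn_integral_cmult, measurable)
   finally show "(nI M (%ww. en ((random_sum W (?l n) ww - (Y ww + a * X ww))\<^sup>2))) \<le>
    2 * (nI M (%ww. en ((random_sum W (es n) ww - Y ww)\<^sup>2))) + 2 * (en (a\<^sup>2) * (nI M (%ww. en ((random_sum W (ks n) ww - X ww)\<^sup>2))))" .
  qed
 qed
qed

text \<open>The empty list already approximates an integrand of mean square zero.\<close>

lemma walsh_limit_eq_0:
 assumes Y: "walsh_limit f Y" and f: "(nI M (%ww. nI c (%z. en ((f z ww)\<^sup>2)))) = 0"
 shows "AE ww in M. Y ww = 0"
proof -
 have [measurable]: "Y \<in> Bm M" using Y by (auto simp: walsh_limit_def)
 have "(%n. nI M (%ww. en ((random_sum W [] ww - Y ww)\<^sup>2))) \<longlonglongrightarrow> 0"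
  by (rule walsh_limit_any_sequence[OF Y]) (simp_all add: f)
 then have "(nI M (%ww. en ((Y ww)\<^sup>2))) = 0" by (simp add: LIMSEQ_const_iff)
 then have "AE ww in M. en ((Y ww)\<^sup>2) = 0" by (subst (asm) nn_integral_0_iff_AE) auto
 then show ?thesis by eventually_elim simp
qed

end

section \<open>Freezing the volatility\<close>

locale independent_walsh_basis = walsh_basis M c W F \<tau> for M :: "'w measure" and c :: "'z measure" and W F \<tau> +
 fixes N :: "'w measure"
 assumes space_N: "space N = space M"
  and indep_N: "indep_set (sets N) (generated_events M W (fmeasurable c))"
begin

text \<open>Adaptedness is kept for the isometry; measurability with respect to \<open>N\<close>
  allows conditioning on the volatility.\<close>

definition frozen_list :: "(('w => real) \<times> real \<times> 'z set) list => bool" where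
 "frozen_list es \<longleftrightarrow> adapted_list es \<and> (\<forall>(Z, a, S)\<in>set es. Z \<in> Bm N)"

lemma frozen_list_simps [simp]:
 "frozen_list []"
 "frozen_list ((Z, a, S) # es) \<longleftrightarrow> Z \<in> Bm N \<and> adapted_list [(Z, a, S)] \<and> frozen_list es"
 "frozen_list (es @ es') \<longleftrightarrow> frozen_list es \<and> frozen_list es'"
 by (auto simp: frozen_list_def ball_Un)

lemma frozen_list_scale: "frozen_list es ==> frozen_list (scale_random r es)"
 unfolding frozen_list_def using adapted_list_scale[of es r] by (auto simp: scale_random_def)

definition coefficients :: "(('w => real) \<times> real \<times> 'z set) list => 'w => (real \<times> 'z set) list" where
 "coefficients es ww = map (%(Z, a, S). (Z ww, S)) es"

lemma coefficients_eq:
 "set_sum W (coefficients es ww) ww' = (\<Sum>(Z, a, S)\<leftarrow>es. Z ww * W S ww')"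
 "step_fun (coefficients es ww) z = random_step es z ww"
 by (induction es) (auto simp: coefficients_def)

lemma fm_coefficients: "adapted_list es ==> fm_list c (coefficients es ww)"
 by (induction es) (auto simp: coefficients_def)

text \<open>Independence makes the joint law of two copies of the sample point, one seen through the
  volatility and one through the noise, a product law. For fixed coefficients the inner integral is
  the Gaussian characteristic function of a deterministic list.\<close>

lemma char_random_sum:
 assumes es: "frozen_list es"
 shows "(CLINT ww|M. exp (\<i> * random_sum W es ww)) =
   (CLINT ww|M. exp (- cor ((LINT z|c. (random_step es z ww)\<^sup>2) / 2)))"
proof -
 define G where "G = {W i -` D \<inter> space M |i D. i \<in> fmeasurable c \<and> D \<in> sets borel}"
 define NW where "NW = sigma (space M) G"
 have G: "G \<subseteq> Pow (space M)" by (auto simp: G_def)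
 have sets_NW: "sets NW = generated_events M W (fmeasurable c)" and space_NW: "space NW = space M"
  using G by (auto simp: NW_def generated_events_def G_def)
 have W_NW: "W D \<in> Bm NW" if "D \<in> fmeasurable c" for D
 proof (rule measurableI)
  fix E :: "real set" assume "E \<in> sets borel"
  then have "W D -` E \<inter> space M \<in> G" using that by (auto simp: G_def)
  then show "W D -` E \<inter> space NW \<in> sets NW" using G by (auto simp: NW_def)
 qed simp
 have iv: "indep_var N (%ww. ww) NW (%ww. ww)"
  by (rule indep_var_subalgebras[OF space_N space_NW]) (use indep_N in \<open>simp_all add: sets_NW\<close>)
 have rv [measurable]: "(%ww. ww) \<in> measurable M N" "(%ww. ww) \<in> measurable M NW"
  using indep_var_rv1[OF iv] indep_var_rv2[OF iv] by auto
 \<comment> \<open>The diagonal map into the product of the two coarser sigma-algebras has a product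
   law, so the integrand is written below as a function of two sample points.\<close>
 have eq: "distr M N (%ww. ww) \<Otimes>\<^sub>M distr M NW (%ww. ww) = distr M (N \<Otimes>\<^sub>M NW) (%ww. (ww, ww))"
  using iv unfolding indep_var_distribution_eq by blast
 interpret D1: prob_space "distr M N (%ww. ww)" by (rule prob_space_distr) measurable
 interpret D2: prob_space "distr M NW (%ww. ww)" by (rule prob_space_distr) measurable
 interpret D: pair_prob_space "distr M N (%ww. ww)" "distr M NW (%ww. ww)" ..
 let ?\<phi> = "%y. exp (\<i> * cor (set_sum W (coefficients es (fst y)) (snd y)))"
 have sum_meas: "(%y. set_sum W (coefficients es (fst y)) (snd y)) \<in> Bm (N \<Otimes>\<^sub>M NW)"
  using es
 proof (induction es)
  case Nil
  then show ?case by (simp add: coefficients_def)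
 next
  case (Cons x es)
  obtain Z a S where x: "x = (Z, a, S)" by (cases x)
  have [measurable]: "Z \<in> Bm N" "W S \<in> Bm NW"
   "(%y. set_sum W (coefficients es (fst y)) (snd y)) \<in> Bm (N \<Otimes>\<^sub>M NW)"
   using Cons W_NW by (auto simp: x)
  have "(%y. Z (fst y) * W S (snd y) + set_sum W (coefficients es (fst y)) (snd y)) \<in> Bm (N \<Otimes>\<^sub>M NW)"
   by measurable
  then show ?case by (simp add: x coefficients_def)
 qed
 then have \<phi>_meas [measurable]: "?\<phi> \<in> Bm (N \<Otimes>\<^sub>M NW)" by measurable
 have pm: "?\<phi> \<in> Bm (distr M N (%ww. ww) \<Otimes>\<^sub>M distr M NW (%ww. ww))"
  by (simp cong: measurable_cong_sets)
 have "(CLINT ww|M. exp (\<i> * random_sum W es ww)) = (CLINT ww|M. ?\<phi> (ww, ww))"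
  by (simp add: random_sum_def coefficients_eq)
 also have "... = (CLINT y|(distr M (N \<Otimes>\<^sub>M NW) (%ww. (ww, ww))). ?\<phi> y)"
  by (subst integral_distr) auto
 also have "... = (CLINT y|(distr M N (%ww. ww) \<Otimes>\<^sub>M distr M NW (%ww. ww)). ?\<phi> y)" by (simp only: eq)
 also have "... = (CLINT ww|(distr M N (%ww. ww)). (CLINT ww'|(distr M NW (%ww. ww)). ?\<phi> (ww, ww')))"
  by (rule D.integral_fst'[symmetric], rule D.P.integrable_const_bound[where B=1]) (use pm in auto)
 also have "... = (CLINT ww|(distr M N (%ww. ww)). exp (- cor ((LINT z|c. (random_step es z ww)\<^sup>2) / 2)))"
 proof (rule Bochner_Integration.integral_cong[OF refl])
  fix ww assume "ww \<in> space (distr M N (%ww. ww))"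
  then have [measurable]: "ww \<in> space N" by simp
  have "(CLINT ww'|(distr M NW (%ww. ww)). ?\<phi> (ww, ww')) = (CLINT ww'|M. ?\<phi> (ww, ww'))"
  proof (subst integral_distr)
   show "(%ww'. ?\<phi> (ww, ww')) \<in> Bm NW" by (rule measurable_Pair2[OF \<phi>_meas]) fact
  qed auto
  also have "... = exp (- cor ((LINT z|c. (random_step es z ww)\<^sup>2) / 2))"
   using char_set_sum[OF fm_coefficients, of es ww] es by (simp add: coefficients_eq(2) frozen_list_def)
  finally show "(CLINT ww'|(distr M NW (%ww. ww)). ?\<phi> (ww, ww')) = exp (- cor ((LINT z|c. (random_step es z ww)\<^sup>2) / 2))" .
 qed
 also have "... = (CLINT ww|M. exp (- cor ((LINT z|c. (random_step es z ww)\<^sup>2) / 2)))"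
 proof (rule integral_distr[OF rv(1)])
  interpret c: sigma_finite_measure c by (rule c_sigma_finite)
  have "(%(ww, z). random_step es z ww) \<in> Bm (N \<Otimes>\<^sub>M c)"
   using es
  proof (induction es)
   case Nil
   have "(%(ww, z). random_step [] z ww) = (%_. 0)" by (auto simp: fun_eq_iff)
   then show ?case by simp
  next
   case (Cons x es)
   obtain Z a S where x: "x = (Z, a, S)" by (cases x)
   have [measurable]: "Z \<in> Bm N" "S \<in> sets c" using Cons(2) by (auto simp: x)
   have es: "frozen_list es" using Cons(2) by (auto simp: x)
   note [measurable] = Cons(1)[OF es]
   have eq: "(%(ww, z). random_step (x # es) z ww) = (%y. Z (fst y) * indicator S (snd y) + (%(ww, z). random_step es z ww) y)"
    by (auto simp: x fun_eq_iff)
   show ?case unfolding eq by measurable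
  qed
  then have "(%(ww, z). (random_step es z ww)\<^sup>2) \<in> Bm (N \<Otimes>\<^sub>M c)" by measurable
  from c.borel_measurable_lebesgue_integral[OF this]
  have [measurable]: "(%ww. LINT z|c. (random_step es z ww)\<^sup>2) \<in> Bm N" .
  show "(%ww. exp (- cor ((LINT z|c. (random_step es z ww)\<^sup>2) / 2))) \<in> Bm N" by measurable
 qed
 finally show ?thesis .
qed

text \<open>Convergence in mean square gives convergence in mean of the sums and of the squared
  integrands, and both exponentials are Lipschitz where they are evaluated.\<close>

lemma char_walsh_limit:
 assumes Y: "walsh_limit f Y" and f2: "(nI M (%ww. nI c (%z. en ((f z ww)\<^sup>2)))) < \<infinity>"
  and es: "\<And>n::nat. frozen_list (es n)"
  and lim: "(%n. nI M (%ww. nI c (%z. en ((random_step (es n) z ww - f z ww)\<^sup>2)))) \<longlonglongrightarrow> 0"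
 shows "(CLINT ww|M. exp (\<i> * Y ww)) = (CLINT ww|M. exp (- cor ((LINT z|c. (f z ww)\<^sup>2) / 2)))"
proof -
 interpret c: sigma_finite_measure c by (rule c_sigma_finite)
 interpret cM: pair_sigma_finite c M ..
 have ad: "adapted_list (es n)" for n using es by (simp add: frozen_list_def)
 have f: "(%(z, ww). f z ww) \<in> Bm (c \<Otimes>\<^sub>M M)" and [measurable]: "Y \<in> Bm M"
  using Y by (auto simp: walsh_limit_def)
 note [measurable] = f random_step_measurable[OF ad] random_sum_measurable[OF ad]
 have "(%n. nI M (%ww. en \<bar>(random_sum W (es n) ww - Y ww) * 1\<bar>)) \<longlonglongrightarrow> 0"
  by (rule mult_tendsto_0_mean[OF _ _ walsh_limit_any_sequence[OF Y ad lim], where C=1])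
    (auto simp: emeasure_space_1)
 then have L1: "(%n. nI M (%ww. en \<bar>random_sum W (es n) ww - Y ww\<bar>)) \<longlonglongrightarrow> 0" by simp
 have conv1: "(%n. CLINT ww|M. exp (\<i> * random_sum W (es n) ww)) \<longlonglongrightarrow> (CLINT ww|M. exp (\<i> * Y ww))"
 proof (rule tendsto_L1_int)
  show "integrable M (%ww. exp (\<i> * cor (random_sum W (es n) ww)))" for n
   by (intro integrable_const_bound[where B=1]) auto
  show "integrable M (%ww. exp (\<i> * cor (Y ww)))"
   by (intro integrable_const_bound[where B=1]) auto
  have le: "norm (exp (\<i> * cor x) - exp (\<i> * cor y)) \<le> \<bar>x - y\<bar>" for x y
  proof -
   have "norm (exp (\<i> * cor x) - exp (\<i> * cor y)) \<le> norm (\<i> * cor x - \<i> * cor y)"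
    by (rule norm_exp_diff_le) auto
   also have "\<i> * cor x - \<i> * cor y = \<i> * cor (x - y)" by (simp add: right_diff_distrib)
   finally show ?thesis by (simp only: norm_mult norm_of_real norm_ii mult_1)
  qed
  show "(%n. nI M (%ww. en (norm (exp (\<i> * cor (random_sum W (es n) ww)) - exp (\<i> * cor (Y ww)))))) \<longlonglongrightarrow> 0"
   by (rule tendsto_0_le_ennreal[OF always_eventually L1]) (intro allI nn_integral_mono ennreal_leI le)
 qed
 have f2': "(nI (c \<Otimes>\<^sub>M M) (%y. en ((f (fst y) (snd y))\<^sup>2))) < \<infinity>" using f2 unfolding iterated_square_eq[OF f] .
 have "(%n. nI (c \<Otimes>\<^sub>M M) (%y. en ((random_step (es n) (fst y) (snd y) - f (fst y) (snd y))\<^sup>2))) \<longlonglongrightarrow> 0"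
  using lim unfolding iterated_square_eq[OF joint_measurable_diff[OF random_step_measurable[OF ad] f]] .
 then have "(%n. nI (c \<Otimes>\<^sub>M M) (%y. en \<bar>(random_step (es n) (fst y) (snd y))\<^sup>2 - (f (fst y) (snd y))\<^sup>2\<bar>)) \<longlonglongrightarrow> 0"
  by (intro square_tendsto_mean f2') measurable
 moreover have "(nI (c \<Otimes>\<^sub>M M) (%y. en \<bar>(random_step (es n) (fst y) (snd y))\<^sup>2 - (f (fst y) (snd y))\<^sup>2\<bar>)) =
   (nI M (%ww. nI c (%z. en \<bar>(random_step (es n) z ww)\<^sup>2 - (f z ww)\<^sup>2\<bar>)))" for n
  using cM.nn_integral_snd[of "%y. en \<bar>(random_step (es n) (fst y) (snd y))\<^sup>2 - (f (fst y) (snd y))\<^sup>2\<bar>"] by simp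
 ultimately have L1': "(%n. nI M (%ww. nI c (%z. en \<bar>(random_step (es n) z ww)\<^sup>2 - (f z ww)\<^sup>2\<bar>))) \<longlonglongrightarrow> 0" by simp
 have f_AE: "AE ww in M. integrable c (%z. (f z ww)\<^sup>2)"
 proof -
  have "AE ww in M. (nI c (%z. en ((f z ww)\<^sup>2))) \<noteq> \<infinity>"
   using f2 by (intro nn_integral_PInf_AE) auto
  then show ?thesis
   by (rule AE_mp) (intro AE_I2 impI integrableI_bounded, auto simp: top.not_eq_extremum)
 qed
 have es_int: "integrable c (%z. (random_step (es n) z ww)\<^sup>2)" for n ww
  using integrable_step_fun_square[OF fm_coefficients[OF ad[of n], of ww]] by (simp add: coefficients_eq(2))
 have m1: "(%ww. LINT z|c. (random_step (es n) z ww)\<^sup>2) \<in> Bm M" for n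
 proof (rule c.borel_measurable_lebesgue_integral)
  show "(%(ww, z). (random_step (es n) z ww)\<^sup>2) \<in> Bm (M \<Otimes>\<^sub>M c)" by measurable
 qed
 have m2: "(%ww. LINT z|c. (f z ww)\<^sup>2) \<in> Bm M"
 proof (rule c.borel_measurable_lebesgue_integral)
  show "(%(ww, z). (f z ww)\<^sup>2) \<in> Bm (M \<Otimes>\<^sub>M c)" by measurable
 qed
 note [measurable] = m1 m2
 have conv2: "(%n. CLINT ww|M. exp (- cor ((LINT z|c. (random_step (es n) z ww)\<^sup>2) / 2))) \<longlonglongrightarrow>
   (CLINT ww|M. exp (- cor ((LINT z|c. (f z ww)\<^sup>2) / 2)))"
 proof (rule tendsto_L1_int)
  have nn: "0 \<le> (LINT z|c. (g z)\<^sup>2)" for g :: "'z => real" by (intro integral_nonneg_AE) auto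
  have n1: "norm (exp (- cor ((LINT z|c. (g z)\<^sup>2) / 2))) \<le> 1" for g :: "'z => real"
   using nn[of g] by simp
  show "integrable M (%ww. exp (- cor ((LINT z|c. (random_step (es n) z ww)\<^sup>2) / 2)))" for n
   by (intro integrable_const_bound[where B=1] AE_I2 n1) measurable
  show "integrable M (%ww. exp (- cor ((LINT z|c. (f z ww)\<^sup>2) / 2)))"
   by (intro integrable_const_bound[where B=1] AE_I2 n1) measurable
  show "(%n. nI M (%ww. en (norm (exp (- cor ((LINT z|c. (random_step (es n) z ww)\<^sup>2) / 2)) -
    exp (- cor ((LINT z|c. (f z ww)\<^sup>2) / 2)))))) \<longlonglongrightarrow> 0"
  proof (rule tendsto_0_le_ennreal[OF always_eventually L1'], intro allI nn_integral_mono_AE)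
   fix n
   show "AE ww in M. en (norm (exp (- cor ((LINT z|c. (random_step (es n) z ww)\<^sup>2) / 2)) -
    exp (- cor ((LINT z|c. (f z ww)\<^sup>2) / 2)))) \<le> (nI c (%z. en \<bar>(random_step (es n) z ww)\<^sup>2 - (f z ww)\<^sup>2\<bar>))"
    using f_AE
   proof eventually_elim
    case (elim ww)
    let ?a = "LINT z|c. (random_step (es n) z ww)\<^sup>2" and ?b = "LINT z|c. (f z ww)\<^sup>2"
    have "norm (exp (- cor (?a / 2)) - exp (- cor (?b / 2))) \<le> norm (- cor (?a / 2) - - cor (?b / 2))"
     using nn by (intro norm_exp_diff_le) auto
    also have "- cor (?a / 2) - - cor (?b / 2) = cor (?b / 2 - ?a / 2)" by simp
    also have "norm (cor (?b / 2 - ?a / 2)) \<le> \<bar>?a - ?b\<bar>" unfolding norm_of_real by linarith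
    finally have "en (norm (exp (- cor (?a / 2)) - exp (- cor (?b / 2)))) \<le> ennreal \<bar>?a - ?b\<bar>"
     by (rule ennreal_leI)
    also have "... \<le> (nI c (%z. en \<bar>(random_step (es n) z ww)\<^sup>2 - (f z ww)\<^sup>2\<bar>))"
     by (rule ennreal_abs_integral_diff_le[OF es_int elim])
    finally show ?case .
   qed
  qed
 qed
 have "(%n. CLINT ww|M. exp (\<i> * random_sum W (es n) ww)) \<longlonglongrightarrow> (CLINT ww|M. exp (- cor ((LINT z|c. (f z ww)\<^sup>2) / 2)))"
  using conv2 by (simp only: char_random_sum[OF es])
 from LIMSEQ_unique[OF conv1 this] show ?thesis .
qed

end

text \<open>By Chebyshev's inequality, square integrability leaves only level sets of finite measure
  for the nonzero values.\<close>

lemma simple_function_list: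
 fixes g :: "'z => real"
 assumes sf: "simple_function c g" and fin: "(nI c (%z. en ((g z)\<^sup>2))) < \<infinity>"
 shows "\<exists>l. fm_list c l \<and> (\<forall>z\<in>space c. step_fun l z = g z)"
proof -
 have fin_im: "finite (g ` space c - {0})" using sf by (simp add: simple_function_def)
 then obtain vs where vs: "set vs = g ` space c - {0}" "distinct vs"
  using finite_distinct_list by blast
 define l where "l = map (%v. (v, g -` {v} \<inter> space c)) vs"
 have "g -` {v} \<inter> space c \<in> fmeasurable c" if "v \<in> set vs" for v
 proof (rule fmeasurableI)
  show meas [measurable]: "g -` {v} \<inter> space c \<in> sets c" using sf by (rule simple_functionD(2))
  have "en (v\<^sup>2) * emeasure c (g -` {v} \<inter> space c) = (nI c (%z. en (v\<^sup>2) * indicator (g -` {v} \<inter> space c) z))"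
   by (rule nn_integral_cmult_indicator[symmetric]) measurable
  also have "... \<le> (nI c (%z. en ((g z)\<^sup>2)))"
   by (intro nn_integral_mono) (auto split: split_indicator)
  finally have le: "en (v\<^sup>2) * emeasure c (g -` {v} \<inter> space c) < \<infinity>" using fin by (rule le_less_trans)
  have "en (v\<^sup>2) \<noteq> 0" using that by (auto simp: vs)
  then show "emeasure c (g -` {v} \<inter> space c) < \<infinity>"
   using le by (auto simp: ennreal_mult_less_top)
 qed
 then have "fm_list c l" by (auto simp: fm_list_def l_def)
 moreover have "step_fun l z = g z" if z: "z \<in> space c" for z
 proof -
  have "step_fun l z = (\<Sum>v\<in>set vs. v * indicator (g -` {v} \<inter> space c) z)"
   using vs(2) by (simp add: step_fun_def l_def sum_list_distinct_conv_sum_set o_def)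
  also have "... = (\<Sum>v\<in>set vs. if v = g z then g z else 0)"
   using z by (intro sum.cong) (auto split: split_indicator)
  also have "... = (if g z \<in> set vs then g z else 0)"
   by (rule sum.delta) (simp only: vs fin_im)
  also have "... = g z" using z by (auto simp: vs)
  finally show ?thesis .
 qed
 ultimately show ?thesis by blast
qed

lemma ex_list_approx_square:
 fixes G :: "'z => real"
 assumes G [measurable]: "G \<in> Bm c" and fin: "(nI c (%z. en ((G z)\<^sup>2))) < \<infinity>" and "e > 0"
 shows "\<exists>l. fm_list c l \<and> (nI c (%z. en ((step_fun l z - G z)\<^sup>2))) < en e"
proof -
 obtain s where s: "\<And>i. simple_function c (s i)" "\<And>x. x \<in> space c ==> (%i. s i x) \<longlonglongrightarrow> G x"
  "\<And>i x. x \<in> space c ==> dist (s i x) 0 \<le> 2 * dist (G x) 0"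
  using borel_measurable_implies_sequence_metric[OF G, of 0] by blast
 have [measurable]: "s i \<in> Bm c" for i using s(1) by (rule borel_measurable_simple_function)
 have sq: "(s i z)\<^sup>2 \<le> 4 * (G z)\<^sup>2" if "z \<in> space c" for i z
 proof -
  have "\<bar>s i z\<bar> \<le> \<bar>2 * G z\<bar>" using s(3)[OF that, of i] by simp
  then have "(s i z)\<^sup>2 \<le> (2 * G z)\<^sup>2" by (simp only: abs_le_square_iff)
  then show ?thesis by (simp add: power_mult_distrib)
 qed
 have fin4: "(nI c (%z. en (r * (G z)\<^sup>2))) < \<infinity>" if "0 \<le> r" for r
  using fin that by (simp add: ennreal_mult nn_integral_cmult ennreal_mult_less_top)
 have "(%i. nI c (%z. en ((s i z - G z)\<^sup>2))) \<longlonglongrightarrow> (nI c (%z. 0))"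
 \<comment> \<open>The approximants satisfy
   \<open>\<bar>s i z\<bar> \<le> 2 * \<bar>G z\<bar>\<close>, so the squared difference is at most
   \<open>2 * 4 + 2\<close> times the square of \<open>G z\<close>.\<close>
 proof (rule nn_integral_dominated_convergence[where w="%z. en (10 * (G z)\<^sup>2)"])
  show "AE z in c. en ((s j z - G z)\<^sup>2) \<le> ennreal (10 * (G z)\<^sup>2)" for j
  proof (intro AE_I2 ennreal_leI)
   fix z assume "z \<in> space c"
   moreover have "(s j z - G z)\<^sup>2 \<le> 2 * (s j z)\<^sup>2 + 2 * (G z)\<^sup>2"
    using zero_le_power2[of "s j z + G z"] by (simp add: power2_eq_square algebra_simps)
   ultimately show "(s j z - G z)\<^sup>2 \<le> 10 * (G z)\<^sup>2" using sq[of z j] by linarith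
  qed
  show "(nI c (%z. en (10 * (G z)\<^sup>2))) < \<infinity>" by (rule fin4) simp
  show "AE z in c. (%i. en ((s i z - G z)\<^sup>2)) \<longlonglongrightarrow> 0"
  proof (rule AE_I2)
   fix z assume "z \<in> space c"
   then have "(%i. (s i z - G z)\<^sup>2) \<longlonglongrightarrow> (G z - G z)\<^sup>2" by (intro tendsto_intros s(2))
   then have "(%i. en ((s i z - G z)\<^sup>2)) \<longlonglongrightarrow> ennreal ((G z - G z)\<^sup>2)" by (rule tendsto_ennrealI)
   then show "(%i. en ((s i z - G z)\<^sup>2)) \<longlonglongrightarrow> 0" by simp
  qed
 qed measurable
 then have "(%i. nI c (%z. en ((s i z - G z)\<^sup>2))) \<longlonglongrightarrow> 0" by simp
 then have "\<forall>\<^sub>F i in sequentially. (nI c (%z. en ((s i z - G z)\<^sup>2))) < en e"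
  using \<open>e > 0\<close> by (intro order_tendstoD(2)) auto
 then obtain i where i: "(nI c (%z. en ((s i z - G z)\<^sup>2))) < en e" by (auto simp: eventually_sequentially)
 have "(nI c (%z. en ((s i z)\<^sup>2))) \<le> (nI c (%z. en (4 * (G z)\<^sup>2)))"
  by (intro nn_integral_mono ennreal_leI sq)
 also have "... < \<infinity>" by (rule fin4) simp
 finally obtain l where l: "fm_list c l" "\<And>z. z \<in> space c ==> step_fun l z = s i z"
  using simple_function_list[OF s(1)] by blast
 have "(nI c (%z. en ((step_fun l z - G z)\<^sup>2))) = (nI c (%z. en ((s i z - G z)\<^sup>2)))"
  by (rule nn_integral_cong) (simp add: l(2))
 then show ?thesis using i l(1) by auto
qed

section \<open>Approximation of the volatility field from its own past\<close>

definition truncate :: "real => real => real" where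
 "truncate K x = max (- K) (min K x)"

lemma truncate_measurable [measurable]: "truncate K \<in> Bm borel"
 unfolding truncate_def by measurable

lemma abs_truncate_le: "0 \<le> K ==> \<bar>truncate K x\<bar> \<le> K"
 by (auto simp: truncate_def)

text \<open>The joint law at the points \<open>0\<close> and \<open>r\<close> is compared with its
  shift by \<open>s\<close>, so expectations of functions of the pair depend on the difference of
  the points only.\<close>

lemma strictly_stationary_pair:
 assumes stationary: "strictly_stationary M \<sigma>"
  and [measurable]: "(%y. \<phi> (fst y) (snd y) :: ennreal) \<in> Bm (borel \<Otimes>\<^sub>M borel)"
 shows "(nI M (%ww. \<phi> (\<sigma> (s + r) ww) (\<sigma> s ww))) = (nI M (%ww. \<phi> (\<sigma> r ww) (\<sigma> 0 ww)))"
proof -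
 have [measurable]: "\<sigma> s \<in> Bm M" for s using stationary by (simp add: strictly_stationary_def)
 let ?J = "{0, r}"
 have eq: "distr M (\<Pi>\<^sub>M t\<in>?J. borel) (%ww. \<lambda>t\<in>?J. \<sigma> (t + s) ww) = distr M (\<Pi>\<^sub>M t\<in>?J. borel) (%ww. \<lambda>t\<in>?J. \<sigma> t ww)"
  using stationary by (auto simp: strictly_stationary_def)
 have [measurable]: "(%x. x r) \<in> Bm (\<Pi>\<^sub>M t\<in>?J. borel :: real measure)" "(%x. x 0) \<in> Bm (\<Pi>\<^sub>M t\<in>?J. borel :: real measure)"
  by (auto intro: measurable_component_singleton)
 have m: "(%x. \<phi> (x r) (x 0)) \<in> Bm (\<Pi>\<^sub>M t\<in>?J. borel :: real measure)"
 proof -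
  have "(%x. (%y. \<phi> (fst y) (snd y)) (x r, x 0)) \<in> Bm (\<Pi>\<^sub>M t\<in>?J. borel :: real measure)" by measurable
  then show ?thesis by simp
 qed
 have t [measurable]: "(%ww. \<lambda>t\<in>?J. \<sigma> (t + u) ww) \<in> measurable M (\<Pi>\<^sub>M t\<in>?J. borel)" for u
  by (intro measurable_restrict) measurable
 have t0 [measurable]: "(%ww. \<lambda>t\<in>?J. \<sigma> t ww) \<in> measurable M (\<Pi>\<^sub>M t\<in>?J. borel)"
  by (intro measurable_restrict) measurable
 have "(nI M (%ww. \<phi> (\<sigma> (s + r) ww) (\<sigma> s ww))) = (\<integral>\<^sup>+x. \<phi> (x r) (x 0) \<partial>distr M (\<Pi>\<^sub>M t\<in>?J. borel) (%ww. \<lambda>t\<in>?J. \<sigma> (t + s) ww))"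
  using m by (subst nn_integral_distr[OF t]) (simp_all add: add.commute)
 also have "... = (nI M (%ww. \<phi> (\<sigma> r ww) (\<sigma> 0 ww)))"
  unfolding eq using m by (subst nn_integral_distr[OF t0]) simp_all
 finally show ?thesis .
qed

lemma strictly_stationary_one:
 assumes stationary: "strictly_stationary M \<sigma>" and [measurable]: "\<phi> \<in> Bm borel"
 shows "(nI M (%ww. \<phi> (\<sigma> s ww))) = (nI M (%ww. (\<phi> (\<sigma> 0 ww) :: ennreal)))"
 using strictly_stationary_pair[OF stationary, of "%x y. \<phi> y" s 0] by simp

text \<open>The abstract index \<open>z\<close> may carry more than a point of space;
  \<open>pos\<close> extracts that point, and the grid argument takes place in its range.\<close>

locale volatility_field = independent_walsh_basis M c W F \<tau> N
 for M :: "'w measure" and c :: "'z measure" and W F \<tau> N +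
 fixes pos :: "'z => real ^ 'd::finite" and i :: 'd and \<sigma> :: "real ^ 'd => 'w => real"
 assumes pos_meas [measurable]: "pos \<in> Bm c"
  and \<tau>_pos: "\<And>z. \<tau> z = pos z $ i"
  and \<sigma>_joint [measurable]: "(%(s, ww). \<sigma> s ww) \<in> Bm (borel \<Otimes>\<^sub>M M)"
  and \<sigma>_F: "\<And>s. \<sigma> s \<in> Bm (F (s $ i))"
  and \<sigma>_N: "\<And>s. \<sigma> s \<in> Bm N"
  and stationary: "strictly_stationary M \<sigma>"
  and second_moment: "integrable M (%ww. (\<sigma> 0 ww)\<^sup>2)"
begin

lemma \<sigma>_meas [measurable]: "\<sigma> s \<in> Bm M"
 using stationary by (simp add: strictly_stationary_def)

lemmas stationary_pair = strictly_stationary_pair[OF stationary]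
 and stationary_one = strictly_stationary_one[OF stationary]

definition variance0 :: real where "variance0 = (LINT ww|M. (\<sigma> 0 ww)\<^sup>2)"

lemma variance0_nonneg: "0 \<le> variance0"
 unfolding variance0_def by (intro integral_nonneg_AE) auto

lemma nn_second_moment: "(nI M (%ww. en ((\<sigma> s ww)\<^sup>2))) = en variance0"
proof -
 have "(nI M (%ww. en ((\<sigma> s ww)\<^sup>2))) = (nI M (%ww. en ((\<sigma> 0 ww)\<^sup>2)))"
  by (rule stationary_one) measurable
 also have "... = en variance0"
  unfolding variance0_def by (intro nn_integral_eq_integral second_moment) auto
 finally show ?thesis .
qed

text \<open>Paths need not be continuous. As a function on a ball times the probability space, the
  truncated field is integrable, so its translates are continuous in mean on average over the ball.
  By stationarity the expectation does not depend on the base point, so the average bounds it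
  everywhere.\<close>

lemma truncated_mean_continuity:
 assumes "0 < e" and K: "0 \<le> K"
 shows "\<exists>d>0. \<forall>s r. norm r < d \<longrightarrow>
  (nI M (%ww. en \<bar>truncate K (\<sigma> (s + r) ww) - truncate K (\<sigma> s ww)\<bar>)) < en e"
proof -
 \<comment> \<open>The cut-off to \<open>?B\<close> must not interfere: from a point of
   \<open>?B'\<close>, shifts shorter than \<open>1/2\<close> stay in \<open>?B\<close>.\<close>
 let ?B = "cball 0 1 :: (real ^ 'd) set" and ?B' = "cball 0 (1/2) :: (real ^ 'd) set"
 define f where "f = (%y::(real ^ 'd) \<times> 'w. truncate K (\<sigma> (fst y) (snd y)) * indicator ?B (fst y))"
 have [measurable]: "(%y. \<sigma> (fst y) (snd y)) \<in> Bm (borel \<Otimes>\<^sub>M M)"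
  using \<sigma>_joint by (simp add: case_prod_beta)
 have [measurable]: "?B \<in> sets borel" by simp
 have [measurable]: "f \<in> Bm (borel \<Otimes>\<^sub>M M)" unfolding f_def by measurable
 interpret lM: pair_sigma_finite lborel M ..
 have fint: "integrable (lborel \<Otimes>\<^sub>M M) f"
 proof (rule Bochner_Integration.integrable_bound)
  have "emeasure (lborel \<Otimes>\<^sub>M M) (?B \<times> space M) < \<infinity>"
   using emeasure_lborel_cball_finite[of "0 :: real ^ 'd" 1] by (subst emeasure_pair_measure_Times) (auto simp: emeasure_space_1)
  then show "integrable (lborel \<Otimes>\<^sub>M M) (%y. K * indicator (?B \<times> space M) y)" by auto
  show "f \<in> Bm (lborel \<Otimes>\<^sub>M M)" by (simp cong: measurable_cong_sets)
  show "AE y in lborel \<Otimes>\<^sub>M M. norm (f y) \<le> norm (K * indicator (?B \<times> space M) y :: real)"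
   using K abs_truncate_le[OF K] by (intro AE_I2) (auto simp: f_def space_pair_measure abs_mult split: split_indicator)
 qed
 have finB: "emeasure lborel ?B' \<noteq> \<infinity>"
  using emeasure_lborel_cball_finite[of "0 :: real ^ 'd" "1/2"] by simp
 define b where "b = measure lborel ?B'"
 have b: "emeasure lborel ?B' = en b" using finB by (simp add: b_def emeasure_eq_ennreal_measure)
 have "0 < b" unfolding b_def by (rule content_cball_pos) simp
 \<comment> \<open>The expectation is constant in the base point and integrates over
   \<open>?B'\<close> to \<open>b\<close> times itself, hence the target
   \<open>e * b\<close>.\<close>
 then have "0 < e * b" using \<open>0 < e\<close> by simp
 from translation_continuous_mean[OF sigma_finite_measure_axioms fint this]
 obtain d where d: "0 < d" "\<And>r. norm r < d ==> (nI (lborel \<Otimes>\<^sub>M M) (%z. en \<bar>f (fst z + r, snd z) - f z\<bar>)) < en (e * b)"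
  by blast
 show ?thesis
 proof (intro exI[of _ "min d (1/2)"] conjI allI impI)
  show "0 < min d (1/2)" using d by simp
  fix s r :: "real ^ 'd" assume r: "norm r < min d (1/2)"
  define w where "w = (nI M (%ww. en \<bar>truncate K (\<sigma> r ww) - truncate K (\<sigma> 0 ww)\<bar>))"
  have w: "(nI M (%ww. en \<bar>truncate K (\<sigma> (t + r) ww) - truncate K (\<sigma> t ww)\<bar>)) = w" for t
   unfolding w_def by (rule stationary_pair[of "%x y. en \<bar>truncate K x - truncate K y\<bar>"]) measurable
  have [measurable]: "(%z. f (fst z + r, snd z)) \<in> Bm (borel \<Otimes>\<^sub>M M)" by measurable
  have "w * emeasure lborel ?B' = (nI lborel (%t. w * indicator ?B' t))"
   by (rule nn_integral_cmult_indicator[symmetric]) simp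
  also have "... \<le> (nI lborel (%t. nI M (%ww. en \<bar>f (t + r, ww) - f (t, ww)\<bar>)))"
  proof (rule nn_integral_mono)
   fix t :: "real ^ 'd"
   show "w * indicator ?B' t \<le> (nI M (%ww. en \<bar>f (t + r, ww) - f (t, ww)\<bar>))"
   proof (cases "t \<in> ?B'")
    case True
    then have "norm t \<le> 1/2" by simp
    then have "norm (t + r) \<le> 1" "norm t \<le> 1" using r norm_triangle_ineq[of t r] by auto
    then have eq: "(nI M (%ww. en \<bar>f (t + r, ww) - f (t, ww)\<bar>)) = w"
     unfolding w[of t, symmetric] by (intro nn_integral_cong) (simp add: f_def)
    show ?thesis unfolding eq using True by simp
   qed simp
  qed
  also have "... = (nI (lborel \<Otimes>\<^sub>M M) (%z. en \<bar>f (fst z + r, snd z) - f z\<bar>))"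
  proof -
   have m: "(%z. en \<bar>f (fst z + r, snd z) - f z\<bar>) \<in> Bm (lborel \<Otimes>\<^sub>M M)"
    by (simp cong: measurable_cong_sets)
   from nn_integral_fst[OF m] show ?thesis by simp
  qed
  also have "... < en (e * b)" using d(2)[of r] r by simp
  finally have less: "w * en b < en e * en b" unfolding b using \<open>0 < e\<close> \<open>0 < b\<close> by (simp add: ennreal_mult)
  have "w < en e"
  proof (rule ccontr)
   assume "\<not> w < en e"
   then have "en e * en b \<le> w * en b" by (intro mult_right_mono) auto
   then show False using less by simp
  qed
  then show "(nI M (%ww. en \<bar>truncate K (\<sigma> (s + r) ww) - truncate K (\<sigma> s ww)\<bar>)) < en e"
   by (simp add: w)
 qed
qed

definition frozen_approximable :: "('z => 'w => real) => bool" where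
 "frozen_approximable f \<longleftrightarrow> (%(z, ww). f z ww) \<in> Bm (c \<Otimes>\<^sub>M M) \<and>
  (\<forall>e>0. \<exists>es. frozen_list es \<and> (nI M (%ww. nI c (%z. en ((random_step es z ww - f z ww)\<^sup>2)))) < en e)"

lemma frozen_approximable_limit:
 assumes f: "(%(z, ww). f z ww) \<in> Bm (c \<Otimes>\<^sub>M M)"
  and lim: "\<And>e. 0 < e ==> \<exists>g. frozen_approximable g \<and> (nI M (%ww. nI c (%z. en ((g z ww - f z ww)\<^sup>2)))) < en e"
 shows "frozen_approximable f"
 unfolding frozen_approximable_def
proof (intro conjI f allI impI)
 fix e :: real assume e: "0 < e"
 then obtain g where g: "frozen_approximable g" "(nI M (%ww. nI c (%z. en ((g z ww - f z ww)\<^sup>2)))) < en (e/4)"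
  using lim[of "e/4"] by auto
 then obtain es where es: "frozen_list es" "(nI M (%ww. nI c (%z. en ((random_step es z ww - g z ww)\<^sup>2)))) < en (e/4)"
  using e unfolding frozen_approximable_def by (meson divide_pos_pos zero_less_numeral)
 have ad: "adapted_list es" using es by (simp add: frozen_list_def)
 have gm: "(%(z, ww). g z ww) \<in> Bm (c \<Otimes>\<^sub>M M)" using g by (simp add: frozen_approximable_def)
 have "(nI M (%ww. nI c (%z. en ((random_step es z ww - f z ww)\<^sup>2)))) =
  (nI M (%ww. nI c (%z. en (((random_step es z ww - g z ww) + (g z ww - f z ww))\<^sup>2))))" by simp
 also have "... \<le> 2 * (nI M (%ww. nI c (%z. en ((random_step es z ww - g z ww)\<^sup>2)))) + 2 * (nI M (%ww. nI c (%z. en ((g z ww - f z ww)\<^sup>2))))"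
  by (intro iterated_square_add_le joint_measurable_diff random_step_measurable ad gm f)
 also have "... < 2 * en (e/4) + 2 * en (e/4)"
  using es(2) g(2) by (intro add_strict_mono ennreal_mult_strict_left_mono) auto
 also have "... = en e"
 proof -
  have "2 * en (e/4) = en (e/2)" using e ennreal_mult[of 2 "e/4"] by simp
  then show ?thesis using e by (simp flip: ennreal_plus)
 qed
 finally show "\<exists>es. frozen_list es \<and> (nI M (%ww. nI c (%z. en ((random_step es z ww - f z ww)\<^sup>2)))) < en e"
  using es by blast
qed

lemma frozen_approximable_add_scale:
 assumes f: "frozen_approximable f" and g: "frozen_approximable g"
 shows "frozen_approximable (%z ww. f z ww + a * g z ww)"
 unfolding frozen_approximable_def
proof (intro conjI allI impI)
 have fm: "(%(z, ww). f z ww) \<in> Bm (c \<Otimes>\<^sub>M M)" and gm: "(%(z, ww). g z ww) \<in> Bm (c \<Otimes>\<^sub>M M)"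
  using f g by (auto simp: frozen_approximable_def)
 note [measurable] = fm gm
 show "(%(z, ww). f z ww + a * g z ww) \<in> Bm (c \<Otimes>\<^sub>M M)" by measurable
 fix e :: real assume e: "0 < e"
 \<comment> \<open>\<open>a\<^sup>2 * d\<close> is at most \<open>e / 8\<close>, and the factor
   \<open>2\<close> of the quadratic inequality makes this \<open>e / 4\<close>.\<close>
 define d where "d = e / 8 / (a\<^sup>2 + 1)"
 have d: "0 < d" using e by (simp add: d_def add_nonneg_pos)
 obtain es where es: "frozen_list es" "(nI M (%ww. nI c (%z. en ((random_step es z ww - f z ww)\<^sup>2)))) < en (e/4)"
  using f e unfolding frozen_approximable_def by (meson divide_pos_pos zero_less_numeral)
 obtain ks where ks: "frozen_list ks" "(nI M (%ww. nI c (%z. en ((random_step ks z ww - g z ww)\<^sup>2)))) < en d"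
  using g d unfolding frozen_approximable_def by meson
 have ad: "adapted_list es" "adapted_list ks" using es ks by (auto simp: frozen_list_def)
 note [measurable] = random_step_measurable[OF ad(1)] random_step_measurable[OF ad(2)]
 have m1: "(%(z, ww). random_step es z ww - f z ww) \<in> Bm (c \<Otimes>\<^sub>M M)" by measurable
 have m2: "(%(z, ww). random_step ks z ww - g z ww) \<in> Bm (c \<Otimes>\<^sub>M M)" by measurable
 have m3: "(%(z, ww). a * (random_step ks z ww - g z ww)) \<in> Bm (c \<Otimes>\<^sub>M M)" by measurable
 let ?l = "es @ scale_random a ks"
 have "random_step ?l z ww - (f z ww + a * g z ww) = (random_step es z ww - f z ww) + a * (random_step ks z ww - g z ww)" for z ww
  by (simp add: algebra_simps)
 then have "(nI M (%ww. nI c (%z. en ((random_step ?l z ww - (f z ww + a * g z ww))\<^sup>2)))) \<le>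
  2 * (nI M (%ww. nI c (%z. en ((random_step es z ww - f z ww)\<^sup>2)))) +
  2 * (nI M (%ww. nI c (%z. en ((a * (random_step ks z ww - g z ww))\<^sup>2))))"
  using iterated_square_add_le[OF m1 m3] by (simp only:)
 also have "(nI M (%ww. nI c (%z. en ((a * (random_step ks z ww - g z ww))\<^sup>2)))) =
  en (a\<^sup>2) * (nI M (%ww. nI c (%z. en ((random_step ks z ww - g z ww)\<^sup>2))))"
  unfolding iterated_square_eq[OF m3] iterated_square_eq[OF m2]
  by (simp only: power_mult_distrib ennreal_mult zero_le_power2) (rule nn_integral_cmult, measurable)
 also have "2 * (nI M (%ww. nI c (%z. en ((random_step es z ww - f z ww)\<^sup>2)))) + 2 * (en (a\<^sup>2) * (nI M (%ww. nI c (%z. en ((random_step ks z ww - g z ww)\<^sup>2)))))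
  < en (e/2) + en (e/2)"
 proof (rule add_strict_mono)
  have "2 * (nI M (%ww. nI c (%z. en ((random_step es z ww - f z ww)\<^sup>2)))) < 2 * en (e/4)"
   using es(2) by (intro ennreal_mult_strict_left_mono) auto
  also have "... = en (e/2)" using e ennreal_mult[of 2 "e/4"] by simp
  finally show "2 * (nI M (%ww. nI c (%z. en ((random_step es z ww - f z ww)\<^sup>2)))) < en (e/2)" .
  have "2 * (en (a\<^sup>2) * (nI M (%ww. nI c (%z. en ((random_step ks z ww - g z ww)\<^sup>2))))) \<le> 2 * (en (a\<^sup>2) * en d)"
   using ks(2) by (intro mult_left_mono) auto
  also have "... = en (2 * (a\<^sup>2 * d))" using d by (simp add: ennreal_mult)
  also have "... < en (e/2)"
  proof (rule ennreal_lessI)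
   show "0 < e / 2" using e by simp
   have "a\<^sup>2 * d \<le> (a\<^sup>2 + 1) * d" using d by (intro mult_right_mono) auto
   also have "... = e / 8"
   proof -
    have "a\<^sup>2 + 1 \<noteq> 0" by (metis add_nonneg_pos less_irrefl zero_le_power2 zero_less_one)
    then show ?thesis unfolding d_def by (rule nonzero_mult_div_cancel_left[of _ "e / 8", unfolded times_divide_eq_right[symmetric]])
   qed
   finally show "2 * (a\<^sup>2 * d) < e / 2" using e by simp
  qed
  finally show "2 * (en (a\<^sup>2) * (nI M (%ww. nI c (%z. en ((random_step ks z ww - g z ww)\<^sup>2))))) < en (e/2)" .
 qed
 also have "... = en e" using e by (simp flip: ennreal_plus)
 finally show "\<exists>es. frozen_list es \<and> (nI M (%ww. nI c (%z. en ((random_step es z ww - (f z ww + a * g z ww))\<^sup>2)))) < en e"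
  using es(1) ks(1) frozen_list_scale by (intro exI[of _ ?l]) simp
qed

lemma frozen_approximable_0: "frozen_approximable (%z ww. 0)"
 unfolding frozen_approximable_def by (auto intro!: exI[of _ "[]"])

lemma swap_square:
 assumes g: "(%(z, ww). g z ww) \<in> Bm (c \<Otimes>\<^sub>M M)"
 shows "(nI M (%ww. nI c (%z. en ((g z ww)\<^sup>2)))) = (nI c (%z. nI M (%ww. en ((g z ww)\<^sup>2))))"
proof -
 interpret c: sigma_finite_measure c by (rule c_sigma_finite)
 interpret cM: pair_sigma_finite c M ..
 note [measurable] = g
 have m: "(%(z, ww). en ((g z ww)\<^sup>2)) \<in> Bm (c \<Otimes>\<^sub>M M)" by measurable
 show ?thesis using cM.Fubini'[OF m] by simp
qed

lemma \<sigma>_pos_measurable [measurable]: "(%(z, ww). \<sigma> (pos z) ww) \<in> Bm (c \<Otimes>\<^sub>M M)"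
proof -
 have "(%y. (%(s, ww). \<sigma> s ww) (pos (fst y), snd y)) \<in> Bm (c \<Otimes>\<^sub>M M)" by measurable
 then show ?thesis by (simp add: case_prod_beta)
qed

text \<open>A point \<open>s\<close> is replaced by the corner \<open>\<alpha>\<close> of its grid cell with the smallest coordinates: the corner lies
 strictly in the past of the cell, so \<open>\<sigma> \<alpha>\<close> is an admissible coefficient there.\<close>

lemma frozen_approximable_bounded_set:
 assumes D: "D \<in> fmeasurable c" and R: "\<And>z. z \<in> D ==> norm (pos z) \<le> R" and K: "0 \<le> K"
 shows "frozen_approximable (%z ww. indicator D z * truncate K (\<sigma> (pos z) ww))"
 unfolding frozen_approximable_def
proof (intro conjI allI impI)
 have [measurable]: "D \<in> sets c" using D by auto
 show fm: "(%(z, ww). indicator D z * truncate K (\<sigma> (pos z) ww)) \<in> Bm (c \<Otimes>\<^sub>M M)" by measurable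
 fix e :: real assume e: "0 < e"
 \<comment> \<open>The squared difference of two truncated values is at most \<open>2 * K\<close>
   times their distance, so the total error is at most \<open>2 * K * \<eta> * measure c D\<close>.
   The added ones keep the denominator positive.\<close>
 define \<eta> where "\<eta> = e / (2 * (2 * K + 1) * (measure c D + 1))"
 have \<eta>: "0 < \<eta>" using e K by (simp add: \<eta>_def add_nonneg_pos)
 obtain d where d: "0 < d" "\<And>s r. norm r < d ==>
   (nI M (%ww. en \<bar>truncate K (\<sigma> (s + r) ww) - truncate K (\<sigma> s ww)\<bar>)) < en \<eta>"
  using truncated_mean_continuity[OF \<eta> K] by blast
 \<comment> \<open>Each coordinate of a point differs from that of its corner by at most
   \<open>\<delta>\<close>, so their distance is at most \<open>d / 2\<close>.\<close>
 define \<delta> where "\<delta> = d / (2 * real CARD('d))"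
 have \<delta>: "0 < \<delta>" using d by (simp add: \<delta>_def)
 \<comment> \<open>The ceiling minus one, not the floor: cells are open at their lower faces, so
   points on grid planes also lie strictly after their corner.\<close>
 define corner where "corner s = (\<chi> j. \<delta> * (of_int \<lceil>s $ j / \<delta>\<rceil> - 1))" for s :: "real ^ 'd"
 define cell where "cell \<alpha> = {s :: real ^ 'd. \<forall>j. \<alpha> $ j < s $ j \<and> s $ j \<le> \<alpha> $ j + \<delta>}" for \<alpha>
 have [measurable]: "(%s :: real ^ 'd. s $ j) \<in> Bm borel" for j
  by (intro borel_measurable_continuous_onI continuous_intros)
 have [measurable]: "cell \<alpha> \<in> sets borel" for \<alpha> unfolding cell_def by measurable
 have corner_cell: "s \<in> cell (corner s)" for s
 proof -
  have "\<delta> * (of_int \<lceil>s $ j / \<delta>\<rceil> - 1) < s $ j \<and> s $ j \<le> \<delta> * (of_int \<lceil>s $ j / \<delta>\<rceil> - 1) + \<delta>" for j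
  proof -
   have "of_int \<lceil>s $ j / \<delta>\<rceil> - 1 < s $ j / \<delta>" "s $ j / \<delta> \<le> of_int \<lceil>s $ j / \<delta>\<rceil>"
    using ceiling_correct[of "s $ j / \<delta>"] by auto
   then have "(of_int \<lceil>s $ j / \<delta>\<rceil> - 1) * \<delta> < s $ j" "s $ j \<le> of_int \<lceil>s $ j / \<delta>\<rceil> * \<delta>"
    using \<delta> by (simp_all only: pos_less_divide_eq pos_divide_le_eq)
   then show ?thesis by (simp add: algebra_simps)
  qed
  then show ?thesis by (simp add: cell_def corner_def)
 qed
 define V where "V = corner ` cball 0 R"
 have finV: "finite V"
 proof -
  define n where "n = \<lceil>\<bar>R\<bar> / \<delta>\<rceil> + 1"
  have "V \<subseteq> (%k. \<chi> j. \<delta> * (of_int (k j) - 1)) ` (UNIV \<rightarrow>\<^sub>E {-n..n})"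
  proof
   fix \<alpha> assume "\<alpha> \<in> V"
   then obtain s where s: "norm s \<le> R" "\<alpha> = corner s" by (auto simp: V_def)
   have "\<lceil>s $ j / \<delta>\<rceil> \<in> {-n..n}" for j
   proof -
    have "\<bar>s $ j\<bar> \<le> \<bar>R\<bar>" using component_le_norm_cart[of s j] s(1) by linarith
    then have "\<bar>s $ j / \<delta>\<bar> \<le> \<bar>R\<bar> / \<delta>" using \<delta> by (simp add: divide_right_mono abs_divide)
    then have "- (\<bar>R\<bar> / \<delta>) \<le> s $ j / \<delta>" "s $ j / \<delta> \<le> \<bar>R\<bar> / \<delta>" by linarith+
    then have "\<lceil>s $ j / \<delta>\<rceil> \<le> \<lceil>\<bar>R\<bar> / \<delta>\<rceil>" "- \<lceil>\<bar>R\<bar> / \<delta>\<rceil> \<le> \<lceil>s $ j / \<delta>\<rceil>"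
     by (auto intro: ceiling_mono) linarith
    then show ?thesis by (simp add: n_def)
   qed
   then show "\<alpha> \<in> (%k. \<chi> j. \<delta> * (of_int (k j) - 1)) ` (UNIV \<rightarrow>\<^sub>E {-n..n})"
    unfolding s(2) corner_def by (intro image_eqI[where x="%j. \<lceil>s $ j / \<delta>\<rceil>"]) auto
  qed
  then show ?thesis by (rule finite_subset) (intro finite_imageI finite_PiE; simp)
 qed
 have uniq: "\<alpha> = corner s" if \<alpha>V: "\<alpha> \<in> V" and s: "s \<in> cell \<alpha>" for \<alpha> s
 proof -
  obtain t where t: "\<alpha> = corner t" using \<alpha>V unfolding V_def by blast
  have "\<alpha> $ j = corner s $ j" for j
  proof -
   define m where "m = \<lceil>t $ j / \<delta>\<rceil>"
   have \<alpha>j: "\<alpha> $ j = \<delta> * (of_int m - 1)" by (simp add: t corner_def m_def)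
   have "\<delta> * (of_int m - 1) < s $ j" "s $ j \<le> \<delta> * (of_int m - 1) + \<delta>" using s unfolding cell_def \<alpha>j[symmetric] by auto
   then have "of_int m - 1 < s $ j / \<delta>" "s $ j / \<delta> \<le> of_int m" using \<delta> by (simp_all add: field_simps)
   then have "\<lceil>s $ j / \<delta>\<rceil> = m" by (simp add: ceiling_eq_iff)
   then show ?thesis by (simp add: \<alpha>j corner_def)
  qed
  then show ?thesis by (simp add: vec_eq_iff)
 qed
 obtain vs where vs: "set vs = V" "distinct vs" using finite_distinct_list[OF finV] by blast
 define es where "es = map (%\<alpha>. (%ww. truncate K (\<sigma> \<alpha> ww), \<alpha> $ i, D \<inter> (pos -` cell \<alpha> \<inter> space c))) vs"
 have "frozen_list es"
  unfolding frozen_list_def adapted_list_def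
 proof (intro conjI ballI)
  fix x assume "x \<in> set es"
  then obtain \<alpha> where x: "x = (%ww. truncate K (\<sigma> \<alpha> ww), \<alpha> $ i, D \<inter> (pos -` cell \<alpha> \<inter> space c))" by (auto simp: es_def)
  have "(%ww. truncate K (\<sigma> \<alpha> ww)) \<in> Bm (F (\<alpha> $ i))" using \<sigma>_F[of \<alpha>] by measurable
  moreover have "\<exists>C. \<forall>ww\<in>space M. \<bar>truncate K (\<sigma> \<alpha> ww)\<bar> \<le> C" using abs_truncate_le[OF K] by blast
  moreover have "D \<inter> (pos -` cell \<alpha> \<inter> space c) \<in> fmeasurable c"
   using D by (intro fmeasurable_Int_fmeasurable) (auto intro: measurable_sets)
  moreover have "\<forall>z\<in>D \<inter> (pos -` cell \<alpha> \<inter> space c). \<alpha> $ i < \<tau> z" by (auto simp: cell_def \<tau>_pos)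
  ultimately show "case x of (Z, a, S) => Z \<in> Bm (F a) \<and> (\<exists>C. \<forall>ww\<in>space M. \<bar>Z ww\<bar> \<le> C) \<and> S \<in> fmeasurable c \<and> (\<forall>z\<in>S. a < \<tau> z)"
   by (simp add: x)
  have "(%ww. truncate K (\<sigma> \<alpha> ww)) \<in> Bm N" using \<sigma>_N[of \<alpha>] by measurable
  then show "case x of (Z, a, S) => Z \<in> Bm N" by (simp add: x)
 qed
 have Dspace: "D \<subseteq> space c" by (rule sets.sets_into_space) measurable
 have step: "random_step es z ww = indicator D z * truncate K (\<sigma> (corner (pos z)) ww)" if z: "z \<in> space c" for z ww
 proof -
  have "random_step es z ww = (\<Sum>\<alpha>\<in>V. truncate K (\<sigma> \<alpha> ww) * indicator (D \<inter> (pos -` cell \<alpha> \<inter> space c)) z)"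
   using vs by (simp add: random_step_def es_def sum_list_distinct_conv_sum_set o_def)
  also have "... = indicator D z * truncate K (\<sigma> (corner (pos z)) ww)"
  proof (cases "z \<in> D")
   case True
   then have "corner (pos z) \<in> V" using R[OF True] by (auto simp: V_def)
   moreover have iff: "pos z \<in> cell \<alpha> \<longleftrightarrow> \<alpha> = corner (pos z)" if "\<alpha> \<in> V" for \<alpha>
    using uniq[OF that] corner_cell[of "pos z"] by metis
   moreover have "(\<Sum>\<alpha>\<in>V. truncate K (\<sigma> \<alpha> ww) * indicator (D \<inter> (pos -` cell \<alpha> \<inter> space c)) z) =
    (\<Sum>\<alpha>\<in>V. if \<alpha> = corner (pos z) then truncate K (\<sigma> (corner (pos z)) ww) else 0)"
    using True z by (intro sum.cong) (simp_all add: iff indicator_def)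
   ultimately show ?thesis using True by (simp only: sum.delta[OF finV] if_True indicator_simps mult_1)
  qed simp
  finally show ?thesis .
 qed
 have ad: "adapted_list es" using \<open>frozen_list es\<close> by (simp add: frozen_list_def)
 have "(nI M (%ww. nI c (%z. en ((random_step es z ww - indicator D z * truncate K (\<sigma> (pos z) ww))\<^sup>2)))) =
  (nI c (%z. nI M (%ww. en ((random_step es z ww - indicator D z * truncate K (\<sigma> (pos z) ww))\<^sup>2))))"
  by (rule swap_square[OF joint_measurable_diff[OF random_step_measurable[OF ad] fm]])
 also have "... \<le> (nI c (%z. en (2 * K * \<eta>) * indicator D z))"
 proof (rule nn_integral_mono)
  fix z assume z: "z \<in> space c"
  show "(nI M (%ww. en ((random_step es z ww - indicator D z * truncate K (\<sigma> (pos z) ww))\<^sup>2))) \<le> ennreal (2 * K * \<eta>) * indicator D z"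
  proof (cases "z \<in> D")
   case True
   define \<alpha> where "\<alpha> = corner (pos z)"
   define r where "r = pos z - \<alpha>"
   have r: "norm r < d"
   proof -
    have "norm r \<le> (\<Sum>j\<in>UNIV. \<bar>r $ j\<bar>)" by (rule norm_le_l1_cart)
    also have "... \<le> (\<Sum>j\<in>(UNIV :: 'd set). \<delta>)"
    proof (rule sum_mono)
     fix j
     have "\<alpha> $ j < pos z $ j \<and> pos z $ j \<le> \<alpha> $ j + \<delta>" using corner_cell[of "pos z"] unfolding \<alpha>_def cell_def by blast
     then show "\<bar>r $ j\<bar> \<le> \<delta>" by (simp add: r_def)
    qed
    also have "... = d / 2" by (simp add: \<delta>_def)
    finally show ?thesis using d(1) by simp
   qed
   have "(nI M (%ww. en ((random_step es z ww - indicator D z * truncate K (\<sigma> (pos z) ww))\<^sup>2))) \<le>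
    (nI M (%ww. en (2 * K) * en \<bar>truncate K (\<sigma> (\<alpha> + r) ww) - truncate K (\<sigma> \<alpha> ww)\<bar>))"
   proof (rule nn_integral_mono)
    fix ww
    let ?a = "truncate K (\<sigma> \<alpha> ww)" and ?b = "truncate K (\<sigma> (\<alpha> + r) ww)"
    have "random_step es z ww - indicator D z * truncate K (\<sigma> (pos z) ww) = - (?b - ?a)"
     using True z by (simp add: step \<alpha>_def r_def)
    then have "(random_step es z ww - indicator D z * truncate K (\<sigma> (pos z) ww))\<^sup>2 = \<bar>?b - ?a\<bar> * \<bar>?b - ?a\<bar>"
     by (simp only: power2_minus power2_eq_square abs_mult_self_eq)
    also have "... \<le> (2 * K) * \<bar>?b - ?a\<bar>"
     using abs_truncate_le[OF K, of "\<sigma> \<alpha> ww"] abs_truncate_le[OF K, of "\<sigma> (\<alpha> + r) ww"] by (intro mult_right_mono) linarith+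
    finally show "en ((random_step es z ww - indicator D z * truncate K (\<sigma> (pos z) ww))\<^sup>2) \<le> ennreal (2 * K) * en \<bar>?b - ?a\<bar>"
     using K by (simp add: ennreal_mult[symmetric] ennreal_leI)
   qed
   also have "... = en (2 * K) * (nI M (%ww. en \<bar>truncate K (\<sigma> (\<alpha> + r) ww) - truncate K (\<sigma> \<alpha> ww)\<bar>))"
    by (rule nn_integral_cmult) measurable
   also have "... \<le> ennreal (2 * K) * en \<eta>" by (intro mult_left_mono less_imp_le[OF d(2)[OF r]]) simp
   also have "... = en (2 * K * \<eta>)" using K \<eta> by (simp add: ennreal_mult)
   finally show ?thesis using True by simp
  next
   case False
   then show ?thesis using z by (simp add: step)
  qed
 qed
 also have "... = en (2 * K * \<eta>) * emeasure c D" by (rule nn_integral_cmult_indicator) measurable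
 also have "... = en (2 * K * \<eta> * measure c D)"
  using K \<eta> D by (simp add: emeasure_eq_measure2 ennreal_mult)
 also have "... < en e"
 proof (rule ennreal_lessI[OF e])
  have "2 * K * \<eta> * measure c D \<le> (2 * K + 1) * \<eta> * (measure c D + 1)"
   using K \<eta> by (intro mult_mono mult_right_mono) auto
  also have "... = e / 2"
  proof -
   have "2 * K + 1 \<noteq> 0" "measure c D + 1 \<noteq> 0" using K measure_nonneg[of c D] by linarith+
   moreover have "A * (e / (2 * A * B)) * B = e / 2" if "A \<noteq> 0" "B \<noteq> 0" for A B :: real using that by simp
   ultimately show ?thesis unfolding \<eta>_def by blast
  qed
  finally show "2 * K * \<eta> * measure c D < e" using e by simp
 qed
 finally show "\<exists>es. frozen_list es \<and> (nI M (%ww. nI c (%z. en ((random_step es z ww - indicator D z * truncate K (\<sigma> (pos z) ww))\<^sup>2)))) < en e"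
  using \<open>frozen_list es\<close> by blast
qed

abbreviation mean_square :: "('z => 'w => real) => ennreal" where
 "mean_square f \<equiv> (nI M (%ww. nI c (%z. en ((f z ww)\<^sup>2))))"

text \<open>Stationarity makes the second moment of the volatility a constant, which leaves the
  integral.\<close>

lemma mean_square_\<sigma>:
 assumes [measurable]: "G \<in> Bm c"
 shows "mean_square (%z ww. G z * \<sigma> (pos z) ww) = en variance0 * (nI c (%z. en ((G z)\<^sup>2)))"
proof -
 have m: "(%(z, ww). G z * \<sigma> (pos z) ww) \<in> Bm (c \<Otimes>\<^sub>M M)" by measurable
 have "mean_square (%z ww. G z * \<sigma> (pos z) ww) = (nI c (%z. nI M (%ww. en ((G z)\<^sup>2) * en ((\<sigma> (pos z) ww)\<^sup>2))))"
  unfolding swap_square[OF m] by (simp only: power_mult_distrib ennreal_mult zero_le_power2)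
 also have "... = (nI c (%z. en variance0 * en ((G z)\<^sup>2)))"
  by (simp add: nn_integral_cmult nn_second_moment mult.commute)
 finally show ?thesis by (simp add: nn_integral_cmult)
qed

text \<open>Truncation and cut-off only move values towards zero, so the error is dominated by the
  integrand itself and vanishes by dominated convergence.\<close>

lemma frozen_approximable_set:
 assumes D: "D \<in> fmeasurable c"
 shows "frozen_approximable (%z ww. indicator D z * \<sigma> (pos z) ww)"
proof (rule frozen_approximable_limit)
 have [measurable]: "D \<in> sets c" using D by auto
 show fm: "(%(z, ww). indicator D z * \<sigma> (pos z) ww) \<in> Bm (c \<Otimes>\<^sub>M M)" by measurable
 define E where "E n = {z\<in>space c. norm (pos z) \<le> real n}" for n
 have [measurable]: "E n \<in> sets c" for n unfolding E_def by measurable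
 define g where "g n z ww = indicator (D \<inter> E n) z * truncate (real n) (\<sigma> (pos z) ww)" for n z ww
 have g: "frozen_approximable (g n)" for n
  unfolding g_def using D by (intro frozen_approximable_bounded_set) (auto simp: E_def intro: fmeasurable_Int_fmeasurable)
 have [measurable]: "(%(z, ww). g n z ww) \<in> Bm (c \<Otimes>\<^sub>M M)" for n using g by (simp add: frozen_approximable_def)
 have dm: "(%(z, ww). g n z ww - indicator D z * \<sigma> (pos z) ww) \<in> Bm (c \<Otimes>\<^sub>M M)" for n by measurable
 have le: "(g n z ww - indicator D z * \<sigma> (pos z) ww)\<^sup>2 \<le> (indicator D z * \<sigma> (pos z) ww)\<^sup>2" for n z ww
  unfolding abs_le_square_iff[symmetric] by (auto simp: g_def truncate_def split: split_indicator)
 have "(%n. nI (c \<Otimes>\<^sub>M M) (%y. en ((g n (fst y) (snd y) - indicator D (fst y) * \<sigma> (pos (fst y)) (snd y))\<^sup>2)))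
  \<longlonglongrightarrow> (nI (c \<Otimes>\<^sub>M M) (%y. 0))"
 proof (rule nn_integral_dominated_convergence[where w="%y. en ((indicator D (fst y) * \<sigma> (pos (fst y)) (snd y))\<^sup>2)"])
  show "(nI (c \<Otimes>\<^sub>M M) (%y. en ((indicator D (fst y) * \<sigma> (pos (fst y)) (snd y))\<^sup>2))) < \<infinity>"
  proof -
   have "(nI c (%z. en ((indicator D z)\<^sup>2))) = (nI c (%z. indicator D z))"
    by (intro nn_integral_cong) (auto split: split_indicator)
   also have "... < \<infinity>" using D by (simp add: fmeasurable_def)
   finally show ?thesis
    unfolding iterated_square_eq[OF fm, symmetric] by (subst mean_square_\<sigma>) (auto simp: ennreal_mult_less_top)
  qed
  show "AE y in c \<Otimes>\<^sub>M M. (%n. en ((g n (fst y) (snd y) - indicator D (fst y) * \<sigma> (pos (fst y)) (snd y))\<^sup>2)) \<longlonglongrightarrow> 0"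
  proof (intro AE_I2 tendsto_eventually)
   fix y assume y: "y \<in> space (c \<Otimes>\<^sub>M M)"
   obtain m :: nat where m: "max (norm (pos (fst y))) \<bar>\<sigma> (pos (fst y)) (snd y)\<bar> \<le> real m" using real_arch_simple by blast
   show "\<forall>\<^sub>F n in sequentially. en ((g n (fst y) (snd y) - indicator D (fst y) * \<sigma> (pos (fst y)) (snd y))\<^sup>2) = 0"
    using eventually_ge_at_top[of m]
   proof eventually_elim
    case (elim n)
    then have "real m \<le> real n" by simp
    then have "norm (pos (fst y)) \<le> real n" "\<bar>\<sigma> (pos (fst y)) (snd y)\<bar> \<le> real n" using m by auto
    then show ?case using y by (auto simp: g_def E_def truncate_def space_pair_measure split: split_indicator)
   qed
  qed
 qed (use le in \<open>auto intro!: ennreal_leI\<close>)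
 then have lim: "(%n. mean_square (%z ww. g n z ww - indicator D z * \<sigma> (pos z) ww)) \<longlonglongrightarrow> 0"
  by (simp add: iterated_square_eq[OF dm])
 fix e :: real assume "0 < e"
 then have "\<forall>\<^sub>F n in sequentially. mean_square (%z ww. g n z ww - indicator D z * \<sigma> (pos z) ww) < en e"
  using lim by (intro order_tendstoD(2)) auto
 then obtain n where "mean_square (%z ww. g n z ww - indicator D z * \<sigma> (pos z) ww) < en e" by (auto simp: eventually_sequentially)
 then show "\<exists>g. frozen_approximable g \<and> mean_square (%z ww. g z ww - indicator D z * \<sigma> (pos z) ww) < en e"
  using g by blast
qed

lemma frozen_approximable_step: "fm_list c l ==> frozen_approximable (%z ww. step_fun l z * \<sigma> (pos z) ww)"
proof (induction l)
 case Nil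
 then show ?case using frozen_approximable_0 by (simp add: step_fun_def)
next
 case (Cons x l)
 obtain a A where x: "x = (a, A)" by force
 have "frozen_approximable (%z ww. step_fun l z * \<sigma> (pos z) ww + a * (indicator A z * \<sigma> (pos z) ww))"
  using Cons x by (intro frozen_approximable_add_scale frozen_approximable_set) (auto simp: fm_list_def)
 then show ?case by (simp add: x step_fun_def algebra_simps)
qed

lemma frozen_approximable_\<sigma>:
 assumes [measurable]: "G \<in> Bm c" and fin: "(nI c (%z. en ((G z)\<^sup>2))) < \<infinity>"
 shows "frozen_approximable (%z ww. G z * \<sigma> (pos z) ww)"
proof (rule frozen_approximable_limit)
 show "(%(z, ww). G z * \<sigma> (pos z) ww) \<in> Bm (c \<Otimes>\<^sub>M M)" by measurable
 fix e :: real assume e: "0 < e"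
 define d where "d = e / (variance0 + 1)"
 have d: "0 < d" using e variance0_nonneg unfolding d_def by (intro divide_pos_pos) linarith+
 obtain l where l: "fm_list c l" "(nI c (%z. en ((step_fun l z - G z)\<^sup>2))) < en d"
  using ex_list_approx_square[OF assms d] by blast
 have [measurable]: "step_fun l \<in> Bm c" by (rule step_fun_measurable[OF l(1)])
 have "mean_square (%z ww. step_fun l z * \<sigma> (pos z) ww - G z * \<sigma> (pos z) ww) = mean_square (%z ww. (step_fun l z - G z) * \<sigma> (pos z) ww)"
  by (simp only: left_diff_distrib)
 also have "... = en variance0 * (nI c (%z. en ((step_fun l z - G z)\<^sup>2)))" by (rule mean_square_\<sigma>) measurable
 also have "... \<le> ennreal variance0 * en d" using l(2) by (intro mult_left_mono) auto
 also have "... = en (variance0 * d)" using d variance0_nonneg by (simp add: ennreal_mult)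
 also have "... < en e"
 proof (rule ennreal_lessI[OF e])
  have "variance0 * d < (variance0 + 1) * d" using d by simp
  also have "... = e" using variance0_nonneg by (simp add: d_def)
  finally show "variance0 * d < e" .
 qed
 finally show "\<exists>g. frozen_approximable g \<and> mean_square (%z ww. g z ww - G z * \<sigma> (pos z) ww) < en e"
  using frozen_approximable_step[OF l(1)] by (intro exI[of _ "%z ww. step_fun l z * \<sigma> (pos z) ww"]) simp
qed

lemma char_walsh_\<sigma>:
 assumes Y: "walsh_limit (%z ww. G z * \<sigma> (pos z) ww) Y"
  and G: "G \<in> Bm c" and fin: "(nI c (%z. en ((G z)\<^sup>2))) < \<infinity>"
 shows "(CLINT ww|M. exp (\<i> * Y ww)) = (CLINT ww|M. exp (- cor ((LINT z|c. (G z * \<sigma> (pos z) ww)\<^sup>2) / 2)))"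
proof -
 let ?f = "%z ww. G z * \<sigma> (pos z) ww"
 have ex: "\<exists>es. frozen_list es \<and> mean_square (%z ww. random_step es z ww - ?f z ww) < en (1 / real (Suc n))" for n
  using frozen_approximable_\<sigma>[OF G fin] unfolding frozen_approximable_def by (simp del: of_nat_Suc)
 have "\<exists>es. \<forall>n. frozen_list (es n) \<and> mean_square (%z ww. random_step (es n) z ww - ?f z ww) < en (1 / real (Suc n))"
  by (rule choice) (rule allI, rule ex)
 then obtain es where all: "\<forall>n. frozen_list (es n) \<and> mean_square (%z ww. random_step (es n) z ww - ?f z ww) < en (1 / real (Suc n))" ..
 note es = conjunct1[OF spec[OF all]] and lt = conjunct2[OF spec[OF all]]
 have "(%n. en (1 / real (Suc n))) \<longlonglongrightarrow> ennreal 0"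
  by (intro tendsto_ennrealI) (rule LIMSEQ_inverse_real_of_nat[unfolded inverse_eq_divide])
 then have l0: "(%n. en (1 / real (Suc n))) \<longlonglongrightarrow> 0" by (simp only: ennreal_0)
 have lim: "(%n. mean_square (%z ww. random_step (es n) z ww - ?f z ww)) \<longlonglongrightarrow> 0"
  by (rule tendsto_0_le_ennreal[OF always_eventually l0]) (rule allI, rule less_imp_le[OF lt])
 have "mean_square ?f < \<infinity>" using fin by (subst mean_square_\<sigma>[OF G]) (auto simp: ennreal_mult_less_top)
 from char_walsh_limit[OF Y this es lim] show ?thesis .
qed

end

section \<open>The jump measure of the integrated variance and its Laplace exponent\<close>

context jump_measure
begin

text \<open>A formula handed to \<open>measure_of\<close> gives a measure with these values only if
  it is countably additive. Here it is the image of a product measure under the map taking a mark, a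
  point of space and a jump to the rescaled jump. Restricting to positive images discards the points
  where nothing is left of the jump.\<close>

lemma jump_measure_V_eq:
 fixes k :: "'y \<times> 't::euclidean_space => real"
 assumes q: "sigma_finite_measure q" and k [measurable]: "k \<in> Bm (q \<Otimes>\<^sub>M lborel)"
 defines "P \<equiv> (q \<Otimes>\<^sub>M lborel) \<Otimes>\<^sub>M \<nu>"
 shows "jump_measure_V \<nu> q k = distr (restrict_space P {x\<in>space P. 0 < k (fst x) * snd x})
   (restrict_space borel {0<..}) (%x. k (fst x) * snd x)" (is "_ = ?D")
proof -
 interpret \<nu>: sigma_finite_measure \<nu> by (rule sigma_finite)
 interpret q: sigma_finite_measure q by fact
 interpret qL: pair_sigma_finite q "lborel :: 't measure" ..
 define R :: "real measure" where "R = restrict_space borel {0<..}"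
 have [measurable]: "(%x. snd x) \<in> Bm P" unfolding P_def by (rule measurable_compose[OF measurable_snd id_measurable_\<nu>])
 have m [measurable]: "(%x. k (fst x) * snd x) \<in> Bm P" unfolding P_def using \<open>_ \<in> Bm P\<close>[unfolded P_def] by measurable
 define A where "A = {x\<in>space P. 0 < k (fst x) * snd x}"
 have A: "A \<in> sets P" unfolding A_def by measurable
 have mR: "(%x. k (fst x) * snd x) \<in> measurable (restrict_space P A) R"
  unfolding R_def by (intro measurable_restrict_space2 measurable_restrict_space1 m) (auto simp: space_restrict_space A_def)
 have D: "?D = distr (restrict_space P A) R (%x. k (fst x) * snd x)" by (simp add: A_def R_def)
 have em: "emeasure ?D B = (nI lborel (%z. nI q (%y. emeasure \<nu> {w\<in>space \<nu>. k (y, z) * w \<in> B})))" if B: "B \<in> sets R" for B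
 proof -
  have Bb: "B \<in> sets borel" "B \<subseteq> {0<..}" using B by (auto simp: R_def sets_restrict_space_iff)
  define S where "S = {x\<in>space P. k (fst x) * snd x \<in> B}"
  have S: "S \<in> sets ((q \<Otimes>\<^sub>M lborel) \<Otimes>\<^sub>M \<nu>)" unfolding S_def P_def[symmetric] using Bb(1) by measurable
  have "emeasure ?D B = emeasure (restrict_space P A) ((%x. k (fst x) * snd x) -` B \<inter> space (restrict_space P A))"
   unfolding D by (rule emeasure_distr[OF mR B])
  also have "(%x. k (fst x) * snd x) -` B \<inter> space (restrict_space P A) = S"
   using Bb(2) by (auto simp: S_def A_def space_restrict_space)
  also have "emeasure (restrict_space P A) S = emeasure P S"
   using A Bb(2) by (intro emeasure_restrict_space) (auto simp: S_def A_def)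
  also have "... = (nI (q \<Otimes>\<^sub>M lborel) (%x. emeasure \<nu> (Pair x -` S)))"
   unfolding P_def by (rule \<nu>.emeasure_pair_measure_alt[OF S])
  also have "... = (nI lborel (%z. nI q (%y. emeasure \<nu> (Pair (y, z) -` S))))"
   using \<nu>.measurable_emeasure_Pair[OF S] by (rule qL.nn_integral_snd[symmetric])
  also have "... = (nI lborel (%z. nI q (%y. emeasure \<nu> {w\<in>space \<nu>. k (y, z) * w \<in> B})))"
   by (intro nn_integral_cong arg_cong[where f="emeasure \<nu>"]) (auto simp: S_def P_def space_pair_measure)
  finally show ?thesis .
 qed
 have spR: "space R = {0<..}" by (simp add: R_def space_restrict_space)
 have "jump_measure_V \<nu> q k = measure_of {0<..} (sets (restrict_space borel {0<..})) (emeasure ?D)"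
  unfolding jump_measure_V_def
 proof (rule measure_of_eq)
  show "sets (restrict_space borel {0<..}) \<subseteq> Pow {0::real<..}" unfolding R_def[symmetric] using sets.space_closed[of R] by (simp only: spR)
  fix a assume "a \<in> sigma_sets {0<..} (sets (restrict_space borel {0::real<..}))"
  then have "a \<in> sets R" using sets.sigma_sets_eq[of R] by (simp only: spR flip: R_def)
  then show "(nI lborel (%z. nI q (%y. emeasure \<nu> {w\<in>space \<nu>. k (y, z) * w \<in> a}))) = emeasure ?D a" by (rule em[symmetric])
 qed
 also have "... = ?D" using measure_of_of_measure[of ?D] by (simp add: R_def space_restrict_space)
 finally show ?thesis .
qed

text \<open>Integrals over the image are integrals over the product, and the mean of the image is
  \<open>mean\<close> times the integral of \<open>k\<close>. The discarded points contribute
  nothing to the exponent since \<open>exp 0 - 1 = 0\<close>.\<close>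

lemma
 fixes k :: "'y \<times> 't::euclidean_space => real"
 assumes q: "sigma_finite_measure q" and k [measurable]: "k \<in> Bm (q \<Otimes>\<^sub>M lborel)"
  and k0: "\<And>z. z \<in> space (q \<Otimes>\<^sub>M lborel) ==> 0 \<le> k z"
  and fin: "en mean * (nI (q \<Otimes>\<^sub>M lborel) (%z. en (k z))) < \<infinity>"
 shows jump_measure_V: "jump_measure (jump_measure_V \<nu> q k)"
  and exponent_jump_measure_V: "\<And>\<zeta>::complex. Re \<zeta> \<le> 0 ==>
   jump_measure.exponent (jump_measure_V \<nu> q k) \<zeta> = (CLINT z|(q \<Otimes>\<^sub>M lborel). exponent (\<zeta> * k z))"
proof -
 define c where "c = q \<Otimes>\<^sub>M (lborel :: 't measure)"
 define P where "P = c \<Otimes>\<^sub>M \<nu>"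
 interpret \<nu>: sigma_finite_measure \<nu> by (rule sigma_finite)
 interpret q: sigma_finite_measure q by fact
 interpret qL: pair_sigma_finite q "lborel :: 't measure" ..
 interpret c: sigma_finite_measure c unfolding c_def by (rule qL.sigma_finite_measure_axioms)
 interpret cP: pair_sigma_finite c \<nu> ..
 define R :: "real measure" where "R = restrict_space borel {0<..}"
 define A where "A = {x\<in>space P. 0 < k (fst x) * snd x}"
 have [measurable]: "k \<in> Bm c" by (simp add: c_def)
 have s [measurable]: "(%x. snd x) \<in> Bm P" unfolding P_def by (rule measurable_compose[OF measurable_snd id_measurable_\<nu>])
 have m [measurable]: "(%x. k (fst x) * snd x) \<in> Bm P" unfolding P_def using s[unfolded P_def] by measurable
 have A [measurable]: "A \<in> sets P" unfolding A_def by measurable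
 have mR: "(%x. k (fst x) * snd x) \<in> measurable (restrict_space P A) R"
  unfolding R_def by (intro measurable_restrict_space2 measurable_restrict_space1 m) (auto simp: space_restrict_space A_def)
 have V: "jump_measure_V \<nu> q k = distr (restrict_space P A) R (%x. k (fst x) * snd x)"
  unfolding A_def P_def c_def R_def by (rule jump_measure_V_eq[OF q k])
 have zero: "k (fst x) * snd x = 0" if "x \<in> space P" "x \<notin> A" for x
 proof -
  have "0 \<le> k (fst x)" "0 < snd x" using that k0 by (auto simp: P_def c_def space_pair_measure space_\<nu>)
  moreover have "\<not> 0 < k (fst x) * snd x" using that by (simp add: A_def)
  ultimately show ?thesis using zero_less_mult_iff[of "k (fst x)" "snd x"] by auto
 qed
 have kw: "(nI P (%x. en (k (fst x) * snd x))) < \<infinity>"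
 proof -
  have "(nI P (%x. en (k (fst x) * snd x))) = (\<integral>\<^sup>+z. \<integral>\<^sup>+w. en (k z * w) \<partial>\<nu> \<partial>c)"
   using m unfolding P_def by (subst \<nu>.nn_integral_fst[symmetric]) auto
  also have "... = (nI c (%z. en (k z) * en mean))"
  proof (rule nn_integral_cong)
   fix z assume "z \<in> space c"
   then have "(\<integral>\<^sup>+w. en (k z * w) \<partial>\<nu>) = (\<integral>\<^sup>+w. en (k z) * en w \<partial>\<nu>)"
    using k0 by (intro nn_integral_cong) (auto simp: c_def space_\<nu> ennreal_mult)
   also have "... = en (k z) * en mean" by (subst nn_integral_cmult) (auto simp: nn_integral_id)
   finally show "(\<integral>\<^sup>+w. en (k z * w) \<partial>\<nu>) = en (k z) * en mean" .
  qed
  also have "... = en mean * (nI c (%z. en (k z)))" by (subst nn_integral_multc) (auto simp: mult.commute)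
  finally show ?thesis using fin by (simp add: c_def)
 qed
 have "(\<integral>\<^sup>+x. en x \<partial>jump_measure_V \<nu> q k) = (\<integral>\<^sup>+x. en (k (fst x) * snd x) \<partial>restrict_space P A)"
  unfolding V using mR by (intro nn_integral_distr) (auto simp: R_def intro!: measurable_restrict_space1)
 also have "... \<le> (nI P (%x. en (k (fst x) * snd x)))"
  by (subst nn_integral_restrict_space) (auto intro!: nn_integral_mono split: split_indicator)
 finally show jm: "jump_measure (jump_measure_V \<nu> q k)"
  using kw by (intro jump_measure.intro) (auto simp: V R_def)
 fix \<zeta> :: complex assume \<zeta>: "Re \<zeta> \<le> 0"
 have int: "integrable P (%x. exp (\<zeta> * cor (k (fst x) * snd x)) - 1)"
 proof (rule Bochner_Integration.integrable_bound)
  have nn: "0 \<le> k (fst x) * snd x" if "x \<in> space P" for x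
   using that zero[of x] by (cases "x \<in> A") (auto simp: A_def)
  have "(nI P (%x. en (norm (k (fst x) * snd x)))) = (nI P (%x. en (k (fst x) * snd x)))"
   by (intro nn_integral_cong) (simp only: nn real_norm_def abs_of_nonneg)
  then have "integrable P (%x. k (fst x) * snd x)" using kw by (intro integrableI_bounded m) simp
  then show "integrable P (%x. norm \<zeta> * (k (fst x) * snd x))" by (rule integrable_mult_right)
  show "AE x in P. norm (exp (\<zeta> * cor (k (fst x) * snd x)) - 1) \<le> norm (norm \<zeta> * (k (fst x) * snd x))"
  proof (rule AE_I2)
   fix x assume "x \<in> space P"
   from norm_exp_scaled_diff_le[OF \<zeta> nn[OF this], of 0] nn[OF this]
   show "norm (exp (\<zeta> * cor (k (fst x) * snd x)) - 1) \<le> norm (norm \<zeta> * (k (fst x) * snd x))" by simp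
  qed
 qed measurable
 have "jump_measure.exponent (jump_measure_V \<nu> q k) \<zeta> = (CLINT x|jump_measure_V \<nu> q k. exp (\<zeta> * cor x) - 1)"
  by (rule jump_measure.exponent_def[OF jm])
 also have "... = (CLINT x|restrict_space P A. exp (\<zeta> * cor (k (fst x) * snd x)) - 1)"
  unfolding V using mR by (intro integral_distr) (auto simp: R_def intro!: measurable_restrict_space1)
 also have "... = (CLINT x|P. indicator A x *\<^sub>R (exp (\<zeta> * cor (k (fst x) * snd x)) - 1))"
  using A sets.sets_into_space[OF A] by (intro integral_restrict_space) (simp add: Int_absorb2)
 also have "... = (CLINT x|P. exp (\<zeta> * cor (k (fst x) * snd x)) - 1)"
 proof (intro Bochner_Integration.integral_cong refl)
  fix x assume x: "x \<in> space P"
  show "indicator A x *\<^sub>R (exp (\<zeta> * cor (k (fst x) * snd x)) - 1) = exp (\<zeta> * cor (k (fst x) * snd x)) - 1"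
  proof (cases "x \<in> A")
   case False
   show ?thesis unfolding zero[OF x False] by simp
  qed simp
 qed
 also have "... = (CLINT z|c. CLINT w|\<nu>. exp (\<zeta> * cor (k z * w)) - 1)"
  using cP.integral_fst'[OF int[unfolded P_def]] by (simp add: P_def)
 finally show "jump_measure.exponent (jump_measure_V \<nu> q k) \<zeta> = (CLINT z|(q \<Otimes>\<^sub>M lborel). exponent (\<zeta> * k z))"
  by (simp add: c_def exponent_def mult.assoc)
qed

text \<open>Each factor of \<open>x\<close> is paid for by half of the decay rate.\<close>

lemma power_exp_bound: "0 < a ==> \<exists>C. \<forall>x\<ge>0. x ^ j * exp (- a * x) \<le> (C::real)"
proof (induction j arbitrary: a)
 case 0
 then show ?case by (intro exI[of _ 1]) simp
next
 case (Suc j)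
 then obtain C where C: "\<And>x. 0 \<le> x ==> x ^ j * exp (- (a/2) * x) \<le> C" by (meson half_gt_zero)
 have "x ^ Suc j * exp (- a * x) \<le> C * (2 / a)" if x: "0 \<le> x" for x
 proof -
  define E where "E = exp (- (a/2) * x)"
  have "(a/2 * x) * E \<le> exp (a/2 * x) * E"
  proof (rule mult_right_mono)
   show "a/2 * x \<le> exp (a/2 * x)" using exp_ge_add_one_self[of "a/2 * x"] by linarith
  qed (simp add: E_def)
  also have "... = 1" by (simp add: E_def flip: exp_add)
  finally have "x * E \<le> 2 / a" using Suc.prems by (simp add: field_simps)
  then have *: "x * exp (- (a/2) * x) \<le> 2 / a" unfolding E_def .
  have "x ^ Suc j * exp (- a * x) = (x ^ j * exp (- (a/2) * x)) * (x * exp (- (a/2) * x))"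
   by (simp add: exp_add[symmetric] mult_ac)
  also have "... \<le> C * (2 / a)" using C[OF x] * x by (intro mult_mono) (auto intro: order_trans[OF _ C[OF x]])
  finally show ?thesis .
 qed
 then show ?case by blast
qed

text \<open>The mean value inequality on the convex half line bounds the difference quotients by
  \<open>w\<close>, and dominated convergence applies along every sequence.\<close>

lemma has_derivative_integral:
 fixes f f' :: "real => real => real"
 assumes z: "a < z" and der: "\<And>x t. x \<in> space N ==> a < t ==> ((%t. f t x) has_real_derivative f' t x) (at t)"
  and le: "\<And>x t. x \<in> space N ==> a < t ==> \<bar>f' t x\<bar> \<le> w x"
  and w: "integrable N w" and f: "\<And>t. a < t ==> integrable N (f t)" and f' [measurable]: "f' z \<in> Bm N"
 shows "((%t. LINT x|N. f t x) has_real_derivative (LINT x|N. f' z x)) (at z)"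
 unfolding has_field_derivative_iff tendsto_at_iff_sequentially
proof (intro allI impI)
 fix X :: "nat => real" assume X: "\<forall>i. X i \<in> UNIV - {z}" "X \<longlonglongrightarrow> z"
 let ?g = "%y. ((LINT x|N. f y x) - (LINT x|N. f z x)) / (y - z)"
 have "\<forall>\<^sub>F i in sequentially. a < X i" using X(2) z by (rule order_tendstoD)
 then obtain n0 where n0: "\<And>i. i \<ge> n0 ==> a < X i" by (auto simp: eventually_sequentially)
 \<comment> \<open>The first terms of a sequence tending to \<open>z\<close> may lie outside the
   half line and are dropped.\<close>
 define Y where "Y i = X (i + n0)" for i
 have Y: "a < Y i" "Y i \<noteq> z" for i using n0 X(1) by (auto simp: Y_def)
 have Yz: "Y \<longlonglongrightarrow> z" unfolding Y_def by (rule LIMSEQ_ignore_initial_segment[OF X(2)])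
 have "(%i. LINT x|N. (f (Y i) x - f z x) / (Y i - z)) \<longlonglongrightarrow> (LINT x|N. f' z x)"
 proof (rule integral_dominated_convergence[where w=w])
  show "f' z \<in> Bm N" "integrable N w" by fact+
  show "(%x. (f (Y i) x - f z x) / (Y i - z)) \<in> Bm N" for i
   using borel_measurable_integrable[OF f[OF Y(1)]] borel_measurable_integrable[OF f[OF z]] by measurable
  show "AE x in N. (%i. (f (Y i) x - f z x) / (Y i - z)) \<longlonglongrightarrow> f' z x"
  proof (rule AE_I2)
   fix x assume "x \<in> space N"
   from der[OF this z] have "((%y. (f y x - f z x) / (y - z)) \<longlongrightarrow> f' z x) (at z)" by (simp add: has_field_derivative_iff)
   then show "(%i. (f (Y i) x - f z x) / (Y i - z)) \<longlonglongrightarrow> f' z x"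
    using Y(2) Yz by (auto simp: tendsto_at_iff_sequentially o_def)
  qed
  show "AE x in N. norm ((f (Y i) x - f z x) / (Y i - z)) \<le> w x" for i
  proof (rule AE_I2)
   fix x assume x: "x \<in> space N"
   have "norm (f (Y i) x - f z x) \<le> w x * norm (Y i - z)"
   proof (rule field_differentiable_bound[of "{a<..}" "%t. f t x" "%t. f' t x"])
    show "((%t. f t x) has_field_derivative f' t x) (at t within {a<..})" if "t \<in> {a<..}" for t
     using der[OF x] that by (auto intro: has_field_derivative_at_within)
   qed (use le[OF x] Y z in auto)
   then show "norm ((f (Y i) x - f z x) / (Y i - z)) \<le> w x"
    using Y(2)[of i] by (simp add: abs_divide pos_divide_le_eq)
  qed
 qed
 moreover have "(LINT x|N. (f (Y i) x - f z x) / (Y i - z)) = ?g (Y i)" for i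
  by (simp only: integral_divide_zero Bochner_Integration.integral_diff[OF f[OF Y(1)] f[OF z]])
 ultimately have "(%i. ?g (X (i + n0))) \<longlonglongrightarrow> (LINT x|N. f' z x)" by (simp only: Y_def)
 then show "(?g \<circ> X) \<longlonglongrightarrow> (LINT x|N. f' z x)" unfolding o_def by (rule LIMSEQ_offset)
qed

text \<open>For \<open>t > z/2\<close> the decay rate \<open>z/2\<close> absorbs the powers, which
  leaves a multiple of \<open>x\<close> as dominating function, integrable by the finite
  mean.\<close>

lemma laplace_derivative:
 fixes n :: nat
 assumes z: "0 < z"
 shows "((%t. LINT x|\<nu>. (- x) ^ n * (x * exp (- t * x))) has_real_derivative
   (LINT x|\<nu>. (- x) ^ Suc n * (x * exp (- z * x)))) (at z)"
proof -
 obtain C where C: "\<And>x. 0 \<le> x ==> x ^ Suc n * exp (- (z/2) * x) \<le> C" using power_exp_bound[of "z/2" "Suc n"] z by auto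
 obtain C' where C': "\<And>x. 0 \<le> x ==> x ^ n * exp (- (z/2) * x) \<le> C'" using power_exp_bound[of "z/2" n] z by auto
 have mono: "\<bar>(- x) ^ m * (x * exp (- t * x))\<bar> \<le> x ^ m * exp (- (z/2) * x) * x" if "0 < x" "z/2 < t" for x t m
 proof -
  have "\<bar>(- x) ^ m * (x * exp (- t * x))\<bar> = x ^ m * exp (- t * x) * x" using that by (simp add: abs_mult power_abs)
  also have "... \<le> x ^ m * exp (- (z/2) * x) * x" using that z by (intro mult_right_mono mult_left_mono) auto
  finally show ?thesis .
 qed
 have le: "\<bar>(- x) ^ Suc n * (x * exp (- t * x))\<bar> \<le> C * x" if "0 < x" "z/2 < t" for x t
  using order_trans[OF mono[OF that, of "Suc n"] mult_right_mono[OF C, of x x]] that by simp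
 have le': "\<bar>(- x) ^ n * (x * exp (- t * x))\<bar> \<le> C' * x" if "0 < x" "z/2 < t" for x t
  using order_trans[OF mono[OF that, of n] mult_right_mono[OF C', of x x]] that by simp
 show ?thesis
 proof (rule has_derivative_integral[where a="z/2" and w="%x. C * x" and f="%t x. (- x) ^ n * (x * exp (- t * x))"])
  show "z / 2 < z" using z by simp
  show "((%t. (- x) ^ n * (x * exp (- t * x))) has_real_derivative (- x) ^ Suc n * (x * exp (- t * x))) (at t)" for x t
   by (auto intro!: derivative_eq_intros)
  show "integrable \<nu> (%x. C * x)" using integrable_id by simp
  show "integrable \<nu> (%x. (- x) ^ n * (x * exp (- t * x)))" if "z/2 < t" for t
  proof (rule Bochner_Integration.integrable_bound)
   show "integrable \<nu> (%x. C' * x)" using integrable_id by simp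
   show "AE x in \<nu>. norm ((- x) ^ n * (x * exp (- t * x))) \<le> norm (C' * x)"
    using order_trans[OF le'[OF _ that] abs_ge_self] by (intro AE_I2) (simp only: space_\<nu> greaterThan_iff real_norm_def)
  qed (rule measurable_\<nu>, measurable)
  show "\<bar>(- x) ^ Suc n * (x * exp (- t * x))\<bar> \<le> C * x" if "x \<in> space \<nu>" "z/2 < t" for x t
   by (rule le[OF _ that(2)]) (use that(1) in \<open>simp add: space_\<nu>\<close>)
  show "(%x. (- x) ^ Suc n * (x * exp (- z * x))) \<in> Bm \<nu>" by (rule measurable_\<nu>) measurable
 qed
qed

lemma integrable_real_exponent: "0 \<le> t ==> integrable \<nu> (%x. exp (- t * x) - 1 :: real)"
 using integrable_Re[OF integrable_exponent[of "cor (- t)"]]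
 by (simp only: of_real_mult[symmetric] exp_of_real minus_complex.simps Re_complex_of_real one_complex.simps)

lemma exponent_of_real:
 assumes "0 \<le> t"
 shows "exponent (- cor t) = cor (LINT x|\<nu>. exp (- t * x) - 1)"
proof -
 have "exponent (- cor t) = (CLINT x|\<nu>. cor (exp (- t * x) - 1))"
  unfolding exponent_def by (intro Bochner_Integration.integral_cong) (simp_all flip: exp_of_real)
 also have "... = cor (LINT x|\<nu>. exp (- t * x) - 1)"
  by (rule integral_complex_of_real)
 finally show ?thesis .
qed

lemma laplace_exponent_derivative:
 assumes z: "0 < z"
 shows "((%t. - (LINT x|\<nu>. exp (- t * x) - 1)) has_real_derivative (LINT x|\<nu>. x * exp (- z * x))) (at z)"
proof -
 have "((%t. LINT x|\<nu>. exp (- t * x) - 1) has_real_derivative (LINT x|\<nu>. - x * exp (- z * x))) (at z)"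
 proof (rule has_derivative_integral[where a=0 and w="%x. x" and f="%t x. exp (- t * x) - 1" and f'="%t x. - x * exp (- t * x)"])
  show "((%t. exp (- t * x) - 1) has_real_derivative - x * exp (- t * x)) (at t)" for x t :: real
   by (auto intro!: derivative_eq_intros)
  show "\<bar>- x * exp (- t * x)\<bar> \<le> x" if "x \<in> space \<nu>" "0 < t" for x t
   using that by (simp add: space_\<nu> abs_mult mult_le_cancel_left1)
  show "(%x. - x * exp (- z * x)) \<in> Bm \<nu>" by (rule measurable_\<nu>) measurable
 qed (use z integrable_id integrable_real_exponent in auto)
 then have "((%t. - (LINT x|\<nu>. exp (- t * x) - 1)) has_real_derivative - (LINT x|\<nu>. - x * exp (- z * x))) (at z)"
  by (rule DERIV_minus)
 then show ?thesis by simp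
qed

text \<open>The derivatives are integrals of \<open>(- x) ^ n * (x * exp (- t * x))\<close>, whose
  sign alternates with \<open>n\<close>. They are identified on the open half line only, so each
  further differentiation is carried out inside that open set.\<close>

lemma completely_monotone_deriv_laplace_exponent:
 "completely_monotone (deriv (%t. - (LINT x|\<nu>. exp (- t * x) - 1)))" (is "completely_monotone ?f")
proof -
 let ?D = "%n t. LINT x|\<nu>. (- x) ^ n * (x * exp (- t * x))"
 have D: "(deriv ^^ n) ?f z = ?D n z" if "0 < z" for n z
  using that
 proof (induction n arbitrary: z)
  case 0
  then show ?case using DERIV_imp_deriv[OF laplace_exponent_derivative] by simp
 next
  case (Suc n)
  have "((deriv ^^ n) ?f has_real_derivative ?D (Suc n) z) (at z)"
   by (rule has_field_derivative_transform_within_open[OF laplace_derivative[OF Suc.prems], of "{0<..}"])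
    (use Suc in auto)
  then show ?case by (simp add: DERIV_imp_deriv)
 qed
 show ?thesis
  unfolding completely_monotone_def
 proof (intro allI impI conjI)
  fix n and z :: real assume z: "0 < z"
  have "((deriv ^^ n) ?f has_real_derivative ?D (Suc n) z) (at z)"
   by (rule has_field_derivative_transform_within_open[OF laplace_derivative[OF z], of "{0<..}"]) (use z D in auto)
  then show "(deriv ^^ n) ?f differentiable (at z)" using real_differentiable_def by blast
  have "(-1) ^ n * (deriv ^^ n) ?f z = (LINT x|\<nu>. (-1) ^ n * ((- x) ^ n * (x * exp (- z * x))))"
   unfolding D[OF z] by simp
  also have "... = (LINT x|\<nu>. x ^ n * (x * exp (- z * x)))"
   by (simp only: mult.assoc[symmetric] power_mult_distrib[symmetric]) simp
  also have "0 \<le> ..." by (intro integral_nonneg_AE AE_I2) (simp add: space_\<nu>)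
  finally show "0 \<le> (-1) ^ n * (deriv ^^ n) ?f z" .
 qed
qed

end

section \<open>Infinitely divisible laws and normal variance mixtures\<close>

lemma
 assumes "real_distribution A" "real_distribution B"
 shows real_distribution_convolution: "real_distribution (convolution A B)"
  and char_convolution: "char (convolution A B) t = char A t * char B t"
proof -
 interpret A: real_distribution A by fact
 interpret B: real_distribution B by fact
 interpret AB: pair_prob_space A B ..
 have m [measurable]: "(%(x, y). x + y) \<in> Bm (A \<Otimes>\<^sub>M B)" by measurable
 show "real_distribution (convolution A B)"
  unfolding convolution_def by (rule AB.real_distribution_distr[OF m])
 have int: "integrable (A \<Otimes>\<^sub>M B) (%z. iexp (t * fst z) * iexp (t * snd z))"
  by (intro AB.integrable_const_bound[where B=1]) (auto simp: norm_mult)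
 have "char (convolution A B) t = (CLINT z|A \<Otimes>\<^sub>M B. iexp (t * (case z of (x, y) => x + y)))"
  unfolding char_def convolution_def by (rule integral_distr[OF m]) measurable
 also have "... = (CLINT z|A \<Otimes>\<^sub>M B. iexp (t * fst z) * iexp (t * snd z))"
  by (intro Bochner_Integration.integral_cong refl) (simp add: case_prod_beta exp_add[symmetric] algebra_simps)
 also have "... = char A t * char B t"
  using AB.integral_fst'[OF int] by (simp add: char_def)
 finally show "char (convolution A B) t = char A t * char B t" .
qed

lemma convolution_power:
 assumes \<rho>: "real_distribution \<rho>"
 shows "real_distribution ((convolution \<rho> ^^ n) (return borel 0)) \<and>
  (\<forall>t. char ((convolution \<rho> ^^ n) (return borel 0)) t = char \<rho> t ^ n)"
proof (induction n)
 case 0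
 have "real_distribution (return borel (0::real))"
  by (intro real_distribution.intro prob_space_return real_distribution_axioms.intro) auto
 moreover have "char (return borel 0) t = 1" for t by (simp add: char_def integral_return)
 ultimately show ?case by simp
next
 case (Suc n)
 then show ?case using real_distribution_convolution[OF \<rho>] char_convolution[OF \<rho>] by simp
qed

text \<open>Convolution powers correspond to powers of the characteristic function, so a root has to
  be exhibited at the level of characteristic functions only.\<close>

lemma infinitely_divisibleI:
 assumes \<mu>: "real_distribution \<mu>"
  and ex: "\<And>n. n \<ge> 1 ==> \<exists>\<rho>. real_distribution \<rho> \<and> (\<forall>t. char \<rho> t ^ n = char \<mu> t)"
 shows "infinitely_divisible \<mu>"
 unfolding infinitely_divisible_def
proof (intro conjI allI impI)
 show "prob_space \<mu>" "sets \<mu> = sets borel"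
  using \<mu> by (auto simp: real_distribution_def real_distribution_axioms_def)
 fix n :: nat assume "n \<ge> 1"
 then obtain \<rho> where \<rho>: "real_distribution \<rho>" "\<And>t. char \<rho> t ^ n = char \<mu> t" using ex by blast
 have "\<mu> = (convolution \<rho> ^^ n) (return borel 0)"
  using convolution_power[OF \<rho>(1), of n] \<rho>(2) by (intro Levy_uniqueness[OF \<mu>]) auto
 then show "\<exists>\<rho>. prob_space \<rho> \<and> sets \<rho> = sets borel \<and> \<mu> = (convolution \<rho> ^^ n) (return borel 0)"
  using \<rho>(1) by (intro exI[of _ \<rho>]) (auto simp: real_distribution_def real_distribution_axioms_def)
qed

text \<open>Given the variance, the law is normal. \<open>max 0\<close> makes the square root
  meaningful for every value, and for laws on the half line it changes nothing almost
  surely.\<close>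

lemma
 assumes "real_distribution \<mu>"
 defines "G \<equiv> distr (\<mu> \<Otimes>\<^sub>M std_normal_distribution) borel (%z. sqrt (max 0 (fst z)) * snd z)"
 shows real_distribution_normal_mixture: "real_distribution G"
  and char_normal_mixture: "char G t = (CLINT v|\<mu>. exp (- cor (t\<^sup>2 / 2) * cor (max 0 v)))"
proof -
 interpret \<mu>: real_distribution \<mu> by fact
 interpret S: real_distribution std_normal_distribution by (rule real_dist_normal_dist)
 interpret P: pair_prob_space \<mu> std_normal_distribution ..
 let ?P = "\<mu> \<Otimes>\<^sub>M std_normal_distribution"
 have m [measurable]: "(%z. sqrt (max 0 (fst z)) * snd z) \<in> Bm ?P" by measurable
 show "real_distribution G" unfolding G_def by (rule P.real_distribution_distr[OF m])
 have int: "integrable ?P (%z. iexp (t * (sqrt (max 0 (fst z)) * snd z)))"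
  by (intro P.integrable_const_bound[where B=1]) auto
 have "char G t = (CLINT z|?P. iexp (t * (sqrt (max 0 (fst z)) * snd z)))"
  unfolding char_def G_def by (rule integral_distr[OF m]) measurable
 also have "... = (CLINT v|\<mu>. char std_normal_distribution (t * sqrt (max 0 v)))"
  using P.integral_fst'[OF int] by (simp add: char_def mult.assoc)
 also have "... = (CLINT v|\<mu>. exp (- cor (t\<^sup>2 / 2) * cor (max 0 v)))"
 proof (intro Bochner_Integration.integral_cong refl)
  fix v
  have "(t * sqrt (max 0 v))\<^sup>2 = t\<^sup>2 * max 0 v" by (simp add: power_mult_distrib)
  then show "char std_normal_distribution (t * sqrt (max 0 v)) = exp (- cor (t\<^sup>2 / 2) * cor (max 0 v))"
   by (simp only: char_std_normal_distribution exp_of_real[symmetric]) simp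
 qed
 finally show "char G t = (CLINT v|\<mu>. exp (- cor (t\<^sup>2 / 2) * cor (max 0 v)))" .
qed

lemma
 fixes f :: "'y \<times> 't::euclidean_space => 'b::{banach, second_countable_topology}"
 assumes q: "sigma_finite_measure q" and f: "integrable (q \<Otimes>\<^sub>M lborel) f" and r: "r \<noteq> 0"
 shows integrable_scale_snd: "integrable (q \<Otimes>\<^sub>M lborel) (%z. f (fst z, r *\<^sub>R snd z))"
  and integral_scale_snd: "\<bar>r\<bar> ^ DIM('t) *\<^sub>R (LINT z|(q \<Otimes>\<^sub>M lborel). f (fst z, r *\<^sub>R snd z)) = (LINT z|(q \<Otimes>\<^sub>M lborel). f z)"
proof -
 interpret q: sigma_finite_measure q by fact
 interpret qL: pair_sigma_finite q "lborel :: 't measure" ..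
 define a where "a = \<bar>r\<bar> ^ DIM('t)"
 have a: "0 < a" using r by (simp add: a_def)
 have L: "lborel = density (distr lborel borel (%x::'t. r *\<^sub>R x)) (%_. en a)"
  using lborel_affine[OF r, of "0::'t"] by (simp add: a_def)
 have fm [measurable]: "f \<in> Bm (q \<Otimes>\<^sub>M borel)"
  using borel_measurable_integrable[OF f] by (simp cong: measurable_cong_sets)
 have m: "(%z. f (fst z, r *\<^sub>R snd z)) \<in> Bm (q \<Otimes>\<^sub>M lborel)" by (simp cong: measurable_cong_sets)
 have nn: "en a * (nI lborel (%z. g (r *\<^sub>R z))) = (nI lborel (%z. g z))" if [measurable]: "g \<in> Bm borel" for g :: "'t => ennreal"
  by (subst (2) L) (simp add: nn_integral_density nn_integral_distr nn_integral_cmult)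
 have "en a * (nI (q \<Otimes>\<^sub>M lborel) (%z. en (norm (f (fst z, r *\<^sub>R snd z))))) =
  (nI q (%y. en a * (nI lborel (%z. en (norm (f (y, r *\<^sub>R z)))))))"
  using m by (subst lborel.nn_integral_fst[symmetric]) (auto intro!: nn_integral_cmult[symmetric] lborel.borel_measurable_nn_integral)
 also have "... = (nI q (%y. (nI lborel (%z. en (norm (f (y, z)))))))"
 proof (rule nn_integral_cong)
  fix y assume "y \<in> space q"
  then have [measurable]: "(%z. f (y, z)) \<in> Bm borel" by measurable
  show "en a * (nI lborel (%z. en (norm (f (y, r *\<^sub>R z))))) = (nI lborel (%z. en (norm (f (y, z)))))"
   by (rule nn) measurable
 qed
 also have "... = (nI (q \<Otimes>\<^sub>M lborel) (%z. en (norm (f z))))"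
  using borel_measurable_integrable[OF f] by (subst lborel.nn_integral_fst[symmetric]) auto
 also have "... < \<infinity>" using f by (simp add: integrable_iff_bounded)
 finally show int: "integrable (q \<Otimes>\<^sub>M lborel) (%z. f (fst z, r *\<^sub>R snd z))"
  using a m by (intro integrableI_bounded) (auto simp: ennreal_mult_less_top)
 have "a *\<^sub>R (LINT z|(q \<Otimes>\<^sub>M lborel). f (fst z, r *\<^sub>R snd z)) = (LINT y|q. a *\<^sub>R (LINT z|lborel. f (y, r *\<^sub>R z)))"
  using qL.integral_fst'[OF int] by simp
 also have "... = (LINT y|q. LINT z|lborel. f (y, z))"
 proof (intro Bochner_Integration.integral_cong refl)
  fix y assume "y \<in> space q"
  then have [measurable]: "(%z. f (y, z)) \<in> Bm borel" by measurable
  show "a *\<^sub>R (LINT z|lborel. f (y, r *\<^sub>R z)) = (LINT z|lborel. f (y, z))"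
   using a by (subst (2) L) (simp add: integral_density integral_distr)
 qed
 also have "... = (LINT z|(q \<Otimes>\<^sub>M lborel). f z)" by (rule qL.integral_fst'[OF f])
 finally show "\<bar>r\<bar> ^ DIM('t) *\<^sub>R (LINT z|(q \<Otimes>\<^sub>M lborel). f (fst z, r *\<^sub>R snd z)) = (LINT z|(q \<Otimes>\<^sub>M lborel). f z)"
  by (simp add: a_def)
qed

text \<open>Stretching space by the factor \<open>n\<^sup>1\<^sup>/\<^sup>d\<close> divides the exponent of the integral by \<open>n\<close>.\<close>

lemma subordinator_root:
 fixes k :: "'y \<times> 't::euclidean_space => real"
 assumes B: "subordinator_basis M (q \<Otimes>\<^sub>M (lborel :: 't measure)) L \<nu>" and q: "sigma_finite_measure q" and n: "n \<ge> 1"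
  and k: "integrable (q \<Otimes>\<^sub>M lborel) k" and k0: "\<And>z. z \<in> space (q \<Otimes>\<^sub>M lborel) ==> 0 \<le> k z"
 shows "\<exists>\<rho>. real_distribution \<rho> \<and> (AE v in \<rho>. 0 \<le> v) \<and> (\<forall>\<zeta>::complex. Re \<zeta> \<le> 0 \<longrightarrow>
  (CLINT v|\<rho>. exp (\<zeta> * v)) ^ n = exp (CLINT z|(q \<Otimes>\<^sub>M lborel). jump_measure.exponent \<nu> (\<zeta> * k z)))"
proof -
 interpret subordinator_basis M "q \<Otimes>\<^sub>M (lborel :: 't measure)" L \<nu> by fact
 define r where "r = root DIM('t) (real n)"
 have r: "r \<noteq> 0" "\<bar>r\<bar> ^ DIM('t) = real n" using n by (auto simp: r_def real_root_pow_pos2)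
 define \<kappa> where "\<kappa> z = k (fst z, r *\<^sub>R snd z)" for z
 have \<kappa>: "integrable (q \<Otimes>\<^sub>M lborel) \<kappa>" unfolding \<kappa>_def by (rule integrable_scale_snd[OF q k r(1)])
 have \<kappa>0: "0 \<le> \<kappa> z" if "z \<in> space (q \<Otimes>\<^sub>M lborel)" for z using that k0 by (auto simp: \<kappa>_def space_pair_measure)
 obtain Y where Y: "L_integral \<kappa> Y" using ex_L_integral[OF \<kappa>] ..
 have [measurable]: "Y \<in> Bm M" using Y by (simp add: L_integral_def)
 have Y0: "AE ww in M. 0 \<le> Y ww" using L_integral_nonneg[OF Y] \<kappa>0 by blast
 show ?thesis
 proof (intro exI[of _ "distr M borel Y"] conjI allI impI)
  show "real_distribution (distr M borel Y)" by (rule real_distribution_distr) measurable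
  show "AE v in distr M borel Y. 0 \<le> v" using Y0 by (subst AE_distr_iff) auto
  fix \<zeta> :: complex assume \<zeta>: "Re \<zeta> \<le> 0"
  let ?E = "%z. exponent (\<zeta> * k z)"
  have int: "integrable (q \<Otimes>\<^sub>M lborel) ?E" by (rule integrable_exponent_comp[OF k k0 \<zeta>])
  have "(CLINT v|distr M borel Y. exp (\<zeta> * v)) = (CLINT ww|M. exp (\<zeta> * Y ww))" by (rule integral_distr) measurable
  also have "... = exp (CLINT z|(q \<Otimes>\<^sub>M lborel). exponent (\<zeta> * \<kappa> z))" by (rule L_integral_transform[OF Y \<kappa>0 \<zeta>])
  finally have "(CLINT v|distr M borel Y. exp (\<zeta> * v)) ^ n = exp (of_nat n * (CLINT z|(q \<Otimes>\<^sub>M lborel). exponent (\<zeta> * \<kappa> z)))"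
   by (simp add: exp_of_nat_mult)
  also have "of_nat n * (CLINT z|(q \<Otimes>\<^sub>M lborel). exponent (\<zeta> * \<kappa> z)) = (CLINT z|(q \<Otimes>\<^sub>M lborel). ?E z)"
   using integral_scale_snd[OF q int r(1)] by (simp add: r(2) \<kappa>_def scaleR_conv_of_real)
  finally show "(CLINT v|distr M borel Y. exp (\<zeta> * v)) ^ n = exp (CLINT z|(q \<Otimes>\<^sub>M lborel). ?E z)" .
 qed
qed

text \<open>The characteristic function of a mixture is the Laplace transform of the variance law at
  \<open>t\<^sup>2 / 2\<close>, so mixing over an \<open>n\<close>-th root of the variance law gives
  an \<open>n\<close>-th root of the mixture. The case \<open>n = 1\<close> provides the variance
  law itself.\<close>

lemma normal_mixture_infinitely_divisible_type_G:
 fixes k :: "'y \<times> 't::euclidean_space => real"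
 assumes B: "subordinator_basis M (q \<Otimes>\<^sub>M (lborel :: 't measure)) L \<nu>" and q: "sigma_finite_measure q"
  and k: "integrable (q \<Otimes>\<^sub>M lborel) k" and k0: "\<And>z. z \<in> space (q \<Otimes>\<^sub>M lborel) ==> 0 \<le> k z"
  and \<mu>: "real_distribution \<mu>"
  and char: "\<And>t. char \<mu> t = exp (CLINT z|(q \<Otimes>\<^sub>M lborel). jump_measure.exponent \<nu> (- cor (t\<^sup>2 / 2) * k z))"
 shows "infinitely_divisible \<mu>" "type_G \<mu>"
proof -
 let ?N = "%\<rho>. distr (\<rho> \<Otimes>\<^sub>M std_normal_distribution) borel (%z. sqrt (max 0 (fst z)) * snd z)"
 have mix: "char (?N \<rho>) t = (CLINT v|\<rho>. exp (- cor (t\<^sup>2 / 2) * cor v))"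
  if "real_distribution \<rho>" "AE v in \<rho>. 0 \<le> v" for \<rho> t
 proof -
  interpret \<rho>: real_distribution \<rho> by fact
  show ?thesis unfolding char_normal_mixture[OF that(1)]
  proof (rule integral_cong_AE)
   show "AE v in \<rho>. exp (- cor (t\<^sup>2 / 2) * cor (max 0 v)) = exp (- cor (t\<^sup>2 / 2) * cor v)"
    using that(2) by eventually_elim (simp only: max_absorb2)
  qed measurable
 qed
 show "infinitely_divisible \<mu>"
 proof (rule infinitely_divisibleI[OF \<mu>])
  fix n :: nat assume "n \<ge> 1"
  from subordinator_root[OF B q this k k0] obtain \<rho> where \<rho>: "real_distribution \<rho>" "AE v in \<rho>. 0 \<le> v"
   "\<And>\<zeta>::complex. Re \<zeta> \<le> 0 ==> (CLINT v|\<rho>. exp (\<zeta> * v)) ^ n = exp (CLINT z|(q \<Otimes>\<^sub>M lborel). jump_measure.exponent \<nu> (\<zeta> * k z))"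
   by blast
  have "char (?N \<rho>) t ^ n = char \<mu> t" for t unfolding mix[OF \<rho>(1,2)] char by (rule \<rho>(3)) simp
  then show "\<exists>\<rho>. real_distribution \<rho> \<and> (\<forall>t. char \<rho> t ^ n = char \<mu> t)"
   using real_distribution_normal_mixture[OF \<rho>(1)] by blast
 qed
 from subordinator_root[OF B q order_refl k k0] obtain \<rho> where \<rho>: "real_distribution \<rho>" "AE v in \<rho>. 0 \<le> v"
  "\<And>\<zeta>::complex. Re \<zeta> \<le> 0 ==> (CLINT v|\<rho>. exp (\<zeta> * v)) = exp (CLINT z|(q \<Otimes>\<^sub>M lborel). jump_measure.exponent \<nu> (\<zeta> * k z))"
  by (auto simp: power_one_right)
 have \<rho>_id: "infinitely_divisible \<rho>"
 proof (rule infinitely_divisibleI[OF \<rho>(1)])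
  fix n :: nat assume "n \<ge> 1"
  from subordinator_root[OF B q this k k0] obtain \<rho>' where \<rho>': "real_distribution \<rho>'"
   "\<And>\<zeta>::complex. Re \<zeta> \<le> 0 ==> (CLINT v|\<rho>'. exp (\<zeta> * v)) ^ n = exp (CLINT z|(q \<Otimes>\<^sub>M lborel). jump_measure.exponent \<nu> (\<zeta> * k z))"
   by blast
  have "char \<rho>' t ^ n = char \<rho> t" for t
   using \<rho>'(2)[of "\<i> * t"] \<rho>(3)[of "\<i> * t"] by (simp add: char_def mult.assoc)
  then show "\<exists>\<rho>'. real_distribution \<rho>' \<and> (\<forall>t. char \<rho>' t ^ n = char \<rho> t)" using \<rho>'(1) by blast
 qed
 interpret \<rho>: real_distribution \<rho> by fact
 interpret S: real_distribution std_normal_distribution by (rule real_dist_normal_dist)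
 interpret P: pair_prob_space \<rho> std_normal_distribution ..
 let ?P = "\<rho> \<Otimes>\<^sub>M std_normal_distribution"
 have eq: "\<mu> = ?N \<rho>"
 proof (rule Levy_uniqueness[OF \<mu> real_distribution_normal_mixture[OF \<rho>(1)]], rule ext)
  show "char \<mu> t = char (?N \<rho>) t" for t unfolding mix[OF \<rho>(1,2)] char by (rule \<rho>(3)[symmetric]) simp
 qed
 have "distr ?P borel fst = distr ?P \<rho> fst" by (rule distr_cong) simp_all
 then have d1: "distr ?P borel fst = \<rho>" by (simp only: S.distr_pair_fst)
 have d2: "distr ?P borel snd = std_normal_distribution"
 proof (rule measure_eqI)
  fix A assume "A \<in> sets (distr ?P borel snd)"
  then have A: "A \<in> sets std_normal_distribution" by simp
  have "emeasure (distr ?P borel snd) A = emeasure ?P (space \<rho> \<times> A)"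
   using A by (subst emeasure_distr) (auto intro!: arg_cong[where f="emeasure ?P"] simp: space_pair_measure)
  also have "... = emeasure std_normal_distribution A" using A sets.top[of \<rho>] by (subst S.emeasure_pair_measure_Times) (simp_all add: \<rho>.emeasure_space_1 del: \<rho>.space_eq_univ)
  finally show "emeasure (distr ?P borel snd) A = emeasure std_normal_distribution A" .
 qed simp
 \<comment> \<open>\<open>type_G\<close> asks for a variance that is nonnegative at every point, so
   the first coordinate is replaced by its positive part, equal to it almost surely.\<close>
 have dmax: "distr ?P borel (%z. max 0 (fst z)) = \<rho>"
 proof -
  have "AE z in distr ?P borel fst. 0 \<le> z" using \<rho>(2) by (simp only: d1)
  then have "AE z in ?P. 0 \<le> fst z" by (intro AE_distrD[of fst ?P borel "%z. 0 \<le> z"]) simp_all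
  then have "AE z in ?P. max 0 (fst z) = fst z" by eventually_elim simp
  then have "distr ?P borel (%z. max 0 (fst z)) = distr ?P borel fst" by (intro distr_cong_AE) auto
  then show ?thesis by (simp add: d1)
 qed
 have ind: "P.indep_var borel (%z. max 0 (fst z)) borel snd"
 proof -
  have "distr ?P (borel \<Otimes>\<^sub>M borel) (%z. (fst z, snd z)) = ?P"
   by (simp add: distr_id2 sets_pair_measure_cong[OF \<rho>.events_eq_borel S.events_eq_borel])
  then have "P.indep_var borel fst borel snd" by (subst P.indep_var_distribution_eq) (simp_all add: d1 d2)
  from P.indep_var_compose[OF this, of "max 0" borel id borel] show ?thesis by (simp add: o_def)
 qed
 show "type_G \<mu>"
  unfolding type_G_def
  by (intro exI[of _ ?P] exI[of _ "%z. max 0 (fst z)"] exI[of _ snd] conjI P.prob_space_axioms ind eq)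
   (simp_all add: dmax \<rho>_id d2)
qed

section \<open>Measure-preserving maps of space\<close>

definition lborel_preserving :: "('t::euclidean_space => 't) => bool" where
 "lborel_preserving T \<longleftrightarrow> T \<in> measurable borel borel \<and> distr lborel borel T = lborel"

lemma lborel_preserving_affine:
 assumes "\<bar>r\<bar> = 1"
 shows "lborel_preserving (%x :: 't::euclidean_space. t + r *\<^sub>R x)"
 using assms lborel_affine[of r t] by (auto simp: lborel_preserving_def density_1)

lemma lborel_preserving_shift: "lborel_preserving (%x :: 't::euclidean_space. x + t)"
 using lborel_preserving_affine[of 1 t] by (simp add: add.commute)

lemma lborel_preserving_reflect: "lborel_preserving (%x :: 't::euclidean_space. t - x)"
 using lborel_preserving_affine[of "-1" t] by simp

lemma distr_map_snd:
 fixes T :: "'t::euclidean_space => 't"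
 assumes T: "lborel_preserving T"
 shows "(%z. (fst z, T (snd z))) \<in> measurable (N \<Otimes>\<^sub>M lborel) (N \<Otimes>\<^sub>M lborel)"
  and "distr (N \<Otimes>\<^sub>M lborel) (N \<Otimes>\<^sub>M lborel) (%z. (fst z, T (snd z))) = N \<Otimes>\<^sub>M lborel"
proof -
 have [measurable]: "T \<in> measurable borel borel" and D: "distr lborel borel T = lborel"
  using T by (auto simp: lborel_preserving_def)
 show "(%z. (fst z, T (snd z))) \<in> measurable (N \<Otimes>\<^sub>M lborel) (N \<Otimes>\<^sub>M lborel)" by measurable
 have "N \<Otimes>\<^sub>M lborel = distr N N (%x. x) \<Otimes>\<^sub>M distr lborel borel T" by (simp add: D)
 also have "... = distr (N \<Otimes>\<^sub>M lborel) (N \<Otimes>\<^sub>M borel) (%(x, y). (x, T y))"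
  by (rule pair_measure_distr) (auto simp: D sigma_finite_lborel)
 also have "... = distr (N \<Otimes>\<^sub>M lborel) (N \<Otimes>\<^sub>M lborel) (%z. (fst z, T (snd z)))"
  by (rule distr_cong) (auto simp: case_prod_beta intro!: sets_pair_measure_cong)
 finally show "distr (N \<Otimes>\<^sub>M lborel) (N \<Otimes>\<^sub>M lborel) (%z. (fst z, T (snd z))) = N \<Otimes>\<^sub>M lborel" ..
qed

lemma nn_integral_map_snd:
 assumes T: "lborel_preserving T" and f: "f \<in> Bm (N \<Otimes>\<^sub>M lborel)"
 shows "(nI (N \<Otimes>\<^sub>M lborel) (%z. f (fst z, T (snd z)))) = (nI (N \<Otimes>\<^sub>M lborel) (%z. f z))"
 using nn_integral_distr[OF distr_map_snd(1)[OF T, where N=N], of f] f by (simp add: distr_map_snd(2)[OF T])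

lemma integral_map_snd:
 fixes f :: "_ => 'b::{banach, second_countable_topology}"
 assumes T: "lborel_preserving T" and f: "f \<in> Bm (N \<Otimes>\<^sub>M lborel)"
 shows "(LINT z|(N \<Otimes>\<^sub>M lborel). f (fst z, T (snd z))) = (LINT z|(N \<Otimes>\<^sub>M lborel). f z)"
 using integral_distr[OF distr_map_snd(1)[OF T, where N=N] f] by (simp add: distr_map_snd(2)[OF T])

text \<open>All jumps are positive, so a vanishing mean makes the jump measure null.\<close>

lemma (in jump_measure) exponent_eq_0_if_mean_0:
 assumes "mean = 0"
 shows "exponent \<zeta> = 0"
proof -
 have "(\<integral>\<^sup>+w. en w \<partial>\<nu>) = 0" using assms by (simp add: nn_integral_id)
 then have "AE w in \<nu>. en w = 0" by (subst (asm) nn_integral_0_iff_AE) auto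
 then have "AE w in \<nu>. exp (\<zeta> * cor w) - 1 = 0"
  using AE_space by eventually_elim (auto simp: space_\<nu> ennreal_eq_0_iff)
 then show ?thesis unfolding exponent_def by (rule integral_eq_zero_AE)
qed

section \<open>The modulated field\<close>

text \<open>The volatility appears twice, as a moving average over \<open>L\<close> and as a field
  measurable with respect to \<open>N\<close>, which is independent of \<open>W\<close>. The two
  bases meet only through it.\<close>

locale modulated_field =
 L: subordinator_basis M "q \<Otimes>\<^sub>M (lborel :: (real ^ 'd::finite) measure)" L \<nu> +
 W: independent_walsh_basis M "p \<Otimes>\<^sub>M (lborel :: (real ^ 'd::finite) measure)" W F "%z. snd z $ i" N
 for M :: "'w measure" and q :: "'y measure" and L \<nu> and p :: "'x measure" and W F and i :: "'d::finite" and N +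
 fixes g :: "'x \<times> (real ^ 'd::finite) => real" and h k :: "'y \<times> (real ^ 'd::finite) => real"
  and \<sigma> :: "real ^ 'd::finite => 'w => real" and X :: "real ^ 'd::finite => 'w => real"
 assumes q: "sigma_finite_measure q" and p: "sigma_finite_measure p"
  and g: "g \<in> Bm (p \<Otimes>\<^sub>M lborel)"
  and h: "h \<in> Bm (q \<Otimes>\<^sub>M lborel)" and h0: "\<And>z. z \<in> space (q \<Otimes>\<^sub>M lborel) ==> 0 \<le> h z"
  and k: "k \<in> Bm (q \<Otimes>\<^sub>M lborel)" and k0: "\<And>z. z \<in> space (q \<Otimes>\<^sub>M lborel) ==> 0 \<le> k z"
  and \<sigma>_joint: "(%(s, ww). \<sigma> s ww) \<in> Bm (borel \<Otimes>\<^sub>M M)"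
  and \<sigma>_F: "\<And>s. \<sigma> s \<in> Bm (F (s $ i))"
  and \<sigma>_N: "\<And>s. \<sigma> s \<in> Bm N"
  and stationary: "strictly_stationary M \<sigma>"
  and finite_variance: "(nI (p \<Otimes>\<^sub>M lborel) (%z. en ((g (fst z, 0 - snd z))\<^sup>2))) * (nI M (%ww. en ((\<sigma> 0 ww)\<^sup>2))) < \<infinity>"
  and rr: "\<And>s. has_rr_integral M (q \<Otimes>\<^sub>M lborel) L (%z. h (fst z, s - snd z)) (%ww. (\<sigma> s ww)\<^sup>2)"
  and k_eq: "\<And>y t u. y \<in> space q ==>
   (nI (p \<Otimes>\<^sub>M lborel) (%z. en ((g (fst z, t - snd z))\<^sup>2 * h (y, snd z - u)))) = en (k (y, t - u))"
  and X: "\<And>t. W.walsh_limit (%z ww. g (fst z, t - snd z) * \<sigma> (snd z) ww) (X t)"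
begin

abbreviation "c \<equiv> p \<Otimes>\<^sub>M (lborel :: (real ^ 'd) measure)"
abbreviation "cs \<equiv> q \<Otimes>\<^sub>M (lborel :: (real ^ 'd) measure)"

definition "G0 = (nI c (%z. en ((g (fst z, 0 - snd z))\<^sup>2)))"
definition "V0 = (nI M (%ww. en ((\<sigma> 0 ww)\<^sup>2)))"
definition "H0 = (nI cs (%z. en (h z)))"
text \<open>The kernel that turns the integral of the squared \<open>G\<close> times the squared
  volatility into an integral over \<open>L\<close>. For \<open>G\<close> built from
  \<open>g\<close> at one point \<open>t\<close> it is a reflected translate of
  \<open>k\<close>.\<close>

definition "mod_kernel G z = (LINT w|c. (G w)\<^sup>2 * h (fst z, snd w - snd z))"
definition "V t ww = (LINT z|c. (g (fst z, t - snd z))\<^sup>2 * (\<sigma> (snd z) ww)\<^sup>2)"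

lemma gm [measurable]: "g \<in> Bm (p \<Otimes>\<^sub>M borel)"
 using g by (simp cong: measurable_cong_sets)

lemma hm [measurable]: "h \<in> Bm (q \<Otimes>\<^sub>M borel)"
 using h by (simp cong: measurable_cong_sets)

lemma km [measurable]: "k \<in> Bm (q \<Otimes>\<^sub>M borel)"
 using k by (simp cong: measurable_cong_sets)

lemma \<sigma>_M [measurable]: "\<sigma> s \<in> Bm M"
 using stationary by (simp add: strictly_stationary_def)

lemma \<sigma>_cM [measurable]: "(%(z, ww). \<sigma> (snd z) ww) \<in> Bm (c \<Otimes>\<^sub>M M)"
proof -
 note [measurable] = \<sigma>_joint
 have "(%y. (%(s, ww). \<sigma> s ww) (snd (fst y), snd y)) \<in> Bm (c \<Otimes>\<^sub>M M)" by measurable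
 then show ?thesis by (simp add: case_prod_beta)
qed

lemma X_M [measurable]: "X t \<in> Bm M"
 using X by (simp add: W.walsh_limit_def)

lemma variance: "(nI M (%ww. en ((\<sigma> s ww)\<^sup>2))) = V0"
 unfolding V0_def by (rule strictly_stationary_one[OF stationary]) measurable

lemma h_shift: "(nI cs (%z. en (h (fst z, s - snd z)))) = H0"
 unfolding H0_def using h by (intro nn_integral_map_snd[OF lborel_preserving_reflect, of "%z. en (h z)"]) simp

lemma g_shift: "(nI c (%z. en ((g (fst z, t - snd z))\<^sup>2))) = G0"
proof -
 have "(%z. en ((g (fst z, 0 - snd z))\<^sup>2)) \<in> Bm c" by measurable
 from nn_integral_map_snd[OF lborel_preserving_shift[of "- t"] this] show ?thesis by (simp add: G0_def)
qed

text \<open>The lower bound is the expectation estimate for nonnegative kernels, the upper one the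
  mean estimate against the empty list. The values are extended because none of them is known to be
  finite at this stage.\<close>

lemma mean_H0: "en L.mean * H0 = V0"
proof (rule antisym)
 have "en L.mean * (nI cs (%z. en (h (fst z, 0 - snd z)))) \<le> (nI M (%ww. en ((\<sigma> 0 ww)\<^sup>2)))"
  using L.rr_integral_expectation[OF rr[of 0]] h0 by (auto simp: space_pair_measure)
 then show "en L.mean * H0 \<le> V0" by (simp only: h_shift variance)
 have "(nI M (%ww. en \<bar>(\<sigma> 0 ww)\<^sup>2\<bar>)) \<le> ennreal L.mean * (nI cs (%z. en \<bar>h (fst z, 0 - snd z)\<bar>))"
  using L.rr_integral_diff_le[OF rr[of 0], of "[]"] by simp
 also have "(nI cs (%z. en \<bar>h (fst z, 0 - snd z)\<bar>)) = H0"
  unfolding h_shift[of 0, symmetric] using h0 by (intro nn_integral_cong) (auto simp: space_pair_measure abs_of_nonneg)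
 finally show "V0 \<le> ennreal L.mean * H0" by (simp add: V0_def)
qed

text \<open>Tonelli exchanges the integrals, and the inner integral of \<open>h\<close> does not
  depend on its shift.\<close>

lemma nn_integral_k: "(nI cs (%z. en (k z))) = G0 * H0"
proof -
 interpret c: sigma_finite_measure c by (rule W.c_sigma_finite)
 interpret cs: sigma_finite_measure cs by (rule L.c_sigma_finite)
 interpret P: pair_sigma_finite cs c ..
 have "(nI cs (%z. en (k z))) = (nI cs (%z. en (k (fst z, 0 - snd z))))"
  using k by (intro nn_integral_map_snd[OF lborel_preserving_reflect, of "%z. en (k z)", symmetric]) simp
 also have "... = (nI cs (%z. nI c (%w. en ((g (fst w, 0 - snd w))\<^sup>2) * en (h (fst z, snd w - snd z)))))"
 proof (rule nn_integral_cong)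
  fix z assume z: "z \<in> space cs"
  then have "fst z \<in> space q" by (auto simp: space_pair_measure)
  from k_eq[OF this, of 0 "snd z"]
  have "en (k (fst z, 0 - snd z)) = (nI c (%w. en ((g (fst w, 0 - snd w))\<^sup>2 * h (fst z, snd w - snd z))))" by simp
  also have "... = (nI c (%w. en ((g (fst w, 0 - snd w))\<^sup>2) * en (h (fst z, snd w - snd z))))"
   using z h0 by (intro nn_integral_cong ennreal_mult) (auto simp: space_pair_measure)
  finally show "en (k (fst z, 0 - snd z)) = ..." .
 qed
 also have "... = (nI c (%w. nI cs (%z. en ((g (fst w, 0 - snd w))\<^sup>2) * en (h (fst z, snd w - snd z)))))"
  by (rule P.Fubini'[symmetric]) measurable
 also have "... = (nI c (%w. en ((g (fst w, 0 - snd w))\<^sup>2) * H0))"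
  by (intro nn_integral_cong) (subst nn_integral_cmult, measurable, simp add: h_shift)
 also have "... = G0 * H0" unfolding G0_def by (rule nn_integral_multc) measurable
 finally show ?thesis .
qed

lemma mean_k: "en L.mean * (nI cs (%z. en (k z))) = G0 * V0"
 unfolding nn_integral_k mean_H0[symmetric] by (simp add: mult_ac)

lemma G0_V0: "G0 * V0 < \<infinity>"
 using finite_variance by (simp add: G0_def V0_def)

lemma mean_square_X: "(nI M (%ww. nI c (%z. en ((g (fst z, t - snd z) * \<sigma> (snd z) ww)\<^sup>2)))) = G0 * V0"
proof -
 interpret c: sigma_finite_measure c by (rule W.c_sigma_finite)
 interpret P: pair_sigma_finite c M ..
 have "(nI M (%ww. nI c (%z. en ((g (fst z, t - snd z) * \<sigma> (snd z) ww)\<^sup>2)))) =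
  (nI c (%z. nI M (%ww. en ((g (fst z, t - snd z) * \<sigma> (snd z) ww)\<^sup>2))))"
  by (rule P.Fubini') measurable
 also have "... = (nI c (%z. en ((g (fst z, t - snd z))\<^sup>2) * V0))"
  by (intro nn_integral_cong) (simp add: power_mult_distrib ennreal_mult nn_integral_cmult variance)
 also have "... = G0 * V0" by (subst nn_integral_multc) (measurable, simp add: g_shift)
 finally show ?thesis .
qed

text \<open>A zero product of extended numbers may hide an infinite factor, so the kernels may fail
  to be integrable; but then all quantities in question vanish.\<close>

lemma degenerate:
 fixes \<zeta> :: complex
 assumes 0: "G0 * V0 = 0"
 shows "AE ww in M. X t ww = 0" "AE ww in M. V t ww = 0" "(CLINT z|cs. L.exponent (\<zeta> * k z)) = 0"
proof -
 interpret c: sigma_finite_measure c by (rule W.c_sigma_finite)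
 show "AE ww in M. X t ww = 0" using W.walsh_limit_eq_0[OF X] mean_square_X 0 by simp
 have "AE ww in M. (nI c (%z. en ((g (fst z, t - snd z) * \<sigma> (snd z) ww)\<^sup>2))) = 0"
  using mean_square_X[of t] unfolding 0 by (subst (asm) nn_integral_0_iff_AE) measurable
 then show "AE ww in M. V t ww = 0"
 proof eventually_elim
  case (elim ww)
  have "V t ww = enn2real (nI c (%z. en ((g (fst z, t - snd z) * \<sigma> (snd z) ww)\<^sup>2)))" if "ww \<in> space M"
   unfolding V_def power_mult_distrib[symmetric] using that by (intro integral_eq_nn_integral) auto
  \<comment> \<open>For \<open>ww\<close> outside the sample space the section need not be
    measurable; its integral is then zero by convention.\<close>
  moreover have "V t ww = 0" if "\<not> (%z. (g (fst z, t - snd z))\<^sup>2 * (\<sigma> (snd z) ww)\<^sup>2) \<in> Bm c"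
   unfolding V_def using that borel_measurable_integrable by (intro not_integrable_integral_eq) blast
  moreover have "V t ww = enn2real (nI c (%z. en ((g (fst z, t - snd z) * \<sigma> (snd z) ww)\<^sup>2)))"
   if "(%z. (g (fst z, t - snd z))\<^sup>2 * (\<sigma> (snd z) ww)\<^sup>2) \<in> Bm c"
   unfolding V_def power_mult_distrib using that by (intro integral_eq_nn_integral) auto
  ultimately show ?case using elim by fastforce
 qed
 \<comment> \<open>By \<open>mean_k\<close> the product of these two numbers vanishes, and either of
   them being zero annihilates the exponent almost everywhere.\<close>
 have "L.mean = 0 \<or> (nI cs (%z. en (k z))) = 0" using mean_k 0 L.mean_nonneg by (auto simp: ennreal_eq_0_iff)
 then have "AE z in cs. L.exponent (\<zeta> * k z) = 0"
 proof
  assume "(nI cs (%z. en (k z))) = 0"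
  then have "AE z in cs. en (k z) = 0" using k by (subst (asm) nn_integral_0_iff_AE) auto
  then show ?thesis using AE_space
  proof eventually_elim
   case (elim z)
   then have "k z = 0" using k0 by (auto simp: ennreal_eq_0_iff antisym)
   then show ?case by (simp add: L.exponent_def)
  qed
 qed (simp add: L.exponent_eq_0_if_mean_0)
 then show "(CLINT z|cs. L.exponent (\<zeta> * k z)) = 0" by (rule integral_eq_zero_AE)
qed

context
 assumes nondegenerate: "G0 * V0 \<noteq> 0"
begin

text \<open>A finite nonzero product of extended numbers has finite factors. The mean of the jumps
  is then positive, and \<open>mean_H0\<close> makes the kernel \<open>h\<close> integrable.\<close>

lemma finite_parts: "G0 < \<infinity>" "V0 < \<infinity>" "H0 < \<infinity>"
proof -
 show "G0 < \<infinity>" "V0 < \<infinity>" using G0_V0 nondegenerate by (auto simp: ennreal_mult_less_top top.not_eq_extremum)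
 then have "en L.mean * H0 < \<infinity>" by (simp add: mean_H0)
 moreover have "en L.mean \<noteq> 0" using nondegenerate mean_H0 by force
 ultimately show "H0 < \<infinity>" by (auto simp: ennreal_mult_less_top)
qed

lemma volatility_field: "volatility_field M c W F (%z. snd z $ i) N snd i \<sigma>"
proof (intro volatility_field.intro W.independent_walsh_basis_axioms volatility_field_axioms.intro)
 show "integrable M (%ww. (\<sigma> 0 ww)\<^sup>2)"
  using finite_parts(2) by (intro integrableI_bounded) (auto simp: V0_def)
qed (use \<sigma>_joint \<sigma>_F \<sigma>_N stationary in auto)


text \<open>The stochastic Fubini theorem with the squared \<open>G\<close> as weight. Its
  hypothesis on the product space holds because the integral of \<open>h\<close> does not feel the
  shift and factors out.\<close>

lemma L_integral_kernel:
 assumes G [measurable]: "G \<in> Bm c" and fin: "(nI c (%z. en ((G z)\<^sup>2))) < \<infinity>"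
 shows "L.L_integral (mod_kernel G) (%ww. LINT w|c. (G w)\<^sup>2 * (\<sigma> (snd w) ww)\<^sup>2)"
proof -
 interpret cs: sigma_finite_measure cs by (rule L.c_sigma_finite)
 have m: "(%(w, z). (G w)\<^sup>2 * h (fst z, snd w - snd z)) \<in> Bm (c \<Otimes>\<^sub>M cs)" by measurable
 have "(nI (c \<Otimes>\<^sub>M cs) (%y. en (norm (case y of (w, z) => (G w)\<^sup>2 * h (fst z, snd w - snd z))))) =
  (nI c (%w. nI cs (%z. en (norm ((G w)\<^sup>2 * h (fst z, snd w - snd z))))))"
  using m by (subst cs.nn_integral_fst[symmetric]) (auto simp: case_prod_beta)
 also have "... = (nI c (%w. en ((G w)\<^sup>2) * H0))"
 proof (rule nn_integral_cong)
  fix w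
  have "(nI cs (%z. en (norm ((G w)\<^sup>2 * h (fst z, snd w - snd z))))) = (nI cs (%z. en ((G w)\<^sup>2) * en (h (fst z, snd w - snd z))))"
   using h0 by (intro nn_integral_cong) (auto simp: space_pair_measure abs_mult ennreal_mult)
  also have "... = en ((G w)\<^sup>2) * H0" by (subst nn_integral_cmult) (measurable, simp add: h_shift)
  finally show "(nI cs (%z. en (norm ((G w)\<^sup>2 * h (fst z, snd w - snd z))))) = en ((G w)\<^sup>2) * H0" .
 qed
 also have "... = (nI c (%w. en ((G w)\<^sup>2))) * H0" by (rule nn_integral_multc) measurable
 also have "... < \<infinity>" using fin finite_parts(3) by (simp add: ennreal_mult_less_top)
 finally have int: "integrable (c \<Otimes>\<^sub>M cs) (%(w, z). (G w)\<^sup>2 * h (fst z, snd w - snd z))"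
  using m by (intro integrableI_bounded) auto
 have "(%(w, ww). (\<sigma> (snd w) ww)\<^sup>2) \<in> Bm (c \<Otimes>\<^sub>M M)" by measurable
 from L.integrated_L_integral[OF W.c_sigma_finite this _ _ int rr] show ?thesis unfolding mod_kernel_def by simp
qed

lemma kernel_nonneg: "z \<in> space cs ==> 0 \<le> mod_kernel G z"
 unfolding mod_kernel_def using h0 by (intro integral_nonneg_AE AE_I2) (auto simp: space_pair_measure)

text \<open>Conditioning on the volatility leaves the Laplace transform of the conditional variance
  at \<open>1/2\<close>, and that variance is an integral over \<open>L\<close>.\<close>

lemma char_modulated:
 assumes G: "G \<in> Bm c" "(nI c (%z. en ((G z)\<^sup>2))) < \<infinity>"
  and Y: "W.walsh_limit (%z ww. G z * \<sigma> (snd z) ww) Y"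
 shows "(CLINT ww|M. iexp (Y ww)) = exp (CLINT z|cs. L.exponent (- (1/2) * cor (mod_kernel G z)))"
proof -
 have "(CLINT ww|M. iexp (Y ww)) = (CLINT ww|M. exp (- (1/2) * cor (LINT w|c. (G w)\<^sup>2 * (\<sigma> (snd w) ww)\<^sup>2)))"
  using volatility_field.char_walsh_\<sigma>[OF volatility_field Y G] by (simp add: power_mult_distrib)
 also have "... = exp (CLINT z|cs. L.exponent (- (1/2) * cor (mod_kernel G z)))"
  by (rule L.L_integral_transform[OF L_integral_kernel[OF G] kernel_nonneg]) simp_all
 finally show ?thesis .
qed

text \<open>Finite linear combinations of the field are Walsh integrals of the same type, which
  brings the finite-dimensional laws within reach of \<open>char_modulated\<close>.\<close>

lemma g_sum:
 fixes \<theta> :: "real ^ 'd => real"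
 assumes "finite J"
 defines "G \<equiv> %r z. \<Sum>t\<in>J. \<theta> t * g (fst z, t + r - snd z)"
 shows "G r \<in> Bm c" "(nI c (%z. en ((G r z)\<^sup>2))) < \<infinity>"
  "W.walsh_limit (%z ww. G r z * \<sigma> (snd z) ww) (%ww. \<Sum>t\<in>J. \<theta> t * X (t + r) ww)"
proof -
 show "G r \<in> Bm c" unfolding G_def by measurable
 show "W.walsh_limit (%z ww. G r z * \<sigma> (snd z) ww) (%ww. \<Sum>t\<in>J. \<theta> t * X (t + r) ww)"
  using assms(1) unfolding G_def
 proof (induction J rule: finite_induct)
  case empty
  then show ?case using W.walsh_limit_zero by simp
 next
  case (insert t J)
  from W.walsh_limit_add_scale[OF insert.IH X[of "t + r"], of "\<theta> t"] insert.hyps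
  show ?case by (simp add: algebra_simps)
 qed
 show "(nI c (%z. en ((G r z)\<^sup>2))) < \<infinity>"
  using assms(1) unfolding G_def
 proof (induction J rule: finite_induct)
  case (insert t J)
  let ?a = "%z. \<Sum>t\<in>J. \<theta> t * g (fst z, t + r - snd z)" and ?b = "%z. \<theta> t * g (fst z, t + r - snd z)"
  have "(nI c (%z. en ((\<Sum>t\<in>insert t J. \<theta> t * g (fst z, t + r - snd z))\<^sup>2))) = (nI c (%z. en ((?a z + ?b z)\<^sup>2)))"
   using insert.hyps by (simp add: add.commute)
  also have "... \<le> 2 * (nI c (%z. en ((?a z)\<^sup>2))) + 2 * (nI c (%z. en ((?b z)\<^sup>2)))"
   by (rule nn_integral_square_add_le) measurable
  also have "(nI c (%z. en ((?b z)\<^sup>2))) = en ((\<theta> t)\<^sup>2) * G0"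
   by (simp only: power_mult_distrib ennreal_mult zero_le_power2) (subst nn_integral_cmult, measurable, simp add: g_shift)
  also have "2 * (nI c (%z. en ((?a z)\<^sup>2))) + 2 * (en ((\<theta> t)\<^sup>2) * G0) < \<infinity>"
   using insert.IH finite_parts(1) by (simp add: ennreal_mult_less_top)
  finally show ?case .
 qed simp
qed

lemma kernel_shift:
 assumes G: "G \<in> Bm c" and z: "z \<in> space cs"
 shows "mod_kernel (%w. G (fst w, snd w + - r)) z = mod_kernel G (fst z, snd z + - r)"
proof -
 have [measurable]: "G \<in> Bm (p \<Otimes>\<^sub>M borel)" using G by (simp cong: measurable_cong_sets)
 have [measurable]: "(%s. h (fst z, s)) \<in> Bm borel"
  using z by (intro measurable_Pair2[OF hm]) (auto simp: space_pair_measure)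
 have "(%w. (G w)\<^sup>2 * h (fst z, snd w + r - snd z)) \<in> Bm c" by measurable
 from integral_map_snd[OF lborel_preserving_shift[of "- r"] this] show ?thesis
  by (simp add: mod_kernel_def algebra_simps)
qed

text \<open>Shifting all points shifts the kernel of every linear combination, while the exponent is
  an integral over the whole of \<open>cs\<close> and blind to shifts.\<close>

lemma stationary_X_nondegenerate: "strictly_stationary M X"
 unfolding strictly_stationary_def
proof (intro conjI allI impI X_M)
 fix J :: "(real ^ 'd) set" and r assume J: "finite J"
 show "distr M (\<Pi>\<^sub>M t\<in>J. borel) (%ww. \<lambda>t\<in>J. X (t + r) ww) = distr M (\<Pi>\<^sub>M t\<in>J. borel) (%ww. \<lambda>t\<in>J. X t ww)"
 proof (rule L.distr_PiM_eqI_char[OF J X_M X_M])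
  fix \<theta> :: "real ^ 'd => real"
  define G where "G r z = (\<Sum>t\<in>J. \<theta> t * g (fst z, t + r - snd z))" for r z
  note sum = g_sum[OF J, of \<theta>, folded G_def]
  have G: "G r = (%w. G 0 (fst w, snd w + - r))" by (simp add: G_def fun_eq_iff algebra_simps)
  have "mod_kernel (G 0) \<in> Bm cs" using L_integral_kernel[OF sum(1,2), of 0] by (auto simp: L.L_integral_def)
  then have m: "(%z. L.exponent (- (1/2) * cor (mod_kernel (G 0) z))) \<in> Bm cs" by measurable
  have "(CLINT ww|M. iexp (\<Sum>t\<in>J. \<theta> t * X (t + r) ww)) = exp (CLINT z|cs. L.exponent (- (1/2) * cor (mod_kernel (G r) z)))"
   by (rule char_modulated[OF sum])
  also have "(CLINT z|cs. L.exponent (- (1/2) * cor (mod_kernel (G r) z))) = (CLINT z|cs. L.exponent (- (1/2) * cor (mod_kernel (G 0) (fst z, snd z + - r))))"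
   unfolding G by (intro Bochner_Integration.integral_cong refl) (simp only: kernel_shift[OF sum(1)])
  also have "... = (CLINT z|cs. L.exponent (- (1/2) * cor (mod_kernel (G 0) z)))"
   by (rule integral_map_snd[OF lborel_preserving_shift m])
  also have "exp ... = (CLINT ww|M. iexp (\<Sum>t\<in>J. \<theta> t * X (t + 0) ww))"
   by (rule char_modulated[OF sum, symmetric])
  finally show "(CLINT ww|M. iexp (\<Sum>t\<in>J. \<theta> t * X (t + r) ww)) = (CLINT ww|M. iexp (\<Sum>t\<in>J. \<theta> t * X t ww))" by simp
 qed
qed

text \<open>At a single point \<open>t\<close> the kernel is \<open>\<theta>\<^sup>2\<close> times a
  reflected translate of \<open>k\<close>, and such maps preserve Lebesgue measure.\<close>

lemma exponent_kernel:
 fixes \<zeta> :: complex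
 shows "(CLINT z|cs. L.exponent (\<zeta> * mod_kernel (%w. \<theta> * g (fst w, t - snd w)) z)) = (CLINT z|cs. L.exponent (\<zeta> * cor (\<theta>\<^sup>2) * k z))"
proof -
 have kern: "mod_kernel (%w. \<theta> * g (fst w, t - snd w)) z = \<theta>\<^sup>2 * k (fst z, t - snd z)" if z: "z \<in> space cs" for z
 proof -
  have [measurable]: "(%s. h (fst z, s)) \<in> Bm borel"
   using z by (intro measurable_Pair2[OF hm]) (auto simp: space_pair_measure)
  \<comment> \<open>\<open>k_eq\<close> speaks of nonnegative integrals, so the Bochner integral is
    first brought to that form.\<close>
  have "(LINT w|c. (g (fst w, t - snd w))\<^sup>2 * h (fst z, snd w - snd z)) =
   enn2real (nI c (%w. en ((g (fst w, t - snd w))\<^sup>2 * h (fst z, snd w - snd z))))"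
   using z h0 by (intro integral_eq_nn_integral AE_I2) (measurable, auto simp: space_pair_measure)
  also have "... = k (fst z, t - snd z)"
   using z k0 by (subst k_eq) (auto simp: space_pair_measure)
  finally show ?thesis by (simp add: mod_kernel_def power_mult_distrib mult.assoc)
 qed
 have "(%z. L.exponent (\<zeta> * cor (\<theta>\<^sup>2 * k z))) \<in> Bm cs" by measurable
 from integral_map_snd[OF lborel_preserving_reflect[of t] this]
 have "(CLINT z|cs. L.exponent (\<zeta> * cor (\<theta>\<^sup>2 * k (fst z, t - snd z)))) = (CLINT z|cs. L.exponent (\<zeta> * cor (\<theta>\<^sup>2 * k z)))" .
 moreover have "(CLINT z|cs. L.exponent (\<zeta> * mod_kernel (%w. \<theta> * g (fst w, t - snd w)) z)) =
  (CLINT z|cs. L.exponent (\<zeta> * cor (\<theta>\<^sup>2 * k (fst z, t - snd z))))"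
  by (intro Bochner_Integration.integral_cong refl) (simp only: kern)
 ultimately show ?thesis by (simp add: mult.assoc)
qed

lemma char_X_nondegenerate: "(CLINT ww|M. iexp (\<theta> * X t ww)) = exp (CLINT z|cs. L.exponent (- cor (\<theta>\<^sup>2 / 2) * k z))"
proof -
 let ?G = "%w. \<theta> * g (fst w, t - snd w)"
 have "?G \<in> Bm c" "(nI c (%z. en ((?G z)\<^sup>2))) < \<infinity>" "W.walsh_limit (%z ww. ?G z * \<sigma> (snd z) ww) (%ww. \<theta> * X t ww)"
  using g_sum[of "{t}" "%_. \<theta>" 0] by simp_all
 from char_modulated[OF this] show ?thesis unfolding exponent_kernel by simp
qed

lemma laplace_V_nondegenerate:
 assumes "0 \<le> \<zeta>"
 shows "(CLINT ww|M. exp (- cor \<zeta> * cor (V t ww))) = exp (CLINT z|cs. L.exponent (- cor \<zeta> * k z))"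
proof -
 let ?G = "%w. 1 * g (fst w, t - snd w)"
 have G: "?G \<in> Bm c" "(nI c (%z. en ((?G z)\<^sup>2))) < \<infinity>"
  using g_sum(1,2)[of "{t}" "%_. 1" 0] by simp_all
 have "(CLINT ww|M. exp (- cor \<zeta> * cor (LINT w|c. (?G w)\<^sup>2 * (\<sigma> (snd w) ww)\<^sup>2))) =
  exp (CLINT z|cs. L.exponent (- cor \<zeta> * mod_kernel ?G z))"
  by (rule L.L_integral_transform[OF L_integral_kernel[OF G] kernel_nonneg]) (use assms in simp_all)
 then show ?thesis unfolding exponent_kernel by (simp add: V_def)
qed

end
end

context modulated_field
begin

lemma V_M [measurable]: "V t \<in> Bm M"
proof -
 interpret c: sigma_finite_measure c by (rule W.c_sigma_finite)
 have [measurable]: "(%y. \<sigma> (snd (snd y)) (fst y)) \<in> Bm (M \<Otimes>\<^sub>M c)"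
  using measurable_pair_swap[OF \<sigma>_cM] by (simp add: case_prod_beta)
 have "(%(ww, z). (g (fst z, t - snd z))\<^sup>2 * (\<sigma> (snd z) ww)\<^sup>2) \<in> Bm (M \<Otimes>\<^sub>M c)" by (subst case_prod_beta') measurable
 then show ?thesis unfolding V_def by (rule c.borel_measurable_lebesgue_integral)
qed

lemma AE_0_exp:
 assumes [measurable]: "Y \<in> Bm M" and Y: "AE ww in M. Y ww = 0"
 shows "(CLINT ww|M. exp (\<zeta> * cor (Y ww))) = 1"
proof -
 have "(CLINT ww|M. exp (\<zeta> * cor (Y ww))) = (CLINT ww|M. 1)"
  by (rule integral_cong_AE) (use Y in \<open>auto elim: eventually_mono\<close>)
 then show ?thesis by (simp add: L.prob_space)
qed

lemma char_X: "(CLINT ww|M. iexp (\<theta> * X t ww)) = exp (CLINT z|cs. L.exponent (- cor (\<theta>\<^sup>2 / 2) * k z))"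
proof (cases "G0 * V0 = 0")
 case True
 show ?thesis using AE_0_exp[OF X_M degenerate(1)[OF True], of "\<i> * \<theta>"] by (simp only: degenerate(3)[OF True] of_real_mult mult.assoc exp_zero)
qed (rule char_X_nondegenerate)

lemma laplace_V:
 assumes "0 \<le> \<zeta>"
 shows "(CLINT ww|M. exp (- cor \<zeta> * cor (V t ww))) = exp (CLINT z|cs. L.exponent (- cor \<zeta> * k z))"
proof (cases "G0 * V0 = 0")
 case True
 show ?thesis using AE_0_exp[OF V_M degenerate(2)[OF True]] by (simp only: degenerate(3)[OF True] exp_zero)
qed (rule laplace_V_nondegenerate[OF _ assms])

lemma stationary_X: "strictly_stationary M X"
proof (cases "G0 * V0 = 0")
 case True
 show ?thesis
  unfolding strictly_stationary_def
 proof (intro conjI allI impI X_M)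
  fix J :: "(real ^ 'd) set" and r assume J: "finite J"
  have "AE ww in M. \<forall>t\<in>J. X (t + r) ww = 0 \<and> X t ww = 0"
   using J degenerate(1)[OF True] by (intro AE_finite_allI) auto
  then have "AE ww in M. (\<lambda>t\<in>J. X (t + r) ww) = (\<lambda>t\<in>J. X t ww)" by eventually_elim (auto simp: restrict_def)
  then show "distr M (\<Pi>\<^sub>M t\<in>J. borel) (%ww. \<lambda>t\<in>J. X (t + r) ww) = distr M (\<Pi>\<^sub>M t\<in>J. borel) (%ww. \<lambda>t\<in>J. X t ww)"
   by (intro distr_cong_AE refl measurable_restrict X_M)
 qed
qed (rule stationary_X_nondegenerate)

lemma infinitely_divisible_type_G_X: "infinitely_divisible (distr M borel (X t))" "type_G (distr M borel (X t))"
proof -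
 have \<mu>: "real_distribution (distr M borel (X t))" by (rule L.real_distribution_distr[OF X_M])
 have char: "char (distr M borel (X t)) \<theta> = exp (CLINT z|cs. L.exponent (- cor (\<theta>\<^sup>2 / 2) * k z))" for \<theta>
  unfolding char_def by (subst integral_distr[OF X_M]) (measurable, rule char_X)
 \<comment> \<open>In the degenerate case \<open>k\<close> may fail to be integrable although its
   exponent integrates to zero; the zero kernel then takes its place.\<close>
 obtain k' :: "'y \<times> (real ^ 'd) => real" where k': "integrable cs k'" "\<And>z. z \<in> space cs ==> 0 \<le> k' z"
  "\<And>\<zeta> :: complex. (CLINT z|cs. L.exponent (\<zeta> * k z)) = (CLINT z|cs. L.exponent (\<zeta> * k' z))"
 proof (cases "G0 * V0 = 0")
  case True
  then show ?thesis using that[of "%_. 0"] degenerate(3)[OF True] by (simp add: L.exponent_def)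
 next
  case False
  have "(nI cs (%z. en (norm (k z)))) = (nI cs (%z. en (k z)))"
   using k0 by (intro nn_integral_cong) simp
  also have "... < \<infinity>" unfolding nn_integral_k using finite_parts[OF False] by (simp add: ennreal_mult_less_top)
  finally have int: "integrable cs k" using k by (intro integrableI_bounded)
  show ?thesis by (rule that[OF int]) (rule k0, assumption, rule refl)
 qed
 have char': "char (distr M borel (X t)) \<theta> = exp (CLINT z|cs. L.exponent (- cor (\<theta>\<^sup>2 / 2) * k' z))" for \<theta>
  unfolding char by (subst k'(3)) (rule refl)
 show "infinitely_divisible (distr M borel (X t))"
  by (rule normal_mixture_infinitely_divisible_type_G(1)) (rule L.subordinator_basis_axioms, rule q, rule k'(1), rule k'(2), assumption, rule \<mu>, rule char')
 show "type_G (distr M borel (X t))"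
  by (rule normal_mixture_infinitely_divisible_type_G(2)) (rule L.subordinator_basis_axioms, rule q, rule k'(1), rule k'(2), assumption, rule \<mu>, rule char')
qed

text \<open>The product of \<open>mean\<close> and the integral of \<open>k\<close> equals the mean
  square of the field, finite in the degenerate case as well, so no distinction of cases arises
  here.\<close>

lemma jump_measure_U: "jump_measure (jump_measure_V \<nu> q k)"
 and exponent_U: "\<And>\<zeta>. 0 \<le> \<zeta> ==>
  (CLINT z|cs. L.exponent (- cor \<zeta> * k z)) = cor (LINT x|jump_measure_V \<nu> q k. exp (- \<zeta> * x) - 1)"
proof -
 have "en L.mean * (nI cs (%z. en (k z))) < \<infinity>" using mean_k G0_V0 by simp
 note * = L.jump_measure_V[OF q k k0 this] L.exponent_jump_measure_V[OF q k k0 this]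
 show "jump_measure (jump_measure_V \<nu> q k)" by (rule *(1))
 then interpret U: jump_measure "jump_measure_V \<nu> q k" .
 fix \<zeta> :: real assume \<zeta>: "0 \<le> \<zeta>"
 have "(CLINT z|cs. L.exponent (- cor \<zeta> * k z)) = U.exponent (- cor \<zeta>)"
  using *(2)[of "- cor \<zeta>"] \<zeta> by simp
 then show "(CLINT z|cs. L.exponent (- cor \<zeta> * k z)) = cor (LINT x|jump_measure_V \<nu> q k. exp (- \<zeta> * x) - 1)"
  using U.exponent_of_real[OF \<zeta>] by simp
qed

end

section \<open>Predictability, adaptedness and Walsh limits\<close>

lemma predictable_joint_measurable:
 assumes F: "\<And>r. sets (F r) \<subseteq> sets M" and \<tau> [measurable]: "\<tau> \<in> Bm E" and \<pi> [measurable]: "\<pi> \<in> measurable E E"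
  and f: "f \<in> Bm (predictable_sigma M F E \<tau> \<pi>)"
 shows "f \<in> Bm (E \<Otimes>\<^sub>M M)"
proof -
 let ?G = "{time_strip E \<tau> \<pi> a b B \<times> A | a b B A. B \<in> sets E \<and> A \<in> sets (F a)}"
 have strip: "time_strip E \<tau> \<pi> a b B \<in> sets E" if [measurable]: "B \<in> sets E" for a b B
  unfolding time_strip_def by measurable
 have G: "S \<in> sets (E \<Otimes>\<^sub>M M)" if "S \<in> ?G" for S using that strip F by blast
 have "(%x. x) \<in> measurable (E \<Otimes>\<^sub>M M) (predictable_sigma M F E \<tau> \<pi>)"
  unfolding predictable_sigma_def
 proof (rule measurable_measure_of)
  show "?G \<subseteq> Pow (space E \<times> space M)" using G sets.sets_into_space[of _ "E \<Otimes>\<^sub>M M"] unfolding space_pair_measure by blast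
  show "(%x. x) \<in> space (E \<Otimes>\<^sub>M M) \<rightarrow> space E \<times> space M" by (simp add: space_pair_measure)
  fix S assume "S \<in> ?G"
  from G[OF this] show "(%x. x) -` S \<inter> space (E \<Otimes>\<^sub>M M) \<in> sets (E \<Otimes>\<^sub>M M)" by simp
 qed
 from measurable_compose[OF this f] show ?thesis by simp
qed

text \<open>At a fixed point of space a generating set has the section \<open>A\<close> or the empty
  one, and \<open>A\<close> only if the point lies after the time \<open>a\<close> with
  \<open>A\<close> in \<open>F a\<close>. So predictability makes the field at each point known at
  its own time.\<close>

lemma predictable_section_measurable:
 assumes F: "\<And>r. space (F r) = space M" "\<And>r r'. r \<le> r' ==> sets (F r) \<subseteq> sets (F r')"
  and s: "s \<in> space E" and f: "(%(s, ww). f s ww) \<in> Bm (predictable_sigma M F E \<tau> \<pi>)"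
 shows "f s \<in> Bm (F (\<tau> s))"
proof -
 let ?G = "{time_strip E \<tau> \<pi> a b B \<times> A | a b B A. B \<in> sets E \<and> A \<in> sets (F a)}"
 have "(%ww. (s, ww)) \<in> measurable (F (\<tau> s)) (predictable_sigma M F E \<tau> \<pi>)"
  unfolding predictable_sigma_def
 proof (rule measurable_measure_of)
  have "A \<subseteq> space M" if "A \<in> sets (F a)" for A a using sets.sets_into_space[OF that] by (simp add: F(1))
  then show "?G \<subseteq> Pow (space E \<times> space M)" by (auto simp: time_strip_def)
  show "(%ww. (s, ww)) \<in> space (F (\<tau> s)) \<rightarrow> space E \<times> space M" using s by (simp add: F(1))
  fix S assume "S \<in> ?G"
  then obtain a b B A where S: "S = time_strip E \<tau> \<pi> a b B \<times> A" "A \<in> sets (F a)" by blast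
  show "(%ww. (s, ww)) -` S \<inter> space (F (\<tau> s)) \<in> sets (F (\<tau> s))"
  proof (cases "s \<in> time_strip E \<tau> \<pi> a b B")
   case True
   then have "A \<in> sets (F (\<tau> s))" using S(2) F(2)[of a "\<tau> s"] by (auto simp: time_strip_def)
   moreover have "(%ww. (s, ww)) -` S \<inter> space (F (\<tau> s)) = A \<inter> space (F (\<tau> s))" using True by (auto simp: S)
   ultimately show ?thesis by auto
  qed (simp add: S)
 qed
 from measurable_compose[OF this f] show ?thesis by simp
qed

text \<open>A strip starts strictly after the time of its coefficient, as adaptedness of lists
  demands, so the simple integrands of the definition are adapted lists.\<close>

lemma (in walsh_basis) walsh_limitI:
 assumes Y: "has_walsh_integral M F c \<tau> \<pi> W f Y" and \<pi>: "\<pi> \<in> measurable c c"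
 shows "walsh_limit f Y"
proof -
 obtain es where es: "\<And>n e. e \<in> set (es n) ==> elementary_integrand F c \<tau> \<pi> e"
  and lim1: "(%n. nI M (%ww. nI c (%z. en ((simple_integrand c \<tau> \<pi> (es n) z ww - f z ww)\<^sup>2)))) \<longlonglongrightarrow> 0"
  and lim2: "(%n. nI M (%ww. en ((walsh_simple_integral c \<tau> \<pi> W (es n) ww - Y ww)\<^sup>2))) \<longlonglongrightarrow> 0"
  using Y unfolding has_walsh_integral_def by blast
 define ks where "ks n = map (%(Z, a, b, B). (Z, a, time_strip c \<tau> \<pi> a b B)) (es n)" for n
 have "adapted_list (ks n)" for n
  using es[of _ n] by (fastforce simp: adapted_list_def ks_def elementary_integrand_def space_F time_strip_def)
 moreover have "random_step (ks n) z ww = simple_integrand c \<tau> \<pi> (es n) z ww" for n z ww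
  by (simp add: random_step_def simple_integrand_def ks_def o_def case_prod_unfold)
 moreover have "random_sum W (ks n) ww = walsh_simple_integral c \<tau> \<pi> W (es n) ww" for n ww
  by (simp add: random_sum_def walsh_simple_integral_def ks_def o_def case_prod_unfold)
 ultimately have "\<exists>ks. (\<forall>n. adapted_list (ks n)) \<and>
  (%n. nI M (%ww. nI c (%z. en ((random_step (ks n) z ww - f z ww)\<^sup>2)))) \<longlonglongrightarrow> 0 \<and>
  (%n. nI M (%ww. en ((random_sum W (ks n) ww - Y ww)\<^sup>2))) \<longlonglongrightarrow> 0"
  using lim1 lim2 by (intro exI[of _ ks]) simp
 moreover have "(%(z, ww). f z ww) \<in> Bm (c \<Otimes>\<^sub>M M)" "Y \<in> Bm M"
  using Y predictable_joint_measurable[OF F_sub \<tau>_meas \<pi>] by (auto simp: has_walsh_integral_def)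
 ultimately show ?thesis by (simp add: walsh_limit_def)
qed

text \<open>The constant characteristic function belongs to the atom at \<open>0\<close>. This is
  how both bases are seen to vanish on the empty set.\<close>

lemma (in prob_space) AE_eq_0_if_char_1:
 assumes Y [measurable]: "Y \<in> Bm M" and char: "\<And>\<theta>. (CLINT ww|M. iexp (\<theta> * Y ww)) = 1"
 shows "AE ww in M. Y ww = 0"
proof -
 have "char (distr M borel Y) t = char (return borel 0) t" for t
 proof -
  have "char (distr M borel Y) t = 1" unfolding char_def by (subst integral_distr[OF Y]) (measurable, rule char)
  then show ?thesis by (simp add: char_def integral_return)
 qed
 moreover have "real_distribution (return borel (0::real))"
  by (intro real_distribution.intro prob_space_return real_distribution_axioms.intro) auto
 ultimately have "distr M borel Y = return borel 0"
  by (intro Levy_uniqueness real_distribution_distr Y) auto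
 moreover have "AE x in return borel (0::real). x = 0" by (subst AE_return) auto
 ultimately have "AE x in distr M borel Y. x = 0" by (simp only:)
 then show ?thesis by (subst (asm) AE_distr_iff) auto
qed

lemma independently_scattered_empty_measurable:
 "independently_scattered M c K ==> K {} \<in> Bm M"
 by (simp add: independently_scattered_def)

lemma reset_coord_measurable:
 fixes i :: "'d::finite"
 shows "reset_coord i \<in> measurable borel borel"
proof -
 have eq: "axis i x = x *\<^sub>R axis i 1" for x :: real by (simp add: axis_def vec_eq_iff)
 have "(%s :: real ^ 'd. s - (s $ i) *\<^sub>R axis i 1) \<in> measurable borel borel"
  by (intro borel_measurable_continuous_onI continuous_intros)
 then show ?thesis unfolding eq[symmetric] .
qed

theorem proposition3:
  fixes M :: "'w measure"
    and XX :: "'x::euclidean_space set" and p :: "'x measure"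
    and YY :: "'y::euclidean_space set" and q :: "'y measure"
    and g :: "'x \<times> (real ^ 'd::finite) \<Rightarrow> real"
    and i :: 'd
    and F :: "real \<Rightarrow> 'w measure"
    and W :: "('x \<times> (real ^ 'd)) set \<Rightarrow> 'w \<Rightarrow> real"
    and L :: "('y \<times> (real ^ 'd)) set \<Rightarrow> 'w \<Rightarrow> real"
    and \<nu> :: "real measure"
    and \<sigma> :: "real ^ 'd \<Rightarrow> 'w \<Rightarrow> real"
    and h k :: "'y \<times> (real ^ 'd) \<Rightarrow> real"
    and X :: "real ^ 'd \<Rightarrow> 'w \<Rightarrow> real"
  assumes "prob_space M"
    and "XX \<in> sets borel" and "prob_space p" and "sets p = sets (restrict_space borel XX)"
    and "YY \<in> sets borel" and "prob_space q" and "sets q = sets (restrict_space borel YY)"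
    and "g \<in> borel_measurable (p \<Otimes>\<^sub>M lborel)"
    \<comment> \<open>the Gaussian basis, the filtration, and the volatility field\<close>
    and "gaussian_basis M (p \<Otimes>\<^sub>M lborel) W"
    and "usual_conditions M F"
    and "\<And>r A. \<lbrakk>A \<in> fmeasurable (p \<Otimes>\<^sub>M lborel); A \<subseteq> {(x, s). s $ i \<le> r}\<rbrakk>
           \<Longrightarrow> W A \<in> borel_measurable (F r)"
    and "\<And>r. prob_space.indep_set M (sets (F r))
           (generated_events M W {A \<in> fmeasurable (p \<Otimes>\<^sub>M lborel). A \<subseteq> {(x, s). r < s $ i}})"
    and "strictly_stationary M \<sigma>"
    and "prob_space.indep_set M (generated_events M \<sigma> UNIV)
           (generated_events M W (fmeasurable (p \<Otimes>\<^sub>M lborel)))"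
    and "(\<lambda>(s, \<omega>). \<sigma> s \<omega>) \<in> borel_measurable
           (predictable_sigma M F borel (\<lambda>s. s $ i) (reset_coord i))"
    and "\<And>t. (\<integral>\<^sup>+(x, s). ennreal ((g (x, t - s))\<^sup>2) * (\<integral>\<^sup>+\<omega>. ennreal ((\<sigma> s \<omega>)\<^sup>2) \<partial>M)
           \<partial>(p \<Otimes>\<^sub>M lborel)) < \<infinity>"
    \<comment> \<open>the Levy basis\<close>
    and "sets \<nu> = sets (restrict_space borel {0<..})"
    and "(\<integral>\<^sup>+w. ennreal (min 1 w) \<partial>\<nu>) < \<infinity>"
    and "(\<integral>\<^sup>+w\<in>{1..}. ennreal (w\<^sup>2) \<partial>\<nu>) < \<infinity>"
    and "levy_basis M (q \<Otimes>\<^sub>M lborel) L"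
    and "\<And>A \<theta>. A \<in> fmeasurable (q \<Otimes>\<^sub>M lborel) \<Longrightarrow>
           (CLINT \<omega>|M. iexp (\<theta> * L A \<omega>)) =
           exp (complex_of_real (measure (q \<Otimes>\<^sub>M lborel) A) * (CLINT w|\<nu>. iexp (\<theta> * w) - 1))"
    \<comment> \<open>the squared volatility is a mixed moving average\<close>
    and "integrability_conditions \<nu> (q \<Otimes>\<^sub>M lborel) h"
    and "\<And>s. has_rr_integral M (q \<Otimes>\<^sub>M lborel) L (\<lambda>(y, u). h (y, s - u)) (\<lambda>\<omega>. (\<sigma> s \<omega>)\<^sup>2)"
    and "\<And>y t u. y \<in> YY \<Longrightarrow>
           (\<integral>\<^sup>+(x, s). ennreal ((g (x, t - s))\<^sup>2 * h (y, s - u)) \<partial>(p \<Otimes>\<^sub>M lborel)) =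
           ennreal (k (y, t - u))"
    and "integrability_conditions \<nu> (q \<Otimes>\<^sub>M lborel) k"
    \<comment> \<open>the volatility modulated mixed moving average\<close>
    and "\<And>t. has_walsh_integral M F (p \<Otimes>\<^sub>M lborel)
           (\<lambda>(x, s). s $ i) (\<lambda>(x, s). (x, reset_coord i s)) W
           (\<lambda>(x, s) \<omega>. g (x, t - s) * \<sigma> s \<omega>) (X t)"
  shows "let U = jump_measure_V \<nu> q k;
             \<Lambda>\<^sub>V = (\<lambda>\<theta>. LINT x|U. exp (- \<theta> * x) - 1);
             \<Psi> = (\<lambda>\<zeta>. - (LINT x|U. exp (- \<zeta> * x) - 1))
         in strictly_stationary M X \<and>
            (\<forall>t. infinitely_divisible (distr M borel (X t)) \<and> type_G (distr M borel (X t))) \<and>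
            (\<forall>\<theta> t. (CLINT \<omega>|M. iexp (\<theta> * X t \<omega>)) = exp (- complex_of_real (\<Psi> (\<theta>\<^sup>2 / 2)))) \<and>
            (\<forall>\<zeta>\<ge>0. \<Psi> \<zeta> = - \<Lambda>\<^sub>V \<zeta>) \<and>
            (\<forall>\<theta>\<ge>0. \<forall>t. (LINT \<omega>|M. exp (- \<theta> * integrated_variance p g \<sigma> t \<omega>)) = exp (\<Lambda>\<^sub>V \<theta>)) \<and>
            \<Psi> 0 = 0 \<and>
            (\<forall>\<zeta>>0. \<Psi> differentiable (at \<zeta>)) \<and> completely_monotone (deriv \<Psi>)"
proof -
 note A = assms
 interpret prob_space M by fact
 interpret p: prob_space p by fact
 interpret q: prob_space q by fact
 interpret pL: pair_sigma_finite p "lborel :: (real ^ 'd) measure" ..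
 interpret qL: pair_sigma_finite q "lborel :: (real ^ 'd) measure" ..
 have space_q: "space q = YY" using sets_eq_imp_space_eq[OF A(7)] by (simp add: space_restrict_space)
 have F2: "sets (F r) \<subseteq> sets M" for r
  by (rule A(10)[unfolded usual_conditions_def, THEN conjunct2, THEN conjunct1, THEN spec])
 have filt: "filtration (space M) F" by (rule A(10)[unfolded usual_conditions_def, THEN conjunct1])
 note F = filtration.space_F[OF filt] F2 filtration.sets_F_mono[OF filt]
 have comp [measurable]: "(%s :: real ^ 'd. s $ i) \<in> Bm borel"
  by (intro borel_measurable_continuous_onI continuous_intros)
 have \<sigma>_joint: "(%(s, ww). \<sigma> s ww) \<in> Bm (borel \<Otimes>\<^sub>M M)"
  by (rule predictable_joint_measurable[OF F(2) comp reset_coord_measurable A(15)])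
 have \<sigma>_F: "\<sigma> s \<in> Bm (F (s $ i))" for s
  by (rule predictable_section_measurable[OF F(1,3) _ A(15)]) simp_all
 \<comment> \<open>The sigma-algebra generated by the volatility, in the form of a measure so that
   measurability of coefficients can be expressed.\<close>
 define N where "N = sigma (space M) {\<sigma> j -` B \<inter> space M | j B. j \<in> UNIV \<and> B \<in> sets borel}"
 have sets_N: "sets N = generated_events M \<sigma> UNIV" and space_N: "space N = space M"
  by (auto simp: N_def generated_events_def intro!: sets_measure_of space_measure_of)
 have \<sigma>_N: "\<sigma> s \<in> Bm N" for s
 proof (rule measurableI)
  fix B :: "real set" assume "B \<in> sets borel"
  then have "\<sigma> s -` B \<inter> space M \<in> sets N"
   unfolding sets_N generated_events_def by (intro sigma_sets.Basic) blast
  then show "\<sigma> s -` B \<inter> space N \<in> sets N" by (simp only: space_N)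
 qed simp
 \<comment> \<open>Below \<open>1\<close> the condition on small jumps bounds \<open>w\<close>, and
   from \<open>1\<close> on \<open>w\<close> is at most its square.\<close>
 have mean: "(\<integral>\<^sup>+w. en w \<partial>\<nu>) < \<infinity>"
 proof -
  have [measurable]: "(%w. w) \<in> Bm \<nu>"
   by (subst measurable_cong_sets[OF A(17) refl]) (rule measurable_restrict_space1, simp)
  have "(\<integral>\<^sup>+w. en w \<partial>\<nu>) \<le> (\<integral>\<^sup>+w. en (min 1 w) + en (w\<^sup>2) * indicator {1..} w \<partial>\<nu>)"
  proof (intro nn_integral_mono)
   fix w :: real
   show "en w \<le> ennreal (min 1 w) + en (w\<^sup>2) * indicator {1..} w"
   proof (cases "1 \<le> w")
    case True
    then have "en w \<le> ennreal (w\<^sup>2)" by (intro ennreal_leI) (simp add: power2_eq_square)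
    then show ?thesis using True by (simp add: add_increasing)
   qed simp
  qed
  also have "... = (\<integral>\<^sup>+w. en (min 1 w) \<partial>\<nu>) + (\<integral>\<^sup>+w\<in>{1..}. en (w\<^sup>2) \<partial>\<nu>)"
   by (rule nn_integral_add) measurable
  also have "... < \<infinity>" using A(18,19) by simp
  finally show ?thesis .
 qed
 have iL: "independently_scattered M (q \<Otimes>\<^sub>M lborel) L" using A(20) by (simp add: levy_basis_def)
 note iW = A(9)[unfolded gaussian_basis_def, THEN conjunct1]
  and char_W = A(9)[unfolded gaussian_basis_def, THEN conjunct2, THEN bspec, THEN spec]
 have L0: "AE ww in M. L {} ww = 0"
  using A(21)[of "{}"] by (intro AE_eq_0_if_char_1 independently_scattered_empty_measurable[OF iL]) simp
 have W0: "AE ww in M. W {} ww = 0"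
  using char_W[of "{}"] by (intro AE_eq_0_if_char_1 independently_scattered_empty_measurable[OF iW]) simp
 have L: "subordinator_basis M (q \<Otimes>\<^sub>M lborel) L \<nu>"
  by (intro subordinator_basis.intro random_set_function.intro random_set_function_axioms.intro jump_measure.intro
   subordinator_basis_axioms.intro prob_space_axioms iL L0 A(17) mean A(21) qL.sigma_finite_measure_axioms)
 have future: "{A \<in> fmeasurable (p \<Otimes>\<^sub>M (lborel :: (real ^ 'd) measure)). A \<subseteq> {(x, s). r < s $ i}} =
  {A \<in> fmeasurable (p \<Otimes>\<^sub>M lborel). \<forall>z\<in>A. r < snd z $ i}" for r by auto
 have W: "independent_walsh_basis M (p \<Otimes>\<^sub>M lborel) W F (%z. snd z $ i) N"
 proof (intro independent_walsh_basis.intro walsh_basis.intro gaussian_set_function.intro random_set_function.intro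
   random_set_function_axioms.intro gaussian_set_function_axioms.intro walsh_basis_axioms.intro
   independent_walsh_basis_axioms.intro prob_space_axioms iW W0 char_W pL.sigma_finite_measure_axioms F space_N)
  show "(%z. snd z $ i :: real) \<in> Bm (p \<Otimes>\<^sub>M lborel)"
   by (rule measurable_compose[OF measurable_snd]) (simp add: comp)
  show "indep_set (sets N) (generated_events M W (fmeasurable (p \<Otimes>\<^sub>M lborel)))"
   unfolding sets_N by (rule A(14))
  show "indep_set (sets (F r)) (generated_events M W {A \<in> fmeasurable (p \<Otimes>\<^sub>M lborel). \<forall>z\<in>A. r < snd z $ i})" for r
   using A(12)[of r] unfolding future .
  show "W B \<in> Bm (F r)" if "B \<in> fmeasurable (p \<Otimes>\<^sub>M lborel)" "\<And>z. z \<in> B ==> snd z $ i \<le> r" for r B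
   by (rule A(11)[OF that(1)]) (use that(2) in force)
 qed
 interpret W: independent_walsh_basis M "p \<Otimes>\<^sub>M lborel" W F "%z. snd z $ i" N by (rule W)
 have field: "modulated_field M q L \<nu> p W F i N g h k \<sigma> X"
 proof (intro modulated_field.intro L W modulated_field_axioms.intro A(8,13) \<sigma>_joint \<sigma>_F \<sigma>_N
   q.sigma_finite_measure_axioms p.sigma_finite_measure_axioms)
  show "h \<in> Bm (q \<Otimes>\<^sub>M lborel)" "k \<in> Bm (q \<Otimes>\<^sub>M lborel)"
   "\<And>z. z \<in> space (q \<Otimes>\<^sub>M lborel) ==> 0 \<le> h z" "\<And>z. z \<in> space (q \<Otimes>\<^sub>M lborel) ==> 0 \<le> k z"
   using A(22,25) by (auto simp: integrability_conditions_def)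
  \<comment> \<open>By stationarity the second moment is a constant that leaves the integral, which
    turns the hypothesis at \<open>t = 0\<close> into a bound on a product.\<close>
  define v where "v = (nI M (%ww. en ((\<sigma> 0 ww)\<^sup>2)))"
  have var: "(nI M (%ww. en ((\<sigma> s ww)\<^sup>2))) = v" for s
   unfolding v_def by (rule strictly_stationary_one[OF A(13)]) measurable
  have [measurable]: "g \<in> Bm (p \<Otimes>\<^sub>M borel)" using A(8) by (simp cong: measurable_cong_sets)
  have "(nI (p \<Otimes>\<^sub>M lborel) (%z. en ((g (fst z, 0 - snd z))\<^sup>2))) * (nI M (%ww. en ((\<sigma> 0 ww)\<^sup>2))) =
   (nI (p \<Otimes>\<^sub>M lborel) (%z. en ((g (fst z, 0 - snd z))\<^sup>2) * (nI M (%ww. en ((\<sigma> 0 ww)\<^sup>2)))))"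
   by (rule nn_integral_multc[symmetric]) measurable
  also have "... < \<infinity>" using A(16)[of 0] by (simp only: var case_prod_unfold)
  finally show "(nI (p \<Otimes>\<^sub>M lborel) (%z. en ((g (fst z, 0 - snd z))\<^sup>2))) * (nI M (%ww. en ((\<sigma> 0 ww)\<^sup>2))) < \<infinity>" .
  show "has_rr_integral M (q \<Otimes>\<^sub>M lborel) L (%z. h (fst z, s - snd z)) (%ww. (\<sigma> s ww)\<^sup>2)" for s
   by (rule A(23)[of s, unfolded case_prod_unfold])
  show "(nI (p \<Otimes>\<^sub>M lborel) (%z. en ((g (fst z, t - snd z))\<^sup>2 * h (y, snd z - u)))) = en (k (y, t - u))"
   if "y \<in> space q" for y t u
   by (rule A(24)[OF that[unfolded space_q], of t u, unfolded case_prod_unfold])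
  have \<pi>': "(%(x, s). (x, T s)) \<in> measurable (p \<Otimes>\<^sub>M lborel) (p \<Otimes>\<^sub>M lborel)"
   if [measurable]: "T \<in> measurable borel borel" for T :: "real ^ 'd => real ^ 'd" by measurable
  have \<pi>: "(%(x, s). (x, reset_coord i s)) \<in> measurable (p \<Otimes>\<^sub>M lborel) (p \<Otimes>\<^sub>M (lborel :: (real ^ 'd) measure))"
   by (rule \<pi>'[OF reset_coord_measurable])
  show "W.walsh_limit (%z ww. g (fst z, t - snd z) * \<sigma> (snd z) ww) (X t)" for t
   by (rule W.walsh_limitI[OF A(26)[of t, unfolded case_prod_unfold] \<pi>[unfolded case_prod_unfold]])
 qed
 interpret modulated_field M q L \<nu> p W F i N g h k \<sigma> X by (rule field)
 interpret U: jump_measure "jump_measure_V \<nu> q k" by (rule jump_measure_U)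
 have V: "integrated_variance p g \<sigma> t ww = V t ww" for t ww
  by (simp add: integrated_variance_def V_def case_prod_unfold)
 show ?thesis
  unfolding Let_def
 proof (intro conjI allI impI)
  show "strictly_stationary M X" by (rule stationary_X)
  show "infinitely_divisible (distr M borel (X t))" "type_G (distr M borel (X t))" for t
   by (rule infinitely_divisible_type_G_X)+
  show "(CLINT ww|M. iexp (\<theta> * X t ww)) = exp (- cor (- (LINT x|jump_measure_V \<nu> q k. exp (- (\<theta>\<^sup>2 / 2) * x) - 1)))" for \<theta> t
   unfolding char_X by (subst exponent_U) simp_all
  show "(LINT ww|M. exp (- \<theta> * integrated_variance p g \<sigma> t ww)) = exp (LINT x|jump_measure_V \<nu> q k. exp (- \<theta> * x) - 1)"
   if "0 \<le> \<theta>" for \<theta> t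
  proof -
   have "cor (LINT ww|M. exp (- \<theta> * V t ww)) = (CLINT ww|M. exp (- cor \<theta> * cor (V t ww)))"
    unfolding integral_complex_of_real[symmetric]
    by (intro Bochner_Integration.integral_cong refl) (simp flip: exp_of_real)
   also have "... = cor (exp (LINT x|jump_measure_V \<nu> q k. exp (- \<theta> * x) - 1))"
    unfolding laplace_V[OF that] exponent_U[OF that] by (simp only: exp_of_real)
   finally show ?thesis unfolding V by (simp only: of_real_eq_iff)
  qed
  show "(%\<zeta>. - (LINT x|jump_measure_V \<nu> q k. exp (- \<zeta> * x) - 1)) differentiable (at \<zeta>)" if "0 < \<zeta>" for \<zeta>
   unfolding real_differentiable_def by (rule exI, rule U.laplace_exponent_derivative[OF that])
  show "completely_monotone (deriv (%\<zeta>. - (LINT x|jump_measure_V \<nu> q k. exp (- \<zeta> * x) - 1)))"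
   by (rule U.completely_monotone_deriv_laplace_exponent)
 qed simp_all
qed

end
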